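(* Let $n\ge 2$, let $\Omega\subset\mathbb R^n$ be an open set, and let $A$ be a Young function. Assume that either $n=2$, or $n\ge 3$ and $$\int^\infty\Big(\frac{t}{A(t)}\Big)^{\frac1{n-2}}\,dt<\infty .$$ Let $A_{n-1}$ be the Young function associated with $A$ and $n$ (defined in the context). Let $u\in W^{1,A}_{\rm loc}(\Omega)$ be a weakly monotone function. Then $u\in L^\infty_{\rm loc}(\Omega)$, and there exists a constant $c=c(n)$, depending only on $n$, such that $$\operatorname{ess\,osc}_{B_r(x)}u\ \le\ c\,r\,A_{n-1}^{-1}\bigg(\frac1{|B_{2r}(x)|}\int_{B_{2r}(x)}A(|\nabla u|)\,dz\bigg)$$ whenever $B_{2r}(x)\subset\subset\Omega$. Moreover, there exists a representative of $u$ that is differentiable a.e. in $\Omega$.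
   Context: Young function: a convex function $A:[0,\infty)\to[0,\infty]$, non-constant in $(0,\infty)$, with $A(0)=0$. An integral $\int^\infty$ with unspecified lower endpoint refers only to behaviour near infinity (lower limit any sufficiently large number). The Young conjugate is $\widetilde A(t)=\sup\{st-A(s): s\ge0\}$, $t\ge0$. Function $A_{n-1}$: if $n=2$, $A_{1}=A$. If $n\ge3$, $A_{n-1}$ is the Young conjugate of the function $t\mapsto t^{\frac{n-1}{n-2}}\int_t^\infty \frac{\widetilde A(r)}{r^{1+\frac{n-1}{n-2}}}\,dr$, $t>0$ (with value $0$ at $t=0$); the integral converges exactly when $\int^\infty(t/A(t))^{1/(n-2)}dt<\infty$. $A_{n-1}^{-1}$ denotes the generalized right-continuous inverse of $A_{n-1}$; the right-hand side of the inequality is understood to be $\infty$ if the integral of $A(|\nabla u|)$ is infinite. Orlicz and Orlicz–Sobolev spaces: for measurable $E\subset\mathbb R^n$, $L^A(E)$ is the space of measurable real-valued $u$ on $E$ with finite Luxemburg norm $\|u\|_{L^A(E)}=\inf\{\lambda>0:\int_E A(|u|/\lambda)\,dx\le1\}$. $W^{1,A}(\Omega)$ is the set of weakly differentiable $u\in L^A(\Omega)$ with $|\nabla u|\in L^A(\Omega)$; $W^{1,A}_{\rm loc}(\Omega)$ is the set of measurable $u$ with $u\in W^{1,A}(\Omega')$ for every bounded open $\Omega'\subset\subset\Omega$. Weakly monotone: $u\in W^{1,1}_{\rm loc}(\Omega)$ is weakly monotone if for every open $\Omega'\subset\subset\Omega$ and every $m,M\in\mathbb R$ with $m\le M$ and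 $(u-M)_+-(m-u)_+\in W^{1,1}_0(\Omega')$, one has $m\le u\le M$ a.e. in $\Omega'$ (here $_+$ denotes positive part). $B_r(x)$ is the ball centered at $x$ with radius $r$, $|\cdot|$ is Lebesgue measure, and $\operatorname{ess\,osc}_{B}u=\operatorname{ess\,sup}_{B}u-\operatorname{ess\,inf}_{B}u$. *)

theory Defs
  imports "HOL-Probability.Essential_Supremum"
begin

section \<open>Young functions\<close>

text \<open>
  A function from \<open>[0,\<infinity>)\<close> to \<open>[0,\<infinity>]\<close> is a term of type \<^typ>\<open>real \<Rightarrow> ennreal\<close>; its
  values at negative arguments are never used.
\<close>

definition young_function :: "(real \<Rightarrow> ennreal) \<Rightarrow> bool" where
  "young_function A \<longleftrightarrow>
     A 0 = 0 \<and>
     (\<forall>s\<ge>0. \<forall>t\<ge>0. \<forall>\<theta>\<in>{0..1}.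
        A ((1 - \<theta>) * s + \<theta> * t) \<le> ennreal (1 - \<theta>) * A s + ennreal \<theta> * A t) \<and>
     (\<exists>s>0. \<exists>t>0. A s \<noteq> A t)"

text \<open>
  Subtraction on \<^typ>\<open>ennreal\<close> is truncated at \<open>0\<close>. This does not affect the supremum, since
  \<open>s = 0\<close> contributes \<open>0\<close> whenever \<open>A 0 = 0\<close>.
\<close>

definition young_conj :: "(real \<Rightarrow> ennreal) \<Rightarrow> real \<Rightarrow> ennreal" where
  "young_conj A t = (SUP s\<in>{0..}. ennreal (s * t) - A s)"

text \<open>The infimum of the empty set is \<open>\<infinity>\<close>; in particular the value at \<open>\<infinity>\<close> is \<open>\<infinity>\<close>.\<close>

definition right_inverse :: "(real \<Rightarrow> ennreal) \<Rightarrow> ennreal \<Rightarrow> ennreal" where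
  "right_inverse A s = Inf {ennreal t | t. 0 \<le> t \<and> s < A t}"

text \<open>
  \<open>young_reduced n A\<close> is the function \<open>A\<^bsub>n-1\<^esub>\<close> (meaningful for \<open>n \<ge> 2\<close>).
\<close>

definition young_reduced :: "nat \<Rightarrow> (real \<Rightarrow> ennreal) \<Rightarrow> real \<Rightarrow> ennreal" where
  "young_reduced n A =
     (if n = 2 then A
      else let p = (real n - 1) / (real n - 2) in
        young_conj (\<lambda>t. if t = 0 then 0
          else ennreal (t powr p) *
               (\<integral>\<^sup>+ r\<in>{t<..}. young_conj A r / ennreal (r powr (1 + p)) \<partial>lborel)))"

text \<open>Powers of extended nonnegative numbers, for exponents \<open>p > 0\<close>.\<close>

definition ennreal_powr :: "ennreal \<Rightarrow> real \<Rightarrow> ennreal" where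
  "ennreal_powr x p = (if x = \<infinity> then \<infinity> else ennreal (enn2real x powr p))"

definition young_growth :: "nat \<Rightarrow> (real \<Rightarrow> ennreal) \<Rightarrow> bool" where
  "young_growth n A \<longleftrightarrow>
     (\<forall>\<^sub>F a in at_top.
        (\<integral>\<^sup>+ t\<in>{a..}. ennreal_powr (ennreal t / A t) (1 / (real n - 2)) \<partial>lborel) < \<infinity>)"


section \<open>Smooth functions with compact support and weak gradients\<close>

definition compactly_contained :: "'a::topological_space set \<Rightarrow> 'a set \<Rightarrow> bool" where
  "compactly_contained S T \<longleftrightarrow> compact (closure S) \<and> closure S \<subseteq> T"

definition partial_deriv :: "'a::euclidean_space \<Rightarrow> ('a \<Rightarrow> real) \<Rightarrow> 'a \<Rightarrow> real" where
  "partial_deriv b f x = frechet_derivative f (at x) b"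

definition gradient :: "('a::euclidean_space \<Rightarrow> real) \<Rightarrow> 'a \<Rightarrow> 'a" where
  "gradient f x = (\<Sum>b\<in>Basis. partial_deriv b f x *\<^sub>R b)"

primrec Ck :: "nat \<Rightarrow> ('a::euclidean_space \<Rightarrow> real) \<Rightarrow> bool" where
  "Ck 0 f \<longleftrightarrow> continuous_on UNIV f"
| "Ck (Suc k) f \<longleftrightarrow> (\<forall>x. f differentiable (at x)) \<and> (\<forall>b\<in>Basis. Ck k (partial_deriv b f))"

definition test_function :: "'a::euclidean_space set \<Rightarrow> ('a \<Rightarrow> real) \<Rightarrow> bool" where
  "test_function \<Omega> \<phi> \<longleftrightarrow> (\<forall>k. Ck k \<phi>) \<and> compactly_contained {x. \<phi> x \<noteq> 0} \<Omega>"

definition loc_integrable ::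
    "'a::euclidean_space set \<Rightarrow> ('a \<Rightarrow> 'b::euclidean_space) \<Rightarrow> bool" where
  "loc_integrable \<Omega> f \<longleftrightarrow> (\<forall>K. compact K \<and> K \<subseteq> \<Omega> \<longrightarrow> f absolutely_integrable_on K)"

definition weak_gradient ::
    "'a::euclidean_space set \<Rightarrow> ('a \<Rightarrow> real) \<Rightarrow> ('a \<Rightarrow> 'a) \<Rightarrow> bool" where
  "weak_gradient \<Omega> u g \<longleftrightarrow>
     loc_integrable \<Omega> u \<and> loc_integrable \<Omega> g \<and>
     (\<forall>\<phi> b. test_function \<Omega> \<phi> \<and> b \<in> Basis \<longrightarrow>
        (LINT x:\<Omega>|lebesgue. u x * partial_deriv b \<phi> x) =
        - (LINT x:\<Omega>|lebesgue. (g x \<bullet> b) * \<phi> x))"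


section \<open>Orlicz and Orlicz--Sobolev spaces\<close>

definition luxemburg_norm ::
    "(real \<Rightarrow> ennreal) \<Rightarrow> 'a::euclidean_space set \<Rightarrow> ('a \<Rightarrow> real) \<Rightarrow> ennreal" where
  "luxemburg_norm A E u =
     Inf {ennreal l | l. 0 < l \<and> (\<integral>\<^sup>+ x\<in>E. A (\<bar>u x\<bar> / l) \<partial>lebesgue) \<le> 1}"

definition orlicz :: "(real \<Rightarrow> ennreal) \<Rightarrow> 'a::euclidean_space set \<Rightarrow> ('a \<Rightarrow> real) set" where
  "orlicz A E = {u. u \<in> borel_measurable (lebesgue_on E) \<and> luxemburg_norm A E u < \<infinity>}"

definition orlicz_sobolev ::
    "(real \<Rightarrow> ennreal) \<Rightarrow> 'a::euclidean_space set \<Rightarrow> ('a \<Rightarrow> real) set" where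
  "orlicz_sobolev A \<Omega> =
     {u \<in> orlicz A \<Omega>. \<exists>g. weak_gradient \<Omega> u g \<and> (\<lambda>x. norm (g x)) \<in> orlicz A \<Omega>}"

definition orlicz_sobolev_loc ::
    "(real \<Rightarrow> ennreal) \<Rightarrow> 'a::euclidean_space set \<Rightarrow> ('a \<Rightarrow> real) set" where
  "orlicz_sobolev_loc A \<Omega> =
     {u \<in> borel_measurable (lebesgue_on \<Omega>).
        \<forall>\<Omega>'. open \<Omega>' \<and> bounded \<Omega>' \<and> compactly_contained \<Omega>' \<Omega> \<longrightarrow> u \<in> orlicz_sobolev A \<Omega>'}"

text \<open>The classical Sobolev space (exponent 1) is the Orlicz--Sobolev space of \<open>A t = t\<close>.\<close>

abbreviation W11_loc :: "'a::euclidean_space set \<Rightarrow> ('a \<Rightarrow> real) set" where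
  "W11_loc \<equiv> orlicz_sobolev_loc ennreal"

text \<open>
  Closure of the test functions in the Sobolev norm (exponent 1).
\<close>

definition W11_0 :: "'a::euclidean_space set \<Rightarrow> ('a \<Rightarrow> real) set" where
  "W11_0 \<Omega> =
     {w \<in> orlicz_sobolev ennreal \<Omega>. \<exists>g. weak_gradient \<Omega> w g \<and>
        (\<exists>\<phi>. (\<forall>k. test_function \<Omega> (\<phi> k)) \<and>
          (\<lambda>k. \<integral>\<^sup>+ x\<in>\<Omega>. ennreal \<bar>w x - \<phi> k x\<bar> \<partial>lebesgue) \<longlonglongrightarrow> 0 \<and>
          (\<lambda>k. \<integral>\<^sup>+ x\<in>\<Omega>. ennreal (norm (g x - gradient (\<phi> k) x)) \<partial>lebesgue) \<longlonglongrightarrow> 0)}"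

definition Linf_loc :: "'a::euclidean_space set \<Rightarrow> ('a \<Rightarrow> real) set" where
  "Linf_loc \<Omega> =
     {u \<in> borel_measurable (lebesgue_on \<Omega>).
        \<forall>\<Omega>'. open \<Omega>' \<and> compactly_contained \<Omega>' \<Omega> \<longrightarrow>
          (\<exists>C. AE x in lebesgue_on \<Omega>'. \<bar>u x\<bar> \<le> C)}"


section \<open>Weak monotonicity and essential oscillation\<close>

definition weakly_monotone :: "'a::euclidean_space set \<Rightarrow> ('a \<Rightarrow> real) \<Rightarrow> bool" where
  "weakly_monotone \<Omega> u \<longleftrightarrow>
     u \<in> W11_loc \<Omega> \<and>
     (\<forall>\<Omega>' m M. open \<Omega>' \<and> compactly_contained \<Omega>' \<Omega> \<and> m \<le> M \<and>
        (\<lambda>x. max (u x - M) 0 - max (m - u x) 0) \<in> W11_0 \<Omega>' \<longrightarrow>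
        (AE x in lebesgue_on \<Omega>'. m \<le> u x \<and> u x \<le> M))"

definition essinf :: "'a measure \<Rightarrow> ('a \<Rightarrow> ereal) \<Rightarrow> ereal" where
  "essinf M f = - esssup M (\<lambda>x. - f x)"

definition essosc :: "'a::euclidean_space set \<Rightarrow> ('a \<Rightarrow> real) \<Rightarrow> ereal" where
  "essosc B u = esssup (lebesgue_on B) (\<lambda>x. ereal (u x)) - essinf (lebesgue_on B) (\<lambda>x. ereal (u x))"

end

theory Submission
  imports Defs "HOL-Analysis.Analysis"
begin

text \<open>
  Let \<open>d = n - 1\<close> and let \<open>\<Psi>\<close> be the Young conjugate of \<open>A\<close>. For a smooth \<open>v\<close>, a point \<open>x\<close> on a
  face of a cube of side comparable to \<open>R\<close> is joined by segments to the points of a fixed far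
  \<open>d\<close>-dimensional cube in the hyperplane of that face. Young's inequality
  \<open>\<bar>\<nabla>v\<bar> k \<le> A (\<bar>\<nabla>v\<bar>) + \<Psi> k\<close> with \<open>k = t / \<theta>\<^sup>d\<^sup>-\<^sup>1\<close> at the fraction \<open>\<theta>\<close> of the segment bounds
  \<open>t \<bar>v x - mean v\<bar>\<close> by \<open>R\<close> times the sum of the average of \<open>A (\<bar>\<nabla>v\<bar>)\<close> over the hyperplane and of
  \<open>\<integral> \<theta>\<^sup>d\<^sup>-\<^sup>1 \<Psi> (t / \<theta>\<^sup>d\<^sup>-\<^sup>1) d\<theta>\<close>. The substitution \<open>r = t / \<theta>\<^sup>d\<^sup>-\<^sup>1\<close> turns the last integral into (a
  multiple of) the function whose conjugate is \<open>A\<^bsub>n-1\<^esub>\<close>, and optimising over \<open>t\<close> yields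
  \<open>A\<^bsub>n-1\<^esub>\<^sup>-\<^sup>1\<close>.

  A weakly monotone \<open>u\<close> is mollified; Fatou's lemma selects a cube on whose faces the averages
  of \<open>A (\<bar>\<nabla>u\<^sub>\<epsilon>\<bar>)\<close> stay bounded along a sequence, so \<open>u\<^sub>\<epsilon>\<close> takes values in some \<open>[m, M]\<close> on the
  boundary of the cube. Smooth truncations of \<open>u\<^sub>\<epsilon>\<close> vanish there, hence the truncation of \<open>u\<close>
  lies in \<open>W11_0\<close> of the cube and weak monotonicity gives \<open>m \<le> u \<le> M\<close> inside. Chaining small
  cubes passes from cubes to balls.

  Applied to the balls of radius \<open>\<delta> \<bar>w\<bar>\<close> about \<open>x + w\<close>, at Lebesgue points \<open>x\<close> of \<open>A (\<bar>\<nabla>u\<bar>)\<close>, the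
  estimate gives oscillation \<open>O(\<delta> \<bar>w\<bar>)\<close>. Together with the \<open>L\<^sup>1\<close>-differentiability of Sobolev
  functions this is differentiability at \<open>x\<close>, so no Rademacher or Stepanov theorem is needed.
\<close>


text \<open>Why the exponent d-1 suffices: a point of the hyperplane is reached from x only at
  fractions \<theta> in a band of ratio 6, because the far cube is seen from x at coordinate
  distances between R and 6R. The factor \<theta>^(d-1) left by the choice of k and the Jacobian
  \<theta>^(-d) combine to 1/\<theta>, whose integral over the band is bounded.

  A finite Luxemburg norm controls A (|grad u| / l) for some l > 0 only; the integral of A (|grad
  u|) may be infinite. The estimates on cubes and balls therefore take any pair \<open>A\<close>,
  \<open>\<Psi>\<close> tied by Young's inequality. They are applied to A and its conjugate for the
  oscillation bound, and to A (s / l) and the correspondingly dilated conjugate for local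
  boundedness and differentiability.

  Bounds on gradients leave an additive constant free. The face integrals of the mollified function
  itself are thus controlled along with them, with a small weight, so that the values at one corner
  have a convergent subsequence and one interval [m, M] serves infinitely many
  mollifications.\<close>

lemma partial_deriv_eq:
  "(f has_derivative f') (at x) \<Longrightarrow> partial_deriv b f x = f' b"
  unfolding partial_deriv_def using frechet_derivative_at by metis

lemma has_derivative_gradient:
  assumes "f differentiable (at x)"
  shows "(f has_derivative (\<lambda>h. gradient f x \<bullet> h)) (at x)"
proof -
  obtain f' where f': "(f has_derivative f') (at x)"
    using assms by (auto simp: differentiable_def)
  then interpret linear f' by (rule has_derivative_linear)
  have "f' h = gradient f x \<bullet> h" for h
  proof -
    have "f' h = f' (\<Sum>b\<in>Basis. (h \<bullet> b) *\<^sub>R b)" by (simp add: euclidean_representation)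
    also have "\<dots> = (\<Sum>b\<in>Basis. (h \<bullet> b) * f' b)" by (simp add: sum scale)
    also have "\<dots> = gradient f x \<bullet> h"
      by (simp add: gradient_def partial_deriv_eq[OF f'] inner_sum_left inner_sum_right
          inner_commute mult.commute)
    finally show ?thesis .
  qed
  then have "f' = (\<lambda>h. gradient f x \<bullet> h)" by auto
  with f' show ?thesis by simp
qed

lemma gradient_inner_Basis: "b \<in> Basis \<Longrightarrow> gradient f x \<bullet> b = partial_deriv b f x"
  by (simp add: gradient_def inner_sum_left inner_Basis if_distrib sum.delta cong: if_cong)

subsection \<open>Functions of class \<open>Ck\<close>\<close>

lemma Ck_imp_continuous_on: "Ck k f \<Longrightarrow> continuous_on S f"
proof (cases k)
  case (Suc m)
  moreover assume "Ck k f"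
  ultimately show ?thesis
    by (simp add: continuous_at_imp_continuous_on differentiable_imp_continuous_within)
qed (auto intro: continuous_on_subset)

lemma Ck_Suc_imp: "Ck (Suc k) f \<Longrightarrow> Ck k f"
proof (induction k arbitrary: f)
  case 0
  then show ?case using Ck_imp_continuous_on[of "Suc 0" f UNIV] by simp
qed auto

lemma partial_deriv_cong_open:
  assumes "open U" "x \<in> U" "\<And>y. y \<in> U \<Longrightarrow> f y = g y"
  shows "partial_deriv b f x = partial_deriv b g x"
proof -
  have "(f has_derivative D) (at x) \<longleftrightarrow> (g has_derivative D) (at x)" for D
    using assms by (auto intro: has_derivative_transform_within_open)
  then show ?thesis unfolding partial_deriv_def frechet_derivative_def by simp
qed

text \<open>Serves to glue a truncated function inside a cube to zero outside it, in
  \<open>cutoff_test_function\<close>.\<close>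

lemma Ck_local:
  assumes "\<And>x. \<exists>U g. open U \<and> x \<in> U \<and> Ck k g \<and> (\<forall>y\<in>U. f y = g y)"
  shows "Ck k f"
  using assms
proof (induction k arbitrary: f)
  case 0
  have "isCont f x" for x
  proof -
    obtain U g where U: "open U" "x \<in> U" "Ck 0 g" "\<And>y. y \<in> U \<Longrightarrow> f y = g y"
      using 0[of x] by auto
    then have "continuous_on U f"
      by (metis Ck_imp_continuous_on continuous_on_cong)
    then show ?thesis using U continuous_on_eq_continuous_at by blast
  qed
  then show ?case by (simp add: continuous_at_imp_continuous_on)
next
  case (Suc k)
  show ?case unfolding Ck.simps
  proof (intro conjI allI ballI)
    fix x
    obtain U g where U: "open U" "x \<in> U" "Ck (Suc k) g" "\<And>y. y \<in> U \<Longrightarrow> f y = g y"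
      using Suc.prems[of x] by auto
    have "g differentiable (at x)" using U by simp
    then obtain D where "(g has_derivative D) (at x)" by (auto simp: differentiable_def)
    then have "(f has_derivative D) (at x)"
      using U by (auto intro: has_derivative_transform_within_open)
    then show "f differentiable (at x)" by (auto simp: differentiable_def)
  next
    fix b :: 'a assume b: "b \<in> Basis"
    show "Ck k (partial_deriv b f)"
    proof (rule Suc.IH)
      fix x
      obtain U g where U: "open U" "x \<in> U" "Ck (Suc k) g" "\<And>y. y \<in> U \<Longrightarrow> f y = g y"
        using Suc.prems[of x] by auto
      then have "Ck k (partial_deriv b g)" "\<forall>y\<in>U. partial_deriv b f y = partial_deriv b g y"
        using b by (auto intro: partial_deriv_cong_open)
      with U show "\<exists>U g. open U \<and> x \<in> U \<and> Ck k g \<and> (\<forall>y\<in>U. partial_deriv b f y = g y)"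
        by blast
    qed
  qed
qed

lemma has_derivative_Ck:
  assumes "Ck (Suc k) f"
  shows "(f has_derivative (\<lambda>h. gradient f x \<bullet> h)) (at x)"
  using assms by (intro has_derivative_gradient) simp

lemma Ck_const: "Ck k (\<lambda>x. c)"
proof (induction k arbitrary: c)
  case (Suc k)
  have "partial_deriv b (\<lambda>x::'a. c) = (\<lambda>x. 0)" for b
    by (rule ext, subst partial_deriv_eq[OF has_derivative_const]) simp
  then show ?case using Suc by simp
qed simp

lemma Ck_add:
  assumes "Ck k f" "Ck k g"
  shows "Ck k (\<lambda>x. f x + g x)"
  using assms
proof (induction k arbitrary: f g)
  case (Suc k)
  have "partial_deriv b (\<lambda>x. f x + g x) = (\<lambda>x. partial_deriv b f x + partial_deriv b g x)"
    if b: "b \<in> Basis" for b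
  proof
    fix x
    have "((\<lambda>x. f x + g x) has_derivative (\<lambda>h. gradient f x \<bullet> h + gradient g x \<bullet> h)) (at x)"
      using Suc.prems by (intro derivative_intros has_derivative_gradient) auto
    from partial_deriv_eq[OF this] show "partial_deriv b (\<lambda>x. f x + g x) x
        = partial_deriv b f x + partial_deriv b g x"
      by (simp add: gradient_inner_Basis b)
  qed
  with Suc show ?case by (auto intro: differentiable_add)
qed (auto intro: continuous_intros)

lemma Ck_mult:
  assumes "Ck k f" "Ck k g"
  shows "Ck k (\<lambda>x. f x * g x)"
  using assms
proof (induction k arbitrary: f g)
  case (Suc k)
  have eq: "partial_deriv b (\<lambda>x. f x * g x)
      = (\<lambda>x. f x * partial_deriv b g x + partial_deriv b f x * g x)"
    if b: "b \<in> Basis" for b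
  proof
    fix x
    have "((\<lambda>x. f x * g x) has_derivative
        (\<lambda>h. f x * (gradient g x \<bullet> h) + (gradient f x \<bullet> h) * g x)) (at x)"
      using Suc.prems by (intro has_derivative_mult has_derivative_gradient) auto
    from partial_deriv_eq[OF this] show "partial_deriv b (\<lambda>x. f x * g x) x
        = f x * partial_deriv b g x + partial_deriv b f x * g x"
      by (simp add: gradient_inner_Basis b)
  qed
  show ?case
    using Suc.prems Suc.IH Ck_Suc_imp[OF Suc.prems(1)] Ck_Suc_imp[OF Suc.prems(2)]
    by (auto simp: eq intro!: differentiable_mult Ck_add)
qed (auto intro: continuous_intros)

lemma Ck_cmult: "Ck k f \<Longrightarrow> Ck k (\<lambda>x. c * f x)"
  by (intro Ck_mult Ck_const)

lemma Ck_diff: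
  assumes "Ck k f" "Ck k g"
  shows "Ck k (\<lambda>x. f x - g x)"
  using Ck_add[OF assms(1) Ck_cmult[OF assms(2), of "-1"]] by simp

lemma Ck_inner_left: "Ck k (\<lambda>x. x \<bullet> a)"
proof (cases k)
  case (Suc m)
  have "partial_deriv b (\<lambda>x::'a. x \<bullet> a) = (\<lambda>x. b \<bullet> a)" for b
    by (rule ext, rule partial_deriv_eq) (auto intro!: derivative_eq_intros)
  then show ?thesis using Suc by (auto simp: Ck_const intro!: derivative_intros differentiableI)
qed (auto intro!: continuous_intros)

lemma Ck_inner_self: "Ck k (\<lambda>x::'a::euclidean_space. x \<bullet> x)"
proof (cases k)
  case (Suc m)
  have "partial_deriv b (\<lambda>x::'a. x \<bullet> x) = (\<lambda>x. 2 * (x \<bullet> b))" for b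
    by (rule ext, rule partial_deriv_eq)
       (auto intro!: derivative_eq_intros simp: inner_commute)
  moreover have "(\<lambda>x::'a. x \<bullet> x) differentiable (at x)" for x
    by (rule differentiableI) (auto intro!: derivative_eq_intros)
  ultimately show ?thesis using Suc by (auto simp: intro!: Ck_cmult Ck_inner_left)
qed (auto intro!: continuous_intros)

lemma Ck_compose:
  fixes F :: "real \<Rightarrow> real"
  assumes "Ck k F" "Ck k q"
  shows "Ck k (\<lambda>x. F (q x))"
  using assms
proof (induction k arbitrary: F)
  case 0
  then show ?case by (auto intro: continuous_on_compose2)
next
  case (Suc k)
  have D: "((\<lambda>x. F (q x)) has_derivative (\<lambda>h. gradient F (q x) \<bullet> (gradient q x \<bullet> h))) (at x)" for x
    using Suc.prems by (intro has_derivative_compose[of q _ x UNIV F, simplified] has_derivative_gradient) auto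
  have eq: "partial_deriv b (\<lambda>x. F (q x)) = (\<lambda>x. partial_deriv 1 F (q x) * partial_deriv b q x)"
    if b: "b \<in> Basis" for b
  proof
    fix x
    show "partial_deriv b (\<lambda>x. F (q x)) x = partial_deriv 1 F (q x) * partial_deriv b q x"
      using partial_deriv_eq[OF D, of b x] by (simp add: gradient_inner_Basis b gradient_def)
  qed
  show ?case
    using Suc.prems Suc.IH Ck_Suc_imp[OF Suc.prems(2)] differentiableI[OF D]
    by (auto simp: eq intro!: Ck_mult)
qed

lemma partial_deriv_compose_real:
  fixes F :: "real \<Rightarrow> real"
  assumes "(F has_real_derivative D) (at (q x))" "q differentiable (at x)" "b \<in> Basis"
  shows "partial_deriv b (\<lambda>x. F (q x)) x = D * partial_deriv b q x"
proof -
  have "((\<lambda>x. F (q x)) has_derivative (\<lambda>h. D * (gradient q x \<bullet> h))) (at x)"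
    using assms
    by (intro has_derivative_compose[of q _ x UNIV F, simplified] has_derivative_gradient)
       (simp_all add: has_field_derivative_def)
  from partial_deriv_eq[OF this] show ?thesis by (simp add: gradient_inner_Basis assms)
qed

lemma partial_deriv_reflect:
  assumes "f differentiable (at (y - x))" "b \<in> Basis"
  shows "partial_deriv b (\<lambda>z. f (y - z)) x = - partial_deriv b f (y - x)"
proof -
  have "((\<lambda>z. f (y - z)) has_derivative (\<lambda>h. gradient f (y - x) \<bullet> (- h))) (at x)"
    using assms
    by (intro has_derivative_compose[of "\<lambda>z. y - z" "\<lambda>h. -h" x UNIV f, simplified] has_derivative_gradient)
       (auto intro!: derivative_eq_intros)
  from partial_deriv_eq[OF this] show ?thesis by (simp add: gradient_inner_Basis assms)
qed

lemma differentiable_reflect: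
  fixes f :: "'a::euclidean_space \<Rightarrow> real"
  assumes "f differentiable (at (y - x))"
  shows "(\<lambda>z. f (y - z)) differentiable (at x)"
proof -
  have "((\<lambda>z. f (y - z)) has_derivative (\<lambda>h. gradient f (y - x) \<bullet> (- h))) (at x)"
    using assms
    by (intro has_derivative_compose[of "\<lambda>z. y - z" "\<lambda>h. -h" x UNIV f, simplified] has_derivative_gradient)
       (auto intro!: derivative_eq_intros)
  then show ?thesis by (rule differentiableI)
qed

lemma Ck_reflect: "Ck k f \<Longrightarrow> Ck k (\<lambda>z. f (y - z))"
proof (induction k arbitrary: f)
  case 0
  then show ?case by (auto intro!: continuous_on_compose2[of UNIV f] continuous_intros)
next
  case (Suc k)
  have "partial_deriv b (\<lambda>z. f (y - z)) = (\<lambda>z. (-1) * partial_deriv b f (y - z))"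
    if "b \<in> Basis" for b
    using Suc.prems that by (intro ext) (simp add: partial_deriv_reflect)
  moreover have "Ck k (\<lambda>z. (-1) * partial_deriv b f (y - z))" if "b \<in> Basis" for b
    using Suc that by (intro Ck_cmult Suc.IH) simp
  ultimately show ?case
    using Suc by (auto intro!: differentiable_reflect)
qed

subsection \<open>Flat functions and mollifiers\<close>

text \<open>Every derivative of exp (-1/t) has the form P (1/t) exp (-1/t). Indexing by the
  polynomial makes the family closed under differentiation, so smoothness is a one-line
  induction.\<close>

definition flat :: "real poly \<Rightarrow> real \<Rightarrow> real" where
  "flat P t = (if t > 0 then poly P (1 / t) * exp (- (1 / t)) else 0)"

text \<open>The free power of x absorbs the factor x in \<open>poly (pCons a P) x\<close>, which is
  why the induction over the polynomial generalises over k.\<close>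

lemma tendsto_poly_exp_neg:
  "((\<lambda>x::real. x ^ k * poly P x * exp (- x)) \<longlongrightarrow> 0) at_top"
proof (induction P arbitrary: k)
  case 0
  then show ?case by simp
next
  case (pCons a P)
  have "((\<lambda>x::real. a * (x ^ k / exp x) + x ^ Suc k * poly P x * exp (- x)) \<longlongrightarrow> a * 0 + 0) at_top"
    by (intro tendsto_intros pCons.IH tendsto_power_div_exp_0)
  then show ?case by (simp add: algebra_simps exp_minus field_simps)
qed

text \<open>The polynomial is x^2 (P - P') taken at x = 1/t: the factor 1/t^2 comes from the inner
  derivative, P from the exponential and -P' from the polynomial. At t = 0 the right-hand limit is a
  limit at infinity in 1/t.\<close>

lemma has_real_derivative_flat:
  "(flat P has_real_derivative flat ([:0, 0, 1:] * (P - pderiv P)) t) (at t)"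
proof -
  consider "t > 0" | "t < 0" | "t = 0" by linarith
  then show ?thesis
  proof cases
    case 1
    have "((\<lambda>t. poly P (1 / t) * exp (- (1 / t))) has_real_derivative
        (poly (pderiv P) (1 / t) * (- (1 / t^2))) * exp (- (1 / t))
          + poly P (1 / t) * (exp (- (1 / t)) * (1 / t^2))) (at t)"
      using 1 by (auto intro!: derivative_eq_intros DERIV_chain2[OF poly_DERIV] simp: power2_eq_square field_simps)
    then have "((\<lambda>t. poly P (1 / t) * exp (- (1 / t))) has_real_derivative
        flat ([:0, 0, 1:] * (P - pderiv P)) t) (at t)"
      by (rule DERIV_cong) (use 1 in \<open>simp add: flat_def field_simps power2_eq_square\<close>)
    then show ?thesis
      by (rule has_field_derivative_transform_within_open[where S = "{0<..}"]) (use 1 in \<open>auto simp: flat_def\<close>)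
  next
    case 2
    have "((\<lambda>t. 0) has_real_derivative 0) (at t)" by simp
    then have "(flat P has_real_derivative 0) (at t)"
      by (rule has_field_derivative_transform_within_open[where S = "{..<0}"]) (use 2 in \<open>auto simp: flat_def\<close>)
    then show ?thesis using 2 by (simp add: flat_def)
  next
    case 3
    have "((\<lambda>h. flat P h / h) \<longlongrightarrow> 0) (at_right 0)"
    proof -
      have "((\<lambda>h. (inverse h) ^ 1 * poly P (inverse h) * exp (- inverse h)) \<longlongrightarrow> 0) (at_right (0::real))"
        using tendsto_poly_exp_neg filterlim_inverse_at_top_right by (rule filterlim_compose)
      then show ?thesis
        by (rule Lim_transform_eventually)
           (auto simp: eventually_at_filter flat_def field_simps)
    qed
    moreover have "((\<lambda>h. flat P h / h) \<longlongrightarrow> 0) (at_left 0)"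
      by (rule Lim_transform_eventually[OF tendsto_const]) (auto simp: eventually_at_filter flat_def)
    ultimately have "((\<lambda>h. flat P h / h) \<longlongrightarrow> 0) (at 0)" by (simp add: filterlim_split_at)
    then show ?thesis using 3 by (simp add: has_field_derivative_iff flat_def)
  qed
qed

lemma Ck_flat: "Ck k (flat P)"
proof (induction k arbitrary: P)
  case 0
  show ?case
    using DERIV_isCont[OF has_real_derivative_flat] by (simp add: continuous_at_imp_continuous_on)
next
  case (Suc k)
  have "partial_deriv 1 (flat P) = flat ([:0, 0, 1:] * (P - pderiv P))"
    by (rule ext, subst partial_deriv_eq[OF has_real_derivative_flat[unfolded has_field_derivative_def]]) simp
  then show ?case
    using Suc has_real_derivative_flat[unfolded has_field_derivative_def]
    by (auto intro: differentiableI)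
qed

lemma flat_1_nonneg: "0 \<le> flat 1 t" and flat_1_le_1: "flat 1 t \<le> 1" and flat_1_eq_0_iff: "flat 1 t = 0 \<longleftrightarrow> t \<le> 0"
  by (auto simp: flat_def)

subsection \<open>Affine changes of variables\<close>

lemma nn_integral_lborel_affine:
  fixes f :: "'a::euclidean_space \<Rightarrow> ennreal"
  assumes [measurable]: "f \<in> borel_measurable borel" and c: "c \<noteq> 0"
  shows "(\<integral>\<^sup>+x. f x \<partial>lborel) = ennreal (\<bar>c\<bar> ^ DIM('a)) * (\<integral>\<^sup>+x. f (t + c *\<^sub>R x) \<partial>lborel)"
  by (subst lborel_affine[OF c, of t])
     (simp add: nn_integral_density nn_integral_distr nn_integral_cmult)

lemma nn_integral_lborel_translate:
  fixes f :: "'a::euclidean_space \<Rightarrow> ennreal"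
  assumes "f \<in> borel_measurable borel"
  shows "(\<integral>\<^sup>+x. f (t + x) \<partial>lborel) = (\<integral>\<^sup>+x. f x \<partial>lborel)"
  using nn_integral_lborel_affine[OF assms, of 1 t] by simp

lemma nn_integral_lborel_reflect:
  fixes f :: "'a::euclidean_space \<Rightarrow> ennreal"
  assumes "f \<in> borel_measurable borel"
  shows "(\<integral>\<^sup>+x. f (t - x) \<partial>lborel) = (\<integral>\<^sup>+x. f x \<partial>lborel)"
  using nn_integral_lborel_affine[OF assms, of "-1" t] by simp

lemma integral_lborel_affine1:
  fixes f :: "'a::euclidean_space \<Rightarrow> real"
  assumes [measurable]: "f \<in> borel_measurable borel" and "\<bar>c\<bar> = 1"
  shows "(\<integral>x. f (t + c *\<^sub>R x) \<partial>lborel) = (\<integral>x. f x \<partial>lborel)"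
    and "integrable lborel (\<lambda>x. f (t + c *\<^sub>R x)) \<longleftrightarrow> integrable lborel f"
proof -
  have c: "c \<noteq> 0" using assms by auto
  have eq: "distr lborel borel (\<lambda>x::'a. t + c *\<^sub>R x) = lborel"
    using lborel_affine[OF c, of t] assms(2) by (simp add: density_1)
  show "(\<integral>x. f (t + c *\<^sub>R x) \<partial>lborel) = (\<integral>x. f x \<partial>lborel)"
    using integral_distr[of "\<lambda>x::'a. t + c *\<^sub>R x" lborel borel f] by (simp add: eq)
  show "integrable lborel (\<lambda>x. f (t + c *\<^sub>R x)) \<longleftrightarrow> integrable lborel f"
    using integrable_distr_eq[of "\<lambda>x::'a. t + c *\<^sub>R x" lborel borel f] by (simp add: eq)
qed

lemma integral_lborel_reflect:
  fixes f :: "'a::euclidean_space \<Rightarrow> real"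
  assumes "f \<in> borel_measurable borel"
  shows "(\<integral>x. f (t - x) \<partial>lborel) = (\<integral>x. f x \<partial>lborel)"
    and "integrable lborel (\<lambda>x. f (t - x)) \<longleftrightarrow> integrable lborel f"
  using integral_lborel_affine1[OF assms, of "-1" t] by auto

lemma integral_lborel_translate:
  fixes f :: "'a::euclidean_space \<Rightarrow> real"
  assumes "f \<in> borel_measurable borel"
  shows "(\<integral>x. f (t + x) \<partial>lborel) = (\<integral>x. f x \<partial>lborel)"
    and "integrable lborel (\<lambda>x. f (t + x)) \<longleftrightarrow> integrable lborel f"
  using integral_lborel_affine1[OF assms, of 1 t] by auto

subsection \<open>Smooth functions with bounded support\<close>

definition Ccinf :: "('a::euclidean_space \<Rightarrow> real) \<Rightarrow> bool" where
  "Ccinf f \<longleftrightarrow> (\<forall>k. Ck k f) \<and> bounded {x. f x \<noteq> 0}"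

lemma Ccinf_differentiable: "Ccinf f \<Longrightarrow> f differentiable (at x)"
  unfolding Ccinf_def by (metis Ck.simps(2))

lemma Ccinf_continuous_on: "Ccinf f \<Longrightarrow> continuous_on S f"
  unfolding Ccinf_def using Ck_imp_continuous_on by blast

lemma Ccinf_measurable [measurable_dest]: "Ccinf f \<Longrightarrow> f \<in> borel_measurable borel"
  by (intro borel_measurable_continuous_onI Ccinf_continuous_on)

lemma partial_deriv_support:
  "{x. partial_deriv b f x \<noteq> 0} \<subseteq> closure {x. f x \<noteq> 0}"
proof
  fix x assume "x \<in> {x. partial_deriv b f x \<noteq> 0}"
  moreover have "partial_deriv b f x = 0" if "x \<notin> closure {x. f x \<noteq> 0}"
  proof -
    have "partial_deriv b f x = partial_deriv b (\<lambda>x. 0) x"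
      by (rule partial_deriv_cong_open[of "- closure {x. f x \<noteq> 0}"])
         (use that closure_subset[of "{x. f x \<noteq> 0}"] in auto)
    also have "\<dots> = 0" by (simp add: partial_deriv_eq[OF has_derivative_const])
    finally show ?thesis .
  qed
  ultimately show "x \<in> closure {x. f x \<noteq> 0}" by auto
qed

lemma Ccinf_partial_deriv: "Ccinf f \<Longrightarrow> b \<in> Basis \<Longrightarrow> Ccinf (partial_deriv b f)"
  unfolding Ccinf_def
  by (metis Ck.simps(2) bounded_closure bounded_subset partial_deriv_support)

lemma Ccinf_reflect: 
  assumes "Ccinf f" shows "Ccinf (\<lambda>z. f (y - z))"
proof -
  have eq: "{x. f (y - x) \<noteq> 0} = (\<lambda>x. y - x) ` {x. f x \<noteq> 0}"
    by (force simp: image_iff intro: exI[of _ "y - _"])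
  have "bounded ((\<lambda>x. y + x) ` uminus ` {x. f x \<noteq> 0})"
    using assms by (intro bounded_translation) (simp add: Ccinf_def)
  then have "bounded {x. f (y - x) \<noteq> 0}"
    unfolding eq by (simp add: image_image)
  then show ?thesis using assms by (auto simp: Ccinf_def Ck_reflect)
qed

lemma Ccinf_support:
  assumes "Ccinf f"
  obtains R where "R > 0" "{x. f x \<noteq> 0} \<subseteq> cball 0 R"
  using assms unfolding Ccinf_def bounded_pos by (auto simp: subset_eq)

lemma Ccinf_bounded:
  assumes "Ccinf f"
  obtains C where "C > 0" "\<And>x. \<bar>f x\<bar> \<le> C"
proof -
  let ?K = "closure {x. f x \<noteq> 0}"
  have "compact ?K" using assms by (simp add: Ccinf_def compact_closure)
  then have "bounded (f ` ?K)"
    using assms by (intro compact_imp_bounded compact_continuous_image Ccinf_continuous_on)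
  then obtain C where C: "C > 0" "\<And>x. x \<in> ?K \<Longrightarrow> \<bar>f x\<bar> \<le> C"
    by (auto simp: bounded_pos)
  have "\<bar>f x\<bar> \<le> C" for x
    using C closure_subset[of "{x. f x \<noteq> 0}"] by (cases "f x = 0") (auto simp: subset_eq)
  with C(1) show ?thesis using that by blast
qed

lemma Ccinf_integrable:
  assumes "Ccinf f"
  shows "integrable lborel f"
proof -
  obtain C where C: "\<And>x. \<bar>f x\<bar> \<le> C" using Ccinf_bounded[OF assms] by metis
  obtain R where R: "{x. f x \<noteq> 0} \<subseteq> cball 0 R"
    using Ccinf_support[OF assms] by metis
  have "integrable lborel (\<lambda>x::'a. C * indicator (cball 0 R) x)"
    using emeasure_lborel_cball_finite[of "0::'a" R] 
    by (intro integrable_mult_right integrable_real_indicator) auto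
  then show ?thesis
  proof (rule Bochner_Integration.integrable_bound)
    show "f \<in> borel_measurable lborel" using Ccinf_measurable[OF assms] by simp
    show "AE x in lborel. norm (f x) \<le> norm (C * indicator (cball 0 R) x)"
    proof (rule AE_I2)
      fix x show "norm (f x) \<le> norm (C * indicator (cball 0 R) x)"
        using C[of x] R by (cases "f x = 0") (auto simp: subset_eq indicator_def)
    qed
  qed
qed

lemma Ccinf_lipschitz:
  assumes "Ccinf f"
  obtains L where "L > 0" "\<And>x y. \<bar>f x - f y\<bar> \<le> L * norm (x - y)"
proof -
  have "\<exists>C>0. \<forall>x. \<bar>partial_deriv b f x\<bar> \<le> C" if "b \<in> Basis" for b
    using Ccinf_bounded[OF Ccinf_partial_deriv[OF assms that]] by metis
  then obtain C where C: "\<And>b. b \<in> Basis \<Longrightarrow> C b > 0"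
    "\<And>b x. b \<in> Basis \<Longrightarrow> \<bar>partial_deriv b f x\<bar> \<le> C b" by metis
  define L where "L = (\<Sum>b\<in>Basis. C b)"
  have "L > 0" unfolding L_def by (intro sum_pos C) auto
  have "norm (gradient f x) \<le> L" for x
  proof -
    have "norm (gradient f x) \<le> (\<Sum>b\<in>Basis. \<bar>gradient f x \<bullet> b\<bar>)" by (rule norm_le_l1)
    also have "\<dots> \<le> L" unfolding L_def by (intro sum_mono) (simp add: gradient_inner_Basis C)
    finally show ?thesis .
  qed
  then have on: "onorm (\<lambda>h. gradient f x \<bullet> h) \<le> L" for x
    by (intro onorm_bound) (use \<open>L > 0\<close> in \<open>auto intro!: order_trans[OF Cauchy_Schwarz_ineq2] mult_right_mono\<close>)
  have "\<bar>f x - f y\<bar> \<le> L * norm (x - y)" for x y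
    using differentiable_bound[of UNIV f "\<lambda>x h. gradient f x \<bullet> h" L x y] on
      has_derivative_gradient[OF Ccinf_differentiable[OF assms]] by simp
  with \<open>L > 0\<close> show ?thesis using that by blast
qed

text \<open>The gradient is Lipschitz, so the second-order remainder is quadratic uniformly in x.
  This uniformity replaces dominated convergence when difference quotients are taken under an
  integral, both in \<open>integral_partial_deriv_eq_0\<close> and in
  \<open>has_derivative_conv\<close>.\<close>

lemma Ccinf_remainder:
  assumes "Ccinf f"
  obtains L where "L > 0" "\<And>x h. \<bar>f (x + h) - f x - gradient f x \<bullet> h\<bar> \<le> L * (norm h)^2"
proof -
  have "\<exists>C>0. \<forall>x y. \<bar>partial_deriv b f x - partial_deriv b f y\<bar> \<le> C * norm (x - y)" if "b \<in> Basis" for b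
    using Ccinf_lipschitz[OF Ccinf_partial_deriv[OF assms that]] by metis
  then obtain C where C: "\<And>b. b \<in> Basis \<Longrightarrow> C b > 0"
    "\<And>b x y. b \<in> Basis \<Longrightarrow> \<bar>partial_deriv b f x - partial_deriv b f y\<bar> \<le> C b * norm (x - y)" by metis
  define L where "L = (\<Sum>b\<in>Basis. C b)"
  have "L > 0" unfolding L_def by (intro sum_pos C) auto
  have lip: "norm (gradient f x - gradient f y) \<le> L * norm (x - y)" for x y
  proof -
    have "norm (gradient f x - gradient f y) \<le> (\<Sum>b\<in>Basis. \<bar>(gradient f x - gradient f y) \<bullet> b\<bar>)"
      by (rule norm_le_l1)
    also have "\<dots> \<le> L * norm (x - y)" unfolding L_def sum_distrib_right
      by (intro sum_mono) (simp add: inner_diff_left gradient_inner_Basis C)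
    finally show ?thesis .
  qed
  have "\<bar>f (x + h) - f x - gradient f x \<bullet> h\<bar> \<le> L * (norm h)^2" for x h
  proof -
    have "norm (f (x + h) - f x - gradient f x \<bullet> (x + h - x)) \<le> norm (x + h - x) * (L * norm h)"
    proof (rule differentiable_bound_linearization[where S = "cball x (norm h)"
          and f' = "\<lambda>z h. gradient f z \<bullet> h"])
      fix z assume z: "z \<in> cball x (norm h)"
      show "(f has_derivative (\<lambda>h. gradient f z \<bullet> h)) (at z within cball x (norm h))"
        by (rule has_derivative_at_withinI[OF has_derivative_gradient[OF Ccinf_differentiable[OF assms]]])
      have "norm (gradient f z - gradient f x) \<le> L * norm h"
        using lip[of z x] z \<open>L > 0\<close>
        by (smt (verit) dist_norm mem_cball mult_left_mono norm_minus_commute)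
      then show "onorm ((\<lambda>h. gradient f z \<bullet> h) - (\<lambda>h. gradient f x \<bullet> h)) \<le> L * norm h"
        using \<open>L > 0\<close>
        by (intro onorm_bound)
           (auto simp flip: inner_diff_left intro!: order_trans[OF Cauchy_Schwarz_ineq2] mult_right_mono)
    qed (auto simp: dist_norm intro: mult_left_le_one_le)
    then show ?thesis by (simp add: power2_eq_square mult_ac)
  qed
  with \<open>L > 0\<close> show ?thesis using that by blast
qed

text \<open>By translation invariance the integral of f (x + h b) - f x is zero. Hence h times the
  integral of the derivative equals, up to sign, the integral of the remainder, which is O(h^2);
  divide by h and let h tend to 0.\<close>

lemma integral_partial_deriv_eq_0:
  assumes f: "Ccinf f" and b: "b \<in> Basis"
  shows "(\<integral>x. partial_deriv b f x \<partial>lborel) = 0"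
proof -
  obtain L where L: "L > 0" "\<And>x h. \<bar>f (x + h) - f x - gradient f x \<bullet> h\<bar> \<le> L * (norm h)^2"
    using Ccinf_remainder[OF f] by metis
  obtain R where R: "{x. f x \<noteq> 0} \<subseteq> cball 0 R"
    using Ccinf_support[OF f] by metis
  \<comment> \<open>The radius R + 1 contains the supports of f and of its translates by h <
    1.\<close>
  define m where "m = measure lborel (cball (0::'a) (R + 1))"
  define I where "I = (\<integral>x. partial_deriv b f x \<partial>lborel)"
  have f0: "f x = 0" if "R < norm x" for x using R that by (force simp: subset_eq)
  have g0: "partial_deriv b f x = 0" if "R < norm x" for x
  proof -
    have "closure {x. f x \<noteq> 0} \<subseteq> cball 0 R" using R by (simp add: closure_minimal)
    with partial_deriv_support[of b f] that show ?thesis by (force simp: subset_eq)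
  qed
  have main: "\<bar>I\<bar> \<le> h * (L * m)" if h: "0 < h" "h < 1" for h
  proof -
    define F where "F x = f (h *\<^sub>R b + x) - f x - h * partial_deriv b f x" for x
    have int: "integrable lborel f" "integrable lborel (\<lambda>x. f (h *\<^sub>R b + x))"
      "integrable lborel (partial_deriv b f)"
      using Ccinf_integrable[OF f] Ccinf_integrable[OF Ccinf_partial_deriv[OF f b]]
        integral_lborel_translate(2)[OF Ccinf_measurable[OF f]] by auto
    have IF: "(\<integral>x. F x \<partial>lborel) = - h * I"
      unfolding F_def using int integral_lborel_translate(1)[OF Ccinf_measurable[OF f]]
      by (simp add: I_def)
    have "\<bar>\<integral>x. F x \<partial>lborel\<bar> \<le> (\<integral>x. L * h^2 * indicator (cball (0::'a) (R + 1)) x \<partial>lborel)"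
    proof (rule order_trans[OF integral_abs_bound], rule integral_mono_AE)
      show "integrable lborel (\<lambda>x. \<bar>F x\<bar>)" unfolding F_def using int by auto
      show "integrable lborel (\<lambda>x::'a. L * h^2 * indicator (cball 0 (R + 1)) x)"
        using emeasure_lborel_cball_finite[of "0::'a" "R + 1"]
        by (intro integrable_mult_right integrable_real_indicator) auto
      have "\<bar>F x\<bar> \<le> L * h^2 * indicator (cball 0 (R + 1)) x" for x
      proof (cases "norm x \<le> R + 1")
        case True
        have "F x = f (x + h *\<^sub>R b) - f x - gradient f x \<bullet> (h *\<^sub>R b)"
          by (simp add: F_def gradient_inner_Basis b add.commute)
        then show ?thesis using L(2)[of x "h *\<^sub>R b"] True h b by simp
      next
        case False
        have "norm x \<le> norm (h *\<^sub>R b + x) + norm (h *\<^sub>R b)"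
          by (metis add_diff_cancel_left' norm_triangle_ineq4 add.commute)
        then have "R < norm (h *\<^sub>R b + x)" using False h b by simp
        then show ?thesis using False by (simp add: F_def f0 g0)
      qed
      then show "AE x in lborel. \<bar>F x\<bar> \<le> L * h^2 * indicator (cball 0 (R + 1)) x" by simp
    qed
    also have "\<dots> = L * h^2 * m"
      using emeasure_lborel_cball_finite[of "0::'a" "R + 1"] by (simp add: m_def)
    finally have "h * \<bar>I\<bar> \<le> h * (h * (L * m))"
      unfolding IF using h by (simp add: abs_mult power2_eq_square mult_ac)
    then show ?thesis using h by simp
  qed
  have "((\<lambda>h. h * (L * m)) \<longlongrightarrow> 0 * (L * m)) (at_right 0)" by (intro tendsto_intros)
  moreover have "\<forall>\<^sub>F h in at_right 0. \<bar>I\<bar> \<le> h * (L * m)"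
    using main eventually_at_right[of 0 "1::real"] by (auto intro!: exI[of _ 1])
  ultimately have "\<bar>I\<bar> \<le> 0 * (L * m)"
    by (rule tendsto_lowerbound) simp
  then show ?thesis by (simp add: I_def)
qed

lemma Ccinf_mult:
  assumes "Ccinf f" "\<And>k. Ck k g"
  shows "Ccinf (\<lambda>x. f x * g x)"
proof -
  have "bounded {x. f x * g x \<noteq> 0}"
    using assms(1) by (auto simp: Ccinf_def intro: bounded_subset)
  then show ?thesis using assms by (auto simp: Ccinf_def intro: Ck_mult)
qed

lemma partial_deriv_mult:
  assumes "f differentiable (at x)" "g differentiable (at x)" "b \<in> Basis"
  shows "partial_deriv b (\<lambda>x. f x * g x) x = f x * partial_deriv b g x + partial_deriv b f x * g x"
proof -
  have "((\<lambda>x. f x * g x) has_derivative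
      (\<lambda>h. f x * (gradient g x \<bullet> h) + (gradient f x \<bullet> h) * g x)) (at x)"
    using assms by (intro has_derivative_mult has_derivative_gradient) auto
  from partial_deriv_eq[OF this] show ?thesis
    by (simp add: gradient_inner_Basis assms)
qed

lemma integration_by_parts:
  assumes f: "Ccinf f" and g: "Ccinf g" and b: "b \<in> Basis"
  shows "(\<integral>x. f x * partial_deriv b g x \<partial>lborel) = - (\<integral>x. partial_deriv b f x * g x \<partial>lborel)"
proof -
  have [simp]: "Ck k f" "Ck k g" for k using f g by (auto simp: Ccinf_def)
  have sm: "Ck k (partial_deriv b g)" "Ck k (partial_deriv b f)" for k
    using Ccinf_partial_deriv[OF f b] Ccinf_partial_deriv[OF g b] by (auto simp: Ccinf_def)
  have i1: "integrable lborel (\<lambda>x. f x * partial_deriv b g x)"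
    by (intro Ccinf_integrable Ccinf_mult f sm)
  have i2: "integrable lborel (\<lambda>x. partial_deriv b f x * g x)"
    by (intro Ccinf_integrable Ccinf_mult Ccinf_partial_deriv f b) simp
  have "0 = (\<integral>x. partial_deriv b (\<lambda>x. f x * g x) x \<partial>lborel)"
    by (rule integral_partial_deriv_eq_0[symmetric]) (auto intro!: Ccinf_mult f b)
  also have "\<dots> = (\<integral>x. f x * partial_deriv b g x + partial_deriv b f x * g x \<partial>lborel)"
    using Ccinf_differentiable f g b by (intro Bochner_Integration.integral_cong refl partial_deriv_mult)
  also have "\<dots> = (\<integral>x. f x * partial_deriv b g x \<partial>lborel) + (\<integral>x. partial_deriv b f x * g x \<partial>lborel)"
    by (rule Bochner_Integration.integral_add[OF i1 i2])
  finally show ?thesis by simp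
qed

subsection \<open>Convolution\<close>

definition conv :: "('a::euclidean_space \<Rightarrow> real) \<Rightarrow> ('a \<Rightarrow> real) \<Rightarrow> 'a \<Rightarrow> real" where
  "conv \<phi> U y = (\<integral>z. \<phi> (y - z) * U z \<partial>lborel)"

lemma conv_integrable:
  assumes \<phi>: "Ccinf \<phi>" and U: "integrable lborel U"
  shows "integrable lborel (\<lambda>z. \<phi> (y - z) * U z)"
proof -
  have [measurable]: "\<phi> \<in> borel_measurable borel" "U \<in> borel_measurable borel"
    using Ccinf_measurable[OF \<phi>] U by auto
  obtain C where C: "C > 0" "\<And>x. \<bar>\<phi> x\<bar> \<le> C" using Ccinf_bounded[OF \<phi>] by metis
  show ?thesis
    by (rule Bochner_Integration.integrable_bound[of lborel "\<lambda>z. C * U z"])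
       (use U C in \<open>auto simp: abs_mult intro!: mult_right_mono\<close>)
qed

lemma has_derivative_conv:
  assumes \<phi>: "Ccinf \<phi>" and U: "integrable lborel U"
  shows "(conv \<phi> U has_derivative
    (\<lambda>h. (\<Sum>b\<in>Basis. conv (partial_deriv b \<phi>) U y *\<^sub>R b) \<bullet> h)) (at y)"
proof -
  obtain L where L: "L > 0" "\<And>x h. \<bar>\<phi> (x + h) - \<phi> x - gradient \<phi> x \<bullet> h\<bar> \<le> L * (norm h)^2"
    using Ccinf_remainder[OF \<phi>] by metis
  define J where "J = (\<integral>z. \<bar>U z\<bar> \<partial>lborel)"
  have "((\<lambda>y'. norm (y' - y)) \<longlongrightarrow> norm (y - y)) (at y)" by (intro tendsto_intros)
  then have "((\<lambda>y'. L * J * norm (y' - y)) \<longlongrightarrow> L * J * 0) (at y)" by (intro tendsto_intros) simp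
  show ?thesis
  proof (rule has_derivativeI_sandwich[of 1 _ _ _ _ "\<lambda>y'. L * J * norm (y' - y)"])
    fix y' assume y': "y' \<noteq> y"
    define h where "h = y' - y"
    let ?g = "\<Sum>b\<in>Basis. conv (partial_deriv b \<phi>) U y *\<^sub>R b"
    have i: "integrable lborel (\<lambda>z. (h \<bullet> b) * (partial_deriv b \<phi> (y - z) * U z))" if "b \<in> Basis" for b
      by (intro integrable_mult_right conv_integrable Ccinf_partial_deriv \<phi> U that)
    have gr: "(\<Sum>b\<in>Basis. (h \<bullet> b) * (partial_deriv b \<phi> (y - z) * U z)) = (gradient \<phi> (y - z) \<bullet> h) * U z" for z
      by (simp add: gradient_def inner_sum_left sum_distrib_left sum_distrib_right mult_ac inner_commute[of h])
    have g: "?g \<bullet> h = (\<integral>z. (gradient \<phi> (y - z) \<bullet> h) * U z \<partial>lborel)"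
    proof -
      have "?g \<bullet> h = (\<Sum>b\<in>Basis. (\<integral>z. (h \<bullet> b) * (partial_deriv b \<phi> (y - z) * U z) \<partial>lborel))"
        by (simp add: inner_sum_left inner_sum_right conv_def inner_commute[of _ h] mult.commute)
      also have "\<dots> = (\<integral>z. (\<Sum>b\<in>Basis. (h \<bullet> b) * (partial_deriv b \<phi> (y - z) * U z)) \<partial>lborel)"
        by (rule Bochner_Integration.integral_sum[symmetric]) (rule i)
      finally show ?thesis by (simp only: gr)
    qed
    have ig: "integrable lborel (\<lambda>z. (gradient \<phi> (y - z) \<bullet> h) * U z)"
    proof -
      have "integrable lborel (\<lambda>z. (\<Sum>b\<in>Basis. (h \<bullet> b) * (partial_deriv b \<phi> (y - z) * U z)))"
        by (rule Bochner_Integration.integrable_sum) (rule i)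
      then show ?thesis by (simp only: gr)
    qed
    have "(\<integral>z. \<phi> (y' - z) * U z - \<phi> (y - z) * U z - (gradient \<phi> (y - z) \<bullet> h) * U z \<partial>lborel)
        = conv \<phi> U y' - conv \<phi> U y - (\<integral>z. (gradient \<phi> (y - z) \<bullet> h) * U z \<partial>lborel)"
      unfolding conv_def by (simp add: Bochner_Integration.integral_diff conv_integrable[OF \<phi> U] ig)
    then have "conv \<phi> U y' - conv \<phi> U y - ?g \<bullet> h =
        (\<integral>z. \<phi> (y' - z) * U z - \<phi> (y - z) * U z - (gradient \<phi> (y - z) \<bullet> h) * U z \<partial>lborel)"
      unfolding g by simp
    also have "\<bar>\<dots>\<bar> \<le> (\<integral>z. L * (norm h)^2 * \<bar>U z\<bar> \<partial>lborel)"
    proof (rule order_trans[OF integral_abs_bound], rule integral_mono)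
      show "integrable lborel (\<lambda>z. \<bar>\<phi> (y' - z) * U z - \<phi> (y - z) * U z - (gradient \<phi> (y - z) \<bullet> h) * U z\<bar>)"
        by (intro integrable_abs Bochner_Integration.integrable_diff conv_integrable[OF \<phi> U] ig)
      show "integrable lborel (\<lambda>z. L * (norm h)^2 * \<bar>U z\<bar>)" using U by simp
      fix z
      have "\<phi> (y' - z) * U z - \<phi> (y - z) * U z - (gradient \<phi> (y - z) \<bullet> h) * U z
        = (\<phi> ((y - z) + h) - \<phi> (y - z) - gradient \<phi> (y - z) \<bullet> h) * U z"
        by (simp add: h_def algebra_simps)
      then show "\<bar>\<phi> (y' - z) * U z - \<phi> (y - z) * U z - (gradient \<phi> (y - z) \<bullet> h) * U z\<bar>
          \<le> L * (norm h)^2 * \<bar>U z\<bar>"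
        using L(2)[of "y - z" h] by (simp add: abs_mult mult_right_mono)
    qed
    also have "\<dots> = L * (norm h)^2 * J" by (simp add: J_def)
    finally show "norm (conv \<phi> U y' - conv \<phi> U y - ?g \<bullet> (y' - y)) / norm (y' - y)
        \<le> L * J * norm (y' - y)"
      using y' by (simp add: h_def[symmetric] divide_le_eq power2_eq_square mult_ac)
  next
    show "((\<lambda>y'. L * J * norm (y' - y)) \<longlongrightarrow> 0) (at y)"
      using \<open>((\<lambda>y'. L * J * norm (y' - y)) \<longlongrightarrow> L * J * 0) (at y)\<close> by simp
  qed (auto intro: bounded_linear_inner_right)
qed

lemma partial_deriv_conv:
  assumes "Ccinf \<phi>" "integrable lborel U" "b \<in> Basis"
  shows "partial_deriv b (conv \<phi> U) y = conv (partial_deriv b \<phi>) U y"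
  using partial_deriv_eq[OF has_derivative_conv[OF assms(1,2)], of b y] assms(3)
  by (simp add: inner_sum_left inner_Basis if_distrib cong: if_cong)

lemma Ck_conv:
  assumes "Ccinf \<phi>" "integrable lborel U"
  shows "Ck k (conv \<phi> U)"
  using assms(1)
proof (induction k arbitrary: \<phi>)
  case 0
  then show ?case
    using has_derivative_continuous[OF has_derivative_conv[OF _ assms(2)]]
    by (auto intro!: continuous_at_imp_continuous_on)
next
  case (Suc k)
  have "partial_deriv b (conv \<phi> U) = conv (partial_deriv b \<phi>) U" if "b \<in> Basis" for b
    using partial_deriv_conv[OF Suc.prems assms(2) that] by auto
  then show ?case
    using Suc Ccinf_partial_deriv differentiableI[OF has_derivative_conv[OF Suc.prems assms(2)]]
    by auto
qed

subsection \<open>Continuity of translations in the mean\<close>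

text \<open>Continuity of translations in L^1 at h = 0. Nonnegative integrals avoid any
  integrability side condition on the difference.\<close>

definition transl_cont :: "('a::euclidean_space \<Rightarrow> real) \<Rightarrow> bool" where
  "transl_cont f \<longleftrightarrow> (\<forall>e>0. \<exists>d>0. \<forall>h. norm h < d \<longrightarrow>
     (\<integral>\<^sup>+x. ennreal \<bar>f (x - h) - f x\<bar> \<partial>lborel) \<le> ennreal e)"

lemma transl_cont_limit:
  assumes [measurable]: "f \<in> borel_measurable borel"
    and g: "\<And>e. e > 0 \<Longrightarrow> \<exists>g. g \<in> borel_measurable borel \<and> transl_cont g \<and>
      (\<integral>\<^sup>+x. ennreal \<bar>f x - g x\<bar> \<partial>lborel) \<le> ennreal e"
  shows "transl_cont f"
  unfolding transl_cont_def
proof (intro allI impI)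
  fix e :: real assume e: "e > 0"
  obtain g where [measurable]: "g \<in> borel_measurable borel" and tg: "transl_cont g"
    and fg: "(\<integral>\<^sup>+x. ennreal \<bar>f x - g x\<bar> \<partial>lborel) \<le> ennreal (e / 3)"
    using g[of "e / 3"] e by auto
  obtain d where d: "d > 0" "\<And>h. norm h < d \<Longrightarrow> (\<integral>\<^sup>+x. ennreal \<bar>g (x - h) - g x\<bar> \<partial>lborel) \<le> ennreal (e / 3)"
    using tg e unfolding transl_cont_def by (meson divide_pos_pos zero_less_numeral)
  have "(\<integral>\<^sup>+x. ennreal \<bar>f (x - h) - f x\<bar> \<partial>lborel) \<le> ennreal e" if "norm h < d" for h
  proof -
    have "(\<integral>\<^sup>+x. ennreal \<bar>f (x - h) - f x\<bar> \<partial>lborel)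
       \<le> (\<integral>\<^sup>+x. ennreal \<bar>f (x - h) - g (x - h)\<bar> + ennreal \<bar>g (x - h) - g x\<bar> + ennreal \<bar>f x - g x\<bar> \<partial>lborel)"
      by (intro nn_integral_mono) (auto simp flip: ennreal_plus intro!: ennreal_leI)
    also have "\<dots> = (\<integral>\<^sup>+x. ennreal \<bar>f (x - h) - g (x - h)\<bar> \<partial>lborel) + (\<integral>\<^sup>+x. ennreal \<bar>g (x - h) - g x\<bar> \<partial>lborel)
        + (\<integral>\<^sup>+x. ennreal \<bar>f x - g x\<bar> \<partial>lborel)"
      by (simp add: nn_integral_add)
    also have "(\<integral>\<^sup>+x. ennreal \<bar>f (x - h) - g (x - h)\<bar> \<partial>lborel) = (\<integral>\<^sup>+x. ennreal \<bar>f x - g x\<bar> \<partial>lborel)"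
      using nn_integral_lborel_translate[of "\<lambda>x. ennreal \<bar>f x - g x\<bar>" "-h"] by simp
    also have "(\<integral>\<^sup>+x. ennreal \<bar>f x - g x\<bar> \<partial>lborel) + (\<integral>\<^sup>+x. ennreal \<bar>g (x - h) - g x\<bar> \<partial>lborel)
        + (\<integral>\<^sup>+x. ennreal \<bar>f x - g x\<bar> \<partial>lborel) \<le> ennreal (e/3) + ennreal (e/3) + ennreal (e/3)"
      by (intro add_mono fg d that)
    also have "\<dots> = ennreal e" using e by (simp flip: ennreal_plus)
    finally show ?thesis .
  qed
  with d(1) show "\<exists>d>0. \<forall>h. norm h < d \<longrightarrow> (\<integral>\<^sup>+x. ennreal \<bar>f (x - h) - f x\<bar> \<partial>lborel) \<le> ennreal e" by blast
qed

lemma transl_cont_cmult: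
  assumes [measurable]: "f \<in> borel_measurable borel" and f: "transl_cont f"
  shows "transl_cont (\<lambda>x. c * f x)"
  unfolding transl_cont_def
proof (intro allI impI)
  fix e :: real assume e: "e > 0"
  then have "e / (\<bar>c\<bar> + 1) > 0" by simp
  then obtain d where d: "d > 0" "\<And>h. norm h < d \<Longrightarrow> (\<integral>\<^sup>+x. ennreal \<bar>f (x - h) - f x\<bar> \<partial>lborel) \<le> ennreal (e / (\<bar>c\<bar> + 1))"
    using f unfolding transl_cont_def by meson
  have "(\<integral>\<^sup>+x. ennreal \<bar>c * f (x - h) - c * f x\<bar> \<partial>lborel) \<le> ennreal e" if "norm h < d" for h
  proof -
    have "(\<integral>\<^sup>+x. ennreal \<bar>c * f (x - h) - c * f x\<bar> \<partial>lborel) = ennreal \<bar>c\<bar> * (\<integral>\<^sup>+x. ennreal \<bar>f (x - h) - f x\<bar> \<partial>lborel)"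
      by (simp add: right_diff_distrib[symmetric] abs_mult ennreal_mult nn_integral_cmult)
    also have "\<dots> \<le> ennreal \<bar>c\<bar> * ennreal (e / (\<bar>c\<bar> + 1))"
      by (intro mult_left_mono d that) simp
    also have "\<dots> \<le> ennreal e"
      using e by (simp flip: ennreal_mult add: ennreal_leI divide_le_eq field_simps)
    finally show ?thesis .
  qed
  with d(1) show "\<exists>d>0. \<forall>h. norm h < d \<longrightarrow> (\<integral>\<^sup>+x. ennreal \<bar>c * f (x - h) - c * f x\<bar> \<partial>lborel) \<le> ennreal e" by blast
qed

lemma transl_cont_add:
  assumes [measurable]: "f \<in> borel_measurable borel" "g \<in> borel_measurable borel"
    and f: "transl_cont f" and g: "transl_cont g"
  shows "transl_cont (\<lambda>x. f x + g x)"
  unfolding transl_cont_def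
proof (intro allI impI)
  fix e :: real assume e: "e > 0"
  obtain d1 where d1: "d1 > 0" "\<And>h. norm h < d1 \<Longrightarrow> (\<integral>\<^sup>+x. ennreal \<bar>f (x - h) - f x\<bar> \<partial>lborel) \<le> ennreal (e / 2)"
    using f e unfolding transl_cont_def by (meson divide_pos_pos zero_less_numeral)
  obtain d2 where d2: "d2 > 0" "\<And>h. norm h < d2 \<Longrightarrow> (\<integral>\<^sup>+x. ennreal \<bar>g (x - h) - g x\<bar> \<partial>lborel) \<le> ennreal (e / 2)"
    using g e unfolding transl_cont_def by (meson divide_pos_pos zero_less_numeral)
  have "(\<integral>\<^sup>+x. ennreal \<bar>f (x - h) + g (x - h) - (f x + g x)\<bar> \<partial>lborel) \<le> ennreal e" if "norm h < min d1 d2" for h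
  proof -
    have "(\<integral>\<^sup>+x. ennreal \<bar>f (x - h) + g (x - h) - (f x + g x)\<bar> \<partial>lborel)
       \<le> (\<integral>\<^sup>+x. ennreal \<bar>f (x - h) - f x\<bar> + ennreal \<bar>g (x - h) - g x\<bar> \<partial>lborel)"
      by (intro nn_integral_mono) (auto simp flip: ennreal_plus intro!: ennreal_leI)
    also have "\<dots> = (\<integral>\<^sup>+x. ennreal \<bar>f (x - h) - f x\<bar> \<partial>lborel) + (\<integral>\<^sup>+x. ennreal \<bar>g (x - h) - g x\<bar> \<partial>lborel)"
      by (simp add: nn_integral_add)
    also have "\<dots> \<le> ennreal (e/2) + ennreal (e/2)"
      using that by (intro add_mono d1 d2) auto
    also have "\<dots> = ennreal e" using e by (simp flip: ennreal_plus)
    finally show ?thesis .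
  qed
  with d1(1) d2(1) show "\<exists>d>0. \<forall>h. norm h < d \<longrightarrow> (\<integral>\<^sup>+x. ennreal \<bar>f (x - h) + g (x - h) - (f x + g x)\<bar> \<partial>lborel) \<le> ennreal e"
    by (intro exI[of _ "min d1 d2"]) auto
qed

text \<open>Regularity squeezes A between a compact C and an open U. Since C has positive distance d
  from the complement of U, a shift by less than d can change the indicator only where x or x - h
  lies in A - C or in U - A: four sets of measure at most e/4.\<close>

lemma transl_cont_indicator_bounded:
  fixes A :: "'a::euclidean_space set"
  assumes A: "A \<in> sets borel" and bd: "bounded A"
  shows "transl_cont (indicator A)"
  unfolding transl_cont_def
proof (intro allI impI)
  fix e :: real assume e: "e > 0"
  obtain U where U: "open U" "A \<subseteq> U" "emeasure lborel (U - A) \<le> ennreal (e / 4)"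
    using outer_regular_lborel_le[OF A, of "e / 4"] e by auto
  obtain V where V: "open V" "- A \<subseteq> V" "emeasure lborel (V - (- A)) \<le> ennreal (e / 4)"
    using outer_regular_lborel_le[of "- A" "e / 4"] A e by auto
  define C where "C = - V"
  have C: "closed C" "C \<subseteq> A" "emeasure lborel (A - C) \<le> ennreal (e / 4)"
    using V by (auto simp: C_def closed_def intro: order_trans[OF emeasure_mono] simp: Int_commute Diff_eq)
  have "compact C" using C bd bounded_subset compact_eq_bounded_closed by blast
  moreover have "closed (- U)" using U by (simp add: closed_def)
  ultimately obtain d where d: "d > 0" "\<And>x y. x \<in> C \<Longrightarrow> y \<in> - U \<Longrightarrow> d \<le> dist x y"
    using separate_compact_closed[of C "- U"] C U by (metis Diff_eq Diff_eq_empty_iff subset_trans)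
  have [measurable]: "A \<in> sets borel" "C \<in> sets borel" "U \<in> sets borel"
    using A C U by auto
  have key: "(\<integral>\<^sup>+x. ennreal \<bar>indicator A (x - h) - indicator A x\<bar> \<partial>lborel) \<le> ennreal e" if h: "norm h < d" for h
  proof -
    have "ennreal \<bar>indicator A (x - h) - indicator A x\<bar> \<le>
        indicator (A - C) x + indicator (U - A) x + indicator (A - C) (x - h) + indicator (U - A) (x - h)" for x
    proof (cases "x \<in> A \<longleftrightarrow> x - h \<in> A")
      case False
      have "dist x (x - h) < d" using h by (simp add: dist_norm)
      then have "x \<in> C \<Longrightarrow> x - h \<in> U" "x - h \<in> C \<Longrightarrow> x \<in> U"
        using d(2)[of x "x - h"] d(2)[of "x - h" x] by (auto simp: dist_commute)
      then have "x \<in> A - C \<or> x \<in> U - A \<or> x - h \<in> A - C \<or> x - h \<in> U - A"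
        using False by auto
      moreover have "ennreal \<bar>indicator A (x - h) - indicator A x\<bar> \<le> 1"
        by (auto simp: indicator_def)
      ultimately show ?thesis
        by (auto simp: indicator_def)
    qed (auto simp: indicator_def)
    then have "(\<integral>\<^sup>+x. ennreal \<bar>indicator A (x - h) - indicator A x\<bar> \<partial>lborel)
      \<le> (\<integral>\<^sup>+x. indicator (A - C) x + indicator (U - A) x + indicator (A - C) (x - h) + indicator (U - A) (x - h) \<partial>lborel)"
      by (intro nn_integral_mono)
    also have "\<dots> = emeasure lborel (A - C) + emeasure lborel (U - A)
       + (\<integral>\<^sup>+x. indicator (A - C) (x - h) \<partial>lborel) + (\<integral>\<^sup>+x. indicator (U - A) (x - h) \<partial>lborel)"
      by (simp add: nn_integral_add)
    also have "(\<integral>\<^sup>+x. indicator (A - C) (x - h) \<partial>lborel) = emeasure lborel (A - C)"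
      using nn_integral_lborel_translate[of "indicator (A - C)" "- h"] by simp
    also have "(\<integral>\<^sup>+x. indicator (U - A) (x - h) \<partial>lborel) = emeasure lborel (U - A)"
      using nn_integral_lborel_translate[of "indicator (U - A)" "- h"] by simp
    also have "emeasure lborel (A - C) + emeasure lborel (U - A) + emeasure lborel (A - C) + emeasure lborel (U - A)
        \<le> ennreal (e/4) + ennreal (e/4) + ennreal (e/4) + ennreal (e/4)"
      by (intro add_mono C U)
    also have "\<dots> = ennreal e" using e by (simp flip: ennreal_plus)
    finally show ?thesis .
  qed
  with d(1) show "\<exists>d>0. \<forall>h. norm h < d \<longrightarrow> (\<integral>\<^sup>+x. ennreal \<bar>indicator A (x - h) - indicator A x\<bar> \<partial>lborel) \<le> ennreal e"
    by blast
qed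

text \<open>The bound 2 |f| is the one supplied by the limit case of
  \<open>integrable_induct\<close>.\<close>

lemma transl_cont_dominated:
  fixes f :: "'a::euclidean_space \<Rightarrow> real"
  assumes [measurable]: "f \<in> borel_measurable borel" "\<And>i. s i \<in> borel_measurable borel"
    and int: "integrable lborel f" and s: "\<And>i::nat. transl_cont (s i)"
    and lim: "\<And>x. (\<lambda>i. s i x) \<longlonglongrightarrow> f x"
    and bd: "\<And>i x. \<bar>s i x\<bar> \<le> 2 * \<bar>f x\<bar>"
  shows "transl_cont f"
proof (rule transl_cont_limit)
  fix e :: real assume e: "e > 0"
  have "(\<lambda>i. \<integral>\<^sup>+x. ennreal (norm (f x - s i x)) \<partial>lborel) \<longlonglongrightarrow> 0"
  proof (rule nn_integral_dominated_convergence_norm[where w = "\<lambda>x. 2 * \<bar>f x\<bar>"])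
    have "(\<integral>\<^sup>+x. ennreal \<bar>2 * f x\<bar> \<partial>lborel) < \<infinity>"
      using integrable_mult_right[OF int, of 2] unfolding integrable_iff_bounded by simp
    then show "(\<integral>\<^sup>+x. ennreal (2 * \<bar>f x\<bar>) \<partial>lborel) < \<infinity>" by (simp add: abs_mult)
  qed (use lim bd in auto)
  then have "\<forall>\<^sub>F i in sequentially. (\<integral>\<^sup>+x. ennreal (norm (f x - s i x)) \<partial>lborel) < ennreal e"
    using e by (intro order_tendstoD) auto
  then obtain i where "(\<integral>\<^sup>+x. ennreal \<bar>f x - s i x\<bar> \<partial>lborel) < ennreal e"
    by (auto simp: eventually_sequentially)
  then show "\<exists>g. g \<in> borel_measurable borel \<and> transl_cont g \<and> (\<integral>\<^sup>+x. ennreal \<bar>f x - g x\<bar> \<partial>lborel) \<le> ennreal e"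
    using s by (intro exI[of _ "s i"]) auto
qed simp

lemma transl_cont_integrable:
  fixes f :: "'a::euclidean_space \<Rightarrow> real"
  assumes "integrable lborel f"
  shows "transl_cont f"
  using assms
proof (induction f rule: integrable_induct)
  case (base A c)
  have A[measurable]: "A \<in> sets borel" using base by simp
  have "transl_cont (indicator A :: 'a \<Rightarrow> real)"
  \<comment> \<open>The set has finite measure but may be unbounded, so it is exhausted by its
    intersections with balls.\<close>
  proof (rule transl_cont_dominated[where s = "\<lambda>i. indicator (A \<inter> cball 0 (real i))"])
    show "transl_cont (indicator (A \<inter> cball 0 (real i)) :: 'a \<Rightarrow> real)" for i
      by (intro transl_cont_indicator_bounded) (auto intro: bounded_subset[OF bounded_cball])
    show "(\<lambda>i. indicator (A \<inter> cball 0 (real i)) x :: real) \<longlonglongrightarrow> indicator A x" for x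
    proof (rule tendsto_eventually)
      obtain N :: nat where "norm x \<le> real N" using real_arch_simple by blast
      then show "\<forall>\<^sub>F i in sequentially. indicator (A \<inter> cball 0 (real i)) x = (indicator A x :: real)"
        by (intro eventually_sequentiallyI[of N]) (auto simp: indicator_def)
    qed
  qed (use base in \<open>auto simp: indicator_def intro!: borel_measurable_indicator\<close>)
  from transl_cont_cmult[OF _ this, of c] show ?case by (simp add: mult.commute)
next
  case (add f g)
  then show ?case by (intro transl_cont_add) auto
next
  case (lim f s)
  show ?case
  proof (rule transl_cont_dominated[of f s])
    show "f \<in> borel_measurable borel" "s i \<in> borel_measurable borel" for i
      using lim(1)[of i] lim(4) by simp_all
    show "(\<lambda>i. s i x) \<longlonglongrightarrow> f x" "\<bar>s i x\<bar> \<le> 2 * \<bar>f x\<bar>" for x i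
      using lim(2)[of x] lim(3)[of x i] by simp_all
  qed (rule lim(4) lim(5))+
qed

subsection \<open>Mollification\<close>

text \<open>The argument e^2 - |x|^2 is a polynomial in x, so smoothness at the origin is automatic,
  and it is positive exactly on the open ball of radius e.\<close>

definition moll :: "real \<Rightarrow> 'a::euclidean_space \<Rightarrow> real" where
  "moll e x = flat 1 (e\<^sup>2 - x \<bullet> x) / (\<integral>z. flat 1 (e\<^sup>2 - z \<bullet> z) \<partial>(lborel :: 'a measure))"

lemma flat_ball_Ccinf:
  assumes "e > 0"
  shows "Ccinf (\<lambda>x::'a::euclidean_space. flat 1 (e\<^sup>2 - x \<bullet> x))"
    and "{x::'a. flat 1 (e\<^sup>2 - x \<bullet> x) \<noteq> 0} = ball 0 e"
proof -
  show *: "{x::'a. flat 1 (e\<^sup>2 - x \<bullet> x) \<noteq> 0} = ball 0 e"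
    using assms by (auto simp: flat_1_eq_0_iff dot_square_norm not_le intro: power2_less_imp_less power_strict_mono)
  show "Ccinf (\<lambda>x::'a. flat 1 (e\<^sup>2 - x \<bullet> x))"
    unfolding Ccinf_def *
    by (auto intro!: Ck_compose[OF Ck_flat] Ck_diff Ck_const Ck_inner_self)
qed

lemma flat_ball_integral_pos:
  assumes "e > 0"
  shows "(\<integral>z. flat 1 (e\<^sup>2 - z \<bullet> z) \<partial>(lborel :: 'a::euclidean_space measure)) > 0"
proof -
  let ?f = "\<lambda>z::'a. flat 1 (e\<^sup>2 - z \<bullet> z)"
  have int: "integrable lborel ?f" by (intro Ccinf_integrable flat_ball_Ccinf assms)
  have "(\<integral>z. ?f z \<partial>lborel) \<noteq> 0"
  proof
    assume "(\<integral>z. ?f z \<partial>lborel) = 0"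
    then have "AE z in lborel. ?f z = 0"
      using integral_nonneg_eq_0_iff_AE[OF int] by (simp add: flat_1_nonneg)
    moreover have "?f z = 0 \<longleftrightarrow> z \<notin> ball 0 e" for z
      using flat_ball_Ccinf(2)[OF assms, where 'a='a] by blast
    ultimately have "AE z in lborel. z \<notin> ball (0::'a) e" by simp
    then have "ball (0::'a) e \<in> null_sets lborel"
      by (simp add: AE_iff_null_sets)
    then have "negligible (ball (0::'a) e)"
      by (simp add: negligible_iff_null_sets null_sets_completionI)
    then show False using assms open_not_negligible[of "ball (0::'a) e"] by simp
  qed
  moreover have "(\<integral>z. ?f z \<partial>lborel) \<ge> 0" by (intro Bochner_Integration.integral_nonneg) (simp add: flat_1_nonneg)
  ultimately show ?thesis by simp
qed

lemma moll_props:
  assumes "e > 0"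
  shows Ccinf_moll: "Ccinf (moll e :: 'a::euclidean_space \<Rightarrow> real)"
    and moll_nonneg: "moll e (x::'a) \<ge> 0"
    and moll_support: "{x::'a. moll e x \<noteq> 0} = ball 0 e"
    and integral_moll: "(\<integral>x. moll e (x::'a) \<partial>lborel) = 1"
    and nn_integral_moll: "(\<integral>\<^sup>+x. ennreal (moll e (x::'a)) \<partial>lborel) = 1"
proof -
  let ?Z = "\<integral>z. flat 1 (e\<^sup>2 - z \<bullet> z) \<partial>(lborel :: 'a measure)"
  note Z = flat_ball_integral_pos[OF assms, where 'a='a]
  have eq: "moll e = (\<lambda>x::'a. flat 1 (e\<^sup>2 - x \<bullet> x) * (1 / ?Z))"
    by (simp add: moll_def fun_eq_iff)
  show C: "Ccinf (moll e :: 'a \<Rightarrow> real)"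
    unfolding eq by (intro Ccinf_mult flat_ball_Ccinf assms Ck_const)
  show nn: "moll e x \<ge> 0" for x :: 'a
    using Z by (simp add: moll_def flat_1_nonneg)
  show "{x::'a. moll e x \<noteq> 0} = ball 0 e"
    using Z by (simp add: moll_def flat_ball_Ccinf(2)[OF assms, symmetric])
  show I: "(\<integral>x. moll e (x::'a) \<partial>lborel) = 1"
    unfolding eq using Z by simp
  show "(\<integral>\<^sup>+x. ennreal (moll e (x::'a)) \<partial>lborel) = 1"
    using nn_integral_eq_integral[OF Ccinf_integrable[OF C]] nn I by simp
qed

lemma moll_eq_0: "e > 0 \<Longrightarrow> e \<le> norm x \<Longrightarrow> moll e x = 0"
  using moll_support[of e] by force

text \<open>Since the kernel has mass 1, the L^1 distance is at most the kernel average of the L^1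
  norms of U (x - w) - U x over |w| < e, and each of these is small by continuity of
  translations.\<close>

lemma conv_moll_L1:
  fixes U :: "'a::euclidean_space \<Rightarrow> real"
  assumes U: "integrable lborel U"
  shows "((\<lambda>e. \<integral>\<^sup>+x. ennreal \<bar>conv (moll e) U x - U x\<bar> \<partial>lborel) \<longlongrightarrow> 0) (at_right 0)"
proof -
  have [measurable]: "U \<in> borel_measurable borel" using U by auto
  have main: "\<forall>\<^sub>F e in at_right 0. (\<integral>\<^sup>+x. ennreal \<bar>conv (moll e) U x - U x\<bar> \<partial>lborel) \<le> ennreal \<delta>" if "\<delta> > 0" for \<delta>
  proof -
    obtain d where d: "d > 0" "\<And>h. norm h < d \<Longrightarrow> (\<integral>\<^sup>+x. ennreal \<bar>U (x - h) - U x\<bar> \<partial>lborel) \<le> ennreal \<delta>"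
      using transl_cont_integrable[OF U] \<open>\<delta> > 0\<close> unfolding transl_cont_def by meson
    have "(\<integral>\<^sup>+x. ennreal \<bar>conv (moll e) U x - U x\<bar> \<partial>lborel) \<le> ennreal \<delta>" if e: "0 < e" "e < d" for e
    proof -
      note m = Ccinf_moll[OF e(1), where 'a='a]
      have [measurable]: "(moll e :: 'a \<Rightarrow> real) \<in> borel_measurable borel" by (rule Ccinf_measurable[OF m])
      have "ennreal \<bar>conv (moll e) U x - U x\<bar> \<le> (\<integral>\<^sup>+w. ennreal (moll e w) * ennreal \<bar>U (x - w) - U x\<bar> \<partial>lborel)" for x
      proof -
        have i1: "integrable lborel (\<lambda>w. moll e w * U (x - w))"
          using conv_integrable[OF m U, of x]
            integral_lborel_reflect(2)[of "\<lambda>z. moll e (x - z) * U z" x] by simp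
        have i2: "integrable lborel (\<lambda>w::'a. moll e w * U x)"
          using Ccinf_integrable[OF m] by simp
        have "conv (moll e) U x = (\<integral>w. moll e w * U (x - w) \<partial>lborel)"
          unfolding conv_def using integral_lborel_reflect(1)[of "\<lambda>z. moll e (x - z) * U z" x] by simp
        moreover have "U x = (\<integral>w. moll e (w::'a) * U x \<partial>lborel)"
          using integral_moll[OF e(1), where 'a='a] by simp
        ultimately have "conv (moll e) U x - U x = (\<integral>w. moll e w * U (x - w) - moll e w * U x \<partial>lborel)"
          using Bochner_Integration.integral_diff[OF i1 i2] by simp
        also have "ennreal \<bar>\<dots>\<bar> \<le> (\<integral>\<^sup>+w. ennreal \<bar>moll e w * U (x - w) - moll e w * U x\<bar> \<partial>lborel)"
          using integral_norm_bound_ennreal[OF Bochner_Integration.integrable_diff[OF i1 i2]] by simp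
        also have "\<dots> = (\<integral>\<^sup>+w. ennreal (moll e w) * ennreal \<bar>U (x - w) - U x\<bar> \<partial>lborel)"
          by (simp add: right_diff_distrib[symmetric] abs_mult ennreal_mult moll_nonneg e)
        finally show ?thesis .
      qed
      then have "(\<integral>\<^sup>+x. ennreal \<bar>conv (moll e) U x - U x\<bar> \<partial>lborel)
        \<le> (\<integral>\<^sup>+x. (\<integral>\<^sup>+w. ennreal (moll e w) * ennreal \<bar>U (x - w) - U x\<bar> \<partial>lborel) \<partial>lborel)"
        by (intro nn_integral_mono)
      also have "\<dots> = (\<integral>\<^sup>+w. (\<integral>\<^sup>+x. ennreal (moll e w) * ennreal \<bar>U (x - w) - U x\<bar> \<partial>lborel) \<partial>lborel)"
        by (rule lborel_pair.Fubini'[symmetric]) measurable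
      also have "\<dots> = (\<integral>\<^sup>+w. ennreal (moll e w) * (\<integral>\<^sup>+x. ennreal \<bar>U (x - w) - U x\<bar> \<partial>lborel) \<partial>lborel)"
        by (intro nn_integral_cong nn_integral_cmult) measurable
      also have "\<dots> \<le> (\<integral>\<^sup>+w. ennreal (moll e w) * ennreal \<delta> \<partial>(lborel::'a measure))"
      proof (intro nn_integral_mono)
        fix w :: 'a
        show "ennreal (moll e w) * (\<integral>\<^sup>+x. ennreal \<bar>U (x - w) - U x\<bar> \<partial>lborel) \<le> ennreal (moll e w) * ennreal \<delta>"
          using d(2)[of w] moll_eq_0[OF e(1), of w] e by (cases "norm w < e") (auto intro: mult_left_mono)
      qed
      also have "\<dots> = ennreal \<delta>"
        by (simp add: nn_integral_multc nn_integral_moll e)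
      finally show ?thesis .
    qed
    then show ?thesis using eventually_at_right[of 0 d] d(1) by (auto intro!: exI[of _ d])
  qed
  show ?thesis
  proof (rule order_tendstoI)
    fix a :: ennreal assume "0 < a"
    then obtain a' where a': "0 < a'" "a' < a" using dense by blast
    define \<delta> where "\<delta> = enn2real a'"
    have "\<delta> > 0" "ennreal \<delta> < a"
      using a' less_trans[OF a'(2), of top] by (cases a'; force simp: \<delta>_def)+
    from main[OF this(1)] this(2) show "\<forall>\<^sub>F e in at_right 0. (\<integral>\<^sup>+x. ennreal \<bar>conv (moll e) U x - U x\<bar> \<partial>lborel) < a"
      by (auto elim!: eventually_mono)
  qed simp
qed

subsection \<open>Lebesgue points\<close>

text \<open>The weak (1,1) bound for the maximal function at radii up to 1, by the 5r-covering
  lemma: the selected disjoint balls carry the mass and their fivefold dilates cover. Returning a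
  Borel superset of the level set avoids the question of its own measurability.\<close>

lemma maximal_weak_type:
  fixes g :: "'a::euclidean_space \<Rightarrow> ennreal"
  assumes [measurable]: "g \<in> borel_measurable borel" and l: "l > 0"
  obtains S where "S \<in> sets borel"
    "{x. \<exists>r. 0 < r \<and> r \<le> 1 \<and> (\<integral>\<^sup>+y\<in>ball x r. g y \<partial>lborel) > ennreal (l * r ^ DIM('a))} \<subseteq> S"
    "emeasure lborel S \<le> ennreal (unit_ball_vol DIM('a) * 5 ^ DIM('a) / l) * (\<integral>\<^sup>+y. g y \<partial>lborel)"
proof -
  let ?n = "DIM('a)" and ?w = "unit_ball_vol (real DIM('a))"
  let ?E = "{x. \<exists>r. 0 < r \<and> r \<le> 1 \<and> (\<integral>\<^sup>+y\<in>ball x r. g y \<partial>lborel) > ennreal (l * r ^ ?n)}"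
  have "\<forall>x\<in>?E. \<exists>r. 0 < r \<and> r \<le> 1 \<and> (\<integral>\<^sup>+y\<in>ball x r. g y \<partial>lborel) > ennreal (l * r ^ ?n)"
    by blast
  from bchoice[OF this] obtain \<rho> where
    \<rho>: "\<And>x. x \<in> ?E \<Longrightarrow> 0 < \<rho> x \<and> \<rho> x \<le> 1 \<and> (\<integral>\<^sup>+y\<in>ball x (\<rho> x). g y \<partial>lborel) > ennreal (l * \<rho> x ^ ?n)"
    by auto
  have "?E \<subseteq> (\<Union>x\<in>?E. ball x (\<rho> x))" using \<rho> by force
  from Vitali_covering_lemma_balls[OF this, of 1] obtain C where C: "countable C" "C \<subseteq> ?E"
    "pairwise (\<lambda>i j. disjnt (ball i (\<rho> i)) (ball j (\<rho> j))) C" "?E \<subseteq> (\<Union>i\<in>C. ball i (5 * \<rho> i))"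
    using \<rho> by (metis (no_types, lifting))
  define S where "S = (\<Union>i\<in>C. ball i (5 * \<rho> i))"
  have dis: "disjoint_family_on (\<lambda>i. ball i (\<rho> i)) C"
    using C(3) by (auto simp: disjoint_family_on_def pairwise_def disjnt_def)
  have S[measurable]: "S \<in> sets borel" unfolding S_def using C(1) by auto
  have "emeasure lborel S = (\<integral>\<^sup>+x. indicator S x \<partial>lborel)" by simp
  \<comment> \<open>Sums over the countable family are written as integrals over
    \<open>count_space C\<close>, which makes the exchange with the Lebesgue integral an instance of
    a general theorem.\<close>
  also have "\<dots> \<le> (\<integral>\<^sup>+x. (\<integral>\<^sup>+i. indicator (ball i (5 * \<rho> i)) x \<partial>count_space C) \<partial>lborel)"
  proof (rule nn_integral_mono)
    fix x
    show "indicator S x \<le> (\<integral>\<^sup>+i. indicator (ball i (5 * \<rho> i)) x \<partial>count_space C)"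
    proof (cases "x \<in> S")
      case True
      then obtain i where i: "i \<in> C" "x \<in> ball i (5 * \<rho> i)" unfolding S_def by auto
      then have "indicator S x \<le> (indicator (ball i (5 * \<rho> i)) x :: ennreal)" by (simp add: indicator_def)
      also have "\<dots> \<le> (\<integral>\<^sup>+i. indicator (ball i (5 * \<rho> i)) x \<partial>count_space C)"
        using i(1) by (rule nn_integral_ge_point)
      finally show ?thesis .
    qed simp
  qed
  also have "\<dots> = (\<integral>\<^sup>+i. (\<integral>\<^sup>+x. indicator (ball i (5 * \<rho> i)) x \<partial>lborel) \<partial>count_space C)"
    using C(1) by (subst nn_integral_count_space_nn_integral) (auto intro!: borel_measurable_indicator)
  also have "\<dots> \<le> (\<integral>\<^sup>+i. ennreal (?w * 5 ^ ?n / l) * (\<integral>\<^sup>+y\<in>ball i (\<rho> i). g y \<partial>lborel) \<partial>count_space C)"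
  proof (rule nn_integral_mono)
    fix i assume "i \<in> space (count_space C)"
    then have i: "0 < \<rho> i" "ennreal (l * \<rho> i ^ ?n) \<le> (\<integral>\<^sup>+y\<in>ball i (\<rho> i). g y \<partial>lborel)"
      using C(2) \<rho>[of i] by (auto intro: less_imp_le)
    have "(\<integral>\<^sup>+x. indicator (ball i (5 * \<rho> i)) x \<partial>lborel) = ennreal (?w * (5 * \<rho> i) ^ ?n)"
      using i by (simp add: emeasure_ball)
    also have "\<dots> = ennreal (?w * 5 ^ ?n / l) * ennreal (l * \<rho> i ^ ?n)"
      using l i by (simp flip: ennreal_mult add: power_mult_distrib)
    also have "\<dots> \<le> ennreal (?w * 5 ^ ?n / l) * (\<integral>\<^sup>+y\<in>ball i (\<rho> i). g y \<partial>lborel)"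
      by (intro mult_left_mono i) simp
    finally show "(\<integral>\<^sup>+x. indicator (ball i (5 * \<rho> i)) x \<partial>lborel)
      \<le> ennreal (?w * 5 ^ ?n / l) * (\<integral>\<^sup>+y\<in>ball i (\<rho> i). g y \<partial>lborel)" .
  qed
  also have "\<dots> = ennreal (?w * 5 ^ ?n / l) * (\<integral>\<^sup>+i. (\<integral>\<^sup>+y\<in>ball i (\<rho> i). g y \<partial>lborel) \<partial>count_space C)"
    by (rule nn_integral_cmult) simp
  also have "(\<integral>\<^sup>+i. (\<integral>\<^sup>+y\<in>ball i (\<rho> i). g y \<partial>lborel) \<partial>count_space C)
      = (\<integral>\<^sup>+i. emeasure (density lborel g) (ball i (\<rho> i)) \<partial>count_space C)"
    by (intro nn_integral_cong) (simp add: emeasure_density)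
  also have "\<dots> = emeasure (density lborel g) (\<Union>i\<in>C. ball i (\<rho> i))"
    by (rule emeasure_UN_countable[symmetric]) (use C(1) dis in auto)
  also have "\<dots> \<le> emeasure (density lborel g) UNIV"
    by (rule emeasure_mono) auto
  also have "\<dots> = (\<integral>\<^sup>+y. g y \<partial>lborel)" by (simp add: emeasure_density)
  finally have "emeasure lborel S \<le> ennreal (?w * 5 ^ ?n / l) * (\<integral>\<^sup>+y. g y \<partial>lborel)"
    by (auto simp: mult_left_mono)
  with S show ?thesis using that C(4) unfolding S_def by blast
qed

text \<open>Dividing by r^n instead of the volume of the ball changes e only by a dimensional
  factor, which keeps the later bookkeeping free of ball volumes.\<close>

definition lebesgue_point :: "('a::euclidean_space \<Rightarrow> real) \<Rightarrow> 'a \<Rightarrow> bool" where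
  "lebesgue_point f x \<longleftrightarrow> (\<forall>e>0. \<exists>d>0. \<forall>r. 0 < r \<and> r < d \<longrightarrow>
     (\<integral>\<^sup>+y\<in>ball x r. ennreal \<bar>f y - f x\<bar> \<partial>lborel) \<le> ennreal (e * r ^ DIM('a)))"

text \<open>Approximate f in L^1 by a continuous p. Off a set of small measure both the averages of
  |f - p| around x and the value |f x - p x| are small, and continuity of p does the rest.\<close>

lemma AE_lebesgue_point:
  fixes f :: "'a::euclidean_space \<Rightarrow> real"
  assumes f: "integrable lborel f"
  shows "AE x in lborel. lebesgue_point f x"
proof -
  let ?n = "DIM('a)" and ?w = "unit_ball_vol (real DIM('a))"
  have fm[measurable]: "f \<in> borel_measurable borel" using f by auto
  define bad where "bad e = {x. \<forall>d>0. \<exists>r. 0 < r \<and> r < d \<and>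
     \<not> (\<integral>\<^sup>+y\<in>ball x r. ennreal \<bar>f y - f x\<bar> \<partial>lborel) \<le> ennreal (e * r ^ ?n)}" for e
  have cover: "\<exists>S\<in>sets borel. bad e \<subseteq> S \<and> emeasure lborel S \<le> ennreal \<delta>" if e: "e > 0" and \<delta>: "\<delta> > 0" for e \<delta>
  proof -
    \<comment> \<open>The sum of the two constants that turn the L^1 error into measure: the
      weak-type constant at level e/3, and the Markov constant at threshold e / (3 w). Each of the
      three parts of |f y - f x| then contributes e/3 after integration over the ball.\<close>
    define K where "K = ?w * 5 ^ ?n / (e / 3) + 3 * ?w / e"
    have w: "?w > 0" by simp
    have K: "K > 0" unfolding K_def using e w by (intro add_pos_pos divide_pos_pos mult_pos_pos) auto
    have "\<forall>\<^sub>F s in at_right 0. (\<integral>\<^sup>+x. ennreal \<bar>conv (moll s) f x - f x\<bar> \<partial>lborel) < ennreal (\<delta> / K)"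
      using conv_moll_L1[OF f] \<delta> K by (intro order_tendstoD) auto
    moreover have "\<forall>\<^sub>F s in at_right (0::real). s > 0" by (simp add: eventually_at_filter)
    ultimately have "\<forall>\<^sub>F s in at_right 0. s > 0 \<and> (\<integral>\<^sup>+x. ennreal \<bar>conv (moll s) f x - f x\<bar> \<partial>lborel) < ennreal (\<delta> / K)"
      by eventually_elim auto
    then obtain s where s: "s > 0" "(\<integral>\<^sup>+x. ennreal \<bar>conv (moll s) f x - f x\<bar> \<partial>lborel) < ennreal (\<delta> / K)"
      using eventually_happens'[of "at_right (0::real)"] by (auto simp: trivial_limit_at_right_real)
    define p where "p = conv (moll s) f"
    have pc: "continuous_on UNIV p" unfolding p_def
      using Ck_imp_continuous_on[OF Ck_conv[OF Ccinf_moll[OF s(1)] f, of 0]] .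
    then have pm[measurable]: "p \<in> borel_measurable borel" by (rule borel_measurable_continuous_onI)
    define g where "g x = ennreal \<bar>p x - f x\<bar>" for x
    have gm[measurable]: "g \<in> borel_measurable borel" unfolding g_def by measurable
    have gI: "(\<integral>\<^sup>+x. g x \<partial>lborel) \<le> ennreal (\<delta> / K)" using s unfolding g_def p_def by simp
    obtain S1 where S1: "S1 \<in> sets borel"
      "{x. \<exists>r. 0 < r \<and> r \<le> 1 \<and> (\<integral>\<^sup>+y\<in>ball x r. g y \<partial>lborel) > ennreal (e / 3 * r ^ ?n)} \<subseteq> S1"
      "emeasure lborel S1 \<le> ennreal (?w * 5 ^ ?n / (e / 3)) * (\<integral>\<^sup>+y. g y \<partial>lborel)"
      using maximal_weak_type[of g "e / 3"] e by auto
    define S2 where "S2 = {x. 1 \<le> ennreal (3 * ?w / e) * g x}"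
    have S2: "S2 \<in> sets borel" unfolding S2_def by measurable
    have "emeasure lborel S2 \<le> ennreal (3 * ?w / e) * (\<integral>\<^sup>+y. g y \<partial>lborel)"
      using nn_integral_Markov_inequality[of "\<lambda>x. g x" UNIV lborel "ennreal (3 * ?w / e)"]
      by (simp add: S2_def)
    then have "emeasure lborel (S1 \<union> S2) \<le> ennreal (?w * 5 ^ ?n / (e / 3)) * (\<integral>\<^sup>+y. g y \<partial>lborel)
        + ennreal (3 * ?w / e) * (\<integral>\<^sup>+y. g y \<partial>lborel)"
      using S1 S2 by (intro order_trans[OF emeasure_subadditive] add_mono) auto
    also have "\<dots> = ennreal K * (\<integral>\<^sup>+y. g y \<partial>lborel)"
      unfolding K_def using e w by (subst ennreal_plus) (auto simp: distrib_right)
    also have "\<dots> \<le> ennreal K * ennreal (\<delta> / K)" by (intro mult_left_mono gI) simp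
    also have "\<dots> = ennreal \<delta>" using K \<delta> by (simp flip: ennreal_mult)
    finally have m: "emeasure lborel (S1 \<union> S2) \<le> ennreal \<delta>" .
    have "bad e \<subseteq> S1 \<union> S2"
    proof (rule subsetI, rule ccontr)
      fix x assume x: "x \<in> bad e" "x \<notin> S1 \<union> S2"
      have "isCont p x" using pc by (simp add: continuous_on_eq_continuous_at)
      then obtain d where d: "d > 0" "\<And>y. dist y x < d \<Longrightarrow> dist (p y) (p x) < e / (3 * ?w)"
        using e w unfolding continuous_at_eps_delta by (metis divide_pos_pos mult_pos_pos zero_less_numeral)
      obtain r where r: "0 < r" "r < min d 1"
        "\<not> (\<integral>\<^sup>+y\<in>ball x r. ennreal \<bar>f y - f x\<bar> \<partial>lborel) \<le> ennreal (e * r ^ ?n)"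
        using x(1) d(1) unfolding bad_def by (auto dest: spec[of _ "min d 1"])
      have g1: "(\<integral>\<^sup>+y\<in>ball x r. g y \<partial>lborel) \<le> ennreal (e / 3 * r ^ ?n)"
      proof (rule ccontr)
        assume "\<not> ?thesis"
        then have "x \<in> S1" using r by (intro subsetD[OF S1(2)]) (auto intro!: exI[of _ r])
        then show False using x by simp
      qed
      have g2: "\<bar>p x - f x\<bar> \<le> e / (3 * ?w)"
      proof (rule ccontr)
        assume "\<not> ?thesis"
        then have "1 \<le> 3 * ?w / e * \<bar>p x - f x\<bar>" using e w by (simp add: field_simps)
        then have "ennreal 1 \<le> ennreal (3 * ?w / e * \<bar>p x - f x\<bar>)" by (rule ennreal_leI)
        then have "x \<in> S2" using e w
          by (simp add: S2_def g_def ennreal_mult[of "3 * ?w / e" "\<bar>p x - f x\<bar>"] del: times_divide_eq_left)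
        then show False using x by simp
      qed
      have "(\<integral>\<^sup>+y\<in>ball x r. ennreal \<bar>f y - f x\<bar> \<partial>lborel)
         \<le> (\<integral>\<^sup>+y. g y * indicator (ball x r) y + ennreal (2 * (e / (3 * ?w))) * indicator (ball x r) y \<partial>lborel)"
      proof (rule nn_integral_mono)
        fix y
        show "ennreal \<bar>f y - f x\<bar> * indicator (ball x r) y
          \<le> g y * indicator (ball x r) y + ennreal (2 * (e / (3 * ?w))) * indicator (ball x r) y"
        proof (cases "y \<in> ball x r")
          case True
          then have "dist (p y) (p x) < e / (3 * ?w)" using r by (intro d) (auto simp: dist_commute)
          then have "\<bar>f y - f x\<bar> \<le> \<bar>p y - f y\<bar> + 2 * (e / (3 * ?w))"
            using g2 by (simp add: dist_real_def) 
          then have "ennreal \<bar>f y - f x\<bar> \<le> ennreal (\<bar>p y - f y\<bar> + 2 * (e / (3 * ?w)))" by (rule ennreal_leI)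
          then show ?thesis using True e w by (simp add: g_def ennreal_plus)
        qed simp
      qed
      also have "\<dots> = (\<integral>\<^sup>+y\<in>ball x r. g y \<partial>lborel) + ennreal (2 * (e / (3 * ?w))) * emeasure lborel (ball x r)"
      proof (subst nn_integral_add)
        have [measurable]: "ball x r \<in> sets borel" by simp
        show "(\<lambda>y. g y * indicator (ball x r) y) \<in> borel_measurable lborel"
          "(\<lambda>y. ennreal (2 * (e / (3 * ?w))) * indicator (ball x r) y) \<in> borel_measurable lborel"
          by measurable
      qed (auto intro!: arg_cong2[of _ _ _ _ "(+)"] nn_integral_cmult_indicator)
      also have "\<dots> \<le> ennreal (e / 3 * r ^ ?n) + ennreal (2 * (e / (3 * ?w))) * ennreal (?w * r ^ ?n)"
        using r by (intro add_mono g1 mult_left_mono) (auto simp: emeasure_ball)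
      also have "\<dots> = ennreal (e * r ^ ?n)"
        using e less_imp_neq[OF w] r by (simp flip: ennreal_mult ennreal_plus add: field_simps)
      finally show False using r by simp
    qed
    with m S1 S2 show ?thesis by (intro bexI[of _ "S1 \<union> S2"]) auto
  qed
  \<comment> \<open>Intersecting covers of measure at most 1 / (k + 1) puts the bad set into a Borel
    null set.\<close>
  have null: "AE x in lborel. x \<notin> bad e" if e: "e > 0" for e
  proof -
    obtain S where S: "\<And>k::nat. S k \<in> sets borel" "\<And>k. bad e \<subseteq> S k" "\<And>k. emeasure lborel (S k) \<le> ennreal (1 / Suc k)"
      using cover[OF e, of "1 / real (Suc _)"] by (metis of_nat_0_less_iff zero_less_Suc zero_less_divide_1_iff)
    have sets: "(\<Inter>k. S k) \<in> sets borel" using S(1) by auto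
    have "emeasure lborel (\<Inter>k. S k) \<le> ennreal (1 / Suc k)" for k
      using S by (intro order_trans[OF emeasure_mono[of _ "S k"] S(3)]) auto
    moreover have "(\<lambda>k. ennreal (1 / Suc k)) \<longlonglongrightarrow> ennreal 0"
      by (intro tendsto_ennrealI) (use LIMSEQ_inverse_real_of_nat in \<open>simp add: inverse_eq_divide\<close>)
    ultimately have "emeasure lborel (\<Inter>k. S k) \<le> ennreal 0"
      by (intro LIMSEQ_le_const[of _ "ennreal 0"]) auto
    then have "(\<Inter>k. S k) \<in> null_sets lborel" using sets by (auto simp: null_sets_def)
    from AE_not_in[OF this] show ?thesis by eventually_elim (use S(2) in auto)
  qed
  have "AE x in lborel. \<forall>k::nat. x \<notin> bad (1 / Suc k)"
    unfolding AE_all_countable using null by auto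
  then show ?thesis
  proof eventually_elim
    fix x assume x: "\<forall>k::nat. x \<notin> bad (1 / Suc k)"
    show "lebesgue_point f x" unfolding lebesgue_point_def
    proof (intro allI impI)
      fix e :: real assume "e > 0"
      then obtain k where k: "1 / real (Suc k) < e" using nat_approx_posE by blast
      from x obtain d where d: "d > 0" "\<And>r. 0 < r \<Longrightarrow> r < d \<Longrightarrow>
        (\<integral>\<^sup>+y\<in>ball x r. ennreal \<bar>f y - f x\<bar> \<partial>lborel) \<le> ennreal (1 / Suc k * r ^ ?n)"
        unfolding bad_def by blast
      have "ennreal (1 / Suc k * r ^ ?n) \<le> ennreal (e * r ^ ?n)" if "0 < r" for r
        using k that by (intro ennreal_leI mult_right_mono) auto
      with d show "\<exists>d>0. \<forall>r. 0 < r \<and> r < d \<longrightarrow>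
          (\<integral>\<^sup>+y\<in>ball x r. ennreal \<bar>f y - f x\<bar> \<partial>lborel) \<le> ennreal (e * r ^ ?n)"
        by (meson order_trans)
    qed
  qed
qed

subsection \<open>Slicing by hyperplanes\<close>

text \<open>
  There is no \<open>(n-1)\<close>-dimensional measure at hand, so an integral over the hyperplane
  \<open>{x. (x - x0) \<bullet> b = \<sigma>}\<close> is written as an \<open>n\<close>-dimensional one over \<open>{\<omega>. 0 \<le> \<omega> \<bullet> b \<le> 1}\<close>, along
  which the integrand does not depend on \<open>\<omega> \<bullet> b\<close>.
\<close>

definition hyp_point :: "'a::euclidean_space \<Rightarrow> 'a \<Rightarrow> real \<Rightarrow> 'a \<Rightarrow> 'a" where
  "hyp_point x0 b \<sigma> \<omega> = x0 + \<omega> + (\<sigma> - \<omega> \<bullet> b) *\<^sub>R b"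

lemma hyp_point_inner:
  assumes "b \<in> Basis" "j \<in> Basis"
  shows "(hyp_point x0 b \<sigma> \<omega> - x0) \<bullet> j = (if j = b then \<sigma> else \<omega> \<bullet> j)"
  using assms by (auto simp: hyp_point_def inner_add_left inner_diff_left inner_Basis algebra_simps)

lemma continuous_on_hyp_point [continuous_intros]: "continuous_on S (hyp_point x0 b \<sigma>)"
  unfolding hyp_point_def by (intro continuous_intros)

lemma hyp_point_measurable [measurable]: "hyp_point x0 b \<sigma> \<in> borel_measurable borel"
  by (intro borel_measurable_continuous_onI continuous_intros)

text \<open>After the shift of \<sigma> by \<omega> \<bullet> b the point is \<omega> + \<sigma> b.
  A second shift, now of \<omega>, leaves \<sigma> only in the condition on the redundant
  coordinate, which integrates to 1.\<close>

lemma nn_integral_slices: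
  fixes F :: "'a::euclidean_space \<Rightarrow> ennreal"
  assumes [measurable]: "F \<in> borel_measurable borel" and b: "b \<in> Basis"
  shows "(\<integral>\<^sup>+\<sigma>. (\<integral>\<^sup>+\<omega>. F (\<omega> + (\<sigma> - \<omega> \<bullet> b) *\<^sub>R b) * indicator {0..1} (\<omega> \<bullet> b) \<partial>lborel) \<partial>lborel)
       = (\<integral>\<^sup>+x. F x \<partial>lborel)"
proof -
  have "(\<integral>\<^sup>+\<sigma>. (\<integral>\<^sup>+\<omega>. F (\<omega> + (\<sigma> - \<omega> \<bullet> b) *\<^sub>R b) * indicator {0..1} (\<omega> \<bullet> b) \<partial>lborel) \<partial>lborel)
     = (\<integral>\<^sup>+\<omega>. (\<integral>\<^sup>+\<sigma>. F (\<omega> + (\<sigma> - \<omega> \<bullet> b) *\<^sub>R b) * indicator {0..1} (\<omega> \<bullet> b) \<partial>lborel) \<partial>lborel)"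
    by (rule lborel_pair.Fubini') measurable
  also have "\<dots> = (\<integral>\<^sup>+\<omega>. (\<integral>\<^sup>+\<sigma>. F (\<omega> + \<sigma> *\<^sub>R b) * indicator {0..1} (\<omega> \<bullet> b) \<partial>lborel) \<partial>lborel)"
  proof (rule nn_integral_cong)
    fix \<omega> :: 'a
    show "(\<integral>\<^sup>+\<sigma>. F (\<omega> + (\<sigma> - \<omega> \<bullet> b) *\<^sub>R b) * indicator {0..1} (\<omega> \<bullet> b) \<partial>lborel)
      = (\<integral>\<^sup>+\<sigma>. F (\<omega> + \<sigma> *\<^sub>R b) * indicator {0..1} (\<omega> \<bullet> b) \<partial>lborel)"
      using nn_integral_lborel_translate[of "\<lambda>\<sigma>. F (\<omega> + \<sigma> *\<^sub>R b) * indicator {0..1} (\<omega> \<bullet> b)" "- (\<omega> \<bullet> b)"]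
      by simp
  qed
  also have "\<dots> = (\<integral>\<^sup>+\<sigma>. (\<integral>\<^sup>+\<omega>. F (\<omega> + \<sigma> *\<^sub>R b) * indicator {0..1} (\<omega> \<bullet> b) \<partial>lborel) \<partial>lborel)"
    by (rule lborel_pair.Fubini') measurable
  also have "\<dots> = (\<integral>\<^sup>+\<sigma>. (\<integral>\<^sup>+\<omega>. F \<omega> * indicator {0..1} ((\<omega> - \<sigma> *\<^sub>R b) \<bullet> b) \<partial>lborel) \<partial>lborel)"
  proof (rule nn_integral_cong)
    fix \<sigma> :: real
    show "(\<integral>\<^sup>+\<omega>. F (\<omega> + \<sigma> *\<^sub>R b) * indicator {0..1} (\<omega> \<bullet> b) \<partial>lborel)
      = (\<integral>\<^sup>+\<omega>. F \<omega> * indicator {0..1} ((\<omega> - \<sigma> *\<^sub>R b) \<bullet> b) \<partial>lborel)"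
      using nn_integral_lborel_translate[of "\<lambda>\<omega>. F \<omega> * indicator {0..1} ((\<omega> - \<sigma> *\<^sub>R b) \<bullet> b)" "\<sigma> *\<^sub>R b"]
      by (simp add: add.commute)
  qed
  also have "\<dots> = (\<integral>\<^sup>+\<omega>. (\<integral>\<^sup>+\<sigma>. F \<omega> * indicator {0..1} ((\<omega> - \<sigma> *\<^sub>R b) \<bullet> b) \<partial>lborel) \<partial>lborel)"
    by (rule lborel_pair.Fubini') measurable
  also have "\<dots> = (\<integral>\<^sup>+\<omega>. F \<omega> * (\<integral>\<^sup>+\<sigma>. indicator {0..1} ((\<omega> - \<sigma> *\<^sub>R b) \<bullet> b) \<partial>lborel) \<partial>lborel)"
    by (intro nn_integral_cong nn_integral_cmult) measurable
  also have "\<dots> = (\<integral>\<^sup>+\<omega>. F \<omega> \<partial>lborel)"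
  proof (rule nn_integral_cong)
    fix \<omega> :: 'a
    have "(\<integral>\<^sup>+\<sigma>. indicator {0..1} ((\<omega> - \<sigma> *\<^sub>R b) \<bullet> b) \<partial>lborel)
        = (\<integral>\<^sup>+\<sigma>. indicator {0..1} ((\<omega> \<bullet> b) - \<sigma>) \<partial>lborel)"
      using b by (simp add: inner_diff_left)
    also have "\<dots> = (\<integral>\<^sup>+\<sigma>. indicator {0..1::real} \<sigma> \<partial>lborel)"
      by (rule nn_integral_lborel_reflect) measurable
    finally show "F \<omega> * (\<integral>\<^sup>+\<sigma>. indicator {0..1} ((\<omega> - \<sigma> *\<^sub>R b) \<bullet> b) \<partial>lborel) = F \<omega>" by simp
  qed
  finally show ?thesis .
qed

subsection \<open>A Morrey estimate on hyperplanes\<close>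

lemma continuous_on_gradient:
  assumes "Ck (Suc 0) v"
  shows "continuous_on S (gradient v)"
proof -
  have "continuous_on S (\<lambda>x. \<Sum>b\<in>Basis. partial_deriv b v x *\<^sub>R b)"
    using assms by (auto intro!: continuous_intros intro: continuous_on_subset)
  then show ?thesis by (simp add: gradient_def[abs_def])
qed

text \<open>The lower limit \<alpha> is 0 for the estimate on hyperplanes. It is positive in
  \<open>L1_increment\<close>, where the change of variables would otherwise produce an unbounded
  power of 1/\<theta>.\<close>

lemma segment_bound:
  fixes v :: "'a::euclidean_space \<Rightarrow> real"
  assumes v: "Ck (Suc 0) v" and "\<alpha> \<le> 1"
  shows "ennreal \<bar>v (x + \<zeta>) - v (x + \<alpha> *\<^sub>R \<zeta>)\<bar>
    \<le> (\<integral>\<^sup>+\<theta>\<in>{\<alpha>..1}. ennreal (norm (gradient v (x + \<theta> *\<^sub>R \<zeta>)) * norm \<zeta>) \<partial>lborel)"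
proof -
  let ?q = "\<lambda>\<theta>. v (x + \<theta> *\<^sub>R \<zeta>)" and ?q' = "\<lambda>\<theta>. gradient v (x + \<theta> *\<^sub>R \<zeta>) \<bullet> \<zeta>"
  have der: "(?q has_real_derivative ?q' \<theta>) (at \<theta>)" for \<theta>
  proof -
    have "((\<lambda>\<theta>. v (x + \<theta> *\<^sub>R \<zeta>)) has_derivative (\<lambda>h. gradient v (x + \<theta> *\<^sub>R \<zeta>) \<bullet> (h *\<^sub>R \<zeta>))) (at \<theta>)"
      by (intro has_derivative_compose[of "\<lambda>\<theta>. x + \<theta> *\<^sub>R \<zeta>" "\<lambda>h. h *\<^sub>R \<zeta>" \<theta> UNIV v, simplified]
          has_derivative_Ck[OF v]) (auto intro!: derivative_eq_intros)
    then show ?thesis by (simp add: has_field_derivative_def mult.commute[of _ "_ \<bullet> _"])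
  qed
  have "continuous_on UNIV ?q'"
    by (intro continuous_intros continuous_on_compose2[OF continuous_on_gradient[OF v, of UNIV]]) auto
  then have cont: "isCont ?q' \<theta>" for \<theta> by (simp add: continuous_on_eq_continuous_at)
  note F = has_bochner_integral_FTC_Icc_real[OF \<open>\<alpha> \<le> 1\<close> der cont]
  have "ennreal \<bar>v (x + \<zeta>) - v (x + \<alpha> *\<^sub>R \<zeta>)\<bar> = ennreal (norm (\<integral>\<theta>. ?q' \<theta> * indicator {\<alpha>..1} \<theta> \<partial>lborel))"
    using has_bochner_integral_integral_eq[OF F] by simp
  also have "\<dots> \<le> (\<integral>\<^sup>+\<theta>. ennreal (norm (?q' \<theta> * indicator {\<alpha>..1} \<theta>)) \<partial>lborel)"
    using F by (intro integral_norm_bound_ennreal) (simp add: has_bochner_integral_iff)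
  also have "\<dots> \<le> (\<integral>\<^sup>+\<theta>\<in>{\<alpha>..1}. ennreal (norm (gradient v (x + \<theta> *\<^sub>R \<zeta>)) * norm \<zeta>) \<partial>lborel)"
    by (intro nn_integral_mono) (auto simp: indicator_def intro!: ennreal_leI Cauchy_Schwarz_ineq2)
  finally show ?thesis .
qed

section \<open>Cubes in a hyperplane and the cone of segments over the far cube\<close>

definition slab :: "'a::euclidean_space \<Rightarrow> real \<Rightarrow> 'a set" where
  "slab b \<rho> = {\<omega>. 0 \<le> \<omega> \<bullet> b \<and> \<omega> \<bullet> b \<le> 1 \<and> (\<forall>j\<in>Basis - {b}. \<bar>\<omega> \<bullet> j\<bar> \<le> \<rho>)}"

text \<open>Coordinates between 3R and 4R: seen from a point whose coordinates are at most 2R in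
  absolute value, every coordinate difference other than the one along b lies between R and 6R. The
  base cube has volume \<open>R ^ (DIM('a) - 1)\<close>.\<close>

definition far_slab :: "'a::euclidean_space \<Rightarrow> real \<Rightarrow> 'a set" where
  "far_slab b R = {\<omega>. 0 \<le> \<omega> \<bullet> b \<and> \<omega> \<bullet> b \<le> 1 \<and> (\<forall>j\<in>Basis - {b}. 3 * R \<le> \<omega> \<bullet> j \<and> \<omega> \<bullet> j \<le> 4 * R)}"

lemma slab_measurable [measurable]: "slab b \<rho> \<in> sets borel"
  unfolding slab_def by measurable

lemma far_slab_eq_cbox:
  assumes "b \<in> Basis"
  shows "far_slab b R = cbox (\<Sum>j\<in>Basis. (if j = b then 0 else 3 * R) *\<^sub>R j) (\<Sum>j\<in>Basis. (if j = b then 1 else 4 * R) *\<^sub>R j)"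
  using assms by (auto simp: far_slab_def cbox_def split: if_splits)

lemma far_slab_measurable [measurable]: "far_slab b R \<in> sets borel"
  unfolding far_slab_def by measurable

lemma compact_far_slab: "b \<in> Basis \<Longrightarrow> compact (far_slab b R)"
  by (simp add: far_slab_eq_cbox)

lemma emeasure_far_slab:
  fixes b :: "'a::euclidean_space"
  assumes b: "b \<in> Basis" and R: "R > 0"
  shows "emeasure lborel (far_slab b R) = ennreal (R ^ (DIM('a) - 1))"
proof -
  have "emeasure lborel (far_slab b R) = ennreal (\<Prod>j\<in>Basis. (if j = b then 1 else R))"
    unfolding far_slab_eq_cbox[OF b]
    by (subst emeasure_lborel_cbox) (use R in \<open>auto simp: inner_diff_left intro!: arg_cong[of _ _ ennreal] prod.cong\<close>)
  also have "(\<Prod>j\<in>Basis. (if j = b then 1 else R)) = (\<Prod>j\<in>Basis - {b}. R)"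
    using b by (subst prod.remove[of _ b]) (auto intro!: prod.cong)
  finally show ?thesis using b by (simp add: card_Diff_singleton)
qed

lemma far_slab_subset: "R > 0 \<Longrightarrow> far_slab b R \<subseteq> slab b (4 * R)"
  by (force simp: far_slab_def slab_def)

text \<open>On the band 1/\<theta> is at most 6R/l, and the band lies in [0, l/R]; the exact value
  log 6 is not worth computing.\<close>

lemma nn_integral_inverse_band:
  fixes l R :: real
  assumes R: "R > 0"
  shows "(\<integral>\<^sup>+\<theta>. ennreal (1 / \<theta>) * indicator {\<theta>. 0 < \<theta> \<and> \<theta> * R \<le> l \<and> l \<le> \<theta> * (6 * R)} \<theta> \<partial>lborel) \<le> 6"
proof (cases "l > 0")
  case True
  have "(\<integral>\<^sup>+\<theta>. ennreal (1 / \<theta>) * indicator {\<theta>. 0 < \<theta> \<and> \<theta> * R \<le> l \<and> l \<le> \<theta> * (6 * R)} \<theta> \<partial>lborel)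
     \<le> (\<integral>\<^sup>+\<theta>. ennreal (6 * R / l) * indicator {0..l / R} \<theta> \<partial>lborel)"
    by (intro nn_integral_mono) (use R True in \<open>auto simp: indicator_def field_simps intro!: ennreal_leI\<close>)
  also have "\<dots> = ennreal (6 * R / l) * ennreal (l / R)"
    using R True by (simp add: nn_integral_cmult)
  also have "\<dots> = 6" using R True by (simp flip: ennreal_mult)
  finally show ?thesis .
next
  case False
  have "(\<integral>\<^sup>+\<theta>. ennreal (1 / \<theta>) * indicator {\<theta>. 0 < \<theta> \<and> \<theta> * R \<le> l \<and> l \<le> \<theta> * (6 * R)} \<theta> \<partial>lborel)
     = nn_integral lborel (\<lambda>\<theta>::real. 0)"
  proof (intro nn_integral_cong)
    fix \<theta> :: real
    have "\<not> (0 < \<theta> \<and> \<theta> * R \<le> l \<and> l \<le> \<theta> * (6 * R))"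
      using False R by (smt (verit) mult_pos_pos)
    then show "ennreal (1 / \<theta>) * indicator {\<theta>. 0 < \<theta> \<and> \<theta> * R \<le> l \<and> l \<le> \<theta> * (6 * R)} \<theta> = 0"
      by simp
  qed
  then show ?thesis by simp
qed

text \<open>Here d is the dimension of the hyperplane. For d = 1 the exponent is 0 and the value is
  \<Psi> t itself, so the geometric estimates treat n = 2 and larger n alike.\<close>

definition cone_integral :: "nat \<Rightarrow> (real \<Rightarrow> ennreal) \<Rightarrow> real \<Rightarrow> ennreal" where
  "cone_integral d \<Psi> t = (\<integral>\<^sup>+\<theta>\<in>{0<..<1}. ennreal (\<theta> ^ (d - 1)) * \<Psi> (t / \<theta> ^ (d - 1)) \<partial>lborel)"

text \<open>In the parameter \<omega>, \<open>T\<close> is the homothety of the hyperplane with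
  centre x and ratio \<theta>. It leaves the redundant coordinate along b unscaled, so the Jacobian
  has the exponent n - 1 of the hyperplane and not n.\<close>

lemma hyp_point_scaling:
  fixes x x0 b :: "'a::euclidean_space"
  assumes b: "b \<in> Basis" and x: "(x - x0) \<bullet> b = \<sigma>" and \<theta>: "\<theta> \<noteq> 0"
  defines "T \<equiv> \<lambda>\<omega>. (\<Sum>j\<in>Basis. (if j = b then 0 else (1 - \<theta>) * ((x - x0) \<bullet> j)) *\<^sub>R j)
      + (\<Sum>j\<in>Basis. ((if j = b then 1 else \<theta>) * (\<omega> \<bullet> j)) *\<^sub>R j)"
  shows "F \<in> borel_measurable borel \<Longrightarrow>
      (\<integral>\<^sup>+\<omega>. F \<omega> \<partial>lborel) = ennreal (\<bar>\<theta>\<bar> ^ (DIM('a) - 1)) * (\<integral>\<^sup>+\<omega>. F (T \<omega>) \<partial>lborel)"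
    and "j \<in> Basis \<Longrightarrow> T \<omega> \<bullet> j = (if j = b then \<omega> \<bullet> b else (1 - \<theta>) * ((x - x0) \<bullet> j) + \<theta> * (\<omega> \<bullet> j))"
    and "hyp_point x0 b \<sigma> (T \<omega>) = x + \<theta> *\<^sub>R (hyp_point x0 b \<sigma> \<omega> - x)"
proof -
  have prod: "(\<Prod>j\<in>Basis. \<bar>if j = b then 1 else \<theta>\<bar>) = \<bar>\<theta>\<bar> ^ (DIM('a) - 1)"
  proof -
    have "(\<Prod>j\<in>Basis. \<bar>if j = b then 1 else \<theta>\<bar>) = (\<Prod>j\<in>Basis - {b}. \<bar>\<theta>\<bar>)"
      using b by (subst prod.remove[of _ b]) (auto intro!: prod.cong)
    then show ?thesis using b by (simp add: card_Diff_singleton)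
  qed
  have Tm[measurable]: "T \<in> borel_measurable borel"
    unfolding T_def by (intro borel_measurable_continuous_onI continuous_intros)
  show "(\<integral>\<^sup>+\<omega>. F \<omega> \<partial>lborel) = ennreal (\<bar>\<theta>\<bar> ^ (DIM('a) - 1)) * (\<integral>\<^sup>+\<omega>. F (T \<omega>) \<partial>lborel)"
    if [measurable]: "F \<in> borel_measurable borel"
    by (subst lborel_affine_euclidean[of "\<lambda>j. if j = b then 1 else \<theta>" "\<Sum>j\<in>Basis. (if j = b then 0 else (1 - \<theta>) * ((x - x0) \<bullet> j)) *\<^sub>R j"])
       (use \<theta> in \<open>simp_all add: T_def[symmetric] prod nn_integral_density nn_integral_distr nn_integral_cmult\<close>)
  show T: "T \<omega> \<bullet> j = (if j = b then \<omega> \<bullet> b else (1 - \<theta>) * ((x - x0) \<bullet> j) + \<theta> * (\<omega> \<bullet> j))" if "j \<in> Basis" for j \<omega>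
    using that by (simp add: T_def inner_add_left)
  show "hyp_point x0 b \<sigma> (T \<omega>) = x + \<theta> *\<^sub>R (hyp_point x0 b \<sigma> \<omega> - x)"
  proof (rule euclidean_eqI)
    fix j :: 'a assume j: "j \<in> Basis"
    have "(hyp_point x0 b \<sigma> (T \<omega>) - x0) \<bullet> j = (x + \<theta> *\<^sub>R (hyp_point x0 b \<sigma> \<omega> - x) - x0) \<bullet> j"
    proof -
      have "x + \<theta> *\<^sub>R (hyp_point x0 b \<sigma> \<omega> - x) - x0 = (1 - \<theta>) *\<^sub>R (x - x0) + \<theta> *\<^sub>R (hyp_point x0 b \<sigma> \<omega> - x0)"
        by (simp add: algebra_simps)
      then have "(x + \<theta> *\<^sub>R (hyp_point x0 b \<sigma> \<omega> - x) - x0) \<bullet> j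
          = (1 - \<theta>) * ((x - x0) \<bullet> j) + \<theta> * ((hyp_point x0 b \<sigma> \<omega> - x0) \<bullet> j)"
        by (simp only: inner_add_left inner_scaleR_left)
      then show ?thesis
        unfolding hyp_point_inner[OF b j] T[OF j] using x by (auto simp: algebra_simps)
    qed
    then show "hyp_point x0 b \<sigma> (T \<omega>) \<bullet> j = (x + \<theta> *\<^sub>R (hyp_point x0 b \<sigma> \<omega> - x)) \<bullet> j"
      by (simp only: inner_diff_left)
  qed
qed

lemma hyperplane_estimate:
  fixes v :: "'a::euclidean_space \<Rightarrow> real" and h :: "'a \<Rightarrow> ennreal" and \<Psi> :: "real \<Rightarrow> ennreal"
    and R t \<sigma> :: real
  assumes n: "DIM('a) \<ge> 2" and b: "b \<in> Basis" and R: "R > 0" and t: "t > 0"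
    and v: "Ck (Suc 0) v"
    and [measurable]: "h \<in> borel_measurable borel" "\<Psi> \<in> borel_measurable borel"
    and young: "\<And>z k. (\<forall>j\<in>Basis. \<bar>(z - x0) \<bullet> j\<bar> \<le> 4 * R) \<Longrightarrow> k > 0 \<Longrightarrow>
        ennreal (norm (gradient v z) * k) \<le> h z + \<Psi> k"
    and x\<sigma>: "(x - x0) \<bullet> b = \<sigma>" and x: "\<And>j. j \<in> Basis \<Longrightarrow> \<bar>(x - x0) \<bullet> j\<bar> \<le> 2 * R"
  shows "ennreal t * (\<integral>\<^sup>+\<omega>\<in>far_slab b R. ennreal \<bar>v (hyp_point x0 b \<sigma> \<omega>) - v x\<bar> \<partial>lborel)
    \<le> ennreal (6 * DIM('a) * R) * (6 * (\<integral>\<^sup>+\<omega>\<in>slab b (4 * R). h (hyp_point x0 b \<sigma> \<omega>) \<partial>lborel)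
        + ennreal (R ^ (DIM('a) - 1)) * cone_integral (DIM('a) - 1) \<Psi> t)"
proof -
  define n where "n = DIM('a)"
  define d where "d = n - 1"
  have d: "d \<ge> 1" "DIM('a) - 1 = d" using n unfolding d_def n_def by auto
  define H where "H = hyp_point x0 b \<sigma>"
  have [measurable]: "H \<in> borel_measurable borel" unfolding H_def by simp
  \<comment> \<open>Each coordinate of \<open>H \<omega> - x\<close> is at most 6R in absolute
    value, so its l^1 norm, and hence its length, is at most 6nR.\<close>
  define C where "C = 6 * real n * R"
  have C: "C > 0" unfolding C_def using R n by (simp add: n_def)
  define W where "W = far_slab b R"
  have W[measurable]: "W \<in> sets borel" unfolding W_def by measurable
  define I where "I = {0<..<1::real}"
  have I[measurable]: "I \<in> sets borel" unfolding I_def by simp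
  have vm[measurable]: "v \<in> borel_measurable borel"
    by (intro borel_measurable_continuous_onI Ck_imp_continuous_on[OF v])
  have gm[measurable]: "gradient v \<in> borel_measurable borel"
    by (intro borel_measurable_continuous_onI continuous_on_gradient[OF v])
  have Winner: "R \<le> (H \<omega> - x) \<bullet> j \<and> (H \<omega> - x) \<bullet> j \<le> 6 * R" if "\<omega> \<in> W" "j \<in> Basis" "j \<noteq> b" for \<omega> j
  proof -
    have "(H \<omega> - x) \<bullet> j = \<omega> \<bullet> j - (x - x0) \<bullet> j"
      using hyp_point_inner[OF b that(2), of x0 \<sigma> \<omega>] that(3) by (simp add: H_def inner_diff_left)
    moreover have "3 * R \<le> \<omega> \<bullet> j" "\<omega> \<bullet> j \<le> 4 * R" using that by (auto simp: W_def far_slab_def)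
    ultimately show ?thesis using x[OF that(2)] by (auto simp: abs_le_iff)
  qed
  have Wb: "(H \<omega> - x) \<bullet> b = 0" for \<omega>
    using hyp_point_inner[OF b b, of x0 \<sigma> \<omega>] x\<sigma> by (simp add: H_def inner_diff_left)
  have Wnorm: "norm (H \<omega> - x) \<le> C" if "\<omega> \<in> W" for \<omega>
  proof -
    have "norm (H \<omega> - x) \<le> (\<Sum>j\<in>Basis. \<bar>(H \<omega> - x) \<bullet> j\<bar>)" by (rule norm_le_l1)
    also have "\<dots> \<le> (\<Sum>j\<in>(Basis::'a set). 6 * R)"
    proof (rule sum_mono)
      fix j :: 'a assume "j \<in> Basis"
      then show "\<bar>(H \<omega> - x) \<bullet> j\<bar> \<le> 6 * R"
        using Winner[OF that, of j] Wb[of \<omega>] R by (cases "j = b") auto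
    qed
    finally show ?thesis by (simp add: C_def n_def)
  qed
  \<comment> \<open>The integrand after Young's inequality with k = t / \<theta>^(d-1), multiplied
    back by \<theta>^(d-1).\<close>
  define K where "K \<theta> \<omega> = ennreal (\<theta> ^ (d - 1)) * (h (x + \<theta> *\<^sub>R (H \<omega> - x)) + \<Psi> (t / \<theta> ^ (d - 1)))" for \<theta> \<omega>
  have step1: "ennreal t * ennreal \<bar>v (H \<omega>) - v x\<bar> \<le> ennreal C * (\<integral>\<^sup>+\<theta>\<in>I. K \<theta> \<omega> \<partial>lborel)"
    if \<omega>: "\<omega> \<in> W" for \<omega>
  proof -
    have "ennreal \<bar>v (H \<omega>) - v x\<bar> \<le> (\<integral>\<^sup>+\<theta>\<in>{0..1}. ennreal (norm (gradient v (x + \<theta> *\<^sub>R (H \<omega> - x))) * norm (H \<omega> - x)) \<partial>lborel)"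
      using segment_bound[OF v, of 0 x "H \<omega> - x"] by simp
    \<comment> \<open>The endpoints are dropped because this choice of k requires \<theta> > 0; they
      form a null set.\<close>
    also have "\<dots> = (\<integral>\<^sup>+\<theta>\<in>I. ennreal (norm (gradient v (x + \<theta> *\<^sub>R (H \<omega> - x))) * norm (H \<omega> - x)) \<partial>lborel)"
    proof (rule nn_integral_cong_AE)
      have "AE \<theta> in lborel. \<theta> \<noteq> (0::real)" "AE \<theta> in lborel. \<theta> \<noteq> (1::real)"
        by (rule AE_lborel_singleton)+
      then show "AE \<theta> in lborel. ennreal (norm (gradient v (x + \<theta> *\<^sub>R (H \<omega> - x))) * norm (H \<omega> - x)) * indicator {0..1} \<theta>
        = ennreal (norm (gradient v (x + \<theta> *\<^sub>R (H \<omega> - x))) * norm (H \<omega> - x)) * indicator I \<theta>"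
        by eventually_elim (auto simp: I_def indicator_def)
    qed
    finally have "ennreal t * ennreal \<bar>v (H \<omega>) - v x\<bar>
       \<le> ennreal t * (\<integral>\<^sup>+\<theta>\<in>I. ennreal (norm (gradient v (x + \<theta> *\<^sub>R (H \<omega> - x))) * norm (H \<omega> - x)) \<partial>lborel)"
      by (intro mult_left_mono) simp_all
    also have "\<dots> = (\<integral>\<^sup>+\<theta>. ennreal t * (ennreal (norm (gradient v (x + \<theta> *\<^sub>R (H \<omega> - x))) * norm (H \<omega> - x)) * indicator I \<theta>) \<partial>lborel)"
      by (rule nn_integral_cmult[symmetric]) measurable
    also have "\<dots> \<le> (\<integral>\<^sup>+\<theta>. ennreal C * (K \<theta> \<omega> * indicator I \<theta>) \<partial>lborel)"
    proof (rule nn_integral_mono)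
      fix \<theta> :: real
      show "ennreal t * (ennreal (norm (gradient v (x + \<theta> *\<^sub>R (H \<omega> - x))) * norm (H \<omega> - x)) * indicator I \<theta>)
        \<le> ennreal C * (K \<theta> \<omega> * indicator I \<theta>)"
      proof (cases "\<theta> \<in> I")
        case True
        then have \<theta>: "0 < \<theta>" "\<theta> < 1" by (auto simp: I_def)
        define z where "z = x + \<theta> *\<^sub>R (H \<omega> - x)"
        have zD: "\<forall>j\<in>Basis. \<bar>(z - x0) \<bullet> j\<bar> \<le> 4 * R"
        proof
          fix j :: 'a assume j: "j \<in> Basis"
          have eq: "(z - x0) \<bullet> j = (1 - \<theta>) * ((x - x0) \<bullet> j) + \<theta> * ((H \<omega> - x0) \<bullet> j)"
            by (simp add: z_def algebra_simps)
          have "\<bar>(H \<omega> - x0) \<bullet> j\<bar> \<le> 4 * R"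
          proof (cases "j = b")
            case True
            then show ?thesis using x[OF b] R x\<sigma> by (simp add: H_def hyp_point_inner[OF b b])
          next
            case False
            then show ?thesis using \<omega> j R by (force simp: H_def hyp_point_inner[OF b j] W_def far_slab_def abs_le_iff)
          qed
          moreover have "\<bar>(x - x0) \<bullet> j\<bar> \<le> 4 * R" using x[OF j] R by linarith
          ultimately have "\<bar>(z - x0) \<bullet> j\<bar> \<le> (1 - \<theta>) * (4 * R) + \<theta> * (4 * R)"
            unfolding eq using \<theta>
            by (intro order_trans[OF abs_triangle_ineq] add_mono) (auto simp: abs_mult intro!: mult_left_mono)
          then show "\<bar>(z - x0) \<bullet> j\<bar> \<le> 4 * R" by (simp add: algebra_simps)
        qed
        have "ennreal t * ennreal (norm (gradient v z) * norm (H \<omega> - x)) \<le> ennreal (t * (norm (gradient v z) * C))"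
          using t Wnorm[OF \<omega>] by (simp flip: ennreal_mult add: ennreal_leI mult_left_mono)
        also have "t * (norm (gradient v z) * C) = C * (\<theta> ^ (d - 1) * (norm (gradient v z) * (t / \<theta> ^ (d - 1))))"
          using \<theta> by simp
        also have "ennreal \<dots> = ennreal C * (ennreal (\<theta> ^ (d - 1)) * ennreal (norm (gradient v z) * (t / \<theta> ^ (d - 1))))"
        proof -
          have "ennreal (C * (P * Q)) = ennreal C * (ennreal P * ennreal Q)" if "0 \<le> P" "0 \<le> Q" for P Q
            using C that by (simp add: ennreal_mult)
          from this[of "\<theta> ^ (d - 1)" "norm (gradient v z) * (t / \<theta> ^ (d - 1))"]
          show ?thesis using \<theta> t by (simp only: zero_le_power zero_le_mult_iff zero_le_divide_iff norm_ge_zero less_imp_le simp_thms)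
        qed
        also have "\<dots> \<le> ennreal C * K \<theta> \<omega>"
          unfolding K_def z_def[symmetric] using \<theta> t by (intro mult_left_mono young zD) auto
        finally show ?thesis using True by (simp add: z_def)
      qed simp
    qed
    also have "\<dots> = ennreal C * (\<integral>\<^sup>+\<theta>\<in>I. K \<theta> \<omega> \<partial>lborel)"
      unfolding K_def by (rule nn_integral_cmult) measurable
    finally show ?thesis .
  qed
  have Km[measurable]: "case_prod K \<in> borel_measurable (lborel \<Otimes>\<^sub>M lborel)"
    unfolding K_def by measurable
  \<comment> \<open>A coordinate within the hyperplane, available because n >= 2. Its difference to
    x tells at which fractions \<theta> a point can be reached.\<close>
  obtain j0 :: 'a where j0: "j0 \<in> Basis" "j0 \<noteq> b"
  proof -
    have "Basis - {b} \<noteq> {}" using n b card_Diff_singleton[OF b] by (metis card.empty diff_is_0_eq' d(1) d(2) not_one_le_zero)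
    then show ?thesis using that by blast
  qed
  \<comment> \<open>If \<omega> parametrises the point at fraction \<theta> of a segment to the far
    cube, then its coordinate difference along \<open>j0\<close> is \<theta> times a number between
    R and 6R.\<close>
  define band :: "real \<Rightarrow> 'a \<Rightarrow> ennreal" where
    "band \<theta> \<omega> = (if 0 < \<theta> \<and> \<theta> * R \<le> (\<omega> - (x - x0)) \<bullet> j0 \<and> (\<omega> - (x - x0)) \<bullet> j0 \<le> \<theta> * (6 * R) then 1 else 0)" for \<theta> \<omega>
  define G where "G \<omega> = h (H \<omega>) * indicator (slab b (4 * R)) \<omega>" for \<omega>
  have [measurable]: "G \<in> borel_measurable borel" unfolding G_def by measurable
  have [measurable]: "case_prod band \<in> borel_measurable (lborel \<Otimes>\<^sub>M lborel)" unfolding band_def by measurable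
  have [measurable]: "(\<lambda>(\<omega>, \<theta>). band \<theta> \<omega>) \<in> borel_measurable (lborel \<Otimes>\<^sub>M lborel)" unfolding band_def by measurable
  have "ennreal t * (\<integral>\<^sup>+\<omega>\<in>W. ennreal \<bar>v (H \<omega>) - v x\<bar> \<partial>lborel)
     = (\<integral>\<^sup>+\<omega>. ennreal t * (ennreal \<bar>v (H \<omega>) - v x\<bar> * indicator W \<omega>) \<partial>lborel)"
    by (rule nn_integral_cmult[symmetric]) measurable
  also have "\<dots> \<le> (\<integral>\<^sup>+\<omega>. ennreal C * (\<integral>\<^sup>+\<theta>. K \<theta> \<omega> * indicator I \<theta> * indicator W \<omega> \<partial>lborel) \<partial>lborel)"
  proof (rule nn_integral_mono)
    fix \<omega>
    show "ennreal t * (ennreal \<bar>v (H \<omega>) - v x\<bar> * indicator W \<omega>)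
       \<le> ennreal C * (\<integral>\<^sup>+\<theta>. K \<theta> \<omega> * indicator I \<theta> * indicator W \<omega> \<partial>lborel)"
      using step1[of \<omega>] by (cases "\<omega> \<in> W") simp_all
  qed
  also have "\<dots> = ennreal C * (\<integral>\<^sup>+\<omega>. (\<integral>\<^sup>+\<theta>. K \<theta> \<omega> * indicator I \<theta> * indicator W \<omega> \<partial>lborel) \<partial>lborel)"
    by (rule nn_integral_cmult) measurable
  also have "(\<integral>\<^sup>+\<omega>. (\<integral>\<^sup>+\<theta>. K \<theta> \<omega> * indicator I \<theta> * indicator W \<omega> \<partial>lborel) \<partial>lborel)
     = (\<integral>\<^sup>+\<theta>. (\<integral>\<^sup>+\<omega>. K \<theta> \<omega> * indicator I \<theta> * indicator W \<omega> \<partial>lborel) \<partial>lborel)"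
    by (rule lborel_pair.Fubini') measurable
  also have "\<dots> \<le> (\<integral>\<^sup>+\<theta>. (\<integral>\<^sup>+\<omega>. ennreal (1 / \<theta>) * band \<theta> \<omega> * G \<omega> \<partial>lborel)
      + ennreal (R ^ d) * (ennreal (\<theta> ^ (d - 1)) * \<Psi> (t / \<theta> ^ (d - 1)) * indicator I \<theta>) \<partial>lborel)"
  proof (rule nn_integral_mono)
    fix \<theta> :: real
    show "(\<integral>\<^sup>+\<omega>. K \<theta> \<omega> * indicator I \<theta> * indicator W \<omega> \<partial>lborel)
      \<le> (\<integral>\<^sup>+\<omega>. ennreal (1 / \<theta>) * band \<theta> \<omega> * G \<omega> \<partial>lborel)
        + ennreal (R ^ d) * (ennreal (\<theta> ^ (d - 1)) * \<Psi> (t / \<theta> ^ (d - 1)) * indicator I \<theta>)"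
    proof (cases "\<theta> \<in> I")
      case True
      then have \<theta>: "0 < \<theta>" "\<theta> < 1" by (auto simp: I_def)
      define T where "T \<omega> = (\<Sum>j\<in>Basis. (if j = b then 0 else (1 - \<theta>) * ((x - x0) \<bullet> j)) *\<^sub>R j)
      + (\<Sum>j\<in>Basis. ((if j = b then 1 else \<theta>) * (\<omega> \<bullet> j)) *\<^sub>R j)" for \<omega>
      have \<theta>0: "\<theta> \<noteq> 0" using \<theta> by simp
      note T = hyp_point_scaling[OF b x\<sigma> \<theta>0, folded T_def]
      have [measurable]: "(\<lambda>\<omega>. h (x + \<theta> *\<^sub>R (H \<omega> - x)) * indicator W \<omega>) \<in> borel_measurable lborel" by measurable
      have "(\<integral>\<^sup>+\<omega>. K \<theta> \<omega> * indicator I \<theta> * indicator W \<omega> \<partial>lborel)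
        = (\<integral>\<^sup>+\<omega>. ennreal (\<theta> ^ (d - 1)) * (h (x + \<theta> *\<^sub>R (H \<omega> - x)) * indicator W \<omega>)
            + ennreal (\<theta> ^ (d - 1)) * \<Psi> (t / \<theta> ^ (d - 1)) * indicator W \<omega> \<partial>lborel)"
        using True by (simp add: K_def algebra_simps)
      also have "\<dots> = ennreal (\<theta> ^ (d - 1)) * (\<integral>\<^sup>+\<omega>. h (x + \<theta> *\<^sub>R (H \<omega> - x)) * indicator W \<omega> \<partial>lborel)
            + ennreal (\<theta> ^ (d - 1)) * \<Psi> (t / \<theta> ^ (d - 1)) * emeasure lborel W"
        by (subst nn_integral_add) (auto simp: nn_integral_cmult nn_integral_cmult_indicator)
      also have "emeasure lborel W = ennreal (R ^ d)"
        using emeasure_far_slab[OF b R] unfolding W_def d(2) .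
      also have "ennreal (\<theta> ^ (d - 1)) * (\<integral>\<^sup>+\<omega>. h (x + \<theta> *\<^sub>R (H \<omega> - x)) * indicator W \<omega> \<partial>lborel)
          \<le> ennreal (\<theta> ^ (d - 1)) * (\<integral>\<^sup>+\<omega>. band \<theta> (T \<omega>) * G (T \<omega>) \<partial>lborel)"
      proof (intro mult_left_mono nn_integral_mono)
        fix \<omega>
        show "h (x + \<theta> *\<^sub>R (H \<omega> - x)) * indicator W \<omega> \<le> band \<theta> (T \<omega>) * G (T \<omega>)"
        proof (cases "\<omega> \<in> W")
          case True
          have Hn: "H (T \<omega>) = x + \<theta> *\<^sub>R (H \<omega> - x)" unfolding H_def by (rule T(3))
          have Ti: "T \<omega> \<bullet> j = (if j = b then \<omega> \<bullet> b else (1 - \<theta>) * ((x - x0) \<bullet> j) + \<theta> * (\<omega> \<bullet> j))" if "j \<in> Basis" for j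
            by (rule T(2)[OF that])
          have "T \<omega> \<in> slab b (4 * R)"
            unfolding slab_def
          proof (intro CollectI conjI ballI)
            show "0 \<le> T \<omega> \<bullet> b" "T \<omega> \<bullet> b \<le> 1" using True by (auto simp: Ti[OF b] W_def far_slab_def)
            fix j assume j: "j \<in> Basis - {b}"
            have "\<bar>(x - x0) \<bullet> j\<bar> \<le> 4 * R" "\<bar>\<omega> \<bullet> j\<bar> \<le> 4 * R"
              using x[of j] j R True by (force simp: W_def far_slab_def abs_le_iff)+
            then have "\<bar>(1 - \<theta>) * ((x - x0) \<bullet> j) + \<theta> * (\<omega> \<bullet> j)\<bar> \<le> (1 - \<theta>) * (4 * R) + \<theta> * (4 * R)"
              using \<theta> by (intro order_trans[OF abs_triangle_ineq] add_mono) (auto simp: abs_mult intro!: mult_left_mono)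
            then show "\<bar>T \<omega> \<bullet> j\<bar> \<le> 4 * R" using j by (simp add: Ti algebra_simps)
          qed
          moreover have "band \<theta> (T \<omega>) = 1"
          proof -
            have eq: "(T \<omega> - (x - x0)) \<bullet> j0 = \<theta> * (\<omega> \<bullet> j0 - (x - x0) \<bullet> j0)"
              using j0 by (simp add: inner_diff_left Ti algebra_simps)
            have "R \<le> \<omega> \<bullet> j0 - (x - x0) \<bullet> j0" "\<omega> \<bullet> j0 - (x - x0) \<bullet> j0 \<le> 6 * R"
              using x[of j0] j0 True by (force simp: W_def far_slab_def abs_le_iff)+
            then show ?thesis using \<theta> unfolding band_def eq by simp
          qed
          ultimately show ?thesis using True by (simp add: G_def Hn)
        qed simp
      qed simp
      \<comment> \<open>Write \<theta>^(d-1) as 1/\<theta> times \<theta>^d: the power \<theta>^d is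
        exactly the Jacobian of \<open>T\<close>, and 1/\<theta> remains for the band
        integral.\<close>
      also have "ennreal (\<theta> ^ (d - 1)) * (\<integral>\<^sup>+\<omega>. band \<theta> (T \<omega>) * G (T \<omega>) \<partial>lborel)
        = ennreal (1 / \<theta>) * (ennreal (\<bar>\<theta>\<bar> ^ d) * (\<integral>\<^sup>+\<omega>. band \<theta> (T \<omega>) * G (T \<omega>) \<partial>lborel))"
      proof -
        have "\<theta> ^ (d - 1) = 1 / \<theta> * \<bar>\<theta>\<bar> ^ d"
          using \<theta> d(1) by (simp add: power_eq_if)
        then have "ennreal (\<theta> ^ (d - 1)) = ennreal (1 / \<theta>) * ennreal (\<bar>\<theta>\<bar> ^ d)"
          using \<theta> ennreal_mult[of "1 / \<theta>" "\<bar>\<theta>\<bar> ^ d"] by simp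
        then show ?thesis by (simp only: mult.assoc)
      qed
      also have "ennreal (\<bar>\<theta>\<bar> ^ d) * (\<integral>\<^sup>+\<omega>. band \<theta> (T \<omega>) * G (T \<omega>) \<partial>lborel) = (\<integral>\<^sup>+\<omega>. band \<theta> \<omega> * G \<omega> \<partial>lborel)"
        unfolding d(2)[symmetric] by (rule T(1)[symmetric]) measurable
      also have "ennreal (1 / \<theta>) * (\<integral>\<^sup>+\<omega>. band \<theta> \<omega> * G \<omega> \<partial>lborel) = (\<integral>\<^sup>+\<omega>. ennreal (1 / \<theta>) * (band \<theta> \<omega> * G \<omega>) \<partial>lborel)"
        by (rule nn_integral_cmult[symmetric]) measurable
      finally show ?thesis using True by (simp add: mult_ac)
    qed simp
  qed
  also have "\<dots> = (\<integral>\<^sup>+\<theta>. (\<integral>\<^sup>+\<omega>. ennreal (1 / \<theta>) * band \<theta> \<omega> * G \<omega> \<partial>lborel) \<partial>lborel)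
      + (\<integral>\<^sup>+\<theta>. ennreal (R ^ d) * (ennreal (\<theta> ^ (d - 1)) * \<Psi> (t / \<theta> ^ (d - 1)) * indicator I \<theta>) \<partial>lborel)"
    by (rule nn_integral_add) measurable
  also have "(\<integral>\<^sup>+\<theta>. ennreal (R ^ d) * (ennreal (\<theta> ^ (d - 1)) * \<Psi> (t / \<theta> ^ (d - 1)) * indicator I \<theta>) \<partial>lborel)
      = ennreal (R ^ d) * cone_integral d \<Psi> t"
    unfolding cone_integral_def I_def by (rule nn_integral_cmult) measurable
  also have "(\<integral>\<^sup>+\<theta>. (\<integral>\<^sup>+\<omega>. ennreal (1 / \<theta>) * band \<theta> \<omega> * G \<omega> \<partial>lborel) \<partial>lborel)
      = (\<integral>\<^sup>+\<omega>. (\<integral>\<^sup>+\<theta>. ennreal (1 / \<theta>) * band \<theta> \<omega> * G \<omega> \<partial>lborel) \<partial>lborel)"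
    by (rule lborel_pair.Fubini') measurable
  also have "\<dots> \<le> (\<integral>\<^sup>+\<omega>. 6 * G \<omega> \<partial>lborel)"
  proof (rule nn_integral_mono)
    fix \<omega>
    have "(\<integral>\<^sup>+\<theta>. ennreal (1 / \<theta>) * band \<theta> \<omega> * G \<omega> \<partial>lborel) = (\<integral>\<^sup>+\<theta>. ennreal (1 / \<theta>) * band \<theta> \<omega> \<partial>lborel) * G \<omega>"
      by (rule nn_integral_multc) measurable
    also have "\<dots> \<le> 6 * G \<omega>"
    proof (rule mult_right_mono)
      have "(\<integral>\<^sup>+\<theta>. ennreal (1 / \<theta>) * band \<theta> \<omega> \<partial>lborel)
        = (\<integral>\<^sup>+\<theta>. ennreal (1 / \<theta>) * indicator {\<theta>. 0 < \<theta> \<and> \<theta> * R \<le> (\<omega> - (x - x0)) \<bullet> j0 \<and> (\<omega> - (x - x0)) \<bullet> j0 \<le> \<theta> * (6 * R)} \<theta> \<partial>lborel)"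
        by (intro nn_integral_cong) (simp add: band_def indicator_def)
      also have "\<dots> \<le> 6" by (rule nn_integral_inverse_band[OF R])
      finally show "(\<integral>\<^sup>+\<theta>. ennreal (1 / \<theta>) * band \<theta> \<omega> \<partial>lborel) \<le> 6" .
    qed simp
    finally show "(\<integral>\<^sup>+\<theta>. ennreal (1 / \<theta>) * band \<theta> \<omega> * G \<omega> \<partial>lborel) \<le> 6 * G \<omega>" .
  qed
  also have "\<dots> = 6 * (\<integral>\<^sup>+\<omega>. G \<omega> \<partial>lborel)"
    by (rule nn_integral_cmult) measurable
  finally show ?thesis
    unfolding d(2) by (simp add: W_def H_def G_def C_def n_def mult_left_mono add_right_mono)
qed

text \<open>The mean over the far cube depends on the face but not on x, so it serves as the common
  reference value for all points of that face.\<close>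

definition hyp_mean :: "('a::euclidean_space \<Rightarrow> real) \<Rightarrow> 'a \<Rightarrow> 'a \<Rightarrow> real \<Rightarrow> real \<Rightarrow> real" where
  "hyp_mean v x0 b \<sigma> R =
     (\<integral>\<omega>. indicator (far_slab b R) \<omega> * v (hyp_point x0 b \<sigma> \<omega>) \<partial>lborel) / R ^ (DIM('a) - 1)"

lemma far_slab_integrable:
  fixes v :: "'a::euclidean_space \<Rightarrow> real"
  assumes b: "b \<in> Basis" and v: "continuous_on UNIV v"
  shows "integrable lborel (\<lambda>\<omega>. indicator (far_slab b R) \<omega> * v (hyp_point x0 b \<sigma> \<omega>))"
proof -
  have "continuous_on (far_slab b R) (\<lambda>\<omega>. v (hyp_point x0 b \<sigma> \<omega>))"
    by (rule continuous_on_compose2[OF v continuous_on_hyp_point]) auto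
  from borel_integrable_compact[OF compact_far_slab[OF b] this] show ?thesis by (simp add: mult.commute)
qed

lemma hyp_mean_estimate:
  fixes v :: "'a::euclidean_space \<Rightarrow> real" and h :: "'a \<Rightarrow> ennreal" and \<Psi> :: "real \<Rightarrow> ennreal"
    and R t \<sigma> :: real
  assumes n: "DIM('a) \<ge> 2" and b: "b \<in> Basis" and R: "R > 0" and t: "t > 0"
    and v: "Ck (Suc 0) v"
    and meas: "h \<in> borel_measurable borel" "\<Psi> \<in> borel_measurable borel"
    and young: "\<And>z k. (\<forall>j\<in>Basis. \<bar>(z - x0) \<bullet> j\<bar> \<le> 4 * R) \<Longrightarrow> k > 0 \<Longrightarrow>
        ennreal (norm (gradient v z) * k) \<le> h z + \<Psi> k"
    and x\<sigma>: "(x - x0) \<bullet> b = \<sigma>" and x: "\<And>j. j \<in> Basis \<Longrightarrow> \<bar>(x - x0) \<bullet> j\<bar> \<le> 2 * R"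
  shows "ennreal (t * R ^ (DIM('a) - 1) * \<bar>v x - hyp_mean v x0 b \<sigma> R\<bar>)
    \<le> ennreal (36 * DIM('a) * R) * ((\<integral>\<^sup>+\<omega>\<in>slab b (4 * R). h (hyp_point x0 b \<sigma> \<omega>) \<partial>lborel)
        + ennreal (R ^ (DIM('a) - 1)) * cone_integral (DIM('a) - 1) \<Psi> t)"
proof -
  define d where "d = DIM('a) - 1"
  define H where "H = hyp_point x0 b \<sigma>"
  let ?i = "indicator (far_slab b R) :: 'a \<Rightarrow> real"
  have Rd: "R ^ d > 0" using R by simp
  have vc: "continuous_on UNIV v" by (rule Ck_imp_continuous_on[OF v])
  have I: "integrable lborel (\<lambda>\<omega>. ?i \<omega> * v (H \<omega>))" "integrable lborel (\<lambda>\<omega>. ?i \<omega> * v x)"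
    using far_slab_integrable[OF b vc, of R x0 \<sigma>] far_slab_integrable[OF b, of "\<lambda>_. v x" R x0 \<sigma>]
    unfolding H_def by auto
  have "measure lborel (far_slab b R) = R ^ d"
    using emeasure_far_slab[OF b R] Rd by (simp add: measure_def d_def)
  then have "(\<integral>\<omega>. ?i \<omega> * v x \<partial>lborel) = R ^ d * v x" by simp
  moreover have "R ^ d * hyp_mean v x0 b \<sigma> R = (\<integral>\<omega>. ?i \<omega> * v (H \<omega>) \<partial>lborel)"
    using R unfolding hyp_mean_def d_def H_def by simp
  ultimately have "R ^ d * (hyp_mean v x0 b \<sigma> R - v x) = (\<integral>\<omega>. ?i \<omega> * v (H \<omega>) - ?i \<omega> * v x \<partial>lborel)"
    by (simp only: Bochner_Integration.integral_diff[OF I] right_diff_distrib)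
  then have "R ^ d * \<bar>v x - hyp_mean v x0 b \<sigma> R\<bar> = norm (\<integral>\<omega>. ?i \<omega> * v (H \<omega>) - ?i \<omega> * v x \<partial>lborel)"
    using Rd by (metis abs_minus_commute abs_mult abs_of_pos real_norm_def)
  also have "ennreal \<dots> \<le> (\<integral>\<^sup>+\<omega>. ennreal (norm (?i \<omega> * v (H \<omega>) - ?i \<omega> * v x)) \<partial>lborel)"
    by (rule integral_norm_bound_ennreal[OF Bochner_Integration.integrable_diff[OF I]])
  also have "\<dots> = (\<integral>\<^sup>+\<omega>\<in>far_slab b R. ennreal \<bar>v (H \<omega>) - v x\<bar> \<partial>lborel)"
    by (intro nn_integral_cong) (auto simp: indicator_def)
  finally have "ennreal t * ennreal (R ^ d * \<bar>v x - hyp_mean v x0 b \<sigma> R\<bar>)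
      \<le> ennreal t * (\<integral>\<^sup>+\<omega>\<in>far_slab b R. ennreal \<bar>v (H \<omega>) - v x\<bar> \<partial>lborel)"
    by (intro mult_left_mono) auto
  also have "\<dots> \<le> ennreal (6 * DIM('a) * R) * (6 * (\<integral>\<^sup>+\<omega>\<in>slab b (4 * R). h (H \<omega>) \<partial>lborel)
        + ennreal (R ^ d) * cone_integral d \<Psi> t)"
    unfolding H_def d_def by (rule hyperplane_estimate[OF n b R t v meas young x\<sigma> x])
  \<comment> \<open>The conjugate term is enlarged by the factor 6 of the band integral, so that
    both terms share the constant 36 = 6 * 6.\<close>
  also have "\<dots> \<le> ennreal (6 * DIM('a) * R) * (6 * (\<integral>\<^sup>+\<omega>\<in>slab b (4 * R). h (H \<omega>) \<partial>lborel)
        + 6 * (ennreal (R ^ d) * cone_integral d \<Psi> t))"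
  proof (intro mult_left_mono add_left_mono)
    have "1 * y \<le> 6 * y" for y :: ennreal by (intro mult_right_mono) auto
    then show "ennreal (R ^ d) * cone_integral d \<Psi> t \<le> 6 * (ennreal (R ^ d) * cone_integral d \<Psi> t)" by simp
  qed simp
  also have "\<dots> = ennreal (36 * DIM('a) * R) * ((\<integral>\<^sup>+\<omega>\<in>slab b (4 * R). h (H \<omega>) \<partial>lborel)
        + ennreal (R ^ d) * cone_integral d \<Psi> t)"
  proof -
    have "ennreal (36 * DIM('a) * R) = ennreal (6 * DIM('a) * R) * 6"
      using R ennreal_mult[of "6 * DIM('a) * R" 6] by (simp add: mult.assoc mult.commute[of _ 6])
    then show ?thesis by (simp add: distrib_left mult.assoc)
  qed
  finally show ?thesis
    using t Rd by (simp add: ennreal_mult[symmetric] d_def H_def mult.assoc)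
qed

text \<open>Combined with a bound on the face integrals of |v|, this keeps the corner values of the
  mollifications in a compact interval.\<close>

lemma hyp_mean_bound:
  fixes v :: "'a::euclidean_space \<Rightarrow> real"
  assumes b: "b \<in> Basis" and R: "R > 0" and v: "continuous_on UNIV v"
  shows "ennreal (R ^ (DIM('a) - 1) * \<bar>hyp_mean v x0 b \<sigma> R\<bar>)
    \<le> (\<integral>\<^sup>+\<omega>\<in>slab b (4 * R). ennreal \<bar>v (hyp_point x0 b \<sigma> \<omega>)\<bar> \<partial>lborel)"
proof -
  let ?f = "\<lambda>\<omega>. indicator (far_slab b R) \<omega> * v (hyp_point x0 b \<sigma> \<omega>)"
  have "R ^ (DIM('a) - 1) * \<bar>hyp_mean v x0 b \<sigma> R\<bar> = norm (\<integral>\<omega>. ?f \<omega> \<partial>lborel)"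
    using R by (simp add: hyp_mean_def)
  also have "ennreal \<dots> \<le> (\<integral>\<^sup>+\<omega>. ennreal (norm (?f \<omega>)) \<partial>lborel)"
    by (rule integral_norm_bound_ennreal[OF far_slab_integrable[OF b v]])
  also have "\<dots> \<le> (\<integral>\<^sup>+\<omega>\<in>slab b (4 * R). ennreal \<bar>v (hyp_point x0 b \<sigma> \<omega>)\<bar> \<partial>lborel)"
    using far_slab_subset[OF R, of b] by (intro nn_integral_mono) (auto simp: indicator_def)
  finally show ?thesis .
qed

subsection \<open>Smooth truncations\<close>

text \<open>For \<open>s > 0\<close> this is \<open>s * exp (- 1 / (k * s))\<close>, which increases to the positive part as \<open>k \<rightarrow> \<infinity>\<close>.\<close>

definition ramp :: "real \<Rightarrow> real \<Rightarrow> real" where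
  "ramp k s = s * flat 1 (k * s)"

definition ramp' :: "real \<Rightarrow> real \<Rightarrow> real" where
  "ramp' k s = (if s > 0 then (1 + 1 / (k * s)) * exp (- (1 / (k * s))) else 0)"

lemma has_real_derivative_ramp:
  assumes k: "k > 0"
  shows "(ramp k has_real_derivative ramp' k s) (at s)"
proof -
  have "((\<lambda>s. flat 1 (k * s)) has_real_derivative flat ([:0, 0, 1:] * (1 - pderiv 1)) (k * s) * k) (at s)"
    by (rule DERIV_chain2[OF has_real_derivative_flat]) (auto intro!: derivative_eq_intros)
  then have "(ramp k has_real_derivative 1 * flat 1 (k * s) + (flat ([:0, 0, 1:] * (1 - pderiv 1)) (k * s) * k) * s) (at s)"
    unfolding ramp_def by (rule DERIV_mult[OF DERIV_ident])
  moreover have "1 * flat 1 (k * s) + (flat ([:0, 0, 1:] * (1 - pderiv 1)) (k * s) * k) * s = ramp' k s"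
    using k by (auto simp: flat_def ramp'_def zero_less_mult_iff pderiv_1 field_simps)
  ultimately show ?thesis by simp
qed

text \<open>With w = 1 / (k s) the derivative is (1 + w) exp (-w), which is at most 1 because 1 + w
  <= exp w. Hence the smooth truncations are 1-Lipschitz.\<close>

lemma ramp'_bounds: assumes "k > 0" shows "0 \<le> ramp' k s" "ramp' k s \<le> 1"
proof -
  show "0 \<le> ramp' k s" using assms by (simp add: ramp'_def)
  have "(1 + w) * exp (- w) \<le> 1" for w :: real
    using exp_ge_add_one_self[of w] by (simp add: exp_minus field_simps)
  then show "ramp' k s \<le> 1" by (simp add: ramp'_def)
qed

lemma ramp_bounds: "0 \<le> ramp k s" "ramp k s \<le> max s 0" if "k > 0"
  using that flat_1_nonneg[of "k * s"] flat_1_le_1[of "k * s"] flat_1_eq_0_iff[of "k * s"]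
  by (cases "s > 0"; auto simp: ramp_def mult_le_0_iff intro: mult_left_le)+

lemma ramp_nonpos: "k > 0 \<Longrightarrow> s \<le> 0 \<Longrightarrow> ramp k s = 0"
  using flat_1_eq_0_iff[of "k * s"] by (simp add: ramp_def mult_le_0_iff)

lemma ramp_tendsto: "(\<lambda>k. ramp (real (Suc k)) s) \<longlonglongrightarrow> max s 0"
  and ramp'_tendsto: "(\<lambda>k. ramp' (real (Suc k)) s) \<longlonglongrightarrow> (if s > 0 then 1 else 0)"
proof -
  have *: "(\<lambda>k. 1 / (real (Suc k) * s)) \<longlonglongrightarrow> 0"
    using tendsto_mult[OF LIMSEQ_inverse_real_of_nat tendsto_const[of "1 / s"]]
    by (simp add: inverse_eq_divide)
  have 1: "(\<lambda>k. s * exp (- (1 / (real (Suc k) * s)))) \<longlonglongrightarrow> s * exp (- 0)"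
    by (intro tendsto_intros *)
  have 2: "(\<lambda>k. (1 + 1 / (real (Suc k) * s)) * exp (- (1 / (real (Suc k) * s)))) \<longlonglongrightarrow> (1 + 0) * exp (- 0)"
    by (intro tendsto_intros *)
  show "(\<lambda>k. ramp (real (Suc k)) s) \<longlonglongrightarrow> max s 0"
  proof (cases "s > 0")
    case True
    then have "(\<lambda>k. ramp (real (Suc k)) s) = (\<lambda>k. s * exp (- (1 / (real (Suc k) * s))))"
      by (auto simp: ramp_def flat_def fun_eq_iff)
    then show ?thesis using 1 True by simp
  qed (simp add: ramp_nonpos max_def)
  show "(\<lambda>k. ramp' (real (Suc k)) s) \<longlonglongrightarrow> (if s > 0 then 1 else 0)"
    using 2 by (cases "s > 0") (simp_all add: ramp'_def)
qed

lemma Ck_ramp: "Ck j (ramp k)"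
proof -
  have "Ck j (\<lambda>s::real. s)" using Ck_inner_left[of j "1::real"] by simp
  then show ?thesis
    unfolding ramp_def by (intro Ck_mult Ck_compose[OF Ck_flat] Ck_cmult)
qed

lemma ramp'_measurable [measurable]: "ramp' k \<in> borel_measurable borel"
  unfolding ramp'_def by measurable

section \<open>Two-sided truncations\<close>

definition trunc :: "real \<Rightarrow> real \<Rightarrow> real \<Rightarrow> real" where
  "trunc m M t = max (t - M) 0 - max (m - t) 0"

text \<open>Smooth, yet exactly zero on [m, M] and not merely small there. This is what gives the
  approximants compact support in the cube.\<close>

definition strunc :: "real \<Rightarrow> real \<Rightarrow> real \<Rightarrow> real \<Rightarrow> real" where
  "strunc k m M t = ramp k (t - M) - ramp k (m - t)"

definition strunc' :: "real \<Rightarrow> real \<Rightarrow> real \<Rightarrow> real \<Rightarrow> real" where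
  "strunc' k m M t = ramp' k (t - M) + ramp' k (m - t)"

text \<open>At the kinks m and M the value 0 is the pointwise limit of the smooth derivatives, so
  the convergence in \<open>strunc'_tendsto\<close> has no exceptional points.\<close>

definition trunc_deriv :: "real \<Rightarrow> real \<Rightarrow> real \<Rightarrow> real" where
  "trunc_deriv m M t = (if t > M \<or> t < m then 1 else 0)"

lemma has_real_derivative_strunc:
  assumes "k > 0"
  shows "(strunc k m M has_real_derivative strunc' k m M t) (at t)"
proof -
  have "((\<lambda>t. ramp k (t - M)) has_real_derivative ramp' k (t - M) * 1) (at t)"
    by (rule DERIV_chain2[OF has_real_derivative_ramp[OF assms]]) (auto intro!: derivative_eq_intros)
  moreover have "((\<lambda>t. ramp k (m - t)) has_real_derivative ramp' k (m - t) * (-1)) (at t)"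
    by (rule DERIV_chain2[OF has_real_derivative_ramp[OF assms]]) (auto intro!: derivative_eq_intros)
  ultimately show ?thesis
    unfolding strunc_def strunc'_def by (auto intro!: derivative_eq_intros)
qed

lemma strunc'_bounds:
  assumes "k > 0" "m \<le> M"
  shows "0 \<le> strunc' k m M t" "strunc' k m M t \<le> 1"
proof -
  show "0 \<le> strunc' k m M t" using ramp'_bounds(1)[OF assms(1)] by (simp add: strunc'_def)
  show "strunc' k m M t \<le> 1"
    using ramp'_bounds(2)[OF assms(1), of "t - M"] ramp'_bounds(2)[OF assms(1), of "m - t"] assms(2)
    by (cases "t \<le> M") (auto simp: strunc'_def ramp'_def)
qed

lemma strunc_lipschitz:
  assumes "k > 0" "m \<le> M"
  shows "\<bar>strunc k m M s - strunc k m M t\<bar> \<le> \<bar>s - t\<bar>"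
proof -
  have "norm (strunc k m M s - strunc k m M t) \<le> 1 * norm (s - t)"
  proof (rule differentiable_bound[of UNIV])
    fix x
    show "(strunc k m M has_derivative (*) (strunc' k m M x)) (at x)"
      using has_real_derivative_strunc[OF assms(1)] by (simp add: has_field_derivative_def)
    show "onorm ((*) (strunc' k m M x)) \<le> 1"
      by (rule onorm_bound) (use strunc'_bounds[OF assms, of x] in \<open>auto simp: abs_mult intro: mult_left_le_one_le\<close>)
  qed auto
  then show ?thesis by simp
qed

lemma strunc_tendsto: "(\<lambda>k. strunc (real (Suc k)) m M t) \<longlonglongrightarrow> trunc m M t"
  unfolding strunc_def trunc_def by (intro tendsto_diff ramp_tendsto)

lemma strunc'_tendsto:
  assumes "m \<le> M"
  shows "(\<lambda>k. strunc' (real (Suc k)) m M t) \<longlonglongrightarrow> trunc_deriv m M t"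
proof -
  have "(\<lambda>k. strunc' (real (Suc k)) m M t) \<longlonglongrightarrow> (if t - M > 0 then 1 else 0) + (if m - t > 0 then 1 else 0)"
    unfolding strunc'_def by (intro tendsto_add ramp'_tendsto)
  also have "(if t - M > 0 then 1 else 0) + (if m - t > 0 then 1 else 0) = trunc_deriv m M t"
    using assms by (auto simp: trunc_deriv_def)
  finally show ?thesis .
qed

lemma strunc_eq_0: "k > 0 \<Longrightarrow> m \<le> t \<Longrightarrow> t \<le> M \<Longrightarrow> strunc k m M t = 0"
  by (simp add: strunc_def ramp_nonpos)

lemma strunc_bound: "k > 0 \<Longrightarrow> \<bar>strunc k m M t\<bar> \<le> \<bar>t\<bar> + \<bar>m\<bar> + \<bar>M\<bar>"
  using ramp_bounds[of k "t - M"] ramp_bounds[of k "m - t"] by (auto simp: strunc_def)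

lemma trunc_bound: "\<bar>trunc m M t\<bar> \<le> \<bar>t\<bar> + \<bar>m\<bar> + \<bar>M\<bar>"
  by (auto simp: trunc_def)

lemma Ck_strunc: "Ck j (strunc k m M)"
proof -
  have id: "Ck j (\<lambda>s::real. s)" using Ck_inner_left[of j "1::real"] by simp
  show ?thesis
    unfolding strunc_def by (intro Ck_diff Ck_compose[OF Ck_ramp] Ck_const id)
qed

lemma trunc_measurables [measurable]:
  "trunc m M \<in> borel_measurable borel" "trunc_deriv m M \<in> borel_measurable borel"
  "strunc k m M \<in> borel_measurable borel" "strunc' k m M \<in> borel_measurable borel"
proof -
  show "strunc k m M \<in> borel_measurable borel"
    by (intro borel_measurable_continuous_onI Ck_imp_continuous_on[OF Ck_strunc[of 0]])
qed (unfold trunc_def trunc_deriv_def strunc'_def, measurable)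

lemma tendsto_strunc':
  assumes k: "k > 0" and "X \<longlonglongrightarrow> t"
  shows "(\<lambda>j. strunc' k m M (X j)) \<longlonglongrightarrow> strunc' k m M t"
proof -
  have eq: "strunc' k m M = partial_deriv 1 (strunc k m M)"
  proof
    fix t show "strunc' k m M t = partial_deriv 1 (strunc k m M) t"
      using partial_deriv_eq[OF has_real_derivative_strunc[OF k, unfolded has_field_derivative_def], of 1 m M t] by simp
  qed
  have "Ck (Suc 0) (strunc k m M)" by (rule Ck_strunc)
  then have "continuous_on UNIV (strunc' k m M)" unfolding eq by simp
  then have "isCont (strunc' k m M) t" by (simp add: continuous_on_eq_continuous_at)
  then show ?thesis using assms(2) by (rule isCont_tendsto_compose)
qed

subsection \<open>Functions in the closure of the test functions\<close>

text \<open>The strict inequalities on the boundary persist in a neighbourhood of it by continuity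
  of w. The truncation vanishes on that neighbourhood, so its extension by zero is smooth with
  compact support inside Q.\<close>

lemma cutoff_test_function:
  fixes w :: "'a::euclidean_space \<Rightarrow> real"
  assumes Q: "open Q" "bounded Q" and w: "\<And>j. Ck j w" and k: "k > 0"
    and bd: "\<And>x. x \<in> closure Q \<Longrightarrow> x \<notin> Q \<Longrightarrow> m < w x \<and> w x < M"
  defines "\<phi> \<equiv> \<lambda>x. if x \<in> Q then strunc k m M (w x) else 0"
  shows "test_function Q \<phi>"
    and "x \<in> Q \<Longrightarrow> gradient \<phi> x = strunc' k m M (w x) *\<^sub>R gradient w x"
proof -
  have comp: "Ck j (\<lambda>x. strunc k m M (w x))" for j by (rule Ck_compose[OF Ck_strunc w])
  have wc: "continuous_on UNIV w" using Ck_imp_continuous_on[OF w] .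
  have sm: "Ck j \<phi>" for j
  proof (rule Ck_local)
    fix x
    consider "x \<in> Q" | "x \<notin> closure Q" | "x \<in> closure Q" "x \<notin> Q" by blast
    then show "\<exists>U g. open U \<and> x \<in> U \<and> Ck j g \<and> (\<forall>y\<in>U. \<phi> y = g y)"
    proof cases
      case 1
      then show ?thesis using Q comp by (intro exI[of _ Q] exI[of _ "\<lambda>x. strunc k m M (w x)"]) (auto simp: \<phi>_def)
    next
      case 2
      then show ?thesis using closure_subset[of Q]
        by (intro exI[of _ "- closure Q"] exI[of _ "\<lambda>x. 0"]) (auto simp: \<phi>_def Ck_const)
    next
      case 3
      have "open (w -` {m<..<M})" using wc by (intro open_vimage) auto
      then show ?thesis using bd[OF 3] k
        by (intro exI[of _ "w -` {m<..<M}"] exI[of _ "\<lambda>x. 0"]) (auto simp: \<phi>_def Ck_const strunc_eq_0)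
    qed
  qed
  have cl: "closure {x. \<phi> x \<noteq> 0} \<subseteq> closure Q \<inter> - (w -` {m<..<M})"
  proof (rule closure_minimal)
    show "{x. \<phi> x \<noteq> 0} \<subseteq> closure Q \<inter> - (w -` {m<..<M})"
      using closure_subset[of Q] strunc_eq_0[OF k] by (auto simp: \<phi>_def split: if_splits)
    have "open (w -` {m<..<M})" using wc by (intro open_vimage) auto
    then show "closed (closure Q \<inter> - (w -` {m<..<M}))" by (intro closed_Int) auto
  qed
  have "closure Q \<inter> - (w -` {m<..<M}) \<subseteq> Q" using bd by auto
  from subset_trans[OF cl this] have "closure {x. \<phi> x \<noteq> 0} \<subseteq> Q" .
  moreover have "compact (closure {x. \<phi> x \<noteq> 0})"
  proof -
    have "bounded (closure Q)" using Q by (simp add: bounded_closure)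
    then show ?thesis using cl by (intro compact_eq_bounded_closed[THEN iffD2] conjI closed_closure) (auto intro: bounded_subset)
  qed
  ultimately show "test_function Q \<phi>"
    using sm by (auto simp: test_function_def compactly_contained_def)
  show "gradient \<phi> x = strunc' k m M (w x) *\<^sub>R gradient w x" if x: "x \<in> Q"
  proof (rule euclidean_eqI)
    fix b :: 'a assume b: "b \<in> Basis"
    have "w differentiable (at x)" using w[of "Suc 0"] by simp
    then have "partial_deriv b (\<lambda>x. strunc k m M (w x)) x = strunc' k m M (w x) * partial_deriv b w x"
      by (intro partial_deriv_compose_real has_real_derivative_strunc k b)
    moreover have "partial_deriv b \<phi> x = partial_deriv b (\<lambda>x. strunc k m M (w x)) x"
      using Q x by (intro partial_deriv_cong_open[of Q]) (auto simp: \<phi>_def)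
    ultimately show "gradient \<phi> x \<bullet> b = (strunc' k m M (w x) *\<^sub>R gradient w x) \<bullet> b"
      using b by (simp add: gradient_inner_Basis)
  qed
qed

text \<open>The limits are taken in this order: first the smoothing parameter k with U fixed, then
  the index i with k fixed. The second limit uses continuity of the smooth derivative along w i x ->
  U x; the limiting derivative \<open>trunc_deriv\<close> jumps at m and M, so w i could not be
  inserted into it directly.\<close>

lemma trunc_approximation:
  fixes U :: "'a::euclidean_space \<Rightarrow> real" and G :: "'a \<Rightarrow> 'a" and w :: "nat \<Rightarrow> 'a \<Rightarrow> real"
  assumes Q: "open Q" "bounded Q" and mM: "m \<le> M" and e: "e > 0"
    and [measurable]: "U \<in> borel_measurable borel" "G \<in> borel_measurable borel"
    and U: "integrable lborel U" and G: "integrable lborel (\<lambda>x. norm (G x))"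
    and w: "\<And>i j. Ck j (w i)"
    and bd: "\<And>i x. x \<in> closure Q \<Longrightarrow> x \<notin> Q \<Longrightarrow> m < w i x \<and> w i x < M"
    and limU: "(\<lambda>i. \<integral>\<^sup>+x\<in>Q. ennreal \<bar>w i x - U x\<bar> \<partial>lborel) \<longlonglongrightarrow> 0"
    and limG: "(\<lambda>i. \<integral>\<^sup>+x\<in>Q. ennreal (norm (gradient (w i) x - G x)) \<partial>lborel) \<longlonglongrightarrow> 0"
    and ae: "AE x in lborel. x \<in> Q \<longrightarrow> (\<lambda>i. w i x) \<longlonglongrightarrow> U x"
  obtains \<phi> where "test_function Q \<phi>"
    "(\<integral>\<^sup>+x\<in>Q. ennreal \<bar>trunc m M (U x) - \<phi> x\<bar> \<partial>lborel) \<le> ennreal e"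
    "(\<integral>\<^sup>+x\<in>Q. ennreal (norm (trunc_deriv m M (U x) *\<^sub>R G x - gradient \<phi> x)) \<partial>lborel) \<le> ennreal e"
proof -
  have Qm[measurable]: "Q \<in> sets borel" using Q by simp
  have Qfin: "emeasure lborel Q < \<infinity>" using emeasure_bounded_finite[OF Q(2)] .
  have wm[measurable]: "w i \<in> borel_measurable borel" for i
    by (intro borel_measurable_continuous_onI Ck_imp_continuous_on[OF w[of 0]])
  have gm[measurable]: "gradient (w i) \<in> borel_measurable borel" for i
    by (intro borel_measurable_continuous_onI continuous_on_gradient[OF w])
  have Gfin: "(\<integral>\<^sup>+x. ennreal (2 * norm (G x)) \<partial>lborel) < \<infinity>"
    using integrable_mult_right[OF G, of 2] unfolding integrable_iff_bounded by simp
  have Ufin: "(\<integral>\<^sup>+x. ennreal ((\<bar>U x\<bar> + \<bar>m\<bar> + \<bar>M\<bar>) * indicator Q x) \<partial>lborel) < \<infinity>"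
  proof -
    have "integrable lborel (\<lambda>x. \<bar>U x\<bar> * indicator Q x + (\<bar>m\<bar> + \<bar>M\<bar>) * indicator Q x)"
      using U Qfin by (intro Bochner_Integration.integrable_add integrable_mult_right integrable_real_mult_indicator) auto
    then have "integrable lborel (\<lambda>x. (\<bar>U x\<bar> + \<bar>m\<bar> + \<bar>M\<bar>) * indicator Q x)"
      by (simp add: algebra_simps)
    then show ?thesis unfolding integrable_iff_bounded by simp
  qed
  have l1: "(\<lambda>k. \<integral>\<^sup>+x. ennreal (norm (trunc m M (U x) * indicator Q x - strunc (real (Suc k)) m M (U x) * indicator Q x)) \<partial>lborel) \<longlonglongrightarrow> 0"
  proof (rule nn_integral_dominated_convergence_norm[OF _ _ _ _ Ufin])
    show "AE x in lborel. norm (strunc (real (Suc k)) m M (U x) * indicator Q x) \<le> (\<bar>U x\<bar> + \<bar>m\<bar> + \<bar>M\<bar>) * indicator Q x" for k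
      using strunc_bound[of "real (Suc k)" m M] by (auto simp: indicator_def)
    show "AE x in lborel. (\<lambda>k. strunc (real (Suc k)) m M (U x) * indicator Q x) \<longlonglongrightarrow> trunc m M (U x) * indicator Q x"
      by (intro AE_I2 tendsto_mult strunc_tendsto tendsto_const)
  qed measurable
  have l2: "(\<lambda>k. \<integral>\<^sup>+x. ennreal (norm (trunc_deriv m M (U x) *\<^sub>R G x - strunc' (real (Suc k)) m M (U x) *\<^sub>R G x)) \<partial>lborel) \<longlonglongrightarrow> 0"
  proof (rule nn_integral_dominated_convergence_norm[OF _ _ _ _ Gfin])
    show "AE x in lborel. norm (strunc' (real (Suc k)) m M (U x) *\<^sub>R G x) \<le> 2 * norm (G x)" for k
    proof (rule AE_I2)
      fix x
      show "norm (strunc' (real (Suc k)) m M (U x) *\<^sub>R G x) \<le> 2 * norm (G x)"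
        using strunc'_bounds[of "real (Suc k)" m M "U x"] mM by (simp add: mult_right_mono)
    qed
    show "AE x in lborel. (\<lambda>k. strunc' (real (Suc k)) m M (U x) *\<^sub>R G x) \<longlonglongrightarrow> trunc_deriv m M (U x) *\<^sub>R G x"
      by (intro AE_I2 tendsto_scaleR strunc'_tendsto mM tendsto_const)
  qed measurable
  have "ennreal (e / 3) > 0" using e by simp
  from order_tendstoD(2)[OF l1 this] order_tendstoD(2)[OF l2 this]
  have "\<forall>\<^sub>F k in sequentially. (\<integral>\<^sup>+x. ennreal (norm (trunc m M (U x) * indicator Q x - strunc (real (Suc k)) m M (U x) * indicator Q x)) \<partial>lborel) < ennreal (e / 3)
    \<and> (\<integral>\<^sup>+x. ennreal (norm (trunc_deriv m M (U x) *\<^sub>R G x - strunc' (real (Suc k)) m M (U x) *\<^sub>R G x)) \<partial>lborel) < ennreal (e / 3)"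
    by eventually_elim auto
  then obtain k' :: nat where k': "(\<integral>\<^sup>+x. ennreal (norm (trunc m M (U x) * indicator Q x - strunc (real (Suc k')) m M (U x) * indicator Q x)) \<partial>lborel) < ennreal (e / 3)"
    "(\<integral>\<^sup>+x. ennreal (norm (trunc_deriv m M (U x) *\<^sub>R G x - strunc' (real (Suc k')) m M (U x) *\<^sub>R G x)) \<partial>lborel) < ennreal (e / 3)"
    by (auto simp: eventually_sequentially)
  define k where "k = real (Suc k')"
  have k: "k > 0" unfolding k_def by simp
  \<comment> \<open>The gradient error is split through \<open>strunc'\<close> at U times G and
    \<open>strunc'\<close> at w i times G; this is the middle term. The last one is bounded by the
    gradient error of w i because \<open>strunc'\<close> is at most 1.\<close>
  have l3: "(\<lambda>i. \<integral>\<^sup>+x. ennreal (norm (strunc' k m M (U x) *\<^sub>R (indicator Q x *\<^sub>R G x) - strunc' k m M (w i x) *\<^sub>R (indicator Q x *\<^sub>R G x))) \<partial>lborel) \<longlonglongrightarrow> 0"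
  proof (rule nn_integral_dominated_convergence_norm[OF _ _ _ _ Gfin])
    show "AE x in lborel. norm (strunc' k m M (w i x) *\<^sub>R (indicator Q x *\<^sub>R G x)) \<le> 2 * norm (G x)" for i
    proof (rule AE_I2)
      fix x
      show "norm (strunc' k m M (w i x) *\<^sub>R (indicator Q x *\<^sub>R G x)) \<le> 2 * norm (G x)"
        using strunc'_bounds[OF k mM, of "w i x"] by (simp add: mult_right_mono indicator_def)
    qed
    show "AE x in lborel. (\<lambda>i. strunc' k m M (w i x) *\<^sub>R (indicator Q x *\<^sub>R G x)) \<longlonglongrightarrow> strunc' k m M (U x) *\<^sub>R (indicator Q x *\<^sub>R G x)"
      using ae
    proof eventually_elim
      fix x assume "x \<in> Q \<longrightarrow> (\<lambda>i. w i x) \<longlonglongrightarrow> U x"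
      then show "(\<lambda>i. strunc' k m M (w i x) *\<^sub>R (indicator Q x *\<^sub>R G x)) \<longlonglongrightarrow> strunc' k m M (U x) *\<^sub>R (indicator Q x *\<^sub>R G x)"
        by (cases "x \<in> Q") (auto intro!: tendsto_intros tendsto_strunc' k)
    qed
  qed measurable
  from order_tendstoD(2)[OF l3 \<open>ennreal (e / 3) > 0\<close>] order_tendstoD(2)[OF limU \<open>ennreal (e / 3) > 0\<close>] order_tendstoD(2)[OF limG \<open>ennreal (e / 3) > 0\<close>]
  have "\<forall>\<^sub>F i in sequentially.
    (\<integral>\<^sup>+x. ennreal (norm (strunc' k m M (U x) *\<^sub>R (indicator Q x *\<^sub>R G x) - strunc' k m M (w i x) *\<^sub>R (indicator Q x *\<^sub>R G x))) \<partial>lborel) < ennreal (e / 3)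
    \<and> (\<integral>\<^sup>+x\<in>Q. ennreal \<bar>w i x - U x\<bar> \<partial>lborel) < ennreal (e / 3)
    \<and> (\<integral>\<^sup>+x\<in>Q. ennreal (norm (gradient (w i) x - G x)) \<partial>lborel) < ennreal (e / 3)"
    by eventually_elim auto
  then obtain i where i: "(\<integral>\<^sup>+x. ennreal (norm (strunc' k m M (U x) *\<^sub>R (indicator Q x *\<^sub>R G x) - strunc' k m M (w i x) *\<^sub>R (indicator Q x *\<^sub>R G x))) \<partial>lborel) < ennreal (e / 3)"
    "(\<integral>\<^sup>+x\<in>Q. ennreal \<bar>w i x - U x\<bar> \<partial>lborel) < ennreal (e / 3)"
    "(\<integral>\<^sup>+x\<in>Q. ennreal (norm (gradient (w i) x - G x)) \<partial>lborel) < ennreal (e / 3)"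
    by (auto simp: eventually_sequentially)
  define \<phi> where "\<phi> x = (if x \<in> Q then strunc k m M (w i x) else 0)" for x
  note \<phi> = cutoff_test_function[OF Q w[where i = i] k bd[where i = i], folded \<phi>_def[abs_def]]
  show ?thesis
  proof (rule that)
    show "test_function Q \<phi>" by (rule \<phi>(1))
    have "(\<integral>\<^sup>+x\<in>Q. ennreal \<bar>trunc m M (U x) - \<phi> x\<bar> \<partial>lborel)
      \<le> (\<integral>\<^sup>+x. ennreal (norm (trunc m M (U x) * indicator Q x - strunc k m M (U x) * indicator Q x))
            + ennreal \<bar>w i x - U x\<bar> * indicator Q x \<partial>lborel)"
    proof (rule nn_integral_mono)
      fix x
      have "\<bar>trunc m M (U x) - strunc k m M (w i x)\<bar> \<le> \<bar>trunc m M (U x) - strunc k m M (U x)\<bar> + \<bar>w i x - U x\<bar>"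
        using strunc_lipschitz[OF k mM, of "w i x" "U x"] by simp
      then have "ennreal \<bar>trunc m M (U x) - strunc k m M (w i x)\<bar> \<le> ennreal \<bar>trunc m M (U x) - strunc k m M (U x)\<bar> + ennreal \<bar>w i x - U x\<bar>"
        by (simp flip: ennreal_plus add: ennreal_leI)
      then show "ennreal \<bar>trunc m M (U x) - \<phi> x\<bar> * indicator Q x
        \<le> ennreal (norm (trunc m M (U x) * indicator Q x - strunc k m M (U x) * indicator Q x))
            + ennreal \<bar>w i x - U x\<bar> * indicator Q x"
        by (cases "x \<in> Q") (auto simp: \<phi>_def)
    qed
    also have "\<dots> = (\<integral>\<^sup>+x. ennreal (norm (trunc m M (U x) * indicator Q x - strunc k m M (U x) * indicator Q x)) \<partial>lborel)
            + (\<integral>\<^sup>+x\<in>Q. ennreal \<bar>w i x - U x\<bar> \<partial>lborel)"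
      by (rule nn_integral_add) measurable
    also have "\<dots> \<le> ennreal (e / 3) + ennreal (e / 3)"
      using k' i unfolding k_def by (intro add_mono less_imp_le) auto
    also have "\<dots> \<le> ennreal e" using e by (simp flip: ennreal_plus add: ennreal_leI)
    finally show "(\<integral>\<^sup>+x\<in>Q. ennreal \<bar>trunc m M (U x) - \<phi> x\<bar> \<partial>lborel) \<le> ennreal e" .
    have "(\<integral>\<^sup>+x\<in>Q. ennreal (norm (trunc_deriv m M (U x) *\<^sub>R G x - gradient \<phi> x)) \<partial>lborel)
      \<le> (\<integral>\<^sup>+x. ennreal (norm (trunc_deriv m M (U x) *\<^sub>R G x - strunc' k m M (U x) *\<^sub>R G x))
          + ennreal (norm (strunc' k m M (U x) *\<^sub>R (indicator Q x *\<^sub>R G x) - strunc' k m M (w i x) *\<^sub>R (indicator Q x *\<^sub>R G x)))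
          + ennreal (norm (gradient (w i) x - G x)) * indicator Q x \<partial>lborel)"
    proof (rule nn_integral_mono)
      fix x
      show "ennreal (norm (trunc_deriv m M (U x) *\<^sub>R G x - gradient \<phi> x)) * indicator Q x
        \<le> ennreal (norm (trunc_deriv m M (U x) *\<^sub>R G x - strunc' k m M (U x) *\<^sub>R G x))
          + ennreal (norm (strunc' k m M (U x) *\<^sub>R (indicator Q x *\<^sub>R G x) - strunc' k m M (w i x) *\<^sub>R (indicator Q x *\<^sub>R G x)))
          + ennreal (norm (gradient (w i) x - G x)) * indicator Q x"
      proof (cases "x \<in> Q")
        case True
        have g: "gradient \<phi> x = strunc' k m M (w i x) *\<^sub>R gradient (w i) x"
          using \<phi>(2)[OF _ _ True] by simp
        define a where "a = trunc_deriv m M (U x) *\<^sub>R G x"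
        define b where "b = strunc' k m M (U x) *\<^sub>R G x"
        define c where "c = strunc' k m M (w i x) *\<^sub>R G x"
        define d where "d = strunc' k m M (w i x) *\<^sub>R gradient (w i) x"
        have "norm (c - d) = \<bar>strunc' k m M (w i x)\<bar> * norm (G x - gradient (w i) x)"
          by (simp add: c_def d_def flip: scaleR_diff_right)
        also have "\<dots> \<le> 1 * norm (G x - gradient (w i) x)"
          using strunc'_bounds[OF k mM, of "w i x"] by (intro mult_right_mono) auto
        finally have "norm (c - d) \<le> norm (gradient (w i) x - G x)" by (simp add: norm_minus_commute)
        moreover have "norm (a - d) \<le> norm (a - b) + norm (b - c) + norm (c - d)"
          using norm_triangle_ineq[of "a - b" "b - c"] norm_triangle_ineq[of "a - c" "c - d"] by simp
        ultimately have "norm (a - d) \<le> norm (a - b) + norm (b - c) + norm (gradient (w i) x - G x)" by simp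
        then have "ennreal (norm (a - d)) \<le> ennreal (norm (a - b)) + ennreal (norm (b - c)) + ennreal (norm (gradient (w i) x - G x))"
          by (simp flip: ennreal_plus add: ennreal_leI)
        then show ?thesis using True unfolding g by (simp add: a_def b_def c_def d_def)
      qed simp
    qed
    also have "\<dots> = (\<integral>\<^sup>+x. ennreal (norm (trunc_deriv m M (U x) *\<^sub>R G x - strunc' k m M (U x) *\<^sub>R G x)) \<partial>lborel)
          + (\<integral>\<^sup>+x. ennreal (norm (strunc' k m M (U x) *\<^sub>R (indicator Q x *\<^sub>R G x) - strunc' k m M (w i x) *\<^sub>R (indicator Q x *\<^sub>R G x))) \<partial>lborel)
          + (\<integral>\<^sup>+x\<in>Q. ennreal (norm (gradient (w i) x - G x)) \<partial>lborel)"
    proof (subst nn_integral_add)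
      show "(\<lambda>x. ennreal (norm (trunc_deriv m M (U x) *\<^sub>R G x - strunc' k m M (U x) *\<^sub>R G x))
          + ennreal (norm (strunc' k m M (U x) *\<^sub>R (indicator Q x *\<^sub>R G x) - strunc' k m M (w i x) *\<^sub>R (indicator Q x *\<^sub>R G x)))) \<in> borel_measurable lborel"
        "(\<lambda>x. ennreal (norm (gradient (w i) x - G x)) * indicator Q x) \<in> borel_measurable lborel"
        by measurable
    qed (intro arg_cong2[of _ _ _ _ "(+)"] refl nn_integral_add; measurable)
    also have "\<dots> \<le> ennreal (e / 3) + ennreal (e / 3) + ennreal (e / 3)"
      using k' i unfolding k_def by (intro add_mono less_imp_le) auto
    also have "\<dots> = ennreal e" using e by (simp flip: ennreal_plus)
    finally show "(\<integral>\<^sup>+x\<in>Q. ennreal (norm (trunc_deriv m M (U x) *\<^sub>R G x - gradient \<phi> x)) \<partial>lborel) \<le> ennreal e" .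
  qed
qed

subsection \<open>Passing between Lebesgue and Borel functions\<close>

lemma test_function_Ccinf: "test_function Q \<phi> \<Longrightarrow> Ccinf \<phi>"
  unfolding test_function_def compactly_contained_def Ccinf_def
  by (auto intro: bounded_subset[OF compact_imp_bounded closure_subset])

lemma test_function_outside: "test_function Q \<phi> \<Longrightarrow> x \<notin> Q \<Longrightarrow> \<phi> x = 0"
  using closure_subset[of "{x. \<phi> x \<noteq> 0}"] by (auto simp: test_function_def compactly_contained_def)

lemma test_function_partial_outside: "test_function Q \<phi> \<Longrightarrow> x \<notin> Q \<Longrightarrow> partial_deriv b \<phi> x = 0"
  using partial_deriv_support[of b \<phi>] by (auto simp: test_function_def compactly_contained_def)

text \<open>Holds without measurability: the nonnegative integral of any function is the same for a
  measure and its completion.\<close>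

lemma set_nn_integral_lebesgue:
  assumes "AE x in lborel. x \<in> Q \<longrightarrow> f x = g x"
  shows "(\<integral>\<^sup>+x\<in>Q. f x \<partial>lebesgue) = (\<integral>\<^sup>+x\<in>Q. g x \<partial>lborel)"
  unfolding nn_integral_completion
  by (rule nn_integral_cong_AE, use assms in eventually_elim) (auto simp: indicator_def)

text \<open>Pairing with a bounded function that vanishes off Q is continuous for convergence in L^1
  of Q. This carries integration by parts from test functions to their limits.\<close>

lemma tendsto_integral_mult:
  fixes F :: "'a::euclidean_space \<Rightarrow> real" and f :: "nat \<Rightarrow> 'a \<Rightarrow> real"
  assumes F: "integrable lborel F" and f: "\<And>k. integrable lborel (f k)"
    and [measurable]: "\<psi> \<in> borel_measurable borel" "Q \<in> sets borel"
    and C: "\<And>x. \<bar>\<psi> x\<bar> \<le> C" and out: "\<And>x. x \<notin> Q \<Longrightarrow> \<psi> x = 0"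
    and lim: "(\<lambda>k. \<integral>\<^sup>+x\<in>Q. ennreal \<bar>F x - f k x\<bar> \<partial>lborel) \<longlonglongrightarrow> 0"
  shows "(\<lambda>k. \<integral>x. f k x * \<psi> x \<partial>lborel) \<longlonglongrightarrow> (\<integral>x. F x * \<psi> x \<partial>lborel)"
proof -
  have [measurable]: "F \<in> borel_measurable borel" "f k \<in> borel_measurable borel" for k
    using F f[of k] by auto
  have C0: "C \<ge> 0" using C[of 0] by linarith
  have int: "integrable lborel (\<lambda>x. h x * \<psi> x)" if h: "integrable lborel h" for h
  proof (rule Bochner_Integration.integrable_bound[of lborel "\<lambda>x. C * h x"])
    have [measurable]: "h \<in> borel_measurable borel" using h by auto
    show "(\<lambda>x. h x * \<psi> x) \<in> borel_measurable lborel" by measurable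
    show "AE x in lborel. norm (h x * \<psi> x) \<le> norm (C * h x)"
      using C C0 by (auto simp: abs_mult mult.commute intro!: mult_right_mono)
  qed (use h in simp)
  have bound: "ennreal (dist (\<integral>x. f k x * \<psi> x \<partial>lborel) (\<integral>x. F x * \<psi> x \<partial>lborel))
      \<le> ennreal C * (\<integral>\<^sup>+x\<in>Q. ennreal \<bar>F x - f k x\<bar> \<partial>lborel)" for k
  proof -
    have "dist (\<integral>x. f k x * \<psi> x \<partial>lborel) (\<integral>x. F x * \<psi> x \<partial>lborel) = norm (\<integral>x. f k x * \<psi> x - F x * \<psi> x \<partial>lborel)"
      by (simp add: dist_norm Bochner_Integration.integral_diff[OF int[OF f] int[OF F]])
    also have "ennreal \<dots> \<le> (\<integral>\<^sup>+x. ennreal (norm (f k x * \<psi> x - F x * \<psi> x)) \<partial>lborel)"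
      by (intro integral_norm_bound_ennreal Bochner_Integration.integrable_diff int f F)
    also have "\<dots> \<le> (\<integral>\<^sup>+x. ennreal C * (ennreal \<bar>F x - f k x\<bar> * indicator Q x) \<partial>lborel)"
    proof (rule nn_integral_mono)
      fix x
      have "\<bar>f k x * \<psi> x - F x * \<psi> x\<bar> \<le> C * \<bar>F x - f k x\<bar>"
      proof -
        have "\<bar>f k x * \<psi> x - F x * \<psi> x\<bar> = \<bar>\<psi> x\<bar> * \<bar>F x - f k x\<bar>"
          by (metis abs_minus_commute abs_mult left_diff_distrib mult.commute)
        then show ?thesis using C[of x] by (simp add: mult_right_mono)
      qed
      then have "ennreal \<bar>f k x * \<psi> x - F x * \<psi> x\<bar> \<le> ennreal C * ennreal \<bar>F x - f k x\<bar>"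
        using C0 by (simp flip: ennreal_mult add: ennreal_leI)
      then show "ennreal (norm (f k x * \<psi> x - F x * \<psi> x)) \<le> ennreal C * (ennreal \<bar>F x - f k x\<bar> * indicator Q x)"
        using out[of x] by (cases "x \<in> Q") auto
    qed
    also have "\<dots> = ennreal C * (\<integral>\<^sup>+x\<in>Q. ennreal \<bar>F x - f k x\<bar> \<partial>lborel)"
      by (rule nn_integral_cmult) measurable
    finally show ?thesis .
  qed
  have "(\<lambda>k. ennreal C * (\<integral>\<^sup>+x\<in>Q. ennreal \<bar>F x - f k x\<bar> \<partial>lborel)) \<longlonglongrightarrow> ennreal C * 0"
    by (intro ennreal_tendsto_cmult lim) simp
  then have lim': "(\<lambda>k. ennreal C * (\<integral>\<^sup>+x\<in>Q. ennreal \<bar>F x - f k x\<bar> \<partial>lborel)) \<longlonglongrightarrow> ennreal 0"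
    by simp
  have "(\<lambda>k. ennreal (dist (\<integral>x. f k x * \<psi> x \<partial>lborel) (\<integral>x. F x * \<psi> x \<partial>lborel))) \<longlonglongrightarrow> ennreal 0"
    by (rule tendsto_sandwich[OF always_eventually always_eventually tendsto_const lim']) (auto simp only: bound ennreal_leI zero_le_dist)
  then have "(\<lambda>k. dist (\<integral>x. f k x * \<psi> x \<partial>lborel) (\<integral>x. F x * \<psi> x \<partial>lborel)) \<longlonglongrightarrow> 0"
    by (subst (asm) tendsto_ennreal_iff) auto
  then show ?thesis by (rule tendsto_dist_iff[THEN iffD2])
qed

lemma orlicz_L1I:
  assumes w: "w \<in> borel_measurable (lebesgue_on Q)"
    and fin: "(\<integral>\<^sup>+x\<in>Q. ennreal \<bar>w x\<bar> \<partial>lebesgue) < \<infinity>" and Q: "Q \<in> sets lebesgue"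
  shows "w \<in> orlicz ennreal Q"
proof -
  \<comment> \<open>The summand 1 keeps l positive when the integral is zero.\<close>
  define l where "l = enn2real (\<integral>\<^sup>+x\<in>Q. ennreal \<bar>w x\<bar> \<partial>lebesgue) + 1"
  have l: "l > 0" unfolding l_def by (simp add: add_nonneg_pos)
  have wm: "(\<lambda>x. ennreal \<bar>w x\<bar> * indicator Q x) \<in> borel_measurable lebesgue"
  proof -
    have [measurable]: "(\<lambda>x. indicator Q x *\<^sub>R w x) \<in> borel_measurable lebesgue"
      using w Q by (subst (asm) borel_measurable_restrict_space_iff) auto
    have "(\<lambda>x. ennreal \<bar>w x\<bar> * indicator Q x) = (\<lambda>x. ennreal \<bar>indicator Q x *\<^sub>R w x\<bar>)"
      by (auto simp: indicator_def)
    then show ?thesis by (simp only:) measurable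
  qed
  have "(\<integral>\<^sup>+x\<in>Q. ennreal (\<bar>w x\<bar> / l) \<partial>lebesgue) = (\<integral>\<^sup>+x. ennreal (1 / l) * (ennreal \<bar>w x\<bar> * indicator Q x) \<partial>lebesgue)"
    using l by (intro nn_integral_cong) (auto simp: indicator_def simp flip: ennreal_mult)
  also have "\<dots> = ennreal (1 / l) * (\<integral>\<^sup>+x\<in>Q. ennreal \<bar>w x\<bar> \<partial>lebesgue)"
    by (rule nn_integral_cmult[OF wm])
  also have "(\<integral>\<^sup>+x\<in>Q. ennreal \<bar>w x\<bar> \<partial>lebesgue) \<le> ennreal l"
    using fin unfolding l_def by (subst ennreal_plus) (auto simp: ennreal_enn2real_if)
  then have "ennreal (1 / l) * (\<integral>\<^sup>+x\<in>Q. ennreal \<bar>w x\<bar> \<partial>lebesgue) \<le> ennreal (1 / l) * ennreal l"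
    by (intro mult_left_mono) auto
  also have "\<dots> = 1" using l by (simp flip: ennreal_mult)
  finally have "luxemburg_norm ennreal Q w \<le> ennreal l"
    unfolding luxemburg_norm_def using l by (intro Inf_lower) auto
  then show ?thesis using w by (auto simp: orlicz_def less_top[symmetric] top_unique)
qed

lemma absolutely_integrable_of_AE_eq:
  fixes f F :: "'a::euclidean_space \<Rightarrow> 'b::euclidean_space"
  assumes F: "integrable lborel F" and K: "K \<in> sets borel" and ae: "AE x in lborel. x \<in> K \<longrightarrow> f x = F x"
  shows "f absolutely_integrable_on K"
proof -
  from ae obtain N where N: "N \<in> null_sets lborel" "{x. \<not> (x \<in> K \<longrightarrow> f x = F x)} \<subseteq> N"
    by (auto simp: eventually_ae_filter)
  have "integrable lborel (\<lambda>x. indicator K x *\<^sub>R F x)"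
    using K F by (intro integrable_mult_indicator) auto
  then have "integrable lebesgue (\<lambda>x. indicator K x *\<^sub>R F x)"
    by (subst integrable_completion) auto
  then have "F absolutely_integrable_on K" by (simp add: set_integrable_def)
  then show ?thesis
    by (rule absolutely_integrable_spike[of _ _ N])
       (use N in \<open>auto simp: negligible_iff_null_sets null_sets_completionI\<close>)
qed

lemma set_integral_lebesgue_AE:
  fixes f F :: "'a::euclidean_space \<Rightarrow> real"
  assumes Q: "Q \<in> sets borel" and f: "(\<lambda>x. indicator Q x * f x) \<in> borel_measurable lebesgue"
    and F: "F \<in> borel_measurable borel" and ae: "AE x in lborel. x \<in> Q \<longrightarrow> f x = F x"
  shows "(LINT x:Q|lebesgue. f x) = (\<integral>x. indicator Q x * F x \<partial>lborel)"
proof -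
  have "(LINT x:Q|lebesgue. f x) = (\<integral>x. indicator Q x * F x \<partial>lebesgue)"
    unfolding set_lebesgue_integral_def
  proof (rule integral_cong_AE)
    show "(\<lambda>x. indicator Q x *\<^sub>R f x) \<in> borel_measurable lebesgue" using f by simp
    show "(\<lambda>x. indicator Q x * F x) \<in> borel_measurable lebesgue"
      using F Q by (intro measurable_completion) simp
    show "AE x in lebesgue. indicator Q x *\<^sub>R f x = indicator Q x * F x"
      using AE_completion[OF ae] by eventually_elim (auto simp: indicator_def)
  qed
  also have "\<dots> = (\<integral>x. indicator Q x * F x \<partial>lborel)"
    using F Q by (intro integral_completion) simp
  finally show ?thesis .
qed

text \<open>The limit field of the gradients is automatically the weak gradient, since both sides of
  integration by parts for the approximating test functions converge. \<open>W\<close> is an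
  integrable Borel function that has to agree with w only on Q.\<close>

lemma W11_0_I:
  fixes w W :: "'a::euclidean_space \<Rightarrow> real" and G :: "'a \<Rightarrow> 'a"
  assumes Q: "open Q" and w: "w \<in> borel_measurable (lebesgue_on Q)"
    and W: "integrable lborel W" and G: "integrable lborel G"
    and ae: "AE x in lborel. x \<in> Q \<longrightarrow> w x = W x"
    and \<phi>: "\<And>k. test_function Q (\<phi> k)"
    and limW: "(\<lambda>k. \<integral>\<^sup>+x\<in>Q. ennreal \<bar>W x - \<phi> k x\<bar> \<partial>lborel) \<longlonglongrightarrow> 0"
    and limG: "(\<lambda>k. \<integral>\<^sup>+x\<in>Q. ennreal (norm (G x - gradient (\<phi> k) x)) \<partial>lborel) \<longlonglongrightarrow> 0"
  shows "w \<in> W11_0 Q"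
proof -
  have Qb[measurable]: "Q \<in> sets borel" using Q by simp
  have [measurable]: "W \<in> borel_measurable borel" "G \<in> borel_measurable borel" using W G by auto
  have QL: "Q \<in> sets lebesgue" by simp
  have wQ: "(\<lambda>x. indicator Q x * w x) \<in> borel_measurable lebesgue"
    using w QL by (subst (asm) borel_measurable_restrict_space_iff) auto
  have weak: "weak_gradient Q w G"
    unfolding weak_gradient_def
  proof (intro conjI allI impI)
    have K: "K \<in> sets borel" if "compact K" for K :: "'a set" using that by (simp add: compact_imp_closed)
    show "loc_integrable Q w" unfolding loc_integrable_def
    proof (intro allI impI)
      fix K assume "compact K \<and> K \<subseteq> Q"
      then show "w absolutely_integrable_on K"
        by (intro absolutely_integrable_of_AE_eq[OF W K]) (use ae in \<open>auto elim!: eventually_mono\<close>)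
    qed
    show "loc_integrable Q G" unfolding loc_integrable_def
      using absolutely_integrable_of_AE_eq[OF G K] by auto
    fix \<psi> and b :: 'a assume "test_function Q \<psi> \<and> b \<in> Basis"
    then have \<psi>: "test_function Q \<psi>" and b: "b \<in> Basis" by auto
    note \<psi>C = test_function_Ccinf[OF \<psi>]
    note pC = Ccinf_partial_deriv[OF \<psi>C b]
    have [measurable]: "\<psi> \<in> borel_measurable borel" "partial_deriv b \<psi> \<in> borel_measurable borel"
      using Ccinf_measurable \<psi>C pC by auto
    obtain C where C: "\<And>x. \<bar>\<psi> x\<bar> \<le> C" using Ccinf_bounded[OF \<psi>C] by metis
    obtain C' where C': "\<And>x. \<bar>partial_deriv b \<psi> x\<bar> \<le> C'" using Ccinf_bounded[OF pC] by metis
    have l1: "(\<lambda>k. \<integral>x. \<phi> k x * partial_deriv b \<psi> x \<partial>lborel) \<longlonglongrightarrow> (\<integral>x. W x * partial_deriv b \<psi> x \<partial>lborel)"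
      using tendsto_integral_mult[OF W Ccinf_integrable[OF test_function_Ccinf[OF \<phi>]] _ Qb C' test_function_partial_outside[OF \<psi>] limW]
      by simp
    have Gb: "integrable lborel (\<lambda>x. G x \<bullet> b)" using G by (rule integrable_inner_left)
    have limGb: "(\<lambda>k. \<integral>\<^sup>+x\<in>Q. ennreal \<bar>G x \<bullet> b - partial_deriv b (\<phi> k) x\<bar> \<partial>lborel) \<longlonglongrightarrow> 0"
    proof (rule tendsto_sandwich[OF _ _ tendsto_const limG])
      have "\<bar>G x \<bullet> b - partial_deriv b (\<phi> k) x\<bar> \<le> norm (G x - gradient (\<phi> k) x)" for k x
        using Basis_le_norm[OF b, of "G x - gradient (\<phi> k) x"] by (simp add: inner_diff_left gradient_inner_Basis b)
      then show "\<forall>\<^sub>F k in sequentially. (\<integral>\<^sup>+x\<in>Q. ennreal \<bar>G x \<bullet> b - partial_deriv b (\<phi> k) x\<bar> \<partial>lborel)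
          \<le> (\<integral>\<^sup>+x\<in>Q. ennreal (norm (G x - gradient (\<phi> k) x)) \<partial>lborel)"
        by (intro always_eventually allI nn_integral_mono mult_right_mono ennreal_leI) auto
    qed simp
    have l2: "(\<lambda>k. \<integral>x. partial_deriv b (\<phi> k) x * \<psi> x \<partial>lborel) \<longlonglongrightarrow> (\<integral>x. (G x \<bullet> b) * \<psi> x \<partial>lborel)"
      using tendsto_integral_mult[OF Gb Ccinf_integrable[OF Ccinf_partial_deriv[OF test_function_Ccinf[OF \<phi>] b]] _ Qb C test_function_outside[OF \<psi>] limGb]
      by simp
    have "(\<lambda>k. \<integral>x. \<phi> k x * partial_deriv b \<psi> x \<partial>lborel) = (\<lambda>k. - (\<integral>x. partial_deriv b (\<phi> k) x * \<psi> x \<partial>lborel))"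
      by (intro ext integration_by_parts test_function_Ccinf[OF \<phi>] \<psi>C b)
    with l1 have "(\<lambda>k. - (\<integral>x. partial_deriv b (\<phi> k) x * \<psi> x \<partial>lborel)) \<longlonglongrightarrow> (\<integral>x. W x * partial_deriv b \<psi> x \<partial>lborel)"
      by simp
    from LIMSEQ_unique[OF this tendsto_minus[OF l2]]
    have eq: "(\<integral>x. W x * partial_deriv b \<psi> x \<partial>lborel) = - (\<integral>x. (G x \<bullet> b) * \<psi> x \<partial>lborel)" .
    have "(LINT x:Q|lebesgue. w x * partial_deriv b \<psi> x) = (\<integral>x. indicator Q x * (W x * partial_deriv b \<psi> x) \<partial>lborel)"
    proof (rule set_integral_lebesgue_AE[OF Qb])
      have "(\<lambda>x. (indicator Q x * w x) * partial_deriv b \<psi> x) \<in> borel_measurable lebesgue"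
        by (rule borel_measurable_times[OF wQ measurable_completion]) simp
      then show "(\<lambda>x. indicator Q x * (w x * partial_deriv b \<psi> x)) \<in> borel_measurable lebesgue"
        by (simp add: mult.assoc)
      show "AE x in lborel. x \<in> Q \<longrightarrow> w x * partial_deriv b \<psi> x = W x * partial_deriv b \<psi> x"
        using ae by eventually_elim auto
    qed measurable
    also have "\<dots> = (\<integral>x. W x * partial_deriv b \<psi> x \<partial>lborel)"
      using test_function_partial_outside[OF \<psi>]
      by (intro Bochner_Integration.integral_cong refl) (auto simp: indicator_def)
    also have "\<dots> = - (\<integral>x. indicator Q x * ((G x \<bullet> b) * \<psi> x) \<partial>lborel)"
      unfolding eq using test_function_outside[OF \<psi>]
      by (intro arg_cong[of _ _ uminus] Bochner_Integration.integral_cong refl) (auto simp: indicator_def)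
    also have "(\<integral>x. indicator Q x * ((G x \<bullet> b) * \<psi> x) \<partial>lborel) = (LINT x:Q|lebesgue. (G x \<bullet> b) * \<psi> x)"
      by (rule set_integral_lebesgue_AE[OF Qb, symmetric]) (auto intro!: measurable_completion)
    finally show "(LINT x:Q|lebesgue. w x * partial_deriv b \<psi> x) = - (LINT x:Q|lebesgue. (G x \<bullet> b) * \<psi> x)" .
  qed
  have o1: "w \<in> orlicz ennreal Q"
  proof (rule orlicz_L1I[OF w _ QL])
    have "(\<integral>\<^sup>+x\<in>Q. ennreal \<bar>w x\<bar> \<partial>lebesgue) = (\<integral>\<^sup>+x\<in>Q. ennreal \<bar>W x\<bar> \<partial>lborel)"
      by (rule set_nn_integral_lebesgue) (use ae in \<open>auto elim!: eventually_mono\<close>)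
    also have "\<dots> \<le> (\<integral>\<^sup>+x. ennreal \<bar>W x\<bar> \<partial>lborel)"
      by (intro nn_integral_mono) (auto simp: indicator_def)
    also have "\<dots> < \<infinity>" using W unfolding integrable_iff_bounded by simp
    finally show "(\<integral>\<^sup>+x\<in>Q. ennreal \<bar>w x\<bar> \<partial>lebesgue) < \<infinity>" .
  qed
  have o2: "(\<lambda>x. norm (G x)) \<in> orlicz ennreal Q"
  proof (rule orlicz_L1I[OF _ _ QL])
    show "(\<lambda>x. norm (G x)) \<in> borel_measurable (lebesgue_on Q)"
      by (intro measurable_restrict_space1 measurable_completion) measurable
    have "(\<integral>\<^sup>+x\<in>Q. ennreal \<bar>norm (G x)\<bar> \<partial>lebesgue) = (\<integral>\<^sup>+x\<in>Q. ennreal (norm (G x)) \<partial>lborel)"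
      by (rule set_nn_integral_lebesgue) auto
    also have "\<dots> \<le> (\<integral>\<^sup>+x. ennreal (norm (G x)) \<partial>lborel)"
      by (intro nn_integral_mono) (auto simp: indicator_def)
    also have "\<dots> < \<infinity>" using G unfolding integrable_iff_bounded by simp
    finally show "(\<integral>\<^sup>+x\<in>Q. ennreal \<bar>norm (G x)\<bar> \<partial>lebesgue) < \<infinity>" .
  qed
  have L1: "(\<integral>\<^sup>+x\<in>Q. ennreal \<bar>w x - \<phi> k x\<bar> \<partial>lebesgue) = (\<integral>\<^sup>+x\<in>Q. ennreal \<bar>W x - \<phi> k x\<bar> \<partial>lborel)" for k
    by (rule set_nn_integral_lebesgue) (use ae in \<open>auto elim!: eventually_mono\<close>)
  have L2: "(\<integral>\<^sup>+x\<in>Q. ennreal (norm (G x - gradient (\<phi> k) x)) \<partial>lebesgue)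
      = (\<integral>\<^sup>+x\<in>Q. ennreal (norm (G x - gradient (\<phi> k) x)) \<partial>lborel)" for k
    by (rule set_nn_integral_lebesgue) auto
  show ?thesis
    unfolding W11_0_def orlicz_sobolev_def
    using weak o1 o2 \<phi> limW limG by (auto simp: L1 L2 intro!: exI[of _ G] exI[of _ \<phi>])
qed

text \<open>On a compact K the pair u, g is replaced by globally integrable Borel functions
  supported in K, which can be mollified. The derivative of the mollification is the mollification
  of the gradient wherever the ball of the kernel stays in K.\<close>

lemma weak_gradient_borel:
  fixes u :: "'a::euclidean_space \<Rightarrow> real"
  assumes wg: "weak_gradient B u g" and K: "compact K" "K \<subseteq> B"
  obtains U G where "integrable lborel U" "integrable lborel G"
    "AE x in lborel. x \<in> K \<longrightarrow> U x = u x \<and> G x = g x"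
    "\<And>x. x \<notin> K \<Longrightarrow> U x = 0 \<and> G x = 0"
    "\<And>y e b. e > 0 \<Longrightarrow> cball y e \<subseteq> K \<Longrightarrow> b \<in> Basis \<Longrightarrow>
       partial_deriv b (conv (moll e) U) y = conv (moll e) (\<lambda>z. G z \<bullet> b) y"
proof -
  have Kb[measurable]: "K \<in> sets borel" using K by (simp add: compact_imp_closed)
  have "set_integrable lebesgue K u" "set_integrable lebesgue K g"
    using wg K unfolding weak_gradient_def loc_integrable_def by auto
  then have ui: "integrable lebesgue (\<lambda>x. indicator K x * u x)" and gi: "integrable lebesgue (\<lambda>x. indicator K x *\<^sub>R g x)"
    by (auto simp: set_integrable_def)
  have borel: "\<exists>F. integrable lborel F \<and> (AE x in lborel. f x = F x)" if f: "integrable lebesgue f" for f :: "'a \<Rightarrow> real"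
  proof -
    obtain F where F: "F \<in> borel_measurable lborel" "AE x in lborel. f x = F x"
      using completion_ex_borel_measurable_real[of f lborel] f by auto
    have "integrable lebesgue F"
      using f F by (subst integrable_cong_AE[of F _ f])
        (auto intro!: measurable_completion dest: AE_completion elim: eventually_mono)
    then have "integrable lborel F" using F(1) by (simp add: integrable_completion)
    with F show ?thesis by blast
  qed
  obtain U0 where U0: "integrable lborel U0" "AE x in lborel. indicator K x * u x = U0 x"
    using borel[OF ui] by auto
  have "\<exists>F. integrable lborel F \<and> (AE x in lborel. (indicator K x *\<^sub>R g x) \<bullet> b = F x)" for b
    by (intro borel integrable_inner_left gi)
  then obtain G0 where G0: "\<And>b. integrable lborel (G0 b)" "\<And>b. AE x in lborel. (indicator K x *\<^sub>R g x) \<bullet> b = G0 b x"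
    by metis
  define U where "U x = indicator K x * U0 x" for x
  define G where "G x = (\<Sum>b\<in>Basis. (indicator K x * G0 b x) *\<^sub>R b)" for x
  have [measurable]: "U0 \<in> borel_measurable borel" "G0 b \<in> borel_measurable borel" for b
    using U0 G0(1)[of b] by auto
  have Ui: "integrable lborel U"
    unfolding U_def using integrable_mult_indicator[of K lborel U0] U0 by simp
  have Gi: "integrable lborel G"
    unfolding G_def using integrable_mult_indicator[of K lborel "G0 _"] G0(1)
    by (intro Bochner_Integration.integrable_sum integrable_scaleR_left) simp
  have "AE x in lborel. \<forall>b\<in>Basis. (indicator K x *\<^sub>R g x) \<bullet> b = G0 b x"
    by (rule AE_finite_allI) (auto simp: G0(2)[simplified])
  with U0(2) have ae: "AE x in lborel. x \<in> K \<longrightarrow> U x = u x \<and> G x = g x"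
  proof eventually_elim
    fix x assume x: "indicator K x * u x = U0 x" "\<forall>b\<in>Basis. (indicator K x *\<^sub>R g x) \<bullet> b = G0 b x"
    show "x \<in> K \<longrightarrow> U x = u x \<and> G x = g x"
    proof
      assume xK: "x \<in> K"
      then have "G x = (\<Sum>b\<in>Basis. (g x \<bullet> b) *\<^sub>R b)"
        using x by (auto simp: G_def intro!: sum.cong)
      then show "U x = u x \<and> G x = g x" using x xK by (simp add: U_def euclidean_representation)
    qed
  qed
  have Gc: "G z \<bullet> b = indicator K z * G0 b z" if "b \<in> Basis" for b z
    using that by (simp add: G_def inner_sum_left inner_Basis if_distrib cong: if_cong)
  have part: "partial_deriv b (conv (moll e) U) y = conv (moll e) (\<lambda>z. G z \<bullet> b) y"
    if e: "e > 0" and ball: "cball y e \<subseteq> K" and b: "b \<in> Basis" for y e b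
  proof -
    \<comment> \<open>The kernel centred at y, as a function of z, is an admissible test function:
      its support lies in \<open>cball y e\<close>, hence in B. Differentiating in z instead of y
      changes the sign, which cancels the minus of the weak formulation.\<close>
    define \<psi> where "\<psi> z = moll e (y - z)" for z
    note mC = Ccinf_moll[OF e, where 'a='a]
    have \<psi>C: "Ccinf \<psi>" unfolding \<psi>_def by (rule Ccinf_reflect[OF mC])
    note pC = Ccinf_partial_deriv[OF \<psi>C b]
    have [measurable]: "\<psi> \<in> borel_measurable borel" "partial_deriv b \<psi> \<in> borel_measurable borel"
      using Ccinf_measurable \<psi>C pC by auto
    have "{z. \<psi> z \<noteq> 0} \<subseteq> cball y e"
      using moll_eq_0[OF e] by (force simp: \<psi>_def dist_norm)
    then have cl: "closure {z. \<psi> z \<noteq> 0} \<subseteq> cball y e" by (rule closure_minimal) simp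
    then have "compact (closure {z. \<psi> z \<noteq> 0})"
      by (meson bounded_cball bounded_subset closed_closure compact_eq_bounded_closed)
    then have test: "test_function B \<psi>"
      using cl ball K(2) \<psi>C by (auto simp: test_function_def compactly_contained_def Ccinf_def)
    have out: "\<psi> z = 0" "partial_deriv b \<psi> z = 0" if "z \<notin> K" for z
      using that cl ball closure_subset[of "{z. \<psi> z \<noteq> 0}"] partial_deriv_support[of b \<psi>] by auto
    have eqB: "(LINT x:B|lebesgue. f x * p x) = (LINT x:K|lebesgue. f x * p x)"
      if "\<And>z. z \<notin> K \<Longrightarrow> p z = 0" for f p :: "'a \<Rightarrow> real"
      unfolding set_lebesgue_integral_def using that K(2)
      by (intro Bochner_Integration.integral_cong refl) (auto simp: indicator_def)
    have "(LINT x:K|lebesgue. u x * partial_deriv b \<psi> x) = - (LINT x:K|lebesgue. (g x \<bullet> b) * \<psi> x)"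
      using wg test b unfolding weak_gradient_def by (simp flip: eqB[of _ u] eqB[of \<psi> "\<lambda>x. g x \<bullet> b"] add: out)
    moreover have "(LINT x:K|lebesgue. u x * partial_deriv b \<psi> x) = (\<integral>x. indicator K x * (U x * partial_deriv b \<psi> x) \<partial>lborel)"
    proof (rule set_integral_lebesgue_AE[OF Kb])
      have "(\<lambda>x. (indicator K x * u x) * partial_deriv b \<psi> x) \<in> borel_measurable lebesgue"
        by (rule borel_measurable_times[OF borel_measurable_integrable[OF ui] measurable_completion]) simp
      then show "(\<lambda>x. indicator K x * (u x * partial_deriv b \<psi> x)) \<in> borel_measurable lebesgue"
        by (simp add: mult.assoc)
      show "AE x in lborel. x \<in> K \<longrightarrow> u x * partial_deriv b \<psi> x = U x * partial_deriv b \<psi> x"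
        using ae by eventually_elim auto
      show "(\<lambda>x. U x * partial_deriv b \<psi> x) \<in> borel_measurable borel" using Ui by simp
    qed
    moreover have "(LINT x:K|lebesgue. (g x \<bullet> b) * \<psi> x) = (\<integral>x. indicator K x * ((G x \<bullet> b) * \<psi> x) \<partial>lborel)"
    proof (rule set_integral_lebesgue_AE[OF Kb])
      have "(\<lambda>x. ((indicator K x *\<^sub>R g x) \<bullet> b) * \<psi> x) \<in> borel_measurable lebesgue"
        by (rule borel_measurable_times[OF borel_measurable_inner[OF borel_measurable_integrable[OF gi]] measurable_completion])
          simp_all
      then show "(\<lambda>x. indicator K x * ((g x \<bullet> b) * \<psi> x)) \<in> borel_measurable lebesgue"
        by (simp add: mult.assoc)
      show "AE x in lborel. x \<in> K \<longrightarrow> (g x \<bullet> b) * \<psi> x = (G x \<bullet> b) * \<psi> x"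
        using ae by eventually_elim auto
      have [measurable]: "G \<in> borel_measurable borel" using Gi by auto
      show "(\<lambda>x. (G x \<bullet> b) * \<psi> x) \<in> borel_measurable borel" by measurable
    qed
    ultimately have eq: "(\<integral>x. indicator K x * (U x * partial_deriv b \<psi> x) \<partial>lborel) = - (\<integral>x. indicator K x * ((G x \<bullet> b) * \<psi> x) \<partial>lborel)"
      by simp
    have p\<psi>: "partial_deriv b \<psi> x = - partial_deriv b (moll e) (y - x)" for x
      unfolding \<psi>_def by (rule partial_deriv_reflect[OF Ccinf_differentiable[OF mC] b])
    have "partial_deriv b (conv (moll e) U) y = (\<integral>z. partial_deriv b (moll e) (y - z) * U z \<partial>lborel)"
      using partial_deriv_conv[OF mC Ui b] by (simp add: conv_def)
    also have "\<dots> = (\<integral>x. - (indicator K x * (U x * partial_deriv b \<psi> x)) \<partial>lborel)"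
      by (intro Bochner_Integration.integral_cong refl) (auto simp: p\<psi> U_def indicator_def)
    also have "\<dots> = - (\<integral>x. indicator K x * (U x * partial_deriv b \<psi> x) \<partial>lborel)" by simp
    also have "\<dots> = (\<integral>x. indicator K x * ((G x \<bullet> b) * \<psi> x) \<partial>lborel)" using eq by simp
    also have "\<dots> = conv (moll e) (\<lambda>z. G z \<bullet> b) y"
      unfolding conv_def by (intro Bochner_Integration.integral_cong refl) (auto simp: \<psi>_def Gc b indicator_def)
    finally show ?thesis .
  qed
  show ?thesis
    by (rule that[OF Ui Gi ae _ part]) (auto simp: U_def G_def)
qed

subsection \<open>Mollified gradients\<close>

text \<open>A version of the convolution for densities such as A (|G|), which may be infinite at
  some points.\<close>

definition nn_conv :: "('a::euclidean_space \<Rightarrow> real) \<Rightarrow> ('a \<Rightarrow> ennreal) \<Rightarrow> 'a \<Rightarrow> ennreal" where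
  "nn_conv \<phi> H y = (\<integral>\<^sup>+z. ennreal (\<phi> (y - z)) * H z \<partial>lborel)"

lemma nn_conv_measurable [measurable]:
  assumes [measurable]: "\<phi> \<in> borel_measurable borel" "H \<in> borel_measurable borel"
  shows "nn_conv \<phi> H \<in> borel_measurable borel"
  unfolding nn_conv_def by measurable

lemma nn_integral_nn_conv_moll:
  fixes H :: "'a::euclidean_space \<Rightarrow> ennreal"
  assumes [measurable]: "H \<in> borel_measurable borel" and e: "e > 0"
  shows "(\<integral>\<^sup>+y. nn_conv (moll e) H y \<partial>lborel) = (\<integral>\<^sup>+z. H z \<partial>lborel)"
proof -
  have [measurable]: "(moll e :: 'a \<Rightarrow> real) \<in> borel_measurable borel" by (rule Ccinf_measurable[OF Ccinf_moll[OF e]])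
  have "(\<integral>\<^sup>+y. nn_conv (moll e) H y \<partial>lborel) = (\<integral>\<^sup>+z. (\<integral>\<^sup>+y. ennreal (moll e (y - z)) * H z \<partial>lborel) \<partial>lborel)"
    unfolding nn_conv_def by (rule lborel_pair.Fubini') measurable
  also have "\<dots> = (\<integral>\<^sup>+z. H z \<partial>lborel)"
  proof (rule nn_integral_cong)
    fix z :: 'a
    have "(\<integral>\<^sup>+y. ennreal (moll e (y - z)) * H z \<partial>lborel) = (\<integral>\<^sup>+y. ennreal (moll e (- z + y)) \<partial>lborel) * H z"
      by (simp add: nn_integral_multc)
    also have "(\<integral>\<^sup>+y. ennreal (moll e (- z + y)) \<partial>lborel) = 1"
      by (subst nn_integral_lborel_translate[of "\<lambda>y. ennreal (moll e y)"]) (simp_all add: nn_integral_moll e)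
    finally show "(\<integral>\<^sup>+y. ennreal (moll e (y - z)) * H z \<partial>lborel) = H z" by simp
  qed
  finally show ?thesis .
qed

lemma nn_integral_moll_shift:
  fixes y :: "'a::euclidean_space"
  assumes e: "e > 0"
  shows "(\<integral>\<^sup>+z. ennreal (moll e (y - z)) \<partial>lborel) = 1"
proof -
  have [measurable]: "(moll e :: 'a \<Rightarrow> real) \<in> borel_measurable borel" by (rule Ccinf_measurable[OF Ccinf_moll[OF e]])
  show ?thesis
    by (subst nn_integral_lborel_reflect[of "\<lambda>y. ennreal (moll e y)"]) (simp_all add: nn_integral_moll e)
qed

lemma conv_moll_le_nn_conv:
  fixes U :: "'a::euclidean_space \<Rightarrow> real"
  assumes U: "integrable lborel U" and e: "e > 0"
  shows "ennreal \<bar>conv (moll e) U y\<bar> \<le> nn_conv (moll e) (\<lambda>z. ennreal \<bar>U z\<bar>) y"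
proof -
  have "ennreal \<bar>conv (moll e) U y\<bar> \<le> (\<integral>\<^sup>+z. ennreal (norm (moll e (y - z) * U z)) \<partial>lborel)"
    unfolding conv_def using integral_norm_bound_ennreal[OF conv_integrable[OF Ccinf_moll[OF e] U]] by simp
  also have "\<dots> = nn_conv (moll e) (\<lambda>z. ennreal \<bar>U z\<bar>) y"
    unfolding nn_conv_def by (intro nn_integral_cong) (simp add: abs_mult ennreal_mult moll_nonneg[OF e])
  finally show ?thesis .
qed

lemma integrable_conv_moll:
  fixes U :: "'a::euclidean_space \<Rightarrow> real"
  assumes U: "integrable lborel U" and e: "e > 0"
  shows "integrable lborel (conv (moll e) U)"
  unfolding integrable_iff_bounded
proof
  have [measurable]: "U \<in> borel_measurable borel" using U by auto
  show "conv (moll e) U \<in> borel_measurable lborel"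
    using borel_measurable_continuous_onI[OF Ck_imp_continuous_on[OF Ck_conv[OF Ccinf_moll[OF e] U, of 0]]] by simp
  have "(\<integral>\<^sup>+x. ennreal (norm (conv (moll e) U x)) \<partial>lborel) \<le> (\<integral>\<^sup>+y. nn_conv (moll e) (\<lambda>z. ennreal \<bar>U z\<bar>) y \<partial>lborel)"
    using conv_moll_le_nn_conv[OF U e] by (intro nn_integral_mono) simp
  also have "\<dots> = (\<integral>\<^sup>+z. ennreal \<bar>U z\<bar> \<partial>lborel)"
    by (rule nn_integral_nn_conv_moll[OF _ e]) measurable
  also have "\<dots> < \<infinity>" using U unfolding integrable_iff_bounded by simp
  finally show "(\<integral>\<^sup>+x. ennreal (norm (conv (moll e) U x)) \<partial>lborel) < \<infinity>" .
qed

text \<open>For fixed k Young's inequality is linear in |G|, so it survives averaging against a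
  kernel of mass 1. This takes the place of Jensen's inequality: the smoothed \<open>H\<close>
  stands in for A of the smoothed gradient.\<close>

lemma gradient_conv_moll_young:
  fixes U :: "'a::euclidean_space \<Rightarrow> real" and G :: "'a \<Rightarrow> 'a"
  assumes G: "integrable lborel G" and e: "e > 0"
    and grad: "\<And>b. b \<in> Basis \<Longrightarrow> partial_deriv b (conv (moll e) U) y = conv (moll e) (\<lambda>z. G z \<bullet> b) y"
    and k: "k > 0" and [measurable]: "H \<in> borel_measurable borel"
    and H: "\<And>z. z \<in> ball y e \<Longrightarrow> ennreal (norm (G z) * k) \<le> H z + \<Psi> k"
  shows "ennreal (norm (gradient (conv (moll e) U) y) * k) \<le> nn_conv (moll e) H y + \<Psi> k"
proof -
  have [measurable]: "(moll e :: 'a \<Rightarrow> real) \<in> borel_measurable borel" by (rule Ccinf_measurable[OF Ccinf_moll[OF e]])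
  have [measurable]: "G \<in> borel_measurable borel" using G by auto
  have int: "integrable lborel (\<lambda>z. moll e (y - z) *\<^sub>R G z)"
  proof -
    obtain C where C: "C > 0" "\<And>x::'a. \<bar>moll e x\<bar> \<le> C" using Ccinf_bounded[OF Ccinf_moll[OF e]] by metis
    show ?thesis
      by (rule Bochner_Integration.integrable_bound[of lborel "\<lambda>z. C *\<^sub>R G z"])
         (use G C in \<open>auto intro!: mult_right_mono\<close>)
  qed
  have "gradient (conv (moll e) U) y = (\<integral>z. moll e (y - z) *\<^sub>R G z \<partial>lborel)"
  proof (rule euclidean_eqI)
    fix b :: 'a assume b: "b \<in> Basis"
    have "(\<integral>z. moll e (y - z) *\<^sub>R G z \<partial>lborel) \<bullet> b = (\<integral>z. (moll e (y - z) *\<^sub>R G z) \<bullet> b \<partial>lborel)"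
      by (rule integral_inner_left[symmetric]) (rule int)
    then show "gradient (conv (moll e) U) y \<bullet> b = (\<integral>z. moll e (y - z) *\<^sub>R G z \<partial>lborel) \<bullet> b"
      using grad[OF b] by (simp add: gradient_inner_Basis b conv_def)
  qed
  then have "ennreal (norm (gradient (conv (moll e) U) y)) \<le> (\<integral>\<^sup>+z. ennreal (norm (moll e (y - z) *\<^sub>R G z)) \<partial>lborel)"
    using integral_norm_bound_ennreal[OF int] by simp
  then have "ennreal (norm (gradient (conv (moll e) U) y)) * ennreal k \<le> (\<integral>\<^sup>+z. ennreal (norm (moll e (y - z) *\<^sub>R G z)) \<partial>lborel) * ennreal k"
    by (rule mult_right_mono) simp
  also have "\<dots> = (\<integral>\<^sup>+z. ennreal (norm (moll e (y - z) *\<^sub>R G z)) * ennreal k \<partial>lborel)"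
    by (rule nn_integral_multc[symmetric]) measurable
  also have "\<dots> \<le> (\<integral>\<^sup>+z. ennreal (moll e (y - z)) * H z + ennreal (moll e (y - z)) * \<Psi> k \<partial>lborel)"
  proof (rule nn_integral_mono)
    fix z
    show "ennreal (norm (moll e (y - z) *\<^sub>R G z)) * ennreal k \<le> ennreal (moll e (y - z)) * H z + ennreal (moll e (y - z)) * \<Psi> k"
    proof (cases "z \<in> ball y e")
      case True
      have "ennreal (norm (moll e (y - z) *\<^sub>R G z)) * ennreal k = ennreal (moll e (y - z)) * ennreal (norm (G z) * k)"
        using k moll_nonneg[OF e, of "y - z"] by (simp add: ennreal_mult mult.assoc)
      also have "\<dots> \<le> ennreal (moll e (y - z)) * (H z + \<Psi> k)" by (intro mult_left_mono H True) simp
      finally show ?thesis by (simp add: distrib_left)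
    next
      case False
      then show ?thesis using moll_eq_0[OF e, of "y - z"] by (simp add: dist_norm)
    qed
  qed
  also have "\<dots> = nn_conv (moll e) H y + (\<integral>\<^sup>+z. ennreal (moll e (y - z)) \<partial>lborel) * \<Psi> k"
    unfolding nn_conv_def by (subst nn_integral_add) (simp_all add: nn_integral_multc)
  finally show ?thesis using k by (simp add: nn_integral_moll_shift[OF e] ennreal_mult)
qed

subsection \<open>Choosing good hyperplanes\<close>

text \<open>Otherwise every slice satisfies q i s >= a for all large i, and Fatou's lemma over an
  interval of length R gives a total of at least R a, more than T. One s thus works for infinitely
  many i.\<close>

lemma frequently_small_slice:
  fixes q :: "nat \<Rightarrow> real \<Rightarrow> ennreal"
  assumes [measurable]: "\<And>i. q i \<in> borel_measurable borel" and R: "R > 0"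
    and T: "\<And>i. (\<integral>\<^sup>+s\<in>{R..2*R}. q i s \<partial>lborel) \<le> T" "T < ennreal (R * a)"
  obtains s where "R \<le> s" "s \<le> 2 * R" "\<exists>\<^sub>\<infinity>i. q i s < ennreal a"
proof (rule ccontr)
  assume *: "\<not> thesis"
  note found = that
  have "ennreal a \<le> liminf (\<lambda>i. q i s)" if "s \<in> {R..2*R}" for s
  proof -
    have "\<not> (\<exists>\<^sub>\<infinity>i. q i s < ennreal a)"
      using * found[of s] that by (metis atLeastAtMost_iff)
    then have "\<forall>\<^sub>\<infinity>i. ennreal a \<le> q i s" by (simp add: not_frequently not_less)
    then show ?thesis by (intro Liminf_bounded) (simp add: cofinite_eq_sequentially)
  qed
  then have "(\<integral>\<^sup>+s. ennreal a * indicator {R..2*R} s \<partial>lborel) \<le> (\<integral>\<^sup>+s. liminf (\<lambda>i. q i s * indicator {R..2*R} s) \<partial>lborel)"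
    by (intro nn_integral_mono) (auto simp: indicator_def)
  also have "\<dots> \<le> liminf (\<lambda>i. \<integral>\<^sup>+s\<in>{R..2*R}. q i s \<partial>lborel)"
    by (rule nn_integral_liminf) measurable
  also have "\<dots> \<le> limsup (\<lambda>i. \<integral>\<^sup>+s\<in>{R..2*R}. q i s \<partial>lborel)" by (rule Liminf_le_Limsup) simp
  also have "\<dots> \<le> T" using T(1) by (intro Limsup_bounded) simp
  finally have "ennreal a * ennreal R \<le> T" using R by (simp add: nn_integral_cmult)
  moreover have "a > 0" using T(2) R by (metis ennreal_neg linorder_not_le mult.commute mult_nonneg_nonpos not_less_zero order_less_imp_le)
  ultimately show False using T(2) R by (simp flip: ennreal_mult add: mult.commute)
qed

text \<open>The sign \<open>sg\<close> lets both faces orthogonal to b be indexed by the same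
  positive distance s.\<close>

lemma slice_integral_le:
  fixes f :: "'a::euclidean_space \<Rightarrow> ennreal"
  assumes [measurable]: "f \<in> borel_measurable borel" and b: "b \<in> Basis" and sg: "\<bar>sg\<bar> = 1"
  shows "(\<integral>\<^sup>+s. (\<integral>\<^sup>+\<omega>\<in>slab b \<rho>. f (hyp_point x0 b (sg * s) \<omega>) \<partial>lborel) \<partial>lborel) \<le> (\<integral>\<^sup>+z. f z \<partial>lborel)"
proof -
  have hp: "hyp_point x0 b \<sigma> \<omega> = x0 + (\<omega> + (\<sigma> - \<omega> \<bullet> b) *\<^sub>R b)" for \<sigma> \<omega> by (simp add: hyp_point_def)
  let ?h = "\<lambda>\<sigma>. \<integral>\<^sup>+\<omega>. f (x0 + (\<omega> + (\<sigma> - \<omega> \<bullet> b) *\<^sub>R b)) * indicator {0..1} (\<omega> \<bullet> b) \<partial>lborel"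
  have hm[measurable]: "?h \<in> borel_measurable borel" by measurable
  have "(\<integral>\<^sup>+s. (\<integral>\<^sup>+\<omega>\<in>slab b \<rho>. f (hyp_point x0 b (sg * s) \<omega>) \<partial>lborel) \<partial>lborel) \<le> (\<integral>\<^sup>+s. ?h (sg * s) \<partial>lborel)"
    unfolding hp by (intro nn_integral_mono) (auto simp: indicator_def slab_def)
  also have "\<dots> = (\<integral>\<^sup>+\<sigma>. ?h \<sigma> \<partial>lborel)"
    using nn_integral_real_affine[OF hm, of sg 0] sg by auto
  also have "\<dots> = (\<integral>\<^sup>+x. f (x0 + x) \<partial>lborel)"
    by (rule nn_integral_slices[OF _ b]) measurable
  also have "\<dots> = (\<integral>\<^sup>+z. f z \<partial>lborel)" by (rule nn_integral_lborel_translate) simp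
  finally show ?thesis .
qed

text \<open>Applying the selection to the sum over all 2n faces makes them good for the same s and
  the same subsequence; this is the factor 2n in front of T.\<close>

lemma good_cube:
  fixes f :: "nat \<Rightarrow> 'a::euclidean_space \<Rightarrow> ennreal"
  assumes [measurable]: "\<And>i. f i \<in> borel_measurable borel" and R: "R > 0"
    and T: "\<And>i. (\<integral>\<^sup>+z. f i z \<partial>lborel) \<le> T" "ennreal (2 * DIM('a)) * T < ennreal (R * a)"
  obtains s r where "R \<le> s" "s \<le> 2 * R" "strict_mono (r :: nat \<Rightarrow> nat)"
    "\<And>i b \<sigma>. b \<in> Basis \<Longrightarrow> \<bar>\<sigma>\<bar> = s \<Longrightarrow>
       (\<integral>\<^sup>+\<omega>\<in>slab b (4 * R). f (r i) (hyp_point x0 b \<sigma> \<omega>) \<partial>lborel) \<le> ennreal a"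
proof -
  let ?q0 = "\<lambda>i b sg s. \<integral>\<^sup>+\<omega>\<in>slab b (4 * R). f i (hyp_point x0 b (sg * s) \<omega>) \<partial>lborel"
  define q where "q i s = (\<Sum>p\<in>Basis \<times> {1, -1}. ?q0 i (fst p) (snd p) s)" for i s
  have [measurable]: "?q0 i b sg \<in> borel_measurable borel" for i b sg
    unfolding hyp_point_def by measurable
  have qm: "q i \<in> borel_measurable borel" for i
    unfolding q_def by measurable
  have qT: "(\<integral>\<^sup>+s\<in>{R..2*R}. q i s \<partial>lborel) \<le> ennreal (2 * DIM('a)) * T" for i
  proof -
    have "(\<integral>\<^sup>+s\<in>{R..2*R}. q i s \<partial>lborel) \<le> (\<integral>\<^sup>+s. q i s \<partial>lborel)"
      by (intro nn_integral_mono) (auto simp: indicator_def)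
    also have "\<dots> = (\<Sum>p\<in>Basis \<times> {1, -1}. (\<integral>\<^sup>+s. ?q0 i (fst p) (snd p) s \<partial>lborel))"
      unfolding q_def by (rule nn_integral_sum) measurable
    also have "\<dots> \<le> (\<Sum>p\<in>(Basis::'a set) \<times> {1::real, -1}. T)"
    proof (intro sum_mono)
      fix p :: "'a \<times> real" assume "p \<in> Basis \<times> {1, -1}"
      then show "(\<integral>\<^sup>+s. ?q0 i (fst p) (snd p) s \<partial>lborel) \<le> T"
        using T(1)[of i] by (intro order_trans[OF slice_integral_le]) auto
    qed
    also have "\<dots> = ennreal (2 * DIM('a)) * T"
      by (simp add: card_cartesian_product ennreal_of_nat_eq_real_of_nat mult.commute)
    finally show ?thesis .
  qed
  obtain s where s: "R \<le> s" "s \<le> 2 * R" "\<exists>\<^sub>\<infinity>i. q i s < ennreal a"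
    by (rule frequently_small_slice[OF qm R qT T(2)])
  then have "infinite {i. q i s < ennreal a}" by (simp add: INFM_iff_infinite)
  then obtain r :: "nat \<Rightarrow> nat" where r: "strict_mono r" "\<And>i. q (r i) s < ennreal a"
    using infinite_enumerate by blast
  show ?thesis
  proof (rule that[OF s(1,2) r(1)])
    fix i and b :: 'a and \<sigma> assume b: "b \<in> Basis" and \<sigma>: "\<bar>\<sigma>\<bar> = s"
    have "\<sigma> = 1 * s \<or> \<sigma> = (-1) * s" using \<sigma> by auto
    then obtain sg where sg: "sg \<in> {1, -1}" "\<sigma> = sg * s" by blast
    have "?q0 (r i) b sg s \<le> q (r i) s"
      unfolding q_def using b sg member_le_sum[of "(b, sg)" "Basis \<times> {1, -1}" "\<lambda>p. ?q0 (r i) (fst p) (snd p) s"] by simp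
    also have "\<dots> \<le> ennreal a" using r(2)[of i] by simp
    finally show "(\<integral>\<^sup>+\<omega>\<in>slab b (4 * R). f (r i) (hyp_point x0 b \<sigma> \<omega>) \<partial>lborel) \<le> ennreal a"
      by (simp add: sg)
  qed
qed

subsection \<open>Oscillation on the boundary of a cube\<close>

text \<open>This corner lies on all n faces with positive sign, so one value serves as the reference
  for the whole boundary.\<close>

definition cube_corner :: "'a::euclidean_space \<Rightarrow> real \<Rightarrow> 'a" where
  "cube_corner x0 s = x0 + (\<Sum>j\<in>Basis. s *\<^sub>R j)"

text \<open>All values on one face are within \<tau> of the mean of that face, so two of them differ
  by at most 2 \<tau>. A face with positive sign contains the corner; from one with negative sign
  the corner is reached through a second face, whence 4 \<tau>.\<close>

lemma cube_boundary_osc: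
  fixes v :: "'a::euclidean_space \<Rightarrow> real" and h :: "'a \<Rightarrow> ennreal" and \<Psi> :: "real \<Rightarrow> ennreal"
    and R t s a \<kappa> :: real
  assumes n: "DIM('a) \<ge> 2" and R: "R > 0" and t: "t > 0" and s: "R \<le> s" "s \<le> 2 * R"
    and v: "Ck (Suc 0) v"
    and meas: "h \<in> borel_measurable borel" "\<Psi> \<in> borel_measurable borel"
    and young: "\<And>z k. (\<forall>j\<in>Basis. \<bar>(z - x0) \<bullet> j\<bar> \<le> 4 * R) \<Longrightarrow> k > 0 \<Longrightarrow>
        ennreal (norm (gradient v z) * k) \<le> h z + \<Psi> k"
    and \<kappa>: "cone_integral (DIM('a) - 1) \<Psi> t = ennreal \<kappa>" "\<kappa> \<ge> 0" and a: "a \<ge> 0"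
    and face: "\<And>b \<sigma>. b \<in> Basis \<Longrightarrow> \<bar>\<sigma>\<bar> = s \<Longrightarrow>
        (\<integral>\<^sup>+\<omega>\<in>slab b (4 * R). h (hyp_point x0 b \<sigma> \<omega>) \<partial>lborel) \<le> ennreal a"
  defines "\<tau> \<equiv> 36 * DIM('a) * R * (a + R ^ (DIM('a) - 1) * \<kappa>) / (t * R ^ (DIM('a) - 1))"
  shows "\<lbrakk>b \<in> Basis; \<bar>(x - x0) \<bullet> b\<bar> = s; \<And>j. j \<in> Basis \<Longrightarrow> \<bar>(x - x0) \<bullet> j\<bar> \<le> s\<rbrakk>
      \<Longrightarrow> \<bar>v x - v (cube_corner x0 s)\<bar> \<le> 4 * \<tau>"
    and "b \<in> Basis \<Longrightarrow> \<bar>v (cube_corner x0 s)\<bar> \<le> \<tau> + \<bar>hyp_mean v x0 b s R\<bar>"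
proof -
  define d where "d = DIM('a) - 1"
  define p where "p = cube_corner x0 s"
  have Rd: "R ^ d > 0" using R by simp
  have s0: "s > 0" using R s by simp
  have est: "\<bar>v x - hyp_mean v x0 b \<sigma> R\<bar> \<le> \<tau>"
    if b: "b \<in> Basis" and \<sigma>: "\<bar>\<sigma>\<bar> = s" and x: "(x - x0) \<bullet> b = \<sigma>" "\<And>j. j \<in> Basis \<Longrightarrow> \<bar>(x - x0) \<bullet> j\<bar> \<le> s" for x b \<sigma>
  proof -
    have "\<bar>(x - x0) \<bullet> j\<bar> \<le> 2 * R" if "j \<in> Basis" for j
      using x(2)[OF that] s by simp
    then have "ennreal (t * R ^ d * \<bar>v x - hyp_mean v x0 b \<sigma> R\<bar>)
      \<le> ennreal (36 * DIM('a) * R) * ((\<integral>\<^sup>+\<omega>\<in>slab b (4 * R). h (hyp_point x0 b \<sigma> \<omega>) \<partial>lborel)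
        + ennreal (R ^ d) * cone_integral d \<Psi> t)"
      unfolding d_def by (intro hyp_mean_estimate[OF n b R t v meas young x(1)])
    also have "\<dots> \<le> ennreal (36 * DIM('a) * R) * (ennreal a + ennreal (R ^ d) * ennreal \<kappa>)"
      using face[OF b \<sigma>] \<kappa>(1) by (intro mult_left_mono add_mono) (auto simp: d_def)
    also have "\<dots> = ennreal (36 * DIM('a) * R * (a + R ^ d * \<kappa>))"
      using a R \<kappa>(2) Rd by (simp flip: ennreal_mult ennreal_plus)
    finally have "t * R ^ d * \<bar>v x - hyp_mean v x0 b \<sigma> R\<bar> \<le> 36 * DIM('a) * R * (a + R ^ d * \<kappa>)"
      using a R \<kappa>(2) Rd by (subst (asm) ennreal_le_iff) auto
    then show ?thesis using t Rd unfolding \<tau>_def d_def[symmetric] by (simp add: le_divide_eq mult_ac)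
  qed
  have pj: "(p - x0) \<bullet> j = s" if "j \<in> Basis" for j
    using that by (simp add: p_def cube_corner_def)
  have two: "\<bar>v x - v y\<bar> \<le> 2 * \<tau>"
    if "b \<in> Basis" "\<bar>\<sigma>\<bar> = s" "(x - x0) \<bullet> b = \<sigma>" "\<And>j. j \<in> Basis \<Longrightarrow> \<bar>(x - x0) \<bullet> j\<bar> \<le> s"
      "(y - x0) \<bullet> b = \<sigma>" "\<And>j. j \<in> Basis \<Longrightarrow> \<bar>(y - x0) \<bullet> j\<bar> \<le> s" for x y b \<sigma>
    using est[OF that(1-4)] est[OF that(1,2,5,6)] by linarith
  have \<tau>0: "\<tau> \<ge> 0" unfolding \<tau>_def using R a \<kappa>(2) t by simp
  show "\<bar>v x - v (cube_corner x0 s)\<bar> \<le> 4 * \<tau>"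
    if b: "b \<in> Basis" and xb: "\<bar>(x - x0) \<bullet> b\<bar> = s" and xj: "\<And>j. j \<in> Basis \<Longrightarrow> \<bar>(x - x0) \<bullet> j\<bar> \<le> s" for x b
  proof (cases "(x - x0) \<bullet> b = s")
    case True
    have "\<bar>v x - v p\<bar> \<le> 2 * \<tau>"
      by (rule two[OF b _ True xj pj[OF b]]) (use s0 pj in auto)
    then show ?thesis using \<tau>0 by (simp add: p_def)
  next
    case False
    then have xb': "(x - x0) \<bullet> b = - s" using xb by auto
    obtain b' :: 'a where b': "b' \<in> Basis" "b' \<noteq> b"
    proof -
      have "card (Basis - {b}) \<ge> 1" using n b by (simp add: card_Diff_singleton)
      then have "Basis - {b} \<noteq> {}" by (metis card.empty not_one_le_zero)
      then show ?thesis using that by blast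
    qed
    \<comment> \<open>The reflection of the corner in the coordinate b. It lies on the face of x
      and, with the corner, on the positive face orthogonal to b'.\<close>
    define p' where "p' = x0 + (\<Sum>j\<in>Basis. (if j = b then - s else s) *\<^sub>R j)"
    have p'j: "(p' - x0) \<bullet> j = (if j = b then - s else s)" if "j \<in> Basis" for j
      using that by (simp add: p'_def)
    have "\<bar>v x - v p'\<bar> \<le> 2 * \<tau>"
      by (rule two[OF b, of "-s"]) (use s0 p'j xb' xj b in auto)
    moreover have "\<bar>v p' - v p\<bar> \<le> 2 * \<tau>"
      by (rule two[OF b'(1), of s]) (use s0 p'j pj b' in auto)
    ultimately show ?thesis by (simp add: p_def)
  qed
  show "\<bar>v (cube_corner x0 s)\<bar> \<le> \<tau> + \<bar>hyp_mean v x0 b s R\<bar>" if b: "b \<in> Basis" for b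
    using est[OF b, of s p] s0 pj b unfolding p_def by force
qed

subsection \<open>Weakly monotone functions on cubes\<close>

lemma open_cube:
  fixes x0 :: "'a::euclidean_space"
  assumes s: "s > 0"
  defines "Q \<equiv> {x. \<forall>j\<in>Basis. \<bar>(x - x0) \<bullet> j\<bar> < s}"
  shows "open Q" "bounded Q" "closure Q = {x. \<forall>j\<in>Basis. \<bar>(x - x0) \<bullet> j\<bar> \<le> s}" "ball x0 s \<subseteq> Q"
proof -
  define l u :: 'a where "l = x0 - (\<Sum>j\<in>Basis. s *\<^sub>R j)" and "u = x0 + (\<Sum>j\<in>Basis. s *\<^sub>R j)"
  have Q: "Q = box l u"
    unfolding Q_def box_def l_def u_def by (auto simp: inner_diff_left inner_add_left abs_less_iff; force)
  have ne: "box l u \<noteq> {}"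
    using s by (simp add: box_ne_empty l_def u_def inner_diff_left inner_add_left)
  show "open Q" "bounded Q" by (simp_all add: Q open_box)
  show "closure Q = {x. \<forall>j\<in>Basis. \<bar>(x - x0) \<bullet> j\<bar> \<le> s}"
    unfolding Q closure_box[OF ne]
    by (auto simp: cbox_def l_def u_def inner_diff_left inner_add_left abs_le_iff; force)
  show "ball x0 s \<subseteq> Q"
  proof
    fix x assume "x \<in> ball x0 s"
    then have "norm (x - x0) < s" by (simp add: dist_norm norm_minus_commute)
    then show "x \<in> Q"
      unfolding Q_def using order_le_less_trans[OF Basis_le_norm[of _ "x - x0"]] by blast
  qed
qed

lemma compact_cube:
  fixes x0 :: "'a::euclidean_space"
  assumes s: "s > 0"
  shows "compact {x. \<forall>j\<in>Basis. \<bar>(x - x0) \<bullet> j\<bar> \<le> s}"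
  unfolding open_cube(3)[OF s, symmetric] compact_closure by (rule open_cube(2)[OF s])

text \<open>A negative real is sent to 0 by \<open>ennreal\<close>, and nothing lies strictly below
  0.\<close>

lemma ennreal_mult_pos_cancel:
  assumes "x < ennreal (R * a)" "R > 0"
  shows "a > 0"
proof (rule ccontr)
  assume "\<not> a > 0"
  then have "R * a \<le> 0" using assms(2) by (simp add: mult_nonneg_nonpos)
  then show False using assms(1) by (simp add: ennreal_neg)
qed

text \<open>The margin 5R is made up of faces at distance at most 2R, far cubes reaching to 4R in
  the hyperplanes of the faces, and mollification radii up to R. The strictness in the hypothesis on
  a leaves room for controlling the mollified function itself.\<close>

lemma weakly_monotone_cube:
  fixes u :: "'a::euclidean_space \<Rightarrow> real" and g :: "'a \<Rightarrow> 'a" and A \<Psi> :: "real \<Rightarrow> ennreal"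
    and R t a \<kappa> :: real
  assumes n: "DIM('a) \<ge> 2" and wm: "weakly_monotone \<Omega> u"
    and B: "compactly_contained B \<Omega>" and wg: "weak_gradient B u g"
    and meas: "A \<in> borel_measurable borel" "\<Psi> \<in> borel_measurable borel"
    and young: "\<And>s k. s \<ge> 0 \<Longrightarrow> k > 0 \<Longrightarrow> ennreal (s * k) \<le> A s + \<Psi> k"
    and R: "R > 0" and cube: "{z. \<forall>j\<in>Basis. \<bar>(z - x0) \<bullet> j\<bar> \<le> 5 * R} \<subseteq> B"
    and t: "t > 0" and \<kappa>: "cone_integral (DIM('a) - 1) \<Psi> t = ennreal \<kappa>" "\<kappa> \<ge> 0"
    and a: "ennreal (2 * DIM('a)) * (\<integral>\<^sup>+z\<in>B. A (norm (g z)) \<partial>lebesgue) < ennreal (R * a)"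
  defines "\<tau> \<equiv> 36 * DIM('a) * R * (a + R ^ (DIM('a) - 1) * \<kappa>) / (t * R ^ (DIM('a) - 1))"
  obtains m M where "m \<le> M" "M - m \<le> 10 * \<tau>"
    "AE x in lborel. x \<in> ball x0 R \<longrightarrow> m \<le> u x \<and> u x \<le> M"
proof -
  define d where "d = DIM('a) - 1"
  have Rd: "R ^ d > 0" using R by simp
  have a0: "a > 0"
    using ennreal_mult_pos_cancel[OF a R] .
  have \<tau>0: "\<tau> > 0" unfolding \<tau>_def d_def[symmetric] using R a0 \<kappa>(2) t Rd n
    by (intro divide_pos_pos mult_pos_pos add_pos_nonneg mult_nonneg_nonneg) auto
  define K where "K = {z. \<forall>j\<in>Basis. \<bar>(z - x0) \<bullet> j\<bar> \<le> 5 * R}"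
  have KB: "K \<subseteq> B" using cube by (simp add: K_def)
  have Kc: "compact K" unfolding K_def using R by (intro compact_cube) simp
  then have Kb[measurable]: "K \<in> sets borel" by (simp add: compact_imp_closed)
  obtain U G where U: "integrable lborel U" and G: "integrable lborel G"
    and ae: "AE x in lborel. x \<in> K \<longrightarrow> U x = u x \<and> G x = g x"
    and grad: "\<And>y e b. e > 0 \<Longrightarrow> cball y e \<subseteq> K \<Longrightarrow> b \<in> Basis \<Longrightarrow>
       partial_deriv b (conv (moll e) U) y = conv (moll e) (\<lambda>z. G z \<bullet> b) y"
  proof (rule weak_gradient_borel[OF wg Kc KB])
    fix U :: "'a \<Rightarrow> real" and G :: "'a \<Rightarrow> 'a"
    assume 1: "integrable lborel U" and 2: "integrable lborel G"
      and 3: "AE x in lborel. x \<in> K \<longrightarrow> U x = u x \<and> G x = g x"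
      and "\<And>x. x \<notin> K \<Longrightarrow> U x = 0 \<and> G x = 0"
      and 4: "\<And>y e b. e > 0 \<Longrightarrow> cball y e \<subseteq> K \<Longrightarrow> b \<in> Basis \<Longrightarrow>
         partial_deriv b (conv (moll e) U) y = conv (moll e) (\<lambda>z. G z \<bullet> b) y"
    show thesis by (rule that[OF 1 2 3 4])
  qed
  have [measurable]: "U \<in> borel_measurable borel" "G \<in> borel_measurable borel" using U G by auto
  define H where "H z = A (norm (G z)) * indicator K z" for z
  have Hm[measurable]: "H \<in> borel_measurable borel" unfolding H_def using meas(1) by measurable
  define D where "D = {z. \<forall>j\<in>Basis. \<bar>(z - x0) \<bullet> j\<bar> \<le> 4 * R}"
  have DK: "cball y e \<subseteq> K" if "y \<in> D" "e \<le> R" for y e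
  proof
    fix z assume "z \<in> cball y e"
    then have z: "norm (z - y) \<le> R" using that by (simp add: dist_norm norm_minus_commute)
    have "\<bar>(z - x0) \<bullet> j\<bar> \<le> 5 * R" if j: "j \<in> Basis" for j
    proof -
      have "\<bar>(z - x0) \<bullet> j\<bar> \<le> \<bar>(z - y) \<bullet> j\<bar> + \<bar>(y - x0) \<bullet> j\<bar>"
        by (simp add: inner_diff_left)
      also have "\<dots> \<le> R + 4 * R"
        using Basis_le_norm[OF j, of "z - y"] z \<open>y \<in> D\<close> j by (intro add_mono) (auto simp: D_def)
      finally show ?thesis by simp
    qed
    then show "z \<in> K" by (simp add: K_def)
  qed
  have IH: "(\<integral>\<^sup>+z. H z \<partial>lborel) \<le> (\<integral>\<^sup>+z\<in>B. A (norm (g z)) \<partial>lebesgue)"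
  proof -
    have "(\<integral>\<^sup>+z. H z \<partial>lborel) \<le> (\<integral>\<^sup>+z\<in>B. A (norm (g z)) \<partial>lborel)"
    proof (rule nn_integral_mono_AE, use ae in eventually_elim)
      fix x assume "x \<in> K \<longrightarrow> U x = u x \<and> G x = g x"
      then show "H x \<le> A (norm (g x)) * indicator B x"
        using KB by (cases "x \<in> K") (auto simp: H_def)
    qed
    then show ?thesis by (simp add: nn_integral_completion)
  qed
  define J where "J = (\<integral>z. \<bar>U z\<bar> \<partial>lborel)"
  have J: "(\<integral>\<^sup>+z. ennreal \<bar>U z\<bar> \<partial>lborel) = ennreal J" "J \<ge> 0"
    unfolding J_def using nn_integral_eq_integral[OF integrable_abs[OF U]] by auto
  have fin: "ennreal (2 * DIM('a)) * (\<integral>\<^sup>+z. H z \<partial>lborel) < ennreal (R * a)"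
    by (rule le_less_trans[OF mult_left_mono[OF IH] a]) simp
  have Hfin: "(\<integral>\<^sup>+z. H z \<partial>lborel) < \<infinity>"
  proof (rule ccontr)
    assume "\<not> ?thesis"
    then have "(\<integral>\<^sup>+z. H z \<partial>lborel) = top" by (metis infinity_ennreal_def top.not_eq_extremum)
    with fin n show False by (simp add: ennreal_mult_top)
  qed
  define h0 where "h0 = enn2real (\<integral>\<^sup>+z. H z \<partial>lborel)"
  have h0: "(\<integral>\<^sup>+z. H z \<partial>lborel) = ennreal h0" "h0 \<ge> 0" unfolding h0_def using Hfin by auto
  have h0a: "2 * DIM('a) * h0 < R * a"
    using fin h0 R a0 by (simp flip: ennreal_mult add: ennreal_less_iff)
  \<comment> \<open>Chosen so that the extra term \<eta> J uses at most half of the gap between 2n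
    times the energy and R a; J + 1 avoids a division by zero.\<close>
  define \<eta> where "\<eta> = (R * a - 2 * DIM('a) * h0) / (4 * DIM('a) * (J + 1))"
  have \<eta>: "\<eta> > 0" unfolding \<eta>_def using h0a J n by (intro divide_pos_pos mult_pos_pos) auto
  have \<eta>2: "2 * DIM('a) * (h0 + \<eta> * J) < R * a"
  proof -
    have "2 * DIM('a) * (\<eta> * J) \<le> 2 * DIM('a) * (\<eta> * (J + 1))" using \<eta> J by (intro mult_left_mono) auto
    also have "\<dots> = (R * a - 2 * DIM('a) * h0) / 2"
    proof -
      have "2 * N * (X / (4 * N * q) * q) = X / 2" if "N > 0" "q > 0" for N q X :: real
        using that by (simp add: field_simps)
      from this[of "real DIM('a)" "J + 1"] show ?thesis unfolding \<eta>_def using J n by simp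
    qed
    finally show ?thesis using h0a by (simp add: distrib_left)
  qed
  define e where "e i = R / real (Suc i)" for i
  have e: "e i > 0" "e i \<le> R" for i unfolding e_def using R by (auto simp: field_simps)
  have elim: "filterlim e (at_right 0) sequentially"
  proof -
    have "(\<lambda>i. R * inverse (real (Suc i))) \<longlonglongrightarrow> R * 0" by (intro tendsto_intros LIMSEQ_inverse_real_of_nat)
    then have "e \<longlonglongrightarrow> 0" by (simp add: e_def[abs_def] inverse_eq_divide)
    moreover have "\<forall>n. e n \<noteq> 0 \<and> e n \<in> {0<..}" using e(1) by (metis greaterThan_iff less_irrefl)
    ultimately show ?thesis unfolding filterlim_at by (simp add: always_eventually)
  qed
  have L1: "(\<lambda>i. \<integral>\<^sup>+x. ennreal \<bar>conv (moll (e i)) F x - F x\<bar> \<partial>lborel) \<longlonglongrightarrow> 0"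
    if "integrable lborel F" for F :: "'a \<Rightarrow> real"
    using filterlim_compose[OF conv_moll_L1[OF that] elim] .
  \<comment> \<open>Convergence in L^1 gives almost everywhere convergence along a subsequence,
    which \<open>trunc_approximation\<close> needs in order to insert the mollifications into
    \<open>strunc'\<close>.\<close>
  obtain r0 :: "nat \<Rightarrow> nat" where r0: "strict_mono r0"
    "AE x in lborel. (\<lambda>i. conv (moll (e (r0 i))) U x - U x) \<longlonglongrightarrow> 0"
  proof -
    have int: "integrable lborel (\<lambda>x. conv (moll (e i)) U x - U x)" for i
      by (intro Bochner_Integration.integrable_diff integrable_conv_moll U e)
    have "(\<lambda>i. ennreal (\<integral>x. norm (conv (moll (e i)) U x - U x) \<partial>lborel)) \<longlonglongrightarrow> ennreal 0"
      using L1[OF U] by (subst nn_integral_eq_integral[symmetric]) (auto intro: int integrable_norm)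
    then have "(\<lambda>i. \<integral>x. norm (conv (moll (e i)) U x - U x) \<partial>lborel) \<longlonglongrightarrow> 0"
      by (subst (asm) tendsto_ennreal_iff) auto
    from tendsto_L1_AE_subseq[OF int this] show ?thesis using that by blast
  qed
  define w0 where "w0 i = conv (moll (e (r0 i))) U" for i
  have w0C: "Ck j (w0 i)" for i j unfolding w0_def by (intro Ck_conv Ccinf_moll e U)
  have w0c: "continuous_on UNIV (w0 i)" for i using Ck_imp_continuous_on[OF w0C[of 0 i]] .
  have w0m[measurable]: "w0 i \<in> borel_measurable borel" for i
    by (intro borel_measurable_continuous_onI w0c)
  define h where "h i = nn_conv (moll (e (r0 i))) H" for i
  have hm[measurable]: "h i \<in> borel_measurable borel" for i
    unfolding h_def by (intro nn_conv_measurable Ccinf_measurable Ccinf_moll e Hm)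
  have hyoung: "ennreal (norm (gradient (w0 i) z) * k) \<le> h i z + \<Psi> k"
    if z: "\<forall>j\<in>Basis. \<bar>(z - x0) \<bullet> j\<bar> \<le> 4 * R" and k: "k > 0" for i z k
    unfolding w0_def h_def
  proof (rule gradient_conv_moll_young[OF G e(1) _ k Hm])
    have sub: "cball z (e (r0 i)) \<subseteq> K" using z by (intro DK e) (simp add: D_def)
    then show "partial_deriv b (conv (moll (e (r0 i))) U) z = conv (moll (e (r0 i))) (\<lambda>z. G z \<bullet> b) z" if "b \<in> Basis" for b
      by (rule grad[OF e(1) _ that])
    show "ennreal (norm (G y) * k) \<le> H y + \<Psi> k" if "y \<in> ball z (e (r0 i))" for y
    proof -
      have "y \<in> K" using that sub ball_subset_cball by blast
      then show ?thesis using young[of "norm (G y)" k] k by (simp add: H_def)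
    qed
  qed
  \<comment> \<open>The energy bound controls oscillations only; the second term controls the size,
    so that the corner values below stay bounded.\<close>
  define f where "f i z = h i z + ennreal \<eta> * ennreal \<bar>w0 i z\<bar>" for i z
  have fm: "f i \<in> borel_measurable borel" for i unfolding f_def by measurable
  have fT: "(\<integral>\<^sup>+z. f i z \<partial>lborel) \<le> ennreal (h0 + \<eta> * J)" for i
  proof -
    have "(\<integral>\<^sup>+z. f i z \<partial>lborel) = (\<integral>\<^sup>+z. h i z \<partial>lborel) + ennreal \<eta> * (\<integral>\<^sup>+z. ennreal \<bar>w0 i z\<bar> \<partial>lborel)"
      unfolding f_def by (subst nn_integral_add) (auto intro!: nn_integral_cmult)
    also have "(\<integral>\<^sup>+z. h i z \<partial>lborel) = ennreal h0"
      unfolding h_def using nn_integral_nn_conv_moll[OF Hm e(1)] h0 by simp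
    also have "(\<integral>\<^sup>+z. ennreal \<bar>w0 i z\<bar> \<partial>lborel) \<le> (\<integral>\<^sup>+y. nn_conv (moll (e (r0 i))) (\<lambda>z. ennreal \<bar>U z\<bar>) y \<partial>lborel)"
      unfolding w0_def by (intro nn_integral_mono conv_moll_le_nn_conv U e)
    also have "\<dots> = ennreal J"
      using nn_integral_nn_conv_moll[OF _ e(1), of "\<lambda>z. ennreal \<bar>U z\<bar>"] J by simp
    finally show ?thesis using \<eta> J h0 by (simp add: ennreal_plus ennreal_mult mult_left_mono add_left_mono)
  qed
  have lt: "ennreal (2 * DIM('a)) * ennreal (h0 + \<eta> * J) < ennreal (R * a)"
  proof -
    have "ennreal (2 * DIM('a)) * ennreal (h0 + \<eta> * J) = ennreal (2 * DIM('a) * (h0 + \<eta> * J))"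
      using \<eta> J h0 by (intro ennreal_mult[symmetric]) auto
    also have "\<dots> < ennreal (R * a)"
      using \<eta>2 \<eta> J h0 by (intro ennreal_lessI) (auto intro: mult_pos_pos R a0)
    finally show ?thesis .
  qed
  obtain s r1 where s: "R \<le> s" "s \<le> 2 * R" and r1: "strict_mono (r1 :: nat \<Rightarrow> nat)"
    and face: "\<And>i b \<sigma>. b \<in> Basis \<Longrightarrow> \<bar>\<sigma>\<bar> = s \<Longrightarrow>
       (\<integral>\<^sup>+\<omega>\<in>slab b (4 * R). f (r1 i) (hyp_point x0 b \<sigma> \<omega>) \<partial>lborel) \<le> ennreal a"
  proof (rule good_cube[OF fm R fT lt])
    fix s r1
    assume 1: "R \<le> s" "s \<le> 2 * R" "strict_mono (r1 :: nat \<Rightarrow> nat)"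
      and 2: "\<And>i b \<sigma>. b \<in> Basis \<Longrightarrow> \<bar>\<sigma>\<bar> = s \<Longrightarrow>
       (\<integral>\<^sup>+\<omega>\<in>slab b (4 * R). f (r1 i) (hyp_point x0 b \<sigma> \<omega>) \<partial>lborel) \<le> ennreal a"
    show thesis by (rule that[OF 1 2])
  qed
  have s0: "s > 0" using s R by simp
  have hface: "(\<integral>\<^sup>+\<omega>\<in>slab b (4 * R). h (r1 i) (hyp_point x0 b \<sigma> \<omega>) \<partial>lborel) \<le> ennreal a"
    if "b \<in> Basis" "\<bar>\<sigma>\<bar> = s" for i b \<sigma>
    by (rule order_trans[OF nn_integral_mono face[OF that, of i]]) (auto simp: f_def indicator_def)
  have wface: "ennreal \<eta> * (\<integral>\<^sup>+\<omega>\<in>slab b (4 * R). ennreal \<bar>w0 (r1 i) (hyp_point x0 b \<sigma> \<omega>)\<bar> \<partial>lborel) \<le> ennreal a"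
    if "b \<in> Basis" "\<bar>\<sigma>\<bar> = s" for i b \<sigma>
  proof -
    have "ennreal \<eta> * (\<integral>\<^sup>+\<omega>\<in>slab b (4 * R). ennreal \<bar>w0 (r1 i) (hyp_point x0 b \<sigma> \<omega>)\<bar> \<partial>lborel)
      = (\<integral>\<^sup>+\<omega>. ennreal \<eta> * (ennreal \<bar>w0 (r1 i) (hyp_point x0 b \<sigma> \<omega>)\<bar> * indicator (slab b (4 * R)) \<omega>) \<partial>lborel)"
      by (rule nn_integral_cmult[symmetric]) measurable
    also have "\<dots> \<le> (\<integral>\<^sup>+\<omega>\<in>slab b (4 * R). f (r1 i) (hyp_point x0 b \<sigma> \<omega>) \<partial>lborel)"
      by (intro nn_integral_mono) (auto simp: f_def indicator_def)
    finally show ?thesis using face[OF that, of i] by (rule order_trans)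
  qed
  have w1C: "Ck (Suc 0) (w0 i)" for i by (rule w0C)
  have osc1: "\<bar>w0 (r1 i) x - w0 (r1 i) (cube_corner x0 s)\<bar> \<le> 4 * \<tau>"
    if b: "b \<in> Basis" "\<bar>(x - x0) \<bullet> b\<bar> = s" and x: "\<And>j. j \<in> Basis \<Longrightarrow> \<bar>(x - x0) \<bullet> j\<bar> \<le> s" for b x i
    unfolding \<tau>_def
    by (rule cube_boundary_osc(1)[OF n R t s w1C hm meas(2) hyoung \<kappa> less_imp_le[OF a0] hface b x])
  have osc2: "\<bar>w0 (r1 i) (cube_corner x0 s)\<bar> \<le> \<tau> + \<bar>hyp_mean (w0 (r1 i)) x0 b0 s R\<bar>"
    if b: "b0 \<in> Basis" for b0 i
    unfolding \<tau>_def
    by (rule cube_boundary_osc(2)[OF n R t s w1C hm meas(2) hyoung \<kappa> less_imp_le[OF a0] hface b])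
  define p where "p = cube_corner x0 s"
  define c where "c i = w0 (r1 i) p" for i
  obtain b0 :: 'a where b0: "b0 \<in> Basis" using nonempty_Basis by blast
  have cb: "c i \<in> {- (\<tau> + a / (\<eta> * R ^ d))..\<tau> + a / (\<eta> * R ^ d)}" for i
  proof -
    have "ennreal (\<eta> * (R ^ d * \<bar>hyp_mean (w0 (r1 i)) x0 b0 s R\<bar>))
        = ennreal \<eta> * ennreal (R ^ d * \<bar>hyp_mean (w0 (r1 i)) x0 b0 s R\<bar>)"
      using \<eta> R by (intro ennreal_mult) auto
    also have "\<dots> \<le> ennreal \<eta> * (\<integral>\<^sup>+\<omega>\<in>slab b0 (4 * R). ennreal \<bar>w0 (r1 i) (hyp_point x0 b0 s \<omega>)\<bar> \<partial>lborel)"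
      unfolding d_def by (intro mult_left_mono hyp_mean_bound b0 R w0c) simp
    also have "\<dots> \<le> ennreal a" using s0 by (intro wface b0) simp
    finally have "\<eta> * (R ^ d * \<bar>hyp_mean (w0 (r1 i)) x0 b0 s R\<bar>) \<le> a"
      using a0 by simp
    then have "\<bar>hyp_mean (w0 (r1 i)) x0 b0 s R\<bar> \<le> a / (\<eta> * R ^ d)"
      using \<eta> Rd by (simp add: le_divide_eq mult_ac)
    with osc2[OF b0, of i] show ?thesis
      unfolding c_def p_def by (auto simp: abs_le_iff)
  qed
  \<comment> \<open>Convergent corner values allow m and M to be fixed once for the whole
    sequence.\<close>
  obtain c0 r2 where r2: "strict_mono (r2 :: nat \<Rightarrow> nat)" "(c \<circ> r2) \<longlonglongrightarrow> c0"
    using compact_Icc[unfolded compact_def, of "- (\<tau> + a / (\<eta> * R ^ d))" "\<tau> + a / (\<eta> * R ^ d)"] cb by blast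
  obtain N where N: "\<And>i. i \<ge> N \<Longrightarrow> \<bar>c (r2 i) - c0\<bar> < \<tau>"
    using r2(2) \<tau>0 unfolding LIMSEQ_iff by (auto simp: o_def)
  define w where "w i = w0 (r1 (r2 (i + N)))" for i
  \<comment> \<open>The boundary values are within 4 \<tau> of the corner value, and that value is
    eventually closer than \<tau> to its limit. This gives the strict inequalities that
    \<open>cutoff_test_function\<close> demands, at the price M - m = 10 \<tau>.\<close>
  define m where "m = c0 - 5 * \<tau>"
  define M where "M = c0 + 5 * \<tau>"
  define Q where "Q = {x. \<forall>j\<in>Basis. \<bar>(x - x0) \<bullet> j\<bar> < s}"
  note Q = open_cube[OF s0, of x0, folded Q_def]
  have QD: "Q \<subseteq> D" using s R by (force simp: Q_def D_def)
  have DsubK: "D \<subseteq> K" using R by (force simp: K_def D_def)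
  have bd: "m < w i x \<and> w i x < M" if x: "x \<in> closure Q" "x \<notin> Q" for i x
  proof -
    obtain b where b: "b \<in> Basis" "\<bar>(x - x0) \<bullet> b\<bar> = s"
      using x unfolding Q(3) by (force simp: Q_def)
    have "\<bar>w i x - c (r2 (i + N))\<bar> \<le> 4 * \<tau>"
      unfolding w_def c_def p_def using x(1) unfolding Q(3) by (intro osc1[OF b]) auto
    moreover have "\<bar>c (r2 (i + N)) - c0\<bar> < \<tau>" by (rule N) simp
    ultimately show ?thesis unfolding m_def M_def by auto
  qed
  define r where "r i = r1 (r2 (i + N))" for i
  have rr: "strict_mono r" unfolding r_def using r1 r2(1) by (auto simp: strict_mono_def)
  have rr0: "strict_mono (r0 \<circ> r)" using rr r0(1) by (rule strict_mono_o[rotated])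
  have wr: "w i = conv (moll (e ((r0 \<circ> r) i))) U" for i by (simp add: w_def w0_def r_def)
  have limU: "(\<lambda>i. \<integral>\<^sup>+x\<in>Q. ennreal \<bar>w i x - U x\<bar> \<partial>lborel) \<longlonglongrightarrow> 0"
  proof (rule tendsto_sandwich[OF _ _ tendsto_const LIMSEQ_subseq_LIMSEQ[OF L1[OF U] rr0]])
    show "\<forall>\<^sub>F i in sequentially. (\<integral>\<^sup>+x\<in>Q. ennreal \<bar>w i x - U x\<bar> \<partial>lborel)
      \<le> ((\<lambda>i. \<integral>\<^sup>+x. ennreal \<bar>conv (moll (e i)) U x - U x\<bar> \<partial>lborel) \<circ> (r0 \<circ> r)) i"
      by (intro always_eventually allI) (auto simp: wr indicator_def intro!: nn_integral_mono)
  qed simp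
  have Gb: "integrable lborel (\<lambda>x. G x \<bullet> b)" for b by (rule integrable_inner_left) (rule G)
  have limG: "(\<lambda>i. \<integral>\<^sup>+x\<in>Q. ennreal (norm (gradient (w i) x - G x)) \<partial>lborel) \<longlonglongrightarrow> 0"
  proof (rule tendsto_sandwich[OF _ _ tendsto_const])
    have "(\<lambda>i. \<Sum>b\<in>Basis. ((\<lambda>i. \<integral>\<^sup>+x. ennreal \<bar>conv (moll (e i)) (\<lambda>x. G x \<bullet> b) x - G x \<bullet> b\<bar> \<partial>lborel) \<circ> (r0 \<circ> r)) i)
        \<longlonglongrightarrow> (\<Sum>b\<in>(Basis :: 'a set). 0)"
      by (intro tendsto_sum LIMSEQ_subseq_LIMSEQ[OF L1[OF Gb] rr0])
    then show "(\<lambda>i. \<Sum>b\<in>Basis. \<integral>\<^sup>+x. ennreal \<bar>conv (moll (e (r0 (r i)))) (\<lambda>x. G x \<bullet> b) x - G x \<bullet> b\<bar> \<partial>lborel) \<longlonglongrightarrow> 0"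
      by simp
    show "\<forall>\<^sub>F i in sequentially. (\<integral>\<^sup>+x\<in>Q. ennreal (norm (gradient (w i) x - G x)) \<partial>lborel)
      \<le> (\<Sum>b\<in>Basis. \<integral>\<^sup>+x. ennreal \<bar>conv (moll (e (r0 (r i)))) (\<lambda>x. G x \<bullet> b) x - G x \<bullet> b\<bar> \<partial>lborel)"
    proof (intro always_eventually allI)
      fix i
      let ?c = "\<lambda>b. conv (moll (e (r0 (r i)))) (\<lambda>x. G x \<bullet> b)"
      have cm[measurable]: "?c b \<in> borel_measurable borel" for b
        using integrable_conv_moll[OF Gb e(1)] by auto
      have "(\<integral>\<^sup>+x\<in>Q. ennreal (norm (gradient (w i) x - G x)) \<partial>lborel)
        \<le> (\<integral>\<^sup>+x. (\<Sum>b\<in>Basis. ennreal \<bar>?c b x - G x \<bullet> b\<bar>) \<partial>lborel)"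
      proof (rule nn_integral_mono)
        fix x
        show "ennreal (norm (gradient (w i) x - G x)) * indicator Q x \<le> (\<Sum>b\<in>Basis. ennreal \<bar>?c b x - G x \<bullet> b\<bar>)"
        proof (cases "x \<in> Q")
          case True
          have "norm (gradient (w i) x - G x) \<le> (\<Sum>b\<in>Basis. \<bar>(gradient (w i) x - G x) \<bullet> b\<bar>)" by (rule norm_le_l1)
          also have "\<dots> = (\<Sum>b\<in>Basis. \<bar>?c b x - G x \<bullet> b\<bar>)"
          proof (intro sum.cong refl)
            fix b :: 'a assume b: "b \<in> Basis"
            have "cball x (e (r0 (r i))) \<subseteq> K" using True QD by (intro DK e) auto
            from grad[OF e(1) this b] show "\<bar>(gradient (w i) x - G x) \<bullet> b\<bar> = \<bar>?c b x - G x \<bullet> b\<bar>"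
              by (simp add: inner_diff_left gradient_inner_Basis b wr)
          qed
          finally have "ennreal (norm (gradient (w i) x - G x)) \<le> ennreal (\<Sum>b\<in>Basis. \<bar>?c b x - G x \<bullet> b\<bar>)" by (rule ennreal_leI)
          also have "\<dots> = (\<Sum>b\<in>Basis. ennreal \<bar>?c b x - G x \<bullet> b\<bar>)" by (rule sum_ennreal[symmetric]) simp
          finally show ?thesis using True by simp
        qed simp
      qed
      also have "\<dots> = (\<Sum>b\<in>Basis. \<integral>\<^sup>+x. ennreal \<bar>?c b x - G x \<bullet> b\<bar> \<partial>lborel)"
        by (rule nn_integral_sum) measurable
      finally show "(\<integral>\<^sup>+x\<in>Q. ennreal (norm (gradient (w i) x - G x)) \<partial>lborel)
        \<le> (\<Sum>b\<in>Basis. \<integral>\<^sup>+x. ennreal \<bar>?c b x - G x \<bullet> b\<bar> \<partial>lborel)" .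
    qed
  qed simp
  have aeU: "AE x in lborel. x \<in> Q \<longrightarrow> (\<lambda>i. w i x) \<longlonglongrightarrow> U x"
    using r0(2)
  proof eventually_elim
    fix x assume "(\<lambda>i. conv (moll (e (r0 i))) U x - U x) \<longlonglongrightarrow> 0"
    then have "(\<lambda>i. conv (moll (e (r0 i))) U x) \<longlonglongrightarrow> U x" by (simp add: LIM_zero_iff)
    from LIMSEQ_subseq_LIMSEQ[OF this rr] show "x \<in> Q \<longrightarrow> (\<lambda>i. w i x) \<longlonglongrightarrow> U x"
      by (simp add: wr o_def)
  qed
  have mM: "m \<le> M" unfolding m_def M_def using \<tau>0 by simp
  have wC: "Ck j (w i)" for i j unfolding w_def by (rule w0C)
  define P where "P k \<phi> \<longleftrightarrow> test_function Q \<phi> \<and>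
    (\<integral>\<^sup>+x\<in>Q. ennreal \<bar>trunc m M (U x) - \<phi> x\<bar> \<partial>lborel) \<le> ennreal (1 / Suc k) \<and>
    (\<integral>\<^sup>+x\<in>Q. ennreal (norm (trunc_deriv m M (U x) *\<^sub>R G x - gradient \<phi> x)) \<partial>lborel) \<le> ennreal (1 / Suc k)" for k \<phi>
  have "\<forall>k. \<exists>\<phi>. P k \<phi>"
  proof
    fix k
    show "\<exists>\<phi>. P k \<phi>" unfolding P_def
      by (rule trunc_approximation[OF Q(1,2) mM _ _ _ U integrable_norm[OF G] wC bd limU limG aeU, of "1 / real (Suc k)"]) auto
  qed
  from choice[OF this] obtain \<phi> where "\<forall>k. P k (\<phi> k)" ..
  then have \<phi>: "test_function Q (\<phi> k)"
    "(\<integral>\<^sup>+x\<in>Q. ennreal \<bar>trunc m M (U x) - \<phi> k x\<bar> \<partial>lborel) \<le> ennreal (1 / Suc k)"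
    "(\<integral>\<^sup>+x\<in>Q. ennreal (norm (trunc_deriv m M (U x) *\<^sub>R G x - gradient (\<phi> k) x)) \<partial>lborel) \<le> ennreal (1 / Suc k)" for k
    unfolding P_def by simp_all
  have inv0: "(\<lambda>k. ennreal (1 / Suc k)) \<longlonglongrightarrow> 0"
  proof -
    have "(\<lambda>k. ennreal (1 / Suc k)) \<longlonglongrightarrow> ennreal 0"
      by (intro tendsto_ennrealI) (use LIMSEQ_inverse_real_of_nat in \<open>simp add: inverse_eq_divide\<close>)
    then show ?thesis by simp
  qed
  have uL: "u \<in> borel_measurable (lebesgue_on \<Omega>)"
    using wm by (simp add: weakly_monotone_def orlicz_sobolev_loc_def)
  have clQ: "closure Q \<subseteq> B" 
  proof -
    have "closure Q \<subseteq> K" unfolding Q(3) K_def using s R by force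
    with KB show ?thesis by blast
  qed
  have B\<Omega>: "B \<subseteq> \<Omega>" using B closure_subset unfolding compactly_contained_def by blast
  have Q\<Omega>: "Q \<subseteq> \<Omega>" using closure_subset clQ B\<Omega> by blast
  have ccQ: "compactly_contained Q \<Omega>"
    unfolding compactly_contained_def using Q(2) clQ B\<Omega> by (auto simp: compact_closure)
  have mem: "(\<lambda>x. max (u x - M) 0 - max (m - u x) 0) \<in> W11_0 Q"
  \<comment> \<open>The truncation need not vanish where U does, so it is cut off outside Q to be
    integrable over the whole space.\<close>
  proof (rule W11_0_I[where W = "\<lambda>x. indicator Q x * trunc m M (U x)" and G = "\<lambda>x. trunc_deriv m M (U x) *\<^sub>R G x" and \<phi> = \<phi>])
    have Qm[measurable]: "Q \<in> sets borel" using Q(1) by simp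
    show "open Q" by (rule Q(1))
    have [measurable]: "u \<in> borel_measurable (lebesgue_on Q)"
      by (rule measurable_restrict_mono[OF uL Q\<Omega>])
    show "(\<lambda>x. max (u x - M) 0 - max (m - u x) 0) \<in> borel_measurable (lebesgue_on Q)" by measurable
    show "integrable lborel (\<lambda>x. indicator Q x * trunc m M (U x))"
    proof (rule Bochner_Integration.integrable_bound[of lborel "\<lambda>x. \<bar>U x\<bar> + (\<bar>m\<bar> + \<bar>M\<bar>) * indicator Q x"])
      show "integrable lborel (\<lambda>x. \<bar>U x\<bar> + (\<bar>m\<bar> + \<bar>M\<bar>) * indicator Q x)"
        using U emeasure_bounded_finite[OF Q(2)] by (intro Bochner_Integration.integrable_add integrable_mult_right integrable_real_indicator integrable_abs) auto
      show "AE x in lborel. norm (indicator Q x * trunc m M (U x)) \<le> norm (\<bar>U x\<bar> + (\<bar>m\<bar> + \<bar>M\<bar>) * indicator Q x)"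
      proof (rule AE_I2)
        fix x
        show "norm (indicator Q x * trunc m M (U x)) \<le> norm (\<bar>U x\<bar> + (\<bar>m\<bar> + \<bar>M\<bar>) * indicator Q x)"
          using trunc_bound[of m M "U x"] by (simp add: indicator_def)
      qed
    qed measurable
    show "integrable lborel (\<lambda>x. trunc_deriv m M (U x) *\<^sub>R G x)"
      by (rule Bochner_Integration.integrable_bound[OF G]) (auto simp: trunc_deriv_def)
    show "AE x in lborel. x \<in> Q \<longrightarrow> max (u x - M) 0 - max (m - u x) 0 = indicator Q x * trunc m M (U x)"
      using ae by eventually_elim (use QD DsubK in \<open>auto simp: trunc_def\<close>)
    show "test_function Q (\<phi> k)" for k by (rule \<phi>(1))
    have eq: "(\<integral>\<^sup>+x\<in>Q. ennreal \<bar>indicator Q x * trunc m M (U x) - \<phi> k x\<bar> \<partial>lborel)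
        = (\<integral>\<^sup>+x\<in>Q. ennreal \<bar>trunc m M (U x) - \<phi> k x\<bar> \<partial>lborel)" for k
      by (intro nn_integral_cong) (auto simp: indicator_def)
    show "(\<lambda>k. \<integral>\<^sup>+x\<in>Q. ennreal \<bar>indicator Q x * trunc m M (U x) - \<phi> k x\<bar> \<partial>lborel) \<longlonglongrightarrow> 0"
      unfolding eq by (rule tendsto_sandwich[OF always_eventually always_eventually tendsto_const inv0]) (simp_all only: \<phi>(2) zero_le simp_thms)
    show "(\<lambda>k. \<integral>\<^sup>+x\<in>Q. ennreal (norm (trunc_deriv m M (U x) *\<^sub>R G x - gradient (\<phi> k) x)) \<partial>lborel) \<longlonglongrightarrow> 0"
      by (rule tendsto_sandwich[OF always_eventually always_eventually tendsto_const inv0]) (simp_all only: \<phi>(3) zero_le simp_thms)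
  qed
  have "AE x in lebesgue_on Q. m \<le> u x \<and> u x \<le> M"
    using wm Q(1) ccQ mM mem unfolding weakly_monotone_def by blast
  then have "AE x in lebesgue. x \<in> Q \<longrightarrow> m \<le> u x \<and> u x \<le> M"
    using Q(1) by (subst (asm) AE_restrict_space_iff) auto
  then have "AE x in lborel. x \<in> Q \<longrightarrow> m \<le> u x \<and> u x \<le> M" by (simp add: AE_completion_iff)
  then have fin: "AE x in lborel. x \<in> ball x0 R \<longrightarrow> m \<le> u x \<and> u x \<le> M"
  proof eventually_elim
    fix x assume "x \<in> Q \<longrightarrow> m \<le> u x \<and> u x \<le> M"
    moreover have "ball x0 R \<subseteq> Q" using Q(4) s by (meson order_trans subset_ball)
    ultimately show "x \<in> ball x0 R \<longrightarrow> m \<le> u x \<and> u x \<le> M" by blast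
  qed
  show ?thesis by (rule that[OF mM _ fin]) (simp add: m_def M_def)
qed

subsection \<open>From cubes to balls\<close>

lemma AE_cover_balls:
  fixes S :: "'a::euclidean_space set"
  assumes R: "R > 0" and P: "\<And>y. y \<in> S \<Longrightarrow> AE z in lborel. z \<in> ball y R \<longrightarrow> P z"
  shows "AE z in lborel. z \<in> S \<longrightarrow> P z"
proof -
  have op: "\<And>X. X \<in> (\<lambda>y. ball y R) ` S \<Longrightarrow> open X" by auto
  obtain F where F: "F \<subseteq> (\<lambda>y. ball y R) ` S" "countable F" "\<Union> F = \<Union> ((\<lambda>y. ball y R) ` S)"
    by (rule Lindelof[OF op])
  have "AE z in lborel. \<forall>X\<in>F. z \<in> X \<longrightarrow> P z"
    using F(1) P by (intro AE_ball_countable[THEN iffD2] F(2)) auto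
  then show ?thesis
  proof eventually_elim
    fix z assume *: "\<forall>X\<in>F. z \<in> X \<longrightarrow> P z"
    show "z \<in> S \<longrightarrow> P z"
    proof
      assume "z \<in> S"
      then have "z \<in> \<Union> ((\<lambda>y. ball y R) ` S)" using R by force
      then show "P z" using * F(3) by blast
    qed
  qed
qed

text \<open>The intersection of the two balls is open and contains y, so it is not a null
  set.\<close>

lemma AE_common_point:
  fixes P Q :: "'a::euclidean_space \<Rightarrow> bool"
  assumes "AE z in lborel. z \<in> ball y R \<longrightarrow> P z" "AE z in lborel. z \<in> ball y' R \<longrightarrow> Q z" "dist y y' < R"
  shows "\<exists>z. P z \<and> Q z"
proof (rule ccontr)
  assume *: "\<not> ?thesis"
  have "AE z in lborel. z \<notin> ball y R \<inter> ball y' R"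
    using assms(1,2) by eventually_elim (use * in auto)
  then have "ball y R \<inter> ball y' R \<in> null_sets lborel"
    by (simp add: AE_iff_null_sets)
  then have "negligible (ball y R \<inter> ball y' R)"
    by (simp add: negligible_iff_null_sets null_sets_completionI)
  moreover have "y \<in> ball y R \<inter> ball y' R"
    using assms(3) by (auto simp: dist_commute intro: le_less_trans[OF zero_le_dist])
  ultimately show False
    using open_not_negligible[OF open_Int[OF open_ball open_ball], of y R y' R] by blast
qed

text \<open>Walk from x to y along the segment in N steps shorter than R. Consecutive balls overlap
  in a set of positive measure, so their intervals share a value of u and the endpoints move by at
  most L per step.\<close>

lemma ess_bound_chain:
  fixes u :: "'a::euclidean_space \<Rightarrow> real"
  assumes R: "R > 0" and r: "r > 0" "r \<le> real N * R" and L: "L \<ge> 0"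
    and loc: "\<And>y. y \<in> ball x r \<Longrightarrow> \<exists>m M. M - m \<le> L \<and> (AE z in lborel. z \<in> ball y R \<longrightarrow> m \<le> u z \<and> u z \<le> M)"
  shows "\<exists>m M. M - m \<le> (2 * real N + 1) * L \<and> (AE z in lborel. z \<in> ball x r \<longrightarrow> m \<le> u z \<and> u z \<le> M)"
proof -
  have "\<forall>y\<in>ball x r. \<exists>p. snd p - fst p \<le> L \<and> (AE z in lborel. z \<in> ball y R \<longrightarrow> fst p \<le> u z \<and> u z \<le> snd p)"
    using loc by simp
  from bchoice[OF this] obtain q where
    q: "\<And>y. y \<in> ball x r \<Longrightarrow> snd (q y) - fst (q y) \<le> L"
      "\<And>y. y \<in> ball x r \<Longrightarrow> AE z in lborel. z \<in> ball y R \<longrightarrow> fst (q y) \<le> u z \<and> u z \<le> snd (q y)"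
    by blast
  define m0 where "m0 = fst (q x)"
  define M0 where "M0 = snd (q x)"
  have xr: "x \<in> ball x r" using r by simp
  have N0: "N > 0" using r R by (metis gr0I less_le_not_le mult_zero_left of_nat_0)
  have bound: "m0 - real N * L \<le> fst (q y) \<and> snd (q y) \<le> M0 + real N * L" if y: "y \<in> ball x r" for y
  proof -
    define p where "p k = x + (real k / real N) *\<^sub>R (y - x)" for k :: nat
    have pb: "p k \<in> ball x r" if "k \<le> N" for k
    proof -
      have "dist x (p k) = real k / real N * norm (y - x)" by (simp add: p_def dist_norm)
      also have "\<dots> \<le> 1 * norm (y - x)" using that N0 by (intro mult_right_mono) auto
      also have "\<dots> < r" using y by (simp add: dist_norm norm_minus_commute)
      finally show ?thesis by simp
    qed
    have step: "dist (p k) (p (Suc k)) < R" for k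
    proof -
      have "p (Suc k) - p k = (1 / real N) *\<^sub>R (y - x)"
        by (simp add: p_def add_divide_distrib scaleR_add_left)
      then have "dist (p k) (p (Suc k)) = norm (y - x) / real N"
        by (metis abs_of_nat dist_commute dist_norm divide_inverse_commute inverse_eq_divide norm_scaleR abs_divide abs_one)
      also have "\<dots> < r / real N" using y N0 by (intro divide_strict_right_mono) (auto simp: dist_norm norm_minus_commute)
      also have "\<dots> \<le> R" using r N0 by (simp add: divide_le_eq mult.commute)
      finally show ?thesis .
    qed
    have "m0 - real k * L \<le> fst (q (p k)) \<and> snd (q (p k)) \<le> M0 + real k * L" if "k \<le> N" for k
      using that
    proof (induction k)
      case 0
      then show ?case by (simp add: p_def m0_def M0_def)
    next
      case (Suc k)
      obtain z where z: "fst (q (p k)) \<le> u z" "u z \<le> snd (q (p k))" "fst (q (p (Suc k))) \<le> u z" "u z \<le> snd (q (p (Suc k)))"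
        using AE_common_point[OF q(2)[OF pb] q(2)[OF pb] step, of k] Suc.prems by auto
      have "snd (q (p (Suc k))) - fst (q (p (Suc k))) \<le> L" using Suc.prems by (intro q(1) pb)
      then show ?case using z Suc by (auto simp: algebra_simps)
    qed
    from this[of N] show ?thesis using N0 by (simp add: p_def)
  qed
  have "AE z in lborel. z \<in> ball x r \<longrightarrow> m0 - real N * L \<le> u z \<and> u z \<le> M0 + real N * L"
  proof (rule AE_cover_balls[OF R])
    fix y assume y: "y \<in> ball x r"
    from q(2)[OF y] show "AE z in lborel. z \<in> ball y R \<longrightarrow> m0 - real N * L \<le> u z \<and> u z \<le> M0 + real N * L"
      by eventually_elim (use bound[OF y] in auto)
  qed
  moreover have "(M0 + real N * L) - (m0 - real N * L) \<le> (2 * real N + 1) * L"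
    using q(1)[OF xr] by (simp add: m0_def M0_def algebra_simps)
  ultimately show ?thesis by blast
qed

text \<open>The factor 12n + 1 is 2N + 1 for a chain of N = 6n cubes. The factor 60 is 10 * 36 * n R
  / r with R = r / (6n). The last factor is C1 + 1, where C1 in \<open>osc_ball\<close> converts the
  average over the ball of radius 2r into the face bound of a cube.\<close>

definition osc_const :: "nat \<Rightarrow> real" where
  "osc_const n = (12 * real n + 1) * (60 * (2 * real n * unit_ball_vol (real n) * (12 * real n) ^ n + 1))"

lemma osc_const_pos: "osc_const n > 0"
  unfolding osc_const_def by (intro mult_pos_pos add_nonneg_pos mult_nonneg_nonneg) auto

lemma osc_ball:
  fixes u :: "'a::euclidean_space \<Rightarrow> real" and g :: "'a \<Rightarrow> 'a" and A \<Psi> :: "real \<Rightarrow> ennreal"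
    and r t \<alpha> \<kappa> :: real
  assumes n: "DIM('a) \<ge> 2" and wm: "weakly_monotone \<Omega> u"
    and r: "r > 0" and B: "compactly_contained (ball x (2 * r)) \<Omega>"
    and wg: "weak_gradient (ball x (2 * r)) u g"
    and meas: "A \<in> borel_measurable borel" "\<Psi> \<in> borel_measurable borel"
    and young: "\<And>s k. s \<ge> 0 \<Longrightarrow> k > 0 \<Longrightarrow> ennreal (s * k) \<le> A s + \<Psi> k"
    and t: "t > 0" and \<kappa>: "cone_integral (DIM('a) - 1) \<Psi> t = ennreal \<kappa>" "\<kappa> \<ge> 0"
    and \<alpha>: "(\<integral>\<^sup>+z\<in>ball x (2 * r). A (norm (g z)) \<partial>lebesgue)
        < ennreal (\<alpha> * (unit_ball_vol DIM('a) * (2 * r) ^ DIM('a)))"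
  shows "\<exists>m M. M - m \<le> osc_const DIM('a) * r * (\<alpha> + \<kappa>) / t \<and>
     (AE z in lborel. z \<in> ball x r \<longrightarrow> m \<le> u z \<and> u z \<le> M)"
proof -
  define n where "n = DIM('a)"
  define \<omega> where "\<omega> = unit_ball_vol (real n)"
  have n2: "n \<ge> 2" using n by (simp add: n_def)
  have \<omega>: "\<omega> > 0" unfolding \<omega>_def by simp
  have \<alpha>0: "\<alpha> > 0"
    using ennreal_mult_pos_cancel[of _ "unit_ball_vol DIM('a) * (2 * r) ^ DIM('a)" \<alpha>] \<alpha> r by (simp add: mult.commute)
  \<comment> \<open>With this R every point of the cube of half side 5R is at distance at most 5nR <
    r from its centre, so cubes centred in the ball of radius r stay in the ball of radius
    2r.\<close>
  define R where "R = r / (6 * real n)"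
  have R: "R > 0" unfolding R_def using r n2 by simp
  have rR: "r = 6 * real n * R" unfolding R_def using n2 by simp
  define C1 where "C1 = 2 * real n * \<omega> * (12 * real n) ^ n"
  have C1: "C1 > 0" unfolding C1_def using \<omega> n2 by simp
  \<comment> \<open>Chosen so that R a is 2n \<alpha> times the volume of the ball of radius 2r,
    using 2r = 12 n R.\<close>
  define a where "a = C1 * \<alpha> * R ^ (n - 1)"
  have Rd: "R ^ (n - 1) > 0" using R by simp
  define \<tau> where "\<tau> = 36 * n * R * (a + R ^ (n - 1) * \<kappa>) / (t * R ^ (n - 1))"
  have \<tau>eq: "\<tau> = 36 * n * R * (C1 * \<alpha> + \<kappa>) / t"
  proof -
    have eq: "36 * n * R * (C1 * \<alpha> * P + P * \<kappa>) / (t * P) = 36 * n * R * (C1 * \<alpha> + \<kappa>) / t" if "P > 0" for P :: real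
    proof -
      have e: "36 * n * R * (C1 * \<alpha> * P + P * \<kappa>) = 36 * n * R * (C1 * \<alpha> + \<kappa>) * P" by (simp add: algebra_simps)
      show ?thesis unfolding e using that by simp
    qed
    show ?thesis unfolding \<tau>_def a_def by (rule eq[OF Rd])
  qed
  \<comment> \<open>C1 \<alpha> + \<kappa> is enlarged to (C1 + 1) (\<alpha> + \<kappa>), so that
    the constant separates from \<alpha> + \<kappa>.\<close>
  define L where "L = 10 * (36 * n * R * ((C1 + 1) * (\<alpha> + \<kappa>)) / t)"
  have L: "L \<ge> 0" unfolding L_def using R C1 \<alpha>0 \<kappa> t by simp
  have \<tau>L: "10 * \<tau> \<le> L"
  proof -
    have "C1 * \<alpha> + \<kappa> \<le> (C1 + 1) * (\<alpha> + \<kappa>)" using C1 \<alpha>0 \<kappa>(2) by (simp add: algebra_simps)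
    then show ?thesis unfolding \<tau>eq L_def using R t by (intro mult_left_mono divide_right_mono) auto
  qed
  have loc: "\<exists>m M. M - m \<le> L \<and> (AE z in lborel. z \<in> ball y R \<longrightarrow> m \<le> u z \<and> u z \<le> M)" if y: "y \<in> ball x r" for y
  proof -
    have cube: "{z. \<forall>j\<in>Basis. \<bar>(z - y) \<bullet> j\<bar> \<le> 5 * R} \<subseteq> ball x (2 * r)"
    proof
      fix z assume "z \<in> {z. \<forall>j\<in>Basis. \<bar>(z - y) \<bullet> j\<bar> \<le> 5 * R}"
      then have "norm (z - y) \<le> (\<Sum>j\<in>(Basis::'a set). 5 * R)"
        by (intro order_trans[OF norm_le_l1] sum_mono) auto
      also have "\<dots> < r" unfolding rR using R n2 by (simp add: n_def)
      finally have "norm (z - y) < r" .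
      moreover have "norm (y - x) < r" using y by (simp add: dist_norm norm_minus_commute)
      ultimately show "z \<in> ball x (2 * r)"
        using norm_triangle_ineq[of "z - y" "y - x"] by (simp add: dist_norm norm_minus_commute)
    qed
    have lt: "ennreal (2 * DIM('a)) * (\<integral>\<^sup>+z\<in>ball x (2 * r). A (norm (g z)) \<partial>lebesgue) < ennreal (R * a)"
    proof -
      have "ennreal (2 * DIM('a)) * (\<integral>\<^sup>+z\<in>ball x (2 * r). A (norm (g z)) \<partial>lebesgue)
        < ennreal (2 * DIM('a)) * ennreal (\<alpha> * (unit_ball_vol DIM('a) * (2 * r) ^ DIM('a)))"
        using n by (intro ennreal_mult_strict_left_mono \<alpha>) auto
      also have "\<dots> = ennreal (2 * n * (\<alpha> * (\<omega> * (2 * r) ^ n)))"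
        using \<alpha>0 r \<omega> by (subst ennreal_mult[symmetric]) (auto simp: n_def \<omega>_def)
      also have "2 * n * (\<alpha> * (\<omega> * (2 * r) ^ n)) = R * a"
      proof -
        have "(2 * r) ^ n = (12 * real n) ^ n * (R * R ^ (n - 1))"
          using n2 by (simp add: rR power_mult_distrib flip: power_Suc)
        then show ?thesis by (simp add: a_def C1_def mult_ac)
      qed
      finally show ?thesis .
    qed
    obtain m M where "m \<le> M" "M - m \<le> 10 * \<tau>" "AE z in lborel. z \<in> ball y R \<longrightarrow> m \<le> u z \<and> u z \<le> M"
      by (rule weakly_monotone_cube[OF n wm B wg meas young R cube t \<kappa> lt, folded n_def, folded \<tau>_def])
    then show ?thesis using \<tau>L by (intro exI[of _ m] exI[of _ M]) auto
  qed
  have "r \<le> real (6 * n) * R" unfolding rR by simp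
  from ess_bound_chain[OF R r this L loc] obtain m M where
    mM: "M - m \<le> (2 * real (6 * n) + 1) * L" "AE z in lborel. z \<in> ball x r \<longrightarrow> m \<le> u z \<and> u z \<le> M" by blast
  have "(2 * real (6 * n) + 1) * L = osc_const DIM('a) * r * (\<alpha> + \<kappa>) / t"
    unfolding L_def osc_const_def n_def[symmetric] \<omega>_def[symmetric] C1_def[symmetric] rR by (simp add: algebra_simps)
  with mM show ?thesis by auto
qed

lemma essosc_le:
  fixes u :: "'a::euclidean_space \<Rightarrow> real"
  assumes u: "u \<in> borel_measurable (lebesgue_on S)" and S: "S \<in> sets lebesgue"
    and b: "AE z in lborel. z \<in> S \<longrightarrow> m \<le> u z \<and> u z \<le> M"
  shows "essosc S u \<le> ereal (M - m)"
proof -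
  have ae: "AE z in lebesgue_on S. m \<le> u z \<and> u z \<le> M"
  proof (rule AE_restrict_space_iff[THEN iffD2])
    show "S \<inter> space lebesgue \<in> sets lebesgue" using S by simp
    show "AE z in lebesgue. z \<in> S \<longrightarrow> m \<le> u z \<and> u z \<le> M" by (rule AE_completion[OF b])
  qed
  have m1: "(\<lambda>x. ereal (u x)) \<in> borel_measurable (lebesgue_on S)" "(\<lambda>x. - ereal (u x)) \<in> borel_measurable (lebesgue_on S)"
    using u by measurable
  have 1: "esssup (lebesgue_on S) (\<lambda>x. ereal (u x)) \<le> ereal M"
    using ae by (intro esssup_I m1) auto
  have 2: "esssup (lebesgue_on S) (\<lambda>x. - ereal (u x)) \<le> ereal (- m)"
    using ae by (intro esssup_I m1) auto
  have "essosc S u = esssup (lebesgue_on S) (\<lambda>x. ereal (u x)) + esssup (lebesgue_on S) (\<lambda>x. - ereal (u x))"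
    by (simp add: essosc_def essinf_def minus_ereal_def)
  also have "\<dots> \<le> ereal M + ereal (- m)" by (rule add_mono[OF 1 2])
  finally show ?thesis by simp
qed

subsection \<open>Young functions\<close>

lemma mono_ennreal_measurable:
  fixes f :: "real \<Rightarrow> ennreal"
  assumes "mono f"
  shows "f \<in> borel_measurable borel"
proof (rule borel_measurableI_greater)
  fix a
  have "is_interval {x. a < f x}"
    using assms unfolding is_interval_1 by (auto dest: monoD intro: less_le_trans)
  then have "{x. a < f x} \<in> sets borel" by (rule real_interval_borel_measurable)
  then show "{x \<in> space borel. a < f x} \<in> sets borel" by simp
qed

lemma young_scale:
  assumes A: "young_function A" and "t \<ge> 0" "0 \<le> \<theta>" "\<theta> \<le> 1"
  shows "A (\<theta> * t) \<le> ennreal \<theta> * A t"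
proof -
  have "A ((1 - \<theta>) * 0 + \<theta> * t) \<le> ennreal (1 - \<theta>) * A 0 + ennreal \<theta> * A t"
    using A assms(2-4) unfolding young_function_def by (meson atLeastAtMost_iff order_refl)
  then show ?thesis using A by (simp add: young_function_def)
qed

lemma young_mono:
  assumes A: "young_function A" and "0 \<le> s" "s \<le> t"
  shows "A s \<le> A t"
proof (cases "t = 0")
  case False
  then have t: "t > 0" using assms by simp
  have "A s = A ((s / t) * t)" using t by simp
  also have "\<dots> \<le> ennreal (s / t) * A t" using assms t by (intro young_scale[OF A]) auto
  also have "\<dots> \<le> 1 * A t" using assms t by (intro mult_right_mono) (auto simp: ennreal_le_1)
  finally show ?thesis by simp
qed (use assms in simp)

text \<open>The values of A at negative arguments are arbitrary; composed with
  \<open>max s 0\<close> it becomes monotone on the whole line, hence Borel.\<close>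

lemma young_extension_measurable [measurable]:
  assumes "young_function A"
  shows "(\<lambda>s. A (max s 0)) \<in> borel_measurable borel"
  by (intro mono_ennreal_measurable monoI young_mono[OF assms]) auto

lemma young_conj_mono: "mono (young_conj A)"
  unfolding young_conj_def
  by (intro monoI SUP_mono) (force intro: ennreal_minus_mono ennreal_leI mult_left_mono)

lemma young_conj_measurable [measurable]: "young_conj A \<in> borel_measurable borel"
  by (rule mono_ennreal_measurable[OF young_conj_mono])

lemma young_inequality:
  assumes "s \<ge> 0"
  shows "ennreal (s * k) \<le> A s + young_conj A k"
proof -
  have "ennreal (s * k) - A s \<le> young_conj A k"
    unfolding young_conj_def using assms by (intro SUP_upper) simp
  then show ?thesis by (simp add: ennreal_minus_le_iff)
qed

text \<open>For s <= y the product s b / y is at most b. For s > y convexity and A 0 = 0 give A s >=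
  s b / y, so the difference is zero.\<close>

lemma young_conj_le:
  assumes A: "young_function A" and y: "y > 0" and b: "b > 0" "ennreal b \<le> A y"
  shows "young_conj A (b / y) \<le> ennreal b"
  unfolding young_conj_def
proof (rule SUP_least)
  fix s :: real assume s: "s \<in> {0..}"
  show "ennreal (s * (b / y)) - A s \<le> ennreal b"
  proof (cases "s \<le> y")
    case True
    then have "s * (b / y) \<le> b" using s y b by (simp add: divide_le_eq mult.commute mult_left_mono)
    then have "ennreal (s * (b / y)) \<le> ennreal b + A s" by (meson add_increasing2 ennreal_leI zero_le)
    then show ?thesis by (simp add: ennreal_minus_le_iff add.commute)
  next
    case False
    then have sy: "s > y" by simp
    have "ennreal b \<le> A ((y / s) * s)" using b y sy by simp
    also have "\<dots> \<le> ennreal (y / s) * A s" using y sy by (intro young_scale[OF A]) auto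
    finally have "ennreal (s / y) * ennreal b \<le> ennreal (s / y) * (ennreal (y / s) * A s)"
      by (intro mult_left_mono) auto
    also have "\<dots> = (ennreal (s / y) * ennreal (y / s)) * A s" by (simp only: mult.assoc)
    also have "ennreal (s / y) * ennreal (y / s) = 1" using y sy by (simp flip: ennreal_mult)
    finally have "ennreal (s * (b / y)) \<le> A s" using y sy b by (simp flip: ennreal_mult)
    then have "ennreal (s * (b / y)) \<le> A s + ennreal b" by (simp add: add_increasing2)
    then show ?thesis by (simp add: ennreal_minus_le_iff)
  qed
qed

section \<open>Finiteness of the cone integral and its comparison with
  \<open>young_reduced\<close>\<close>

lemma cone_integral_1: "cone_integral (Suc 0) \<Psi> t = \<Psi> t"
  unfolding cone_integral_def by (simp add: nn_integral_cmult_indicator)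

lemma young_function_pos:
  assumes A: "young_function A"
  obtains y b where "y > 0" "b > 0" "ennreal b \<le> A y"
proof -
  obtain s t where st: "s > 0" "t > 0" "A s \<noteq> A t" using A by (auto simp: young_function_def)
  then obtain y where y: "y > 0" "A y \<noteq> 0" by metis
  define b where "b = (if A y = top then 1 else enn2real (A y))"
  have "b > 0" "ennreal b \<le> A y"
    unfolding b_def using y(2) by (auto simp: enn2real_positive_iff less_top[symmetric] zero_less_iff_neq_zero)
  with y(1) show ?thesis by (rule that)
qed

text \<open>If s contributes to the supremum then A s < s k, and by convexity A \<sigma> <= \<sigma>
  k on all of (0, s]. So s is at most the measure of this sublevel set, and the contribution is at
  most s k. Unlike the supremum, the integral form allows an exchange of integrals.\<close>

lemma young_conj_le_measure:
  assumes A: "young_function A" and k: "k > 0"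
  shows "young_conj A k \<le> ennreal k * (\<integral>\<^sup>+\<sigma>\<in>{0<..}. (if A (max \<sigma> 0) \<le> ennreal (\<sigma> * k) then 1 else 0) \<partial>lborel)"
    (is "_ \<le> _ * ?I")
  unfolding young_conj_def
proof (rule SUP_least)
  fix s :: real assume s: "s \<in> {0..}"
  show "ennreal (s * k) - A s \<le> ennreal k * ?I"
  proof (cases "ennreal (s * k) \<le> A s")
    case True
    then have "ennreal (s * k) \<le> A s + ennreal k * ?I" by (simp add: add_increasing2)
    then show ?thesis by (simp add: ennreal_minus_le_iff)
  next
    case False
    have "ennreal s = (\<integral>\<^sup>+\<sigma>. indicator {0<..s} \<sigma> \<partial>lborel)" using s by simp
    also have "\<dots> \<le> ?I"
    proof (rule nn_integral_mono)
      fix \<sigma> :: real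
      show "indicator {0<..s} \<sigma> \<le> (if A (max \<sigma> 0) \<le> ennreal (\<sigma> * k) then 1 else 0 :: ennreal) * indicator {0<..} \<sigma>"
      proof (cases "\<sigma> \<in> {0<..s}")
        case True
        then have \<sigma>: "0 < \<sigma>" "\<sigma> \<le> s" by auto
        have "A \<sigma> = A ((\<sigma> / s) * s)" using \<sigma> by simp
        also have "\<dots> \<le> ennreal (\<sigma> / s) * A s" using \<sigma> by (intro young_scale[OF A]) auto
        also have "\<dots> \<le> ennreal (\<sigma> / s) * ennreal (s * k)" using False by (intro mult_left_mono) auto
        also have "\<dots> = ennreal (\<sigma> * k)" using \<sigma> k by (simp flip: ennreal_mult)
        finally have "A (max \<sigma> 0) \<le> ennreal (\<sigma> * k)" using \<sigma> by (simp add: max_def)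
        then show ?thesis using \<sigma> by (auto simp: indicator_def)
      qed simp
    qed
    finally have "ennreal k * ennreal s \<le> ennreal k * ?I" by (intro mult_left_mono) auto
    then have "ennreal (s * k) \<le> ennreal k * ?I" using s k by (simp flip: ennreal_mult add: mult.commute)
    then have "ennreal (s * k) \<le> A s + ennreal k * ?I" by (simp add: add_increasing)
    then show ?thesis by (simp add: ennreal_minus_le_iff)
  qed
qed

text \<open>
  By \<open>young_conj_le_measure\<close> the integrand is at most the measure of
  \<open>{\<sigma>. A \<sigma> \<le> \<sigma> / \<theta> ^ (n - 2)}\<close>; exchanging the integrals, \<open>\<theta>\<close> then ranges up to the power
  \<open>1 / (n - 2)\<close> of \<open>\<sigma> / A \<sigma>\<close>.
\<close>

lemma growth_cone_integral_finite:
  assumes A: "young_function A" and n: "n \<ge> 3" and growth: "young_growth n A"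
  shows "cone_integral (n - 1) (young_conj A) 1 < \<infinity>"
proof -
  define q where "q = 1 / (real n - 2)"
  define m where "m = n - 2"
  have m: "m \<ge> 1" "n - 1 - 1 = m" "q = 1 / real m" using n unfolding m_def q_def by (auto simp: of_nat_diff)
  define B where "B s = A (max s 0)" for s
  have [measurable]: "B \<in> borel_measurable borel" unfolding B_def using A by measurable
  define P where "P = (\<lambda>a. (\<integral>\<^sup>+ t\<in>{a..}. ennreal_powr (ennreal t / A t) q \<partial>lborel) < \<infinity>)"
  have "\<forall>\<^sub>F a in at_top. P a" using growth unfolding young_growth_def P_def q_def .
  then obtain a0 where a0: "\<And>a. a \<ge> a0 \<Longrightarrow> P a" by (auto simp: eventually_at_top_linorder)
  define a where "a = max a0 1"
  have a: "a > 0" "P a" unfolding a_def using a0[of "max a0 1"] by auto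
  define E where "E \<theta> \<sigma> = (if B \<sigma> \<le> ennreal (\<sigma> * (1 / \<theta> ^ m)) then 1 else 0 :: ennreal)" for \<theta> \<sigma> :: real
  have [measurable]: "case_prod E \<in> borel_measurable (lborel \<Otimes>\<^sub>M lborel)" unfolding E_def by measurable
  have [measurable]: "(\<lambda>(\<sigma>, \<theta>). E \<theta> \<sigma>) \<in> borel_measurable (lborel \<Otimes>\<^sub>M lborel)" unfolding E_def by measurable
  have [measurable]: "E \<theta> \<in> borel_measurable borel" for \<theta> unfolding E_def by measurable
  have "cone_integral (n - 1) (young_conj A) 1 = (\<integral>\<^sup>+\<theta>\<in>{0<..<1}. ennreal (\<theta> ^ m) * young_conj A (1 / \<theta> ^ m) \<partial>lborel)"
    unfolding cone_integral_def m(2) ..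
  also have "\<dots> \<le> (\<integral>\<^sup>+\<theta>. (\<integral>\<^sup>+\<sigma>. E \<theta> \<sigma> * indicator {0<..} \<sigma> * indicator {0<..<1} \<theta> \<partial>lborel) \<partial>lborel)"
  proof (rule nn_integral_mono)
    fix \<theta> :: real
    show "ennreal (\<theta> ^ m) * young_conj A (1 / \<theta> ^ m) * indicator {0<..<1} \<theta>
      \<le> (\<integral>\<^sup>+\<sigma>. E \<theta> \<sigma> * indicator {0<..} \<sigma> * indicator {0<..<1} \<theta> \<partial>lborel)"
    proof (cases "\<theta> \<in> {0<..<1}")
      case True
      then have \<theta>: "\<theta> ^ m > 0" by simp
      have "ennreal (\<theta> ^ m) * young_conj A (1 / \<theta> ^ m) \<le> ennreal (\<theta> ^ m) * (ennreal (1 / \<theta> ^ m) * (\<integral>\<^sup>+\<sigma>\<in>{0<..}. E \<theta> \<sigma> \<partial>lborel))"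
        unfolding E_def B_def using \<theta> by (intro mult_left_mono young_conj_le_measure[OF A]) auto
      also have "\<dots> = (ennreal (\<theta> ^ m) * ennreal (1 / \<theta> ^ m)) * (\<integral>\<^sup>+\<sigma>\<in>{0<..}. E \<theta> \<sigma> \<partial>lborel)" by (simp only: mult.assoc)
      also have "ennreal (\<theta> ^ m) * ennreal (1 / \<theta> ^ m) = 1"
      proof -
        have "ennreal c * ennreal (1 / c) = 1" if "c > 0" for c
          using that by (simp flip: ennreal_mult)
        from this[OF \<theta>] show ?thesis .
      qed
      finally show ?thesis using True by simp
    qed simp
  qed
  also have "\<dots> = (\<integral>\<^sup>+\<sigma>. (\<integral>\<^sup>+\<theta>. E \<theta> \<sigma> * indicator {0<..} \<sigma> * indicator {0<..<1} \<theta> \<partial>lborel) \<partial>lborel)"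
    by (rule lborel_pair.Fubini') measurable
  also have "\<dots> \<le> (\<integral>\<^sup>+\<sigma>. indicator {0..a} \<sigma> + ennreal_powr (ennreal \<sigma> / A \<sigma>) q * indicator {a..} \<sigma> \<partial>lborel)"
  proof (rule nn_integral_mono)
    fix \<sigma> :: real
    \<comment> \<open>Up to \<open>a\<close> the growth hypothesis gives nothing, and the range of
      \<theta> bounds the inner integral by 1. Beyond \<open>a\<close> the inequality A \<sigma> <=
      \<sigma> / \<theta>^m forces \<theta> <= (\<sigma> / A \<sigma>)^q.\<close>
    consider "\<sigma> \<le> 0" | "0 < \<sigma>" "\<sigma> \<le> a" | "a < \<sigma>" by linarith
    then show "(\<integral>\<^sup>+\<theta>. E \<theta> \<sigma> * indicator {0<..} \<sigma> * indicator {0<..<1} \<theta> \<partial>lborel)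
      \<le> indicator {0..a} \<sigma> + ennreal_powr (ennreal \<sigma> / A \<sigma>) q * indicator {a..} \<sigma>"
    proof cases
      case 1
      then show ?thesis by simp
    next
      case 2
      have "(\<integral>\<^sup>+\<theta>. E \<theta> \<sigma> * indicator {0<..} \<sigma> * indicator {0<..<1} \<theta> \<partial>lborel) \<le> (\<integral>\<^sup>+\<theta>. indicator {0<..<1::real} \<theta> \<partial>lborel)"
        by (intro nn_integral_mono) (auto simp: E_def indicator_def)
      then show ?thesis using 2 by (simp add: add_increasing2)
    next
      case 3
      have \<sigma>: "\<sigma> > 0" using 3 a by simp
      then have B: "B \<sigma> = A \<sigma>" by (simp add: B_def max_def)
      have "(\<integral>\<^sup>+\<theta>. E \<theta> \<sigma> * indicator {0<..} \<sigma> * indicator {0<..<1} \<theta> \<partial>lborel) \<le> ennreal_powr (ennreal \<sigma> / A \<sigma>) q"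
      \<comment> \<open>An infinite quotient, which occurs when A \<sigma> = 0, makes the right-hand
        side infinite.\<close>
      proof (cases "ennreal \<sigma> / A \<sigma> = \<infinity>")
        case False
        then have A0: "A \<sigma> \<noteq> 0" using \<sigma> by (auto simp: ennreal_divide_zero)
        define x where "x = enn2real (ennreal \<sigma> / A \<sigma>)"
        have "(\<integral>\<^sup>+\<theta>. E \<theta> \<sigma> * indicator {0<..} \<sigma> * indicator {0<..<1} \<theta> \<partial>lborel) \<le> (\<integral>\<^sup>+\<theta>. indicator {0..x powr q} \<theta> \<partial>lborel)"
        proof (rule nn_integral_mono)
          fix \<theta> :: real
          show "E \<theta> \<sigma> * indicator {0<..} \<sigma> * indicator {0<..<1} \<theta> \<le> indicator {0..x powr q} \<theta>"
          proof (cases "\<theta> \<in> {0<..<1} \<and> B \<sigma> \<le> ennreal (\<sigma> * (1 / \<theta> ^ m))")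
            case True
            then have \<theta>: "0 < \<theta>" "\<theta> < 1" and le: "A \<sigma> \<le> ennreal (\<sigma> * (1 / \<theta> ^ m))" by (auto simp: B)
            have "A \<sigma> < top" using le by (rule le_less_trans) simp
            then obtain y where y: "A \<sigma> = ennreal y" "y \<ge> 0" by (cases "A \<sigma>") auto
            with A0 have y0: "y > 0" by (simp add: less_le)
            have "x = \<sigma> / y" unfolding x_def y using \<sigma> y0 by (simp add: divide_ennreal)
            then have x: "y * x = \<sigma>" using y0 by simp
            have "y \<le> \<sigma> * (1 / \<theta> ^ m)" using le \<sigma> \<theta> unfolding y by (subst (asm) ennreal_le_iff) auto
            then have "y * \<theta> ^ m \<le> y * x" unfolding x using \<theta> by (simp add: field_simps)
            then have "\<theta> ^ m \<le> x" using y0 by simp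
            then have "\<theta> powr real m \<le> x" using \<theta> by (simp add: powr_realpow)
            then have "(\<theta> powr real m) powr q \<le> x powr q" using m by (intro powr_mono2) auto
            then have "\<theta> \<le> x powr q" using \<theta> m by (simp add: powr_powr)
            then show ?thesis using \<theta> by (auto simp: E_def indicator_def)
          qed (auto simp: E_def indicator_def)
        qed
        also have "\<dots> = ennreal (x powr q)" by simp
        finally show ?thesis using False by (simp add: ennreal_powr_def x_def)
      qed (simp add: ennreal_powr_def)
      then show ?thesis using 3 by (simp add: add_increasing)
    qed
  qed
  also have "\<dots> \<le> (\<integral>\<^sup>+\<sigma>. indicator {0..a} \<sigma> \<partial>lborel) + (\<integral>\<^sup>+ t\<in>{a..}. ennreal_powr (ennreal t / A t) q \<partial>lborel)"
  proof -
    \<comment> \<open>Measurability is proved for \<open>B\<close> and transferred, since the two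
      functions agree on the half-line beyond \<open>a\<close>.\<close>
    have meas: "(\<lambda>\<sigma>. ennreal_powr (ennreal \<sigma> / A \<sigma>) q * indicator {a..} \<sigma>) \<in> borel_measurable lborel"
    proof -
      have "(\<lambda>\<sigma>. ennreal_powr (ennreal \<sigma> / B \<sigma>) q * indicator {a..} \<sigma>) \<in> borel_measurable lborel"
        unfolding ennreal_powr_def by measurable
      also have "(\<lambda>\<sigma>. ennreal_powr (ennreal \<sigma> / B \<sigma>) q * indicator {a..} \<sigma>) = (\<lambda>\<sigma>. ennreal_powr (ennreal \<sigma> / A \<sigma>) q * indicator {a..} \<sigma>)"
        using a by (auto simp: B_def indicator_def max_def)
      finally show ?thesis .
    qed
    show ?thesis using meas by (subst nn_integral_add) auto
  qed
  also have "\<dots> < \<infinity>" using a unfolding P_def by (simp add: ennreal_add_eq_top less_top[symmetric])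
  finally show ?thesis .
qed

text \<open>Substitute \<theta> = (t / r)^q with q = 1 / (n - 2), so that \<theta>^(n-2) = t / r.
  The derivative contributes a factor q <= 1, and estimating it by 1 leaves an inequality.\<close>

lemma cone_integral_le_reduced:
  fixes \<Psi> :: "real \<Rightarrow> ennreal"
  assumes n: "n \<ge> 3" and t: "t > 0" and [measurable]: "\<Psi> \<in> borel_measurable borel"
  defines "p \<equiv> (real n - 1) / (real n - 2)"
  shows "cone_integral (n - 1) \<Psi> t
    \<le> ennreal (t powr p) * (\<integral>\<^sup>+ r\<in>{t<..}. \<Psi> r / ennreal (r powr (1 + p)) \<partial>lborel)"
proof -
  define m where "m = n - 2"
  have m: "m \<ge> 1" "n - 1 - 1 = m" using n unfolding m_def by auto
  define q where "q = 1 / real m"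
  have q: "0 < q" "q \<le> 1" "p = 1 + q" using n m(1) unfolding p_def q_def m_def by (auto simp: of_nat_diff field_simps)
  define f where "f \<theta> = ennreal (\<theta> ^ m) * \<Psi> (t / \<theta> ^ m)" for \<theta> :: real
  have [measurable]: "f \<in> borel_measurable borel" unfolding f_def by measurable
  let ?\<Phi> = "ennreal (t powr p) * (\<integral>\<^sup>+ r\<in>{t<..}. \<Psi> r / ennreal (r powr (1 + p)) \<partial>lborel)"
  have part: "(\<integral>\<^sup>+\<theta>. f \<theta> * indicator {\<epsilon>..1} \<theta> \<partial>lborel) \<le> ?\<Phi>" if \<epsilon>: "0 < \<epsilon>" "\<epsilon> < 1" for \<epsilon>
  proof -
    define K where "K = t / \<epsilon> ^ m"
    have K: "K > t" unfolding K_def using t \<epsilon> m(1) power_less_one_iff[of \<epsilon> m] by (simp add: less_divide_eq)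
    \<comment> \<open>The substitution rule is applied to an increasing map, whereas \<theta>
      decreases in r; hence the variable x = -r.\<close>
    define g where "g x = (t / (- x)) powr q" for x
    have g1: "g (- t) = 1" unfolding g_def using t by simp
    have g2: "g (- K) = \<epsilon>"
    proof -
      have "g (- K) = (\<epsilon> ^ m) powr q" unfolding g_def K_def using t \<epsilon> by simp
      also have "\<dots> = (\<epsilon> powr real m) powr q" using \<epsilon> by (simp add: powr_realpow)
      also have "\<dots> = \<epsilon>" using \<epsilon> m by (simp add: powr_powr q_def)
      finally show ?thesis .
    qed
    have der: "(g has_real_derivative q * (t / (- x)) powr q / (- x)) (at x)" if "x \<in> {- K..- t}" for x
    proof -
      have x: "x < 0" using that t by auto
      have "((\<lambda>x. (t / (- x)) powr q) has_real_derivative q * (t / (- x)) powr (q - 1) * (t / x^2)) (at x)"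
        using x t by (auto intro!: derivative_eq_intros simp: power2_eq_square divide_less_0_iff zero_less_divide_iff)
      moreover have "q * (t / (- x)) powr (q - 1) * (t / x^2) = q * (t / (- x)) powr q / (- x)"
        using x t by (simp add: powr_diff power2_eq_square divide_less_0_iff zero_less_divide_iff field_simps)
      ultimately show ?thesis unfolding g_def by simp
    qed
    have cont: "continuous_on {- K..- t} (\<lambda>x. q * (t / (- x)) powr q / (- x))"
      using t by (intro continuous_intros) auto
    have "(\<integral>\<^sup>+\<theta>. f \<theta> * indicator {g (- K)..g (- t)} \<theta> \<partial>lborel)
      = (\<integral>\<^sup>+x. f (g x) * ennreal (q * (t / (- x)) powr q / (- x)) * indicator {- K..- t} x \<partial>lborel)"
    proof (rule nn_integral_substitution_aux[OF _ _ der cont])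
      show "q * (t / (- x)) powr q / (- x) \<ge> 0" if "x \<in> {- K..- t}" for x
        using q t that by (intro divide_nonneg_nonneg mult_nonneg_nonneg) auto
    qed (use K in auto)
    also have "\<dots> \<le> (\<integral>\<^sup>+x. ennreal (t powr p) * (\<Psi> (- x) / ennreal ((- x) powr (1 + p)) * indicator {t..} (- x)) \<partial>lborel)"
    proof (rule nn_integral_mono)
      fix x
      show "f (g x) * ennreal (q * (t / (- x)) powr q / (- x)) * indicator {- K..- t} x
        \<le> ennreal (t powr p) * (\<Psi> (- x) / ennreal ((- x) powr (1 + p)) * indicator {t..} (- x))"
      proof (cases "x \<in> {- K..- t}")
        case True
        define r where "r = - x"
        have r: "r \<ge> t" "r > 0" using True t by (auto simp: r_def)
        have gm: "(g x) ^ m = t / r"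
        proof -
          have "(g x) ^ m = ((t / r) powr q) powr real m"
            unfolding g_def r_def[symmetric] using r t by (simp add: powr_realpow)
          also have "\<dots> = t / r" using r t m by (simp add: powr_powr q_def)
          finally show ?thesis .
        qed
        have fgx: "f (g x) = ennreal (t / r) * \<Psi> r" unfolding f_def gm using r t by simp
        have "f (g x) * ennreal (q * (t / r) powr q / r) = ennreal (t / r * (q * (t / r) powr q / r)) * \<Psi> r"
        proof -
          have "ennreal (t / r * (q * (t / r) powr q / r)) = ennreal (t / r) * ennreal (q * (t / r) powr q / r)"
            using r t q by (intro ennreal_mult) auto
          then show ?thesis using fgx by (simp only: mult_ac)
        qed
        also have "t / r * (q * (t / r) powr q / r) \<le> t powr p / r powr (1 + p)"
        proof -
          have "t / r * (q * (t / r) powr q / r) = q * (t powr p / r powr (1 + p))"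
            using r t unfolding q(3) by (simp add: powr_divide powr_add field_simps power2_eq_square)
          also have "\<dots> \<le> 1 * (t powr p / r powr (1 + p))" using q by (intro mult_right_mono) auto
          finally show ?thesis by simp
        qed
        then have "ennreal (t / r * (q * (t / r) powr q / r)) * \<Psi> r \<le> ennreal (t powr p / r powr (1 + p)) * \<Psi> r"
          by (intro mult_right_mono ennreal_leI) auto
        also have "\<dots> = ennreal (t powr p) * (\<Psi> r / ennreal (r powr (1 + p)))"
          using r t by (simp add: divide_ennreal[symmetric] ennreal_times_divide mult.commute)
        finally show ?thesis using True r by (simp add: r_def)
      qed simp
    qed
    also have "\<dots> = ennreal (t powr p) * (\<integral>\<^sup>+x. \<Psi> (- x) / ennreal ((- x) powr (1 + p)) * indicator {t..} (- x) \<partial>lborel)"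
      by (rule nn_integral_cmult) measurable
    also have "(\<integral>\<^sup>+x. \<Psi> (- x) / ennreal ((- x) powr (1 + p)) * indicator {t..} (- x) \<partial>lborel)
        = (\<integral>\<^sup>+ r\<in>{t..}. \<Psi> r / ennreal (r powr (1 + p)) \<partial>lborel)"
      using nn_integral_lborel_reflect[of "\<lambda>r. \<Psi> r / ennreal (r powr (1 + p)) * indicator {t..} r" 0] by simp
    also have "\<dots> = (\<integral>\<^sup>+ r\<in>{t<..}. \<Psi> r / ennreal (r powr (1 + p)) \<partial>lborel)"
    proof (rule nn_integral_cong_AE)
      have "AE r in lborel. r \<noteq> t" by (rule AE_lborel_singleton)
      then show "AE r in lborel. \<Psi> r / ennreal (r powr (1 + p)) * indicator {t..} r = \<Psi> r / ennreal (r powr (1 + p)) * indicator {t<..} r"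
        by eventually_elim (auto simp: indicator_def)
    qed
    finally show ?thesis unfolding g1 g2 .
  qed
  have "cone_integral (n - 1) \<Psi> t = (\<integral>\<^sup>+\<theta>. f \<theta> * indicator {0<..<1} \<theta> \<partial>lborel)"
    unfolding cone_integral_def m(2) f_def ..
  \<comment> \<open>The substitution is carried out on [\<epsilon>, 1], and Fatou's lemma lets
    \<epsilon> tend to 0. The denominators start at 2 because \<open>part\<close> requires
    \<epsilon> < 1.\<close>
  also have "\<dots> \<le> (\<integral>\<^sup>+\<theta>. liminf (\<lambda>k. f \<theta> * indicator {1 / real (Suc (Suc k))..1} \<theta>) \<partial>lborel)"
  proof (rule nn_integral_mono)
    fix \<theta> :: real
    show "f \<theta> * indicator {0<..<1} \<theta> \<le> liminf (\<lambda>k. f \<theta> * indicator {1 / real (Suc (Suc k))..1} \<theta>)"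
    proof (cases "\<theta> \<in> {0<..<1}")
      case True
      then obtain N where N: "1 / real (Suc N) < \<theta>" using nat_approx_posE[of \<theta>] by auto
      have "\<forall>\<^sub>F k in sequentially. f \<theta> \<le> f \<theta> * indicator {1 / real (Suc (Suc k))..1} \<theta>"
      proof (rule eventually_sequentiallyI[of N])
        fix k assume "N \<le> k"
        then have "1 / real (Suc (Suc k)) \<le> 1 / real (Suc N)" by (intro divide_left_mono) auto
        then show "f \<theta> \<le> f \<theta> * indicator {1 / real (Suc (Suc k))..1} \<theta>" using N True by (simp add: indicator_def)
      qed
      then show ?thesis using True by (simp add: Liminf_bounded)
    qed simp
  qed
  also have "\<dots> \<le> liminf (\<lambda>k. \<integral>\<^sup>+\<theta>. f \<theta> * indicator {1 / real (Suc (Suc k))..1} \<theta> \<partial>lborel)"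
    by (rule nn_integral_liminf) measurable
  also have "\<dots> \<le> limsup (\<lambda>k. \<integral>\<^sup>+\<theta>. f \<theta> * indicator {1 / real (Suc (Suc k))..1} \<theta> \<partial>lborel)"
    by (rule Liminf_le_Limsup) simp
  also have "\<dots> \<le> ?\<Phi>"
    by (intro Limsup_bounded always_eventually allI part) auto
  finally show ?thesis .
qed

text \<open>
  The factor \<open>2\<close> accommodates the case \<open>n = 2\<close>: there \<open>t\<close> is chosen as a slope \<open>b / y\<close> with
  \<open>\<beta> < b < A y\<close>, which costs \<open>\<beta> + b\<close> but avoids the biconjugate of \<open>A\<close>.
\<close>

lemma right_inverse_bound:
  fixes e :: ereal and C \<beta> :: real
  assumes A: "young_function A" and n: "n \<ge> 2" and \<beta>: "\<beta> \<ge> 0" and C: "C > 0"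
    and bound: "\<And>t \<kappa>. t > 0 \<Longrightarrow> \<kappa> \<ge> 0 \<Longrightarrow> cone_integral (n - 1) (young_conj A) t = ennreal \<kappa>
      \<Longrightarrow> e \<le> ereal (C * (\<beta> + \<kappa>) / t)"
  shows "e \<le> enn2ereal (ennreal (2 * C) * right_inverse (young_reduced n A) (ennreal \<beta>))"
proof -
  have key: "e \<le> ereal (2 * C * y)" if y: "y \<ge> 0" and less: "ennreal \<beta> < young_reduced n A y" for y
  proof (cases "n = 2")
    case True
    then have Ay: "ennreal \<beta> < A y" using less by (simp add: young_reduced_def)
    have y0: "y > 0"
    proof (rule ccontr)
      assume "\<not> y > 0"
      then have "A y = 0" using y A by (simp add: young_function_def)
      with Ay show False by simp
    qed
    obtain b' where b': "ennreal \<beta> < b'" "b' < A y" using dense[OF Ay] by blast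
    define b where "b = enn2real b'"
    have "b' < top" using b'(2) by (rule less_le_trans) simp
    then have b'e: "b' = ennreal b" unfolding b_def by simp
    have b: "b > \<beta>" "b > 0" using b'(1) \<beta> unfolding b'e by (auto simp: ennreal_less_iff)
    have le: "young_conj A (b / y) \<le> ennreal b"
      using b'(2) b by (intro young_conj_le[OF A y0]) (auto simp: b'e)
    define \<kappa> where "\<kappa> = enn2real (young_conj A (b / y))"
    have fin: "young_conj A (b / y) < top" using le by (rule le_less_trans) simp
    have \<kappa>: "young_conj A (b / y) = ennreal \<kappa>" "\<kappa> \<ge> 0" unfolding \<kappa>_def using fin by auto
    have "\<kappa> \<le> b" using le b unfolding \<kappa>(1) by (simp add: ennreal_le_iff)
    have "e \<le> ereal (C * (\<beta> + \<kappa>) / (b / y))"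
      using y0 b \<kappa> True by (intro bound) (auto simp: cone_integral_1)
    also have "C * (\<beta> + \<kappa>) / (b / y) \<le> 2 * C * y"
    proof -
      have "C * (\<beta> + \<kappa>) \<le> C * (2 * b)" using \<open>\<kappa> \<le> b\<close> b C by (intro mult_left_mono) auto
      then have "C * (\<beta> + \<kappa>) * y \<le> C * (2 * b) * y" using y0 by (intro mult_right_mono) auto
      then show ?thesis using b y0 by (simp add: field_simps)
    qed
    finally show ?thesis by simp
  next
    case False
    then have n3: "n \<ge> 3" using n by simp
    define p where "p = (real n - 1) / (real n - 2)"
    define \<Phi> where "\<Phi> t = (if t = 0 then 0 else ennreal (t powr p) *
               (\<integral>\<^sup>+ r\<in>{t<..}. young_conj A r / ennreal (r powr (1 + p)) \<partial>lborel))" for t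
    have "young_reduced n A = young_conj \<Phi>"
      unfolding young_reduced_def \<Phi>_def[abs_def] p_def Let_def using False by simp
    with less have "ennreal \<beta> < (SUP s\<in>{0..}. ennreal (s * y) - \<Phi> s)"
      by (simp add: young_conj_def)
    \<comment> \<open>Any t witnessing that the supremum defining the conjugate exceeds \<beta>
      satisfies \<beta> + \<Phi> t < t y, which is the estimate needed after division by t. It is
      not 0, since the term at 0 vanishes.\<close>
    then obtain t where t: "t \<ge> 0" "ennreal \<beta> < ennreal (t * y) - \<Phi> t"
      by (auto simp: less_SUP_iff)
    then have t0: "t > 0" by (cases "t = 0") (auto simp: \<Phi>_def)
    have "\<Phi> t < top"
    proof (rule ccontr)
      assume "\<not> \<Phi> t < top"
      then have "\<Phi> t = top" by (metis top.not_eq_extremum)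
      with t(2) show False by simp
    qed
    define \<phi> where "\<phi> = enn2real (\<Phi> t)"
    have \<phi>: "\<Phi> t = ennreal \<phi>" "\<phi> \<ge> 0" unfolding \<phi>_def using \<open>\<Phi> t < top\<close> by auto
    have "ennreal \<beta> < ennreal (t * y - \<phi>)"
      using t(2) \<phi> by (simp add: ennreal_minus)
    then have ty: "\<beta> < t * y - \<phi>" using \<beta> by (simp add: ennreal_less_iff)
    have le: "cone_integral (n - 1) (young_conj A) t \<le> ennreal \<phi>"
      using cone_integral_le_reduced[OF n3 t0 young_conj_measurable, of A] t0 \<phi>(1) by (simp add: \<Phi>_def p_def)
    define \<kappa> where "\<kappa> = enn2real (cone_integral (n - 1) (young_conj A) t)"
    have fin: "cone_integral (n - 1) (young_conj A) t < top" using le by (rule le_less_trans) simp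
    have \<kappa>: "cone_integral (n - 1) (young_conj A) t = ennreal \<kappa>" "\<kappa> \<ge> 0" unfolding \<kappa>_def using fin by auto
    have "\<kappa> \<le> \<phi>" using le \<phi> unfolding \<kappa>(1) by (simp add: ennreal_le_iff)
    have "e \<le> ereal (C * (\<beta> + \<kappa>) / t)" by (rule bound[OF t0 \<kappa>(2,1)])
    also have "C * (\<beta> + \<kappa>) / t \<le> 2 * C * y"
    proof -
      have "\<beta> + \<kappa> \<le> t * y" using ty \<open>\<kappa> \<le> \<phi>\<close> by simp
      then have "C * (\<beta> + \<kappa>) \<le> C * (t * y)" using C by (intro mult_left_mono) auto
      also have "\<dots> \<le> 2 * C * y * t" using C y t0 by (simp add: mult_ac)
      finally show ?thesis using t0 by (simp add: divide_le_eq)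
    qed
    finally show ?thesis by simp
  qed
  let ?\<rho> = "right_inverse (young_reduced n A) (ennreal \<beta>)"
  show ?thesis
  \<comment> \<open>The bound holds for each y in the set whose infimum is the right inverse. A real
    w strictly between the two sides would produce such a y with 2 C y < w, contradicting it; the
    empty set needs no separate case.\<close>
  proof (rule ccontr)
    assume "\<not> ?thesis"
    then have gt: "enn2ereal (ennreal (2 * C) * ?\<rho>) < e" by simp
    then obtain w where w: "enn2ereal (ennreal (2 * C) * ?\<rho>) < ereal w" "ereal w < e"
      using ereal_dense2 by blast
    have w0: "w > 0" using w(1) by (metis enn2ereal_nonneg ereal_less(2) le_less_trans)
    have "ennreal (2 * C) * ?\<rho> < ennreal w"
      using w(1) w0 by (metis enn2ereal_ennreal less_ennreal.rep_eq less_imp_le)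
    have "?\<rho> < ennreal (w / (2 * C))"
    proof (rule ccontr)
      assume "\<not> ?\<rho> < ennreal (w / (2 * C))"
      then have "ennreal (2 * C) * ennreal (w / (2 * C)) \<le> ennreal (2 * C) * ?\<rho>" by (intro mult_left_mono) auto
      moreover have "ennreal (2 * C) * ennreal (w / (2 * C)) = ennreal w"
        using C w0 by (simp flip: ennreal_mult)
      ultimately show False using \<open>ennreal (2 * C) * ?\<rho> < ennreal w\<close> by simp
    qed
    then obtain y where y: "0 \<le> y" "ennreal \<beta> < young_reduced n A y" "ennreal y < ennreal (w / (2 * C))"
      unfolding right_inverse_def Inf_less_iff by auto
    then have "y < w / (2 * C)" by (simp add: ennreal_less_iff)
    then have "2 * C * y < w" using C by (simp add: less_divide_eq mult.commute)
    then have "ereal (2 * C * y) < e" using w(2) by (meson ereal_less_eq(3) le_less_trans less_imp_le)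
    then show False using key[OF y(1,2)] by simp
  qed
qed

subsection \<open>Differentiability at Lebesgue points\<close>

lemma lebesgue_point_vector:
  fixes G :: "'a::euclidean_space \<Rightarrow> 'a"
  assumes [measurable]: "G \<in> borel_measurable borel"
    and lp: "\<And>b. b \<in> Basis \<Longrightarrow> lebesgue_point (\<lambda>z. G z \<bullet> b) x" and e: "e > 0"
  shows "\<exists>d>0. \<forall>r. 0 < r \<and> r < d \<longrightarrow>
     (\<integral>\<^sup>+y\<in>ball x r. ennreal (norm (G y - G x)) \<partial>lborel) \<le> ennreal (e * r ^ DIM('a))"
proof -
  define e' where "e' = e / DIM('a)"
  have e': "e' > 0" unfolding e'_def using e by simp
  have "\<forall>b\<in>Basis. \<exists>d>0. \<forall>r. 0 < r \<and> r < d \<longrightarrow>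
     (\<integral>\<^sup>+y\<in>ball x r. ennreal \<bar>G y \<bullet> b - G x \<bullet> b\<bar> \<partial>lborel) \<le> ennreal (e' * r ^ DIM('a))"
    using lp e' unfolding lebesgue_point_def by blast
  from bchoice[OF this] obtain d where d: "\<And>b. b \<in> Basis \<Longrightarrow> d b > 0"
    "\<And>b r. b \<in> Basis \<Longrightarrow> 0 < r \<Longrightarrow> r < d b \<Longrightarrow>
     (\<integral>\<^sup>+y\<in>ball x r. ennreal \<bar>G y \<bullet> b - G x \<bullet> b\<bar> \<partial>lborel) \<le> ennreal (e' * r ^ DIM('a))" by blast
  define D where "D = Min (d ` Basis)"
  have D: "D > 0" "\<And>b. b \<in> Basis \<Longrightarrow> D \<le> d b"
    unfolding D_def using d(1) by auto
  have "(\<integral>\<^sup>+y\<in>ball x r. ennreal (norm (G y - G x)) \<partial>lborel) \<le> ennreal (e * r ^ DIM('a))" if r: "0 < r" "r < D" for r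
  proof -
    have [measurable]: "ball x r \<in> sets borel" by simp
    have "(\<integral>\<^sup>+y\<in>ball x r. ennreal (norm (G y - G x)) \<partial>lborel)
      \<le> (\<integral>\<^sup>+y. (\<Sum>b\<in>Basis. ennreal \<bar>G y \<bullet> b - G x \<bullet> b\<bar> * indicator (ball x r) y) \<partial>lborel)"
    proof (rule nn_integral_mono)
      fix y
      have "norm (G y - G x) \<le> (\<Sum>b\<in>Basis. \<bar>G y \<bullet> b - G x \<bullet> b\<bar>)"
        using norm_le_l1[of "G y - G x"] by (simp add: inner_diff_left)
      then have "ennreal (norm (G y - G x)) \<le> (\<Sum>b\<in>Basis. ennreal \<bar>G y \<bullet> b - G x \<bullet> b\<bar>)"
        by (subst sum_ennreal) (auto intro: ennreal_leI)
      then show "ennreal (norm (G y - G x)) * indicator (ball x r) y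
        \<le> (\<Sum>b\<in>Basis. ennreal \<bar>G y \<bullet> b - G x \<bullet> b\<bar> * indicator (ball x r) y)"
        by (simp add: sum_distrib_right[symmetric] mult_right_mono)
    qed
    also have "\<dots> = (\<Sum>b\<in>Basis. (\<integral>\<^sup>+y\<in>ball x r. ennreal \<bar>G y \<bullet> b - G x \<bullet> b\<bar> \<partial>lborel))"
      by (rule nn_integral_sum) measurable
    also have "\<dots> \<le> (\<Sum>b\<in>(Basis::'a set). ennreal (e' * r ^ DIM('a)))"
      using D(2) r by (intro sum_mono d(2)) (auto intro: less_le_trans)
    also have "\<dots> = ennreal (e * r ^ DIM('a))"
      using e r by (subst sum_ennreal) (auto simp: e'_def)
    finally show ?thesis .
  qed
  with D(1) show ?thesis by blast
qed

lemma nn_integral_ball_scale: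
  fixes f :: "'a::euclidean_space \<Rightarrow> ennreal"
  assumes [measurable]: "f \<in> borel_measurable borel" and \<theta>: "\<theta> > 0"
  shows "(\<integral>\<^sup>+\<zeta>\<in>ball 0 s. f (x + \<theta> *\<^sub>R \<zeta>) \<partial>lborel) = ennreal (1 / \<theta> ^ DIM('a)) * (\<integral>\<^sup>+z\<in>ball x (\<theta> * s). f z \<partial>lborel)"
proof -
  have [measurable]: "ball x (\<theta> * s) \<in> sets borel" by simp
  have "(\<integral>\<^sup>+z\<in>ball x (\<theta> * s). f z \<partial>lborel)
      = ennreal (\<bar>\<theta>\<bar> ^ DIM('a)) * (\<integral>\<^sup>+\<zeta>. f (x + \<theta> *\<^sub>R \<zeta>) * indicator (ball x (\<theta> * s)) (x + \<theta> *\<^sub>R \<zeta>) \<partial>lborel)"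
    using \<theta> by (intro nn_integral_lborel_affine) auto
  also have "(\<integral>\<^sup>+\<zeta>. f (x + \<theta> *\<^sub>R \<zeta>) * indicator (ball x (\<theta> * s)) (x + \<theta> *\<^sub>R \<zeta>) \<partial>lborel) = (\<integral>\<^sup>+\<zeta>\<in>ball 0 s. f (x + \<theta> *\<^sub>R \<zeta>) \<partial>lborel)"
    using \<theta> by (intro nn_integral_cong) (auto simp: indicator_def dist_norm)
  finally have eq: "(\<integral>\<^sup>+z\<in>ball x (\<theta> * s). f z \<partial>lborel) = ennreal (\<theta> ^ DIM('a)) * (\<integral>\<^sup>+\<zeta>\<in>ball 0 s. f (x + \<theta> *\<^sub>R \<zeta>) \<partial>lborel)"
    using \<theta> by simp
  have "ennreal (1 / \<theta> ^ DIM('a)) * ennreal (\<theta> ^ DIM('a)) = 1"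
    using \<theta> by (subst ennreal_mult[symmetric]) auto
  then show ?thesis unfolding eq mult.assoc[symmetric] by simp
qed

lemma gradient_diff_linear:
  fixes v :: "'a::euclidean_space \<Rightarrow> real"
  assumes "Ck (Suc 0) v"
  shows "gradient (\<lambda>y. v y - y \<bullet> a) x = gradient v x - a"
proof (rule euclidean_eqI)
  fix b :: 'a assume b: "b \<in> Basis"
  have "((\<lambda>y. v y - y \<bullet> a) has_derivative (\<lambda>h. gradient v x \<bullet> h - h \<bullet> a)) (at x)"
    by (intro has_derivative_diff has_derivative_Ck[OF assms] has_derivative_inner_left has_derivative_ident)
  from partial_deriv_eq[OF this, of b] show "gradient (\<lambda>y. v y - y \<bullet> a) x \<bullet> b = (gradient v x - a) \<bullet> b"
    by (simp add: gradient_inner_Basis b inner_diff_left inner_commute[of b a])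
qed

text \<open>After subtracting the linear function with gradient G x, only |grad w - G x| is
  integrated along the segments. Under the dilation by \<theta> the Lebesgue-point part scales
  exactly and yields e s^n independently of \<alpha>. Only the mollification error picks up the
  factor \<alpha>^(-n), and it tends to 0 for fixed \<alpha>.\<close>

lemma L1_increment:
  fixes w :: "'a::euclidean_space \<Rightarrow> real" and G :: "'a \<Rightarrow> 'a"
  assumes w: "Ck (Suc 0) w" and [measurable]: "G \<in> borel_measurable borel"
    and \<alpha>: "0 < \<alpha>" "\<alpha> < 1" and s: "s > 0" and e: "e \<ge> 0"
    and leb: "\<And>r. 0 < r \<Longrightarrow> r \<le> s \<Longrightarrow> (\<integral>\<^sup>+y\<in>ball x r. ennreal (norm (G y - G x)) \<partial>lborel) \<le> ennreal (e * r ^ DIM('a))"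
  shows "(\<integral>\<^sup>+\<zeta>\<in>ball 0 s. ennreal \<bar>w (x + \<zeta>) - w (x + \<alpha> *\<^sub>R \<zeta>) - (1 - \<alpha>) * (\<zeta> \<bullet> G x)\<bar> \<partial>lborel)
    \<le> ennreal s * (ennreal (1 / \<alpha> ^ DIM('a)) * (\<integral>\<^sup>+y\<in>ball x s. ennreal (norm (gradient w y - G y)) \<partial>lborel)
       + ennreal (e * s ^ DIM('a)))"
proof -
  let ?n = "DIM('a)"
  define v where "v y = w y - y \<bullet> G x" for y
  have vC: "Ck (Suc 0) v" unfolding v_def by (intro Ck_diff w Ck_inner_left)
  have vg: "gradient v y = gradient w y - G x" for y
    unfolding v_def by (rule gradient_diff_linear[OF w])
  define N where "N y = ennreal (norm (gradient v y))" for y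
  have gv[measurable]: "gradient v \<in> borel_measurable borel" "gradient w \<in> borel_measurable borel"
    by (intro borel_measurable_continuous_onI continuous_on_gradient vC w)+
  have [measurable]: "N \<in> borel_measurable borel" unfolding N_def by measurable
  have [measurable]: "ball (0::'a) s \<in> sets borel" "ball x s \<in> sets borel" by auto
  define D where "D = (\<integral>\<^sup>+y\<in>ball x s. ennreal (norm (gradient w y - G y)) \<partial>lborel)"
  have slice: "(\<integral>\<^sup>+\<zeta>\<in>ball 0 s. N (x + \<theta> *\<^sub>R \<zeta>) \<partial>lborel) \<le> ennreal (1 / \<alpha> ^ ?n) * D + ennreal (e * s ^ ?n)"
    if \<theta>: "\<alpha> \<le> \<theta>" "\<theta> \<le> 1" for \<theta>
  proof -
    have \<theta>0: "\<theta> > 0" using \<theta> \<alpha> by simp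
    have [measurable]: "ball x (\<theta> * s) \<in> sets borel" by simp
    have "(\<integral>\<^sup>+z\<in>ball x (\<theta> * s). N z \<partial>lborel)
        \<le> (\<integral>\<^sup>+z. ennreal (norm (gradient w z - G z)) * indicator (ball x s) z + ennreal (norm (G z - G x)) * indicator (ball x (\<theta> * s)) z \<partial>lborel)"
    proof (rule nn_integral_mono)
      fix z
      have "ball x (\<theta> * s) \<subseteq> ball x s" using \<theta> s by (intro subset_ball) (simp add: mult_le_cancel_right1)
      moreover have "norm (gradient w z - G x) \<le> norm (gradient w z - G z) + norm (G z - G x)"
        using norm_triangle_ineq[of "gradient w z - G z" "G z - G x"] by simp
      then have "ennreal (norm (gradient w z - G x)) \<le> ennreal (norm (gradient w z - G z)) + ennreal (norm (G z - G x))"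
        by (simp flip: ennreal_plus add: ennreal_leI)
      ultimately show "N z * indicator (ball x (\<theta> * s)) z \<le> ennreal (norm (gradient w z - G z)) * indicator (ball x s) z
          + ennreal (norm (G z - G x)) * indicator (ball x (\<theta> * s)) z"
        unfolding N_def vg by (cases "z \<in> ball x (\<theta> * s)") auto
    qed
    also have "\<dots> = D + (\<integral>\<^sup>+z\<in>ball x (\<theta> * s). ennreal (norm (G z - G x)) \<partial>lborel)"
      unfolding D_def by (rule nn_integral_add) measurable
    also have "\<dots> \<le> D + ennreal (e * (\<theta> * s) ^ ?n)"
      using \<theta>0 \<theta> s by (intro add_left_mono leb) (auto simp: mult_le_cancel_right1)
    finally have "ennreal (1 / \<theta> ^ ?n) * (\<integral>\<^sup>+z\<in>ball x (\<theta> * s). N z \<partial>lborel)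
        \<le> ennreal (1 / \<theta> ^ ?n) * (D + ennreal (e * (\<theta> * s) ^ ?n))" by (rule mult_left_mono) simp
    also have "\<dots> = ennreal (1 / \<theta> ^ ?n) * D + ennreal (e * s ^ ?n)"
    proof -
      have "ennreal (1 / \<theta> ^ ?n) * ennreal (e * (\<theta> * s) ^ ?n) = ennreal (1 / \<theta> ^ ?n * (e * (\<theta> * s) ^ ?n))"
        using \<theta>0 e s by (intro ennreal_mult[symmetric]) auto
      also have "1 / \<theta> ^ ?n * (e * (\<theta> * s) ^ ?n) = e * s ^ ?n" using \<theta>0 by (simp add: power_mult_distrib)
      finally show ?thesis by (simp add: distrib_left)
    qed
    also have "\<dots> \<le> ennreal (1 / \<alpha> ^ ?n) * D + ennreal (e * s ^ ?n)"
      using \<alpha> \<theta> \<theta>0 by (intro add_right_mono mult_right_mono ennreal_leI divide_left_mono power_mono) auto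
    finally show ?thesis by (simp add: nn_integral_ball_scale[OF _ \<theta>0])
  qed
  have "(\<integral>\<^sup>+\<zeta>\<in>ball 0 s. ennreal \<bar>w (x + \<zeta>) - w (x + \<alpha> *\<^sub>R \<zeta>) - (1 - \<alpha>) * (\<zeta> \<bullet> G x)\<bar> \<partial>lborel)
    \<le> (\<integral>\<^sup>+\<zeta>. (\<integral>\<^sup>+\<theta>. ennreal s * (N (x + \<theta> *\<^sub>R \<zeta>) * indicator (ball 0 s) \<zeta> * indicator {\<alpha>..1} \<theta>) \<partial>lborel) \<partial>lborel)"
  proof (rule nn_integral_mono)
    fix \<zeta> :: 'a
    show "ennreal \<bar>w (x + \<zeta>) - w (x + \<alpha> *\<^sub>R \<zeta>) - (1 - \<alpha>) * (\<zeta> \<bullet> G x)\<bar> * indicator (ball 0 s) \<zeta>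
      \<le> (\<integral>\<^sup>+\<theta>. ennreal s * (N (x + \<theta> *\<^sub>R \<zeta>) * indicator (ball 0 s) \<zeta> * indicator {\<alpha>..1} \<theta>) \<partial>lborel)"
    proof (cases "\<zeta> \<in> ball 0 s")
      case True
      have "w (x + \<zeta>) - w (x + \<alpha> *\<^sub>R \<zeta>) - (1 - \<alpha>) * (\<zeta> \<bullet> G x) = v (x + \<zeta>) - v (x + \<alpha> *\<^sub>R \<zeta>)"
        by (simp add: v_def inner_add_left algebra_simps)
      then have "ennreal \<bar>w (x + \<zeta>) - w (x + \<alpha> *\<^sub>R \<zeta>) - (1 - \<alpha>) * (\<zeta> \<bullet> G x)\<bar>
          \<le> (\<integral>\<^sup>+\<theta>\<in>{\<alpha>..1}. ennreal (norm (gradient v (x + \<theta> *\<^sub>R \<zeta>)) * norm \<zeta>) \<partial>lborel)"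
        using segment_bound[OF vC less_imp_le[OF \<alpha>(2)], of x \<zeta>] by simp
      also have "\<dots> \<le> (\<integral>\<^sup>+\<theta>. ennreal s * (N (x + \<theta> *\<^sub>R \<zeta>) * indicator (ball 0 s) \<zeta> * indicator {\<alpha>..1} \<theta>) \<partial>lborel)"
      proof (rule nn_integral_mono)
        fix \<theta> :: real
        have "ennreal (norm (gradient v (x + \<theta> *\<^sub>R \<zeta>)) * norm \<zeta>) \<le> ennreal (s * norm (gradient v (x + \<theta> *\<^sub>R \<zeta>)))"
          using True by (intro ennreal_leI) (simp add: mult.commute mult_right_mono)
        also have "\<dots> = ennreal s * N (x + \<theta> *\<^sub>R \<zeta>)" unfolding N_def using s by (intro ennreal_mult) auto
        finally show "ennreal (norm (gradient v (x + \<theta> *\<^sub>R \<zeta>)) * norm \<zeta>) * indicator {\<alpha>..1} \<theta>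
          \<le> ennreal s * (N (x + \<theta> *\<^sub>R \<zeta>) * indicator (ball 0 s) \<zeta> * indicator {\<alpha>..1} \<theta>)"
          using True by (cases "\<theta> \<in> {\<alpha>..1}") auto
      qed
      finally show ?thesis using True by simp
    qed simp
  qed
  also have "\<dots> = (\<integral>\<^sup>+\<theta>. (\<integral>\<^sup>+\<zeta>. ennreal s * (N (x + \<theta> *\<^sub>R \<zeta>) * indicator (ball 0 s) \<zeta> * indicator {\<alpha>..1} \<theta>) \<partial>lborel) \<partial>lborel)"
    by (rule lborel_pair.Fubini') measurable
  also have "\<dots> \<le> (\<integral>\<^sup>+\<theta>. ennreal s * (ennreal (1 / \<alpha> ^ ?n) * D + ennreal (e * s ^ ?n)) * indicator {\<alpha>..1} \<theta> \<partial>lborel)"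
  proof (rule nn_integral_mono)
    fix \<theta> :: real
    show "(\<integral>\<^sup>+\<zeta>. ennreal s * (N (x + \<theta> *\<^sub>R \<zeta>) * indicator (ball 0 s) \<zeta> * indicator {\<alpha>..1} \<theta>) \<partial>lborel)
      \<le> ennreal s * (ennreal (1 / \<alpha> ^ ?n) * D + ennreal (e * s ^ ?n)) * indicator {\<alpha>..1} \<theta>"
    proof (cases "\<theta> \<in> {\<alpha>..1}")
      case True
      have "(\<integral>\<^sup>+\<zeta>. ennreal s * (N (x + \<theta> *\<^sub>R \<zeta>) * indicator (ball 0 s) \<zeta> * indicator {\<alpha>..1} \<theta>) \<partial>lborel)
        = ennreal s * (\<integral>\<^sup>+\<zeta>\<in>ball 0 s. N (x + \<theta> *\<^sub>R \<zeta>) \<partial>lborel)"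
        using True by (simp add: nn_integral_cmult)
      also have "\<dots> \<le> ennreal s * (ennreal (1 / \<alpha> ^ ?n) * D + ennreal (e * s ^ ?n))"
        using True by (intro mult_left_mono slice) auto
      finally show ?thesis using True by simp
    qed simp
  qed
  also have "\<dots> = ennreal s * (ennreal (1 / \<alpha> ^ ?n) * D + ennreal (e * s ^ ?n)) * ennreal (1 - \<alpha>)"
    using \<alpha> by (simp add: nn_integral_cmult_indicator)
  also have "\<dots> \<le> ennreal s * (ennreal (1 / \<alpha> ^ ?n) * D + ennreal (e * s ^ ?n)) * 1"
    using \<alpha> by (intro mult_left_mono) (auto simp: ennreal_le_1)
  finally show ?thesis by (simp add: D_def)
qed

text \<open>Passing to the limit in the mollification with \<alpha> fixed gives an increment bound
  that is uniform in \<alpha>. Then \<alpha> is taken small enough, depending on s, for U (x +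
  \<alpha> \<zeta>) to be replaced by U x.\<close>

lemma L1_differentiability:
  fixes U :: "'a::euclidean_space \<Rightarrow> real" and G :: "'a \<Rightarrow> 'a"
  assumes U: "integrable lborel U" and G: "integrable lborel G"
    and grad: "\<And>y e b. e > 0 \<Longrightarrow> cball y e \<subseteq> K \<Longrightarrow> b \<in> Basis \<Longrightarrow>
       partial_deriv b (conv (moll e) U) y = conv (moll e) (\<lambda>z. G z \<bullet> b) y"
    and s0: "s0 > 0" "cball x s0 \<subseteq> K"
    and lpU: "lebesgue_point U x" and lpG: "\<And>b. b \<in> Basis \<Longrightarrow> lebesgue_point (\<lambda>z. G z \<bullet> b) x"
    and e: "e > 0"
  shows "\<exists>d>0. \<forall>s. 0 < s \<and> s < d \<longrightarrow>
    (\<integral>\<^sup>+z\<in>ball x s. ennreal \<bar>U z - U x - (z - x) \<bullet> G x\<bar> \<partial>lborel) \<le> ennreal (e * s ^ (DIM('a) + 1))"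
proof -
  let ?n = "DIM('a)"
  define \<omega> where "\<omega> = unit_ball_vol (real ?n)"
  have \<omega>: "\<omega> > 0" unfolding \<omega>_def by simp
  have [measurable]: "U \<in> borel_measurable borel" "G \<in> borel_measurable borel" using U G by auto
  define e1 where "e1 = e / 3"
  have e1: "e1 > 0" unfolding e1_def using e by simp
  obtain d1 where d1: "d1 > 0" "\<And>r. 0 < r \<Longrightarrow> r < d1 \<Longrightarrow>
     (\<integral>\<^sup>+y\<in>ball x r. ennreal (norm (G y - G x)) \<partial>lborel) \<le> ennreal (e1 * r ^ ?n)"
    using lebesgue_point_vector[OF _ lpG e1] by auto
  define d where "d = min d1 (s0 / 2)"
  have d: "d > 0" unfolding d_def using d1 s0 by simp
  have main: "(\<integral>\<^sup>+z\<in>ball x s. ennreal \<bar>U z - U x - (z - x) \<bullet> G x\<bar> \<partial>lborel) \<le> ennreal (e * s ^ (?n + 1))"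
    if s: "0 < s" "s < d" for s
  proof -
    have [measurable]: "ball (0::'a) s \<in> sets borel" by simp
    have leb: "(\<integral>\<^sup>+y\<in>ball x r. ennreal (norm (G y - G x)) \<partial>lborel) \<le> ennreal (e1 * r ^ ?n)" if "0 < r" "r \<le> s" for r
      using that s d1(2)[of r] unfolding d_def by simp
    have A: "(\<integral>\<^sup>+\<zeta>\<in>ball 0 s. ennreal \<bar>U (x + \<zeta>) - U (x + \<alpha> *\<^sub>R \<zeta>) - (1 - \<alpha>) * (\<zeta> \<bullet> G x)\<bar> \<partial>lborel) \<le> ennreal (e1 * s ^ (?n + 1))"
      (is "?L \<le> _") if \<alpha>: "0 < \<alpha>" "\<alpha> < 1" for \<alpha>
    proof -
      define E where "E \<epsilon> = (\<integral>\<^sup>+y. ennreal \<bar>conv (moll \<epsilon>) U y - U y\<bar> \<partial>lborel)" for \<epsilon>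
      define F where "F \<epsilon> = (\<Sum>b\<in>Basis. \<integral>\<^sup>+y. ennreal \<bar>conv (moll \<epsilon>) (\<lambda>z. G z \<bullet> b) y - G y \<bullet> b\<bar> \<partial>lborel)" for \<epsilon>
      define RHS where "RHS \<epsilon> = ennreal s * (ennreal (1 / \<alpha> ^ ?n) * F \<epsilon> + ennreal (e1 * s ^ ?n)) + E \<epsilon> + ennreal (1 / \<alpha> ^ ?n) * E \<epsilon>" for \<epsilon>
      have bound: "?L \<le> RHS \<epsilon>" if \<epsilon>: "0 < \<epsilon>" "\<epsilon> < s0 / 2" for \<epsilon>
      proof -
        define w where "w = conv (moll \<epsilon>) U"
        have wC: "Ck (Suc 0) w" unfolding w_def by (intro Ck_conv Ccinf_moll \<epsilon> U)
        have [measurable]: "w \<in> borel_measurable borel"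
          by (intro borel_measurable_continuous_onI Ck_imp_continuous_on[OF wC])
        have DF: "(\<integral>\<^sup>+y\<in>ball x s. ennreal (norm (gradient w y - G y)) \<partial>lborel) \<le> F \<epsilon>"
        proof -
          have cm[measurable]: "conv (moll \<epsilon>) (\<lambda>z. G z \<bullet> b) \<in> borel_measurable borel" for b
            using integrable_conv_moll[OF integrable_inner_left[OF G] \<epsilon>(1)] by auto
          have "(\<integral>\<^sup>+y\<in>ball x s. ennreal (norm (gradient w y - G y)) \<partial>lborel)
            \<le> (\<integral>\<^sup>+y. (\<Sum>b\<in>Basis. ennreal \<bar>conv (moll \<epsilon>) (\<lambda>z. G z \<bullet> b) y - G y \<bullet> b\<bar>) \<partial>lborel)"
          proof (rule nn_integral_mono)
            fix y
            show "ennreal (norm (gradient w y - G y)) * indicator (ball x s) y \<le> (\<Sum>b\<in>Basis. ennreal \<bar>conv (moll \<epsilon>) (\<lambda>z. G z \<bullet> b) y - G y \<bullet> b\<bar>)"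
            proof (cases "y \<in> ball x s")
              case True
              have "cball y \<epsilon> \<subseteq> cball x s0"
              proof
                fix z assume "z \<in> cball y \<epsilon>"
                then have "dist x z \<le> s + \<epsilon>" using True dist_triangle[of x z y] by simp
                then show "z \<in> cball x s0" using s \<epsilon> by (simp add: d_def)
              qed
              then have sub: "cball y \<epsilon> \<subseteq> K" using s0 by blast
              have "norm (gradient w y - G y) \<le> (\<Sum>b\<in>Basis. \<bar>(gradient w y - G y) \<bullet> b\<bar>)" by (rule norm_le_l1)
              also have "\<dots> = (\<Sum>b\<in>Basis. \<bar>conv (moll \<epsilon>) (\<lambda>z. G z \<bullet> b) y - G y \<bullet> b\<bar>)"
                using grad[OF \<epsilon>(1) sub] by (intro sum.cong refl) (simp add: w_def inner_diff_left gradient_inner_Basis)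
              finally have "ennreal (norm (gradient w y - G y)) \<le> (\<Sum>b\<in>Basis. ennreal \<bar>conv (moll \<epsilon>) (\<lambda>z. G z \<bullet> b) y - G y \<bullet> b\<bar>)"
                by (subst sum_ennreal) (auto intro: ennreal_leI)
              then show ?thesis using True by simp
            qed simp
          qed
          also have "\<dots> = F \<epsilon>" unfolding F_def by (rule nn_integral_sum) measurable
          finally show ?thesis .
        qed
        have "?L \<le> (\<integral>\<^sup>+\<zeta>. ennreal \<bar>w (x + \<zeta>) - w (x + \<alpha> *\<^sub>R \<zeta>) - (1 - \<alpha>) * (\<zeta> \<bullet> G x)\<bar> * indicator (ball 0 s) \<zeta>
            + ennreal \<bar>w (x + \<zeta>) - U (x + \<zeta>)\<bar>
            + ennreal \<bar>w (x + \<alpha> *\<^sub>R \<zeta>) - U (x + \<alpha> *\<^sub>R \<zeta>)\<bar> * indicator (ball 0 s) \<zeta> \<partial>lborel)"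
        proof (rule nn_integral_mono)
          fix \<zeta>
          have "\<bar>U (x + \<zeta>) - U (x + \<alpha> *\<^sub>R \<zeta>) - (1 - \<alpha>) * (\<zeta> \<bullet> G x)\<bar>
            \<le> \<bar>w (x + \<zeta>) - w (x + \<alpha> *\<^sub>R \<zeta>) - (1 - \<alpha>) * (\<zeta> \<bullet> G x)\<bar> + \<bar>w (x + \<zeta>) - U (x + \<zeta>)\<bar> + \<bar>w (x + \<alpha> *\<^sub>R \<zeta>) - U (x + \<alpha> *\<^sub>R \<zeta>)\<bar>"
            by linarith
          then have "ennreal \<bar>U (x + \<zeta>) - U (x + \<alpha> *\<^sub>R \<zeta>) - (1 - \<alpha>) * (\<zeta> \<bullet> G x)\<bar>
            \<le> ennreal \<bar>w (x + \<zeta>) - w (x + \<alpha> *\<^sub>R \<zeta>) - (1 - \<alpha>) * (\<zeta> \<bullet> G x)\<bar> + ennreal \<bar>w (x + \<zeta>) - U (x + \<zeta>)\<bar> + ennreal \<bar>w (x + \<alpha> *\<^sub>R \<zeta>) - U (x + \<alpha> *\<^sub>R \<zeta>)\<bar>"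
            by (simp flip: ennreal_plus add: ennreal_leI)
          then show "ennreal \<bar>U (x + \<zeta>) - U (x + \<alpha> *\<^sub>R \<zeta>) - (1 - \<alpha>) * (\<zeta> \<bullet> G x)\<bar> * indicator (ball 0 s) \<zeta>
            \<le> ennreal \<bar>w (x + \<zeta>) - w (x + \<alpha> *\<^sub>R \<zeta>) - (1 - \<alpha>) * (\<zeta> \<bullet> G x)\<bar> * indicator (ball 0 s) \<zeta>
            + ennreal \<bar>w (x + \<zeta>) - U (x + \<zeta>)\<bar>
            + ennreal \<bar>w (x + \<alpha> *\<^sub>R \<zeta>) - U (x + \<alpha> *\<^sub>R \<zeta>)\<bar> * indicator (ball 0 s) \<zeta>"
            by (cases "\<zeta> \<in> ball 0 s") auto
        qed
        also have "\<dots> = (\<integral>\<^sup>+\<zeta>\<in>ball 0 s. ennreal \<bar>w (x + \<zeta>) - w (x + \<alpha> *\<^sub>R \<zeta>) - (1 - \<alpha>) * (\<zeta> \<bullet> G x)\<bar> \<partial>lborel)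
            + (\<integral>\<^sup>+\<zeta>. ennreal \<bar>w (x + \<zeta>) - U (x + \<zeta>)\<bar> \<partial>lborel)
            + (\<integral>\<^sup>+\<zeta>\<in>ball 0 s. ennreal \<bar>w (x + \<alpha> *\<^sub>R \<zeta>) - U (x + \<alpha> *\<^sub>R \<zeta>)\<bar> \<partial>lborel)"
          by (simp add: nn_integral_add)
        also have "\<dots> \<le> RHS \<epsilon>"
          unfolding RHS_def
        proof (intro add_mono)
          show "(\<integral>\<^sup>+\<zeta>\<in>ball 0 s. ennreal \<bar>w (x + \<zeta>) - w (x + \<alpha> *\<^sub>R \<zeta>) - (1 - \<alpha>) * (\<zeta> \<bullet> G x)\<bar> \<partial>lborel)
            \<le> ennreal s * (ennreal (1 / \<alpha> ^ ?n) * F \<epsilon> + ennreal (e1 * s ^ ?n))"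
            by (rule order_trans[OF L1_increment[OF wC _ \<alpha> s(1) less_imp_le[OF e1] leb]])
               (auto intro!: mult_left_mono add_right_mono DF)
          show "(\<integral>\<^sup>+\<zeta>. ennreal \<bar>w (x + \<zeta>) - U (x + \<zeta>)\<bar> \<partial>lborel) \<le> E \<epsilon>"
            unfolding E_def w_def[symmetric]
            by (subst nn_integral_lborel_translate[of "\<lambda>y. ennreal \<bar>w y - U y\<bar>"]) auto
          have "(\<integral>\<^sup>+\<zeta>\<in>ball 0 s. ennreal \<bar>w (x + \<alpha> *\<^sub>R \<zeta>) - U (x + \<alpha> *\<^sub>R \<zeta>)\<bar> \<partial>lborel)
            = ennreal (1 / \<alpha> ^ ?n) * (\<integral>\<^sup>+z\<in>ball x (\<alpha> * s). ennreal \<bar>w z - U z\<bar> \<partial>lborel)"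
            by (rule nn_integral_ball_scale[of "\<lambda>y. ennreal \<bar>w y - U y\<bar>", OF _ \<alpha>(1)]) measurable
          also have "\<dots> \<le> ennreal (1 / \<alpha> ^ ?n) * E \<epsilon>"
            unfolding E_def w_def[symmetric] by (intro mult_left_mono nn_integral_mono) (auto simp: indicator_def)
          finally show "(\<integral>\<^sup>+\<zeta>\<in>ball 0 s. ennreal \<bar>w (x + \<alpha> *\<^sub>R \<zeta>) - U (x + \<alpha> *\<^sub>R \<zeta>)\<bar> \<partial>lborel) \<le> ennreal (1 / \<alpha> ^ ?n) * E \<epsilon>" .
        qed
        finally show ?thesis .
      qed
      have E0: "(E \<longlongrightarrow> 0) (at_right 0)" unfolding E_def by (rule conv_moll_L1[OF U])
      have "(F \<longlongrightarrow> (\<Sum>b\<in>(Basis::'a set). 0)) (at_right 0)"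
        unfolding F_def by (intro tendsto_sum conv_moll_L1 integrable_inner_left G)
      then have F0: "(F \<longlongrightarrow> 0) (at_right 0)" by simp
      have "(RHS \<longlongrightarrow> ennreal s * (ennreal (1 / \<alpha> ^ ?n) * 0 + ennreal (e1 * s ^ ?n)) + 0 + ennreal (1 / \<alpha> ^ ?n) * 0) (at_right 0)"
        unfolding RHS_def by (intro tendsto_add ennreal_tendsto_cmult tendsto_const E0 F0) auto
      moreover have "ennreal s * (ennreal (1 / \<alpha> ^ ?n) * 0 + ennreal (e1 * s ^ ?n)) + 0 + ennreal (1 / \<alpha> ^ ?n) * 0 = ennreal (e1 * s ^ (?n + 1))"
        using s e1 by (simp flip: ennreal_mult add: mult_ac)
      ultimately have "(RHS \<longlongrightarrow> ennreal (e1 * s ^ (?n + 1))) (at_right 0)" by simp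
      moreover have "\<forall>\<^sub>F \<epsilon> in at_right 0. ?L \<le> RHS \<epsilon>"
        unfolding eventually_at_right_field using s0 bound by (intro exI[of _ "s0 / 2"]) auto
      ultimately show ?thesis by (rule tendsto_lowerbound) simp
    qed
    \<comment> \<open>The tolerance e1 * s depends on s. This is harmless, because only the radius
      \<alpha> s has to fall below d2 and \<alpha> is chosen after s.\<close>
    obtain d2 where d2: "d2 > 0" "\<And>r. 0 < r \<Longrightarrow> r < d2 \<Longrightarrow>
      (\<integral>\<^sup>+y\<in>ball x r. ennreal \<bar>U y - U x\<bar> \<partial>lborel) \<le> ennreal (e1 * s * r ^ ?n)"
    proof -
      have "e1 * s > 0" using e1 s by simp
      then have "\<exists>d>0. \<forall>r. 0 < r \<and> r < d \<longrightarrow>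
        (\<integral>\<^sup>+y\<in>ball x r. ennreal \<bar>U y - U x\<bar> \<partial>lborel) \<le> ennreal (e1 * s * r ^ ?n)"
        using lpU unfolding lebesgue_point_def by simp
      then show thesis using that by (elim exE conjE) simp
    qed
    \<comment> \<open>The three bounds ensure \<alpha> < 1, \<alpha> s < d2, and that the omitted
      linear part \<alpha> (\<zeta> \<bullet> G x) integrates to at most e1 s^(n+1).\<close>
    define \<alpha> where "\<alpha> = min (1 / 2) (min (d2 / (2 * s)) (e1 / ((norm (G x) + 1) * \<omega>)))"
    have \<alpha>: "0 < \<alpha>" "\<alpha> < 1" unfolding \<alpha>_def using d2(1) s e1 \<omega> by (auto intro!: divide_pos_pos mult_pos_pos add_nonneg_pos)
    have "\<alpha> * s \<le> d2 / (2 * s) * s" unfolding \<alpha>_def using s by (intro mult_right_mono) auto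
    then have \<alpha>s: "\<alpha> * s < d2" using s d2(1) by simp
    have \<alpha>G: "\<alpha> * norm (G x) * \<omega> \<le> e1"
    proof -
      have "\<alpha> * ((norm (G x) + 1) * \<omega>) \<le> e1 / ((norm (G x) + 1) * \<omega>) * ((norm (G x) + 1) * \<omega>)"
        unfolding \<alpha>_def using \<omega> by (intro mult_right_mono) auto
      also have "\<dots> = e1"
      proof -
        have "q / Q * Q = q" if "Q > 0" for q Q :: real using that by simp
        moreover have "(norm (G x) + 1) * \<omega> > 0" using \<omega> by (intro mult_pos_pos add_nonneg_pos) auto
        ultimately show ?thesis by blast
      qed
      finally have "\<alpha> * norm (G x) * \<omega> + \<alpha> * \<omega> \<le> e1" by (simp add: algebra_simps)
      moreover have "\<alpha> * \<omega> \<ge> 0" using \<alpha> \<omega> by simp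
      ultimately show ?thesis by linarith
    qed
    have "(\<integral>\<^sup>+z\<in>ball x s. ennreal \<bar>U z - U x - (z - x) \<bullet> G x\<bar> \<partial>lborel)
      = (\<integral>\<^sup>+\<zeta>\<in>ball 0 s. ennreal \<bar>U (x + \<zeta>) - U x - \<zeta> \<bullet> G x\<bar> \<partial>lborel)"
      using nn_integral_ball_scale[of "\<lambda>z. ennreal \<bar>U z - U x - (z - x) \<bullet> G x\<bar>" 1 x s] by simp
    also have "\<dots> \<le> (\<integral>\<^sup>+\<zeta>. ennreal \<bar>U (x + \<zeta>) - U (x + \<alpha> *\<^sub>R \<zeta>) - (1 - \<alpha>) * (\<zeta> \<bullet> G x)\<bar> * indicator (ball 0 s) \<zeta>
       + ennreal \<bar>U (x + \<alpha> *\<^sub>R \<zeta>) - U x\<bar> * indicator (ball 0 s) \<zeta> + ennreal (\<alpha> * norm (G x) * s) * indicator (ball 0 s) \<zeta> \<partial>lborel)"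
    proof (rule nn_integral_mono)
      fix \<zeta> :: 'a
      show "ennreal \<bar>U (x + \<zeta>) - U x - \<zeta> \<bullet> G x\<bar> * indicator (ball 0 s) \<zeta>
        \<le> ennreal \<bar>U (x + \<zeta>) - U (x + \<alpha> *\<^sub>R \<zeta>) - (1 - \<alpha>) * (\<zeta> \<bullet> G x)\<bar> * indicator (ball 0 s) \<zeta>
       + ennreal \<bar>U (x + \<alpha> *\<^sub>R \<zeta>) - U x\<bar> * indicator (ball 0 s) \<zeta> + ennreal (\<alpha> * norm (G x) * s) * indicator (ball 0 s) \<zeta>"
      proof (cases "\<zeta> \<in> ball 0 s")
        case True
        have "\<bar>\<zeta> \<bullet> G x\<bar> \<le> norm (G x) * s"
          using Cauchy_Schwarz_ineq2[of \<zeta> "G x"] True by (smt (verit) mem_ball_0 mult.commute mult_left_mono norm_ge_zero)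
        then have "\<alpha> * \<bar>\<zeta> \<bullet> G x\<bar> \<le> \<alpha> * norm (G x) * s" using \<alpha> by (simp add: mult.assoc mult_left_mono)
        then have "\<bar>\<alpha> * (\<zeta> \<bullet> G x)\<bar> \<le> \<alpha> * norm (G x) * s" using \<alpha> by (simp add: abs_mult)
        then have "\<bar>U (x + \<zeta>) - U x - \<zeta> \<bullet> G x\<bar> \<le> \<bar>U (x + \<zeta>) - U (x + \<alpha> *\<^sub>R \<zeta>) - (1 - \<alpha>) * (\<zeta> \<bullet> G x)\<bar>
           + \<bar>U (x + \<alpha> *\<^sub>R \<zeta>) - U x\<bar> + \<alpha> * norm (G x) * s"
          by (simp add: left_diff_distrib abs_if split: if_splits)
        then have "ennreal \<bar>U (x + \<zeta>) - U x - \<zeta> \<bullet> G x\<bar> \<le> ennreal (\<bar>U (x + \<zeta>) - U (x + \<alpha> *\<^sub>R \<zeta>) - (1 - \<alpha>) * (\<zeta> \<bullet> G x)\<bar>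
           + \<bar>U (x + \<alpha> *\<^sub>R \<zeta>) - U x\<bar> + \<alpha> * norm (G x) * s)" by (rule ennreal_leI)
        also have "\<dots> = ennreal \<bar>U (x + \<zeta>) - U (x + \<alpha> *\<^sub>R \<zeta>) - (1 - \<alpha>) * (\<zeta> \<bullet> G x)\<bar> + ennreal \<bar>U (x + \<alpha> *\<^sub>R \<zeta>) - U x\<bar> + ennreal (\<alpha> * norm (G x) * s)"
          using \<alpha> s by (simp add: ennreal_plus)
        finally show ?thesis using True by simp
      qed simp
    qed
    also have "\<dots> = (\<integral>\<^sup>+\<zeta>\<in>ball 0 s. ennreal \<bar>U (x + \<zeta>) - U (x + \<alpha> *\<^sub>R \<zeta>) - (1 - \<alpha>) * (\<zeta> \<bullet> G x)\<bar> \<partial>lborel)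
       + (\<integral>\<^sup>+\<zeta>\<in>ball 0 s. ennreal \<bar>U (x + \<alpha> *\<^sub>R \<zeta>) - U x\<bar> \<partial>lborel)
       + ennreal (\<alpha> * norm (G x) * s) * emeasure lborel (ball (0::'a) s)"
      by (simp add: nn_integral_add nn_integral_cmult_indicator)
    also have "\<dots> \<le> ennreal (e1 * s ^ (?n + 1)) + ennreal (e1 * s ^ (?n + 1)) + ennreal (e1 * s ^ (?n + 1))"
    proof (intro add_mono A \<alpha>)
      have "(\<integral>\<^sup>+\<zeta>\<in>ball 0 s. ennreal \<bar>U (x + \<alpha> *\<^sub>R \<zeta>) - U x\<bar> \<partial>lborel)
        = ennreal (1 / \<alpha> ^ ?n) * (\<integral>\<^sup>+z\<in>ball x (\<alpha> * s). ennreal \<bar>U z - U x\<bar> \<partial>lborel)"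
        by (rule nn_integral_ball_scale[of "\<lambda>y. ennreal \<bar>U y - U x\<bar>", OF _ \<alpha>(1)]) measurable
      also have "\<dots> \<le> ennreal (1 / \<alpha> ^ ?n) * ennreal (e1 * s * (\<alpha> * s) ^ ?n)"
        using \<alpha> s \<alpha>s by (intro mult_left_mono d2) auto
      also have "\<dots> = ennreal (1 / \<alpha> ^ ?n * (e1 * s * (\<alpha> * s) ^ ?n))"
        using \<alpha> s e1 by (intro ennreal_mult[symmetric]) auto
      also have "1 / \<alpha> ^ ?n * (e1 * s * (\<alpha> * s) ^ ?n) = e1 * s ^ (?n + 1)"
        using \<alpha> by (simp add: power_mult_distrib)
      finally show "(\<integral>\<^sup>+\<zeta>\<in>ball 0 s. ennreal \<bar>U (x + \<alpha> *\<^sub>R \<zeta>) - U x\<bar> \<partial>lborel) \<le> ennreal (e1 * s ^ (?n + 1))" .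
      have "ennreal (\<alpha> * norm (G x) * s) * emeasure lborel (ball (0::'a) s) = ennreal (\<alpha> * norm (G x) * s * (\<omega> * s ^ ?n))"
        using \<alpha> s \<omega> by (subst ennreal_mult) (auto simp: emeasure_ball \<omega>_def)
      also have "\<alpha> * norm (G x) * s * (\<omega> * s ^ ?n) = (\<alpha> * norm (G x) * \<omega>) * s ^ (?n + 1)" by (simp add: mult_ac)
      also have "ennreal \<dots> \<le> ennreal (e1 * s ^ (?n + 1))"
        using \<alpha>G s by (intro ennreal_leI mult_right_mono) auto
      finally show "ennreal (\<alpha> * norm (G x) * s) * emeasure lborel (ball (0::'a) s) \<le> ennreal (e1 * s ^ (?n + 1))" .
    qed
    also have "\<dots> = ennreal (e * s ^ (?n + 1))"
      using e1 s by (simp flip: ennreal_plus) (simp add: e1_def)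
    finally show ?thesis .
  qed
  with d show ?thesis by blast
qed

text \<open>The oscillation hypothesis turns an L^1 expansion into a pointwise one. In the ball of
  radius \<delta> \<sigma> about y the error F cannot exceed \<delta> \<sigma> almost everywhere, so
  some z there has a small error and U z in [m, M]. Then v y is within C \<delta> \<sigma> of U z,
  and z is within \<delta> \<sigma> of y.\<close>

lemma differentiable_at_good_point:
  fixes U v :: "'a::euclidean_space \<Rightarrow> real" and G :: "'a \<Rightarrow> 'a"
  assumes U: "integrable lborel U" and G: "integrable lborel G"
    and grad: "\<And>y e b. e > 0 \<Longrightarrow> cball y e \<subseteq> K \<Longrightarrow> b \<in> Basis \<Longrightarrow>
       partial_deriv b (conv (moll e) U) y = conv (moll e) (\<lambda>z. G z \<bullet> b) y"
    and s0: "s0 > 0" "cball x s0 \<subseteq> K"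
    and lpU: "lebesgue_point U x" and lpG: "\<And>b. b \<in> Basis \<Longrightarrow> lebesgue_point (\<lambda>z. G z \<bullet> b) x"
    and C: "C \<ge> 0"
    and osc: "\<And>\<delta>. 0 < \<delta> \<Longrightarrow> \<delta> \<le> 1 / 2 \<Longrightarrow> \<exists>d>0. \<forall>\<sigma> y. 0 < \<sigma> \<and> \<sigma> < d \<and> dist y x \<le> \<sigma> \<longrightarrow>
       (\<exists>m M. M - m \<le> C * \<delta> * \<sigma> \<and> m \<le> v y \<and> v y \<le> M \<and>
          (AE z in lborel. z \<in> ball y (\<delta> * \<sigma>) \<longrightarrow> m \<le> U z \<and> U z \<le> M))"
  shows "v x = U x" and "(v has_derivative (\<lambda>h. h \<bullet> G x)) (at x)"
proof -
  let ?n = "DIM('a)"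
  define \<omega> where "\<omega> = unit_ball_vol (real ?n)"
  have \<omega>: "\<omega> > 0" unfolding \<omega>_def by simp
  define C' where "C' = C + norm (G x) + 1"
  have C': "C' > 0" unfolding C'_def using C by (simp add: add_nonneg_pos)
  have main: "\<exists>d>0. \<forall>\<sigma> y. 0 < \<sigma> \<and> \<sigma> < d \<and> dist y x \<le> \<sigma> \<longrightarrow> \<bar>v y - U x - (y - x) \<bullet> G x\<bar> \<le> C' * \<delta> * \<sigma>"
    if \<delta>: "0 < \<delta>" "\<delta> \<le> 1 / 2" for \<delta>
  proof -
    \<comment> \<open>With this e the allowed error e (2 \<sigma>)^(n+1) is half of \<delta>
      \<sigma> times the volume of the small ball.\<close>
    define e where "e = \<omega> * \<delta> ^ (?n + 1) / 2 ^ (?n + 2)"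
    have e: "e > 0" unfolding e_def using \<omega> \<delta> by simp
    obtain d1 where d1: "d1 > 0" "\<And>\<sigma> y. 0 < \<sigma> \<Longrightarrow> \<sigma> < d1 \<Longrightarrow> dist y x \<le> \<sigma> \<Longrightarrow>
       (\<exists>m M. M - m \<le> C * \<delta> * \<sigma> \<and> m \<le> v y \<and> v y \<le> M \<and>
          (AE z in lborel. z \<in> ball y (\<delta> * \<sigma>) \<longrightarrow> m \<le> U z \<and> U z \<le> M))"
      using osc[OF \<delta>] by auto
    obtain d2 where d2: "d2 > 0" "\<And>s. 0 < s \<Longrightarrow> s < d2 \<Longrightarrow>
      (\<integral>\<^sup>+z\<in>ball x s. ennreal \<bar>U z - U x - (z - x) \<bullet> G x\<bar> \<partial>lborel) \<le> ennreal (e * s ^ (?n + 1))"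
      using L1_differentiability[OF U G grad s0 lpU lpG e] by auto
    have "\<bar>v y - U x - (y - x) \<bullet> G x\<bar> \<le> C' * \<delta> * \<sigma>"
      if \<sigma>: "0 < \<sigma>" "\<sigma> < min d1 (d2 / 2)" and y: "dist y x \<le> \<sigma>" for \<sigma> y
    proof -
      define F where "F z = U z - U x - (z - x) \<bullet> G x" for z
      obtain m M where mM: "M - m \<le> C * \<delta> * \<sigma>" "m \<le> v y" "v y \<le> M"
        and ae: "AE z in lborel. z \<in> ball y (\<delta> * \<sigma>) \<longrightarrow> m \<le> U z \<and> U z \<le> M"
        using d1(2)[of \<sigma> y] \<sigma> y by auto
      have "\<exists>z\<in>ball y (\<delta> * \<sigma>). m \<le> U z \<and> U z \<le> M \<and> \<bar>F z\<bar> \<le> \<delta> * \<sigma>"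
      proof (rule ccontr)
        assume *: "\<not> ?thesis"
        have sub: "ball y (\<delta> * \<sigma>) \<subseteq> ball x (2 * \<sigma>)"
        proof
          fix z assume "z \<in> ball y (\<delta> * \<sigma>)"
          then have "dist x z < \<sigma> + \<delta> * \<sigma>" using y dist_triangle[of x z y] by (simp add: dist_commute)
          also have "\<delta> * \<sigma> \<le> 1 * \<sigma>" using \<delta> \<sigma> by (intro mult_right_mono) auto
          finally show "z \<in> ball x (2 * \<sigma>)" by simp
        qed
        have "ennreal (\<delta> * \<sigma> * (\<omega> * (\<delta> * \<sigma>) ^ ?n)) = (\<integral>\<^sup>+z. ennreal (\<delta> * \<sigma>) * indicator (ball y (\<delta> * \<sigma>)) z \<partial>lborel)"
          using \<delta> \<sigma> \<omega> by (subst nn_integral_cmult_indicator) (auto simp: emeasure_ball \<omega>_def ennreal_mult)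
        also have "\<dots> \<le> (\<integral>\<^sup>+z\<in>ball x (2 * \<sigma>). ennreal \<bar>F z\<bar> \<partial>lborel)"
        proof (rule nn_integral_mono_AE, use ae in eventually_elim)
          fix z assume z: "z \<in> ball y (\<delta> * \<sigma>) \<longrightarrow> m \<le> U z \<and> U z \<le> M"
          show "ennreal (\<delta> * \<sigma>) * indicator (ball y (\<delta> * \<sigma>)) z \<le> ennreal \<bar>F z\<bar> * indicator (ball x (2 * \<sigma>)) z"
          proof (cases "z \<in> ball y (\<delta> * \<sigma>)")
            case True
            then have "\<delta> * \<sigma> \<le> \<bar>F z\<bar>" using * z by force
            then show ?thesis using True sub by (auto intro: ennreal_leI)
          qed simp
        qed
        also have "\<dots> \<le> ennreal (e * (2 * \<sigma>) ^ (?n + 1))"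
          unfolding F_def using \<sigma> by (intro d2) auto
        finally have "\<delta> * \<sigma> * (\<omega> * (\<delta> * \<sigma>) ^ ?n) \<le> e * (2 * \<sigma>) ^ (?n + 1)"
          using e \<sigma> by (subst (asm) ennreal_le_iff) auto
        moreover have "e * (2 * \<sigma>) ^ (?n + 1) = \<delta> * \<sigma> * (\<omega> * (\<delta> * \<sigma>) ^ ?n) / 2"
          unfolding e_def by (simp add: power_mult_distrib)
        moreover have "\<delta> * \<sigma> * (\<omega> * (\<delta> * \<sigma>) ^ ?n) > 0" using \<delta> \<sigma> \<omega> by simp
        ultimately show False by linarith
      qed
      then obtain z where z: "dist y z < \<delta> * \<sigma>" "m \<le> U z" "U z \<le> M" "\<bar>F z\<bar> \<le> \<delta> * \<sigma>" by auto
      have "\<bar>(z - y) \<bullet> G x\<bar> \<le> norm (z - y) * norm (G x)" by (rule Cauchy_Schwarz_ineq2)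
      also have "\<dots> \<le> \<delta> * \<sigma> * norm (G x)" using z(1) by (intro mult_right_mono) (auto simp: dist_norm norm_minus_commute)
      finally have zy: "\<bar>(z - y) \<bullet> G x\<bar> \<le> \<delta> * \<sigma> * norm (G x)" .
      have "v y - U x - (y - x) \<bullet> G x = (v y - U z) + F z + (z - y) \<bullet> G x"
        by (simp add: F_def inner_diff_left)
      then have "\<bar>v y - U x - (y - x) \<bullet> G x\<bar> \<le> C * \<delta> * \<sigma> + \<delta> * \<sigma> + \<delta> * \<sigma> * norm (G x)"
        using mM z zy by linarith
      then show ?thesis by (simp add: C'_def algebra_simps)
    qed
    then show ?thesis using d1(1) d2(1) by (intro exI[of _ "min d1 (d2 / 2)"]) auto
  qed
  show eq: "v x = U x"
  proof (rule ccontr)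
    assume "v x \<noteq> U x"
    then have pos: "\<bar>v x - U x\<bar> > 0" by simp
    obtain d where d: "d > 0" "\<And>\<sigma> y. 0 < \<sigma> \<Longrightarrow> \<sigma> < d \<Longrightarrow> dist y x \<le> \<sigma> \<Longrightarrow> \<bar>v y - U x - (y - x) \<bullet> G x\<bar> \<le> C' * (1 / 2) * \<sigma>"
      using main[of "1 / 2"] by auto
    \<comment> \<open>Taking y = x, the bound C' \<sigma> / 2 is at most half of |v x - U
      x|.\<close>
    define \<sigma> where "\<sigma> = min (d / 2) (\<bar>v x - U x\<bar> / C')"
    have \<sigma>: "0 < \<sigma>" "\<sigma> < d" unfolding \<sigma>_def using d(1) pos C' by auto
    have "C' * \<sigma> \<le> \<bar>v x - U x\<bar>"
      unfolding \<sigma>_def using C' by (metis le_divide_eq min.cobounded2 mult.commute)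
    moreover have "\<bar>v x - U x\<bar> \<le> C' * (1 / 2) * \<sigma>" using d(2)[OF \<sigma>, of x] \<sigma> by simp
    ultimately show False using pos C' \<sigma>(1) by (simp add: field_simps)
  qed
  show "(v has_derivative (\<lambda>h. h \<bullet> G x)) (at x)"
    unfolding has_derivative_at_alt
  proof (intro conjI allI impI)
    show "bounded_linear (\<lambda>h. h \<bullet> G x)" by (rule bounded_linear_inner_left)
    fix e :: real assume e: "e > 0"
    define \<delta> where "\<delta> = min (1 / 2) (e / C')"
    have \<delta>: "0 < \<delta>" "\<delta> \<le> 1 / 2"
      unfolding \<delta>_def using e C' by (simp_all only: min.cobounded1, simp)
    have C\<delta>: "C' * \<delta> \<le> e" unfolding \<delta>_def using C' by (metis le_divide_eq min.cobounded2 mult.commute)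
    obtain d where d: "d > 0" "\<And>\<sigma> y. 0 < \<sigma> \<Longrightarrow> \<sigma> < d \<Longrightarrow> dist y x \<le> \<sigma> \<Longrightarrow> \<bar>v y - U x - (y - x) \<bullet> G x\<bar> \<le> C' * \<delta> * \<sigma>"
      using main[OF \<delta>] by auto
    have "norm (v y - v x - (y - x) \<bullet> G x) \<le> e * norm (y - x)" if "norm (y - x) < d" for y
    proof (cases "y = x")
      case False
      have "\<bar>v y - U x - (y - x) \<bullet> G x\<bar> \<le> C' * \<delta> * norm (y - x)"
        using that False by (intro d(2)) (auto simp: dist_norm)
      also have "\<dots> \<le> e * norm (y - x)" using C\<delta> by (intro mult_right_mono) auto
      finally show ?thesis by (simp add: eq)
    qed simp
    with d(1) show "\<exists>d>0. \<forall>y. norm (y - x) < d \<longrightarrow> norm (v y - v x - (y - x) \<bullet> G x) \<le> e * norm (y - x)" by blast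
  qed
qed

subsection \<open>The oscillation estimate\<close>

lemma weak_gradient_subset:
  assumes wg: "weak_gradient B u g" and sub: "B' \<subseteq> B"
  shows "weak_gradient B' u g"
  unfolding weak_gradient_def
proof (intro conjI allI impI)
  show "loc_integrable B' u" "loc_integrable B' g"
    using wg sub unfolding weak_gradient_def loc_integrable_def by auto
  fix \<phi> and b :: 'a assume "test_function B' \<phi> \<and> b \<in> Basis"
  then have \<phi>: "test_function B' \<phi>" and b: "b \<in> Basis" by auto
  have "test_function B \<phi>" using \<phi> sub by (auto simp: test_function_def compactly_contained_def)
  then have eq: "(LINT x:B|lebesgue. u x * partial_deriv b \<phi> x) = - (LINT x:B|lebesgue. (g x \<bullet> b) * \<phi> x)"
    using wg b unfolding weak_gradient_def by blast
  have "(LINT x:B'|lebesgue. u x * partial_deriv b \<phi> x) = (LINT x:B|lebesgue. u x * partial_deriv b \<phi> x)"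
    unfolding set_lebesgue_integral_def using sub test_function_partial_outside[OF \<phi>]
    by (intro Bochner_Integration.integral_cong refl) (auto simp: indicator_def)
  moreover have "(LINT x:B'|lebesgue. (g x \<bullet> b) * \<phi> x) = (LINT x:B|lebesgue. (g x \<bullet> b) * \<phi> x)"
    unfolding set_lebesgue_integral_def using sub test_function_outside[OF \<phi>]
    by (intro Bochner_Integration.integral_cong refl) (auto simp: indicator_def)
  ultimately show "(LINT x:B'|lebesgue. u x * partial_deriv b \<phi> x) = - (LINT x:B'|lebesgue. (g x \<bullet> b) * \<phi> x)"
    using eq by simp
qed

lemma open_cballE:
  fixes x :: "'a::metric_space"
  assumes "open S" "x \<in> S"
  obtains e where "e > 0" "cball x e \<subseteq> S"
proof -
  have "\<forall>x\<in>S. \<exists>e>0. cball x e \<subseteq> S" using assms(1) by (simp only: open_contains_cball)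
  from bspec[OF this assms(2)] show thesis using that by (elim exE conjE)
qed

lemma compactly_contained_ball:
  "r > 0 \<Longrightarrow> compactly_contained (ball x r) \<Omega> \<longleftrightarrow> cball (x::'a::euclidean_space) r \<subseteq> \<Omega>"
  by (simp add: compactly_contained_def)

lemma weakly_monotone_measurable:
  assumes "weakly_monotone \<Omega> u" "S \<subseteq> \<Omega>"
  shows "u \<in> borel_measurable (lebesgue_on S)"
proof -
  have "u \<in> borel_measurable (lebesgue_on \<Omega>)"
    using assms(1) by (simp add: weakly_monotone_def orlicz_sobolev_loc_def)
  then show ?thesis using assms(2) by (rule measurable_restrict_mono)
qed

lemma oscillation_estimate:
  fixes u :: "'a::euclidean_space \<Rightarrow> real"
  assumes n: "DIM('a) \<ge> 2" and A: "young_function A" and wm: "weakly_monotone \<Omega> u"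
    and r: "r > 0" and B: "compactly_contained (ball x (2 * r)) \<Omega>"
    and wg: "weak_gradient (ball x (2 * r)) u g"
  shows "essosc (ball x r) u \<le> enn2ereal (ennreal (2 * osc_const DIM('a) * r) *
      right_inverse (young_reduced DIM('a) A)
        ((\<integral>\<^sup>+z\<in>ball x (2 * r). A (norm (g z)) \<partial>lebesgue) / emeasure lebesgue (ball x (2 * r))))"
proof -
  let ?n = "DIM('a)"
  define V where "V = unit_ball_vol (real ?n) * (2 * r) ^ ?n"
  have V: "V > 0" unfolding V_def using r by simp
  have vol: "emeasure lebesgue (ball x (2 * r)) = ennreal V"
    unfolding V_def using r by (simp add: emeasure_ball)
  define C where "C = osc_const ?n * r"
  have C: "C > 0" unfolding C_def using osc_const_pos r by simp
  define A' where "A' s = A (max s 0)" for s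
  have A'm: "A' \<in> borel_measurable borel" unfolding A'_def by (rule young_extension_measurable[OF A])
  have A'n: "A' (norm y) = A (norm y)" for y :: 'a by (simp add: A'_def max_def)
  have young: "ennreal (s * k) \<le> A' s + young_conj A k" if "s \<ge> 0" "k > 0" for s k
    using young_inequality[OF that(1), of k A] that by (simp add: A'_def max_def)
  define I where "I = (\<integral>\<^sup>+z\<in>ball x (2 * r). A (norm (g z)) \<partial>lebesgue)"
  show ?thesis
  proof (cases "I = top")
    case True
    \<comment> \<open>At the argument \<infinity> the right inverse is the infimum of the empty set,
      so the right-hand side is \<infinity>.\<close>
    have "right_inverse (young_reduced ?n A) (I / ennreal V) = top"
      unfolding True using V by (simp add: ennreal_top_divide right_inverse_def)
    moreover have "ennreal (2 * osc_const ?n * r) * top = top"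
      using osc_const_pos[of ?n] r by (subst ennreal_mult_top) (auto simp: ennreal_eq_0_iff mult_le_0_iff)
    ultimately show ?thesis unfolding I_def[symmetric] vol by (simp only: enn2ereal_top) simp
  next
    case False
    define i where "i = enn2real I"
    have i: "I = ennreal i" "i \<ge> 0" unfolding i_def using False by (auto simp: less_top)
    define \<beta> where "\<beta> = i / V"
    have \<beta>: "\<beta> \<ge> 0" "I / ennreal V = ennreal \<beta>" "i = \<beta> * V"
      unfolding \<beta>_def i using i V by (auto simp: divide_ennreal)
    have um: "u \<in> borel_measurable (lebesgue_on (ball x r))"
      by (rule weakly_monotone_measurable[OF wm]) (use B r in \<open>auto simp: compactly_contained_ball\<close>)
    have "essosc (ball x r) u \<le> enn2ereal (ennreal (2 * C) * right_inverse (young_reduced ?n A) (ennreal \<beta>))"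
    proof (rule right_inverse_bound[OF A n \<beta>(1) C])
      fix t \<kappa> :: real
      assume t: "t > 0" and \<kappa>: "\<kappa> \<ge> 0" "cone_integral (?n - 1) (young_conj A) t = ennreal \<kappa>"
      show "essosc (ball x r) u \<le> ereal (C * (\<beta> + \<kappa>) / t)"
      proof (rule ereal_le_epsilon2)
        fix \<epsilon> :: real assume \<epsilon>: "0 < \<epsilon>"
        \<comment> \<open>\<open>osc_ball\<close> needs an average strictly below \<alpha>; this
          excess over \<beta> raises the bound by exactly \<epsilon>.\<close>
        define \<alpha> where "\<alpha> = \<beta> + \<epsilon> * t / C"
        have "\<beta> < \<alpha>" unfolding \<alpha>_def using \<epsilon> t C by simp
        then have "\<beta> * V < \<alpha> * V" using V by simp
        then have "(\<integral>\<^sup>+z\<in>ball x (2 * r). A' (norm (g z)) \<partial>lebesgue) < ennreal (\<alpha> * (unit_ball_vol ?n * (2 * r) ^ ?n))"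
          unfolding A'n I_def[symmetric] i(1) \<beta>(3) V_def[symmetric] using \<beta>(1) V by (simp add: ennreal_less_iff)
        from osc_ball[OF n wm r B wg A'm young_conj_measurable young t \<kappa>(2,1) this]
        obtain m M where mM: "M - m \<le> C * (\<alpha> + \<kappa>) / t"
          "AE z in lborel. z \<in> ball x r \<longrightarrow> m \<le> u z \<and> u z \<le> M"
          unfolding C_def by blast
        have "essosc (ball x r) u \<le> ereal (M - m)" by (rule essosc_le[OF um _ mM(2)]) simp
        also have "\<dots> \<le> ereal (C * (\<alpha> + \<kappa>) / t)" using mM(1) by simp
        also have "C * (\<alpha> + \<kappa>) / t = C * (\<beta> + \<kappa>) / t + \<epsilon>"
          unfolding \<alpha>_def using C t by (simp add: field_simps)
        finally show "essosc (ball x r) u \<le> ereal (C * (\<beta> + \<kappa>) / t) + ereal \<epsilon>" by simp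
      qed
    qed
    then show ?thesis unfolding I_def[symmetric] vol \<beta>(2) C_def by (simp add: mult.assoc)
  qed
qed

subsection \<open>Local boundedness and differentiability\<close>

lemma orlicz_sobolev_locD:
  fixes u :: "'a::euclidean_space \<Rightarrow> real"
  assumes u: "u \<in> orlicz_sobolev_loc A \<Omega>" and r: "r > 0" and B: "compactly_contained (ball x r) \<Omega>"
  obtains g l where "weak_gradient (ball x r) u g" "l > 0"
    "(\<integral>\<^sup>+z\<in>ball x r. A (norm (g z) / l) \<partial>lebesgue) \<le> 1"
proof -
  have "u \<in> orlicz_sobolev A (ball x r)"
    using u B unfolding orlicz_sobolev_loc_def by auto
  then obtain g where g: "weak_gradient (ball x r) u g" "(\<lambda>z. norm (g z)) \<in> orlicz A (ball x r)"
    unfolding orlicz_sobolev_def by blast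
  then have "luxemburg_norm A (ball x r) (\<lambda>z. norm (g z)) < \<infinity>" by (simp add: orlicz_def)
  then obtain l where "l > 0" "(\<integral>\<^sup>+z\<in>ball x r. A (norm (g z) / l) \<partial>lebesgue) \<le> 1"
    unfolding luxemburg_norm_def Inf_less_iff by auto
  with g(1) show ?thesis by (rule that)
qed

text \<open>Replacing A s by A (s / l) replaces the conjugate at k by the conjugate at l k; a finite
  cone integral at t1 is thereby moved to t1 / l.\<close>

lemma cone_integral_scale:
  "cone_integral d (\<lambda>k. \<Psi> (l * k)) t = cone_integral d \<Psi> (l * t)"
  by (simp add: cone_integral_def)

lemma AE_cover_open:
  fixes S :: "'a::euclidean_space set"
  assumes P: "\<And>y. y \<in> S \<Longrightarrow> \<exists>r>0. AE z in lborel. z \<in> ball y r \<longrightarrow> P z"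
  shows "AE z in lborel. z \<in> S \<longrightarrow> P z"
proof -
  have "\<forall>y\<in>S. \<exists>r. r > 0 \<and> (AE z in lborel. z \<in> ball y r \<longrightarrow> P z)" using P by auto
  from bchoice[OF this] obtain r where r: "\<And>y. y \<in> S \<Longrightarrow> r y > 0"
    "\<And>y. y \<in> S \<Longrightarrow> AE z in lborel. z \<in> ball y (r y) \<longrightarrow> P z" by blast
  have op: "\<And>X. X \<in> (\<lambda>y. ball y (r y)) ` S \<Longrightarrow> open X" by auto
  obtain F where F: "F \<subseteq> (\<lambda>y. ball y (r y)) ` S" "countable F" "\<Union> F = \<Union> ((\<lambda>y. ball y (r y)) ` S)"
    by (rule Lindelof[OF op])
  have "AE z in lborel. \<forall>X\<in>F. z \<in> X \<longrightarrow> P z"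
    using F(1) r(2) by (intro AE_ball_countable[THEN iffD2] F(2)) auto
  then show ?thesis
  proof eventually_elim
    fix z assume *: "\<forall>X\<in>F. z \<in> X \<longrightarrow> P z"
    show "z \<in> S \<longrightarrow> P z"
    proof
      assume "z \<in> S"
      then have "z \<in> \<Union> ((\<lambda>y. ball y (r y)) ` S)" using r(1) by force
      then show "P z" using * F(3) by blast
    qed
  qed
qed

text \<open>
  The lower limit of essential infima. Where \<open>u\<close> is not locally essentially bounded, \<open>Sup\<close> is a
  junk value.
\<close>

definition ess_lower :: "('a::euclidean_space \<Rightarrow> real) \<Rightarrow> 'a \<Rightarrow> real" where
  "ess_lower u y = Sup {q. \<exists>\<rho>>0. AE z in lborel. z \<in> ball y \<rho> \<longrightarrow> q \<le> u z}"

text \<open>A number that is essentially below u on some ball about y is at most M, because two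
  concentric balls share a point where both bounds hold. So the supremum is that of a nonempty set
  bounded above.\<close>

lemma ess_lower_bounds:
  assumes \<rho>: "\<rho> > 0" and ae: "AE z in lborel. z \<in> ball y \<rho> \<longrightarrow> m \<le> u z \<and> u z \<le> M"
  shows "m \<le> ess_lower u y" "ess_lower u y \<le> M"
proof -
  let ?S = "{q. \<exists>\<rho>>0. AE z in lborel. z \<in> ball y \<rho> \<longrightarrow> q \<le> u z}"
  have mS: "m \<in> ?S" using \<rho> ae by (auto intro!: exI[of _ \<rho>] elim!: eventually_mono)
  have ub: "q \<le> M" if q: "q \<in> ?S" for q
  proof -
    obtain \<rho>' where \<rho>': "\<rho>' > 0" "AE z in lborel. z \<in> ball y \<rho>' \<longrightarrow> q \<le> u z" using q by auto
    define R where "R = min \<rho> \<rho>'"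
    have R: "R > 0" unfolding R_def using \<rho> \<rho>' by simp
    have 1: "AE z in lborel. z \<in> ball y R \<longrightarrow> u z \<le> M" using ae by eventually_elim (auto simp: R_def)
    have 2: "AE z in lborel. z \<in> ball y R \<longrightarrow> q \<le> u z" using \<rho>'(2) by eventually_elim (auto simp: R_def)
    from AE_common_point[OF 1 2] R obtain z where "u z \<le> M \<and> q \<le> u z" by auto
    then show ?thesis by linarith
  qed
  then have "bdd_above ?S" by (auto simp: bdd_above_def)
  then show "m \<le> ess_lower u y" unfolding ess_lower_def by (rule cSup_upper[OF mS])
  show "ess_lower u y \<le> M" unfolding ess_lower_def using mS ub by (intro cSup_least) auto
qed

lemma weakly_monotone_locally_bounded:
  fixes u :: "'a::euclidean_space \<Rightarrow> real"
  assumes n: "DIM('a) \<ge> 2" and A: "young_function A" and wm: "weakly_monotone \<Omega> u"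
    and u: "u \<in> orlicz_sobolev_loc A \<Omega>"
    and t: "t1 > 0" "cone_integral (DIM('a) - 1) (young_conj A) t1 < \<infinity>"
    and r: "r > 0" and B: "compactly_contained (ball x (2 * r)) \<Omega>"
  shows "\<exists>C. AE z in lborel. z \<in> ball x r \<longrightarrow> \<bar>u z\<bar> \<le> C"
proof -
  have r2: "2 * r > 0" using r by simp
  obtain g l where g: "weak_gradient (ball x (2 * r)) u g" and l: "l > 0"
    and I: "(\<integral>\<^sup>+z\<in>ball x (2 * r). A (norm (g z) / l) \<partial>lebesgue) \<le> 1"
    by (rule orlicz_sobolev_locD[OF u r2 B])
  define A' where "A' s = A (max (s / l) 0)" for s
  have [measurable]: "(\<lambda>s. A (max s 0)) \<in> borel_measurable borel" by (rule young_extension_measurable[OF A])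
  have A'm: "A' \<in> borel_measurable borel"
    unfolding A'_def by (rule measurable_compose[of "\<lambda>s. s / l" borel borel "\<lambda>s. A (max s 0)"]) measurable
  have A'n: "A' (norm y) = A (norm y / l)" for y :: 'a using l by (simp add: A'_def max_absorb1)
  have \<Psi>m: "(\<lambda>k. young_conj A (l * k)) \<in> borel_measurable borel" by measurable
  have young: "ennreal (s * k) \<le> A' s + young_conj A (l * k)" if "s \<ge> 0" "k > 0" for s k
    using young_inequality[of "s / l" "l * k" A] that l by (simp add: A'_def max_absorb1)
  define \<kappa> where "\<kappa> = enn2real (cone_integral (DIM('a) - 1) (young_conj A) t1)"
  have \<kappa>: "cone_integral (DIM('a) - 1) (\<lambda>k. young_conj A (l * k)) (t1 / l) = ennreal \<kappa>" "\<kappa> \<ge> 0"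
    unfolding \<kappa>_def cone_integral_scale using t l by auto
  define V where "V = unit_ball_vol (real DIM('a)) * (2 * r) ^ DIM('a)"
  have V: "V > 0" unfolding V_def using r by simp
  \<comment> \<open>The level 2 / V is one convenient choice that makes the inequality strict, as
    the modular is at most 1.\<close>
  have "(\<integral>\<^sup>+z\<in>ball x (2 * r). A' (norm (g z)) \<partial>lebesgue) < ennreal (2 / V * (unit_ball_vol DIM('a) * (2 * r) ^ DIM('a)))"
    unfolding A'n V_def[symmetric] using V by (intro le_less_trans[OF I]) simp
  from osc_ball[OF n wm r B g A'm \<Psi>m young _ \<kappa> this] t(1) l obtain m M where
    "AE z in lborel. z \<in> ball x r \<longrightarrow> m \<le> u z \<and> u z \<le> M" by (auto simp: field_simps)
  then have "AE z in lborel. z \<in> ball x r \<longrightarrow> \<bar>u z\<bar> \<le> \<bar>m\<bar> + \<bar>M\<bar>"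
    by eventually_elim auto
  then show ?thesis ..
qed

lemma weakly_monotone_Linf_loc:
  fixes u :: "'a::euclidean_space \<Rightarrow> real"
  assumes n: "DIM('a) \<ge> 2" and A: "young_function A" and wm: "weakly_monotone \<Omega> u"
    and \<Omega>: "open \<Omega>" and u: "u \<in> orlicz_sobolev_loc A \<Omega>"
    and t: "t1 > 0" "cone_integral (DIM('a) - 1) (young_conj A) t1 < \<infinity>"
  shows "u \<in> Linf_loc \<Omega>"
  unfolding Linf_loc_def
proof (intro CollectI conjI allI impI)
  show "u \<in> borel_measurable (lebesgue_on \<Omega>)" by (rule weakly_monotone_measurable[OF wm]) simp
  fix \<Omega>' assume "open \<Omega>' \<and> compactly_contained \<Omega>' \<Omega>"
  then have \<Omega>': "open \<Omega>'" "compact (closure \<Omega>')" "closure \<Omega>' \<subseteq> \<Omega>" by (auto simp: compactly_contained_def)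
  have "\<exists>r C. r > 0 \<and> (AE z in lborel. z \<in> ball x r \<longrightarrow> \<bar>u z\<bar> \<le> C)" if x: "x \<in> closure \<Omega>'" for x
  proof -
    obtain e where e: "e > 0" "cball x e \<subseteq> \<Omega>" using \<Omega> subsetD[OF \<Omega>'(3) x] by (rule open_cballE)
    have "compactly_contained (ball x (2 * (e / 2))) \<Omega>" using e by (simp add: compactly_contained_ball)
    from weakly_monotone_locally_bounded[OF n A wm u t _ this] e(1)
    have "\<exists>C. AE z in lborel. z \<in> ball x (e / 2) \<longrightarrow> \<bar>u z\<bar> \<le> C" by auto
    with e(1) have "e / 2 > 0 \<and> (\<exists>C. AE z in lborel. z \<in> ball x (e / 2) \<longrightarrow> \<bar>u z\<bar> \<le> C)" by simp
    then show ?thesis by (simp only: ex_simps(2)) (rule exI)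
  qed
  then have "\<forall>x\<in>closure \<Omega>'. \<exists>p. fst p > 0 \<and> (AE z in lborel. z \<in> ball x (fst p) \<longrightarrow> \<bar>u z\<bar> \<le> snd p)"
    by simp
  from bchoice[OF this] obtain p where
    p: "\<forall>x\<in>closure \<Omega>'. fst (p x) > 0 \<and> (AE z in lborel. z \<in> ball x (fst (p x)) \<longrightarrow> \<bar>u z\<bar> \<le> snd (p x))" ..
  define r C where "r x = fst (p x)" and "C x = snd (p x)" for x
  have rC: "\<And>x. x \<in> closure \<Omega>' \<Longrightarrow> r x > 0"
    "\<And>x. x \<in> closure \<Omega>' \<Longrightarrow> AE z in lborel. z \<in> ball x (r x) \<longrightarrow> \<bar>u z\<bar> \<le> C x"
    using p unfolding r_def C_def by auto
  obtain D where D: "D \<subseteq> closure \<Omega>'" "finite D" "closure \<Omega>' \<subseteq> (\<Union>x\<in>D. ball x (r x))"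
    by (rule compactE_image[OF \<Omega>'(2), of "closure \<Omega>'" "\<lambda>x. ball x (r x)"]) (use rC(1) in force)+
  have "AE z in lborel. \<forall>x\<in>D. z \<in> ball x (r x) \<longrightarrow> \<bar>u z\<bar> \<le> C x"
    using D(1) rC(2) by (intro AE_finite_allI D(2)) auto
  then have ae: "AE z in lborel. z \<in> \<Omega>' \<longrightarrow> \<bar>u z\<bar> \<le> (\<Sum>x\<in>D. \<bar>C x\<bar>)"
  proof eventually_elim
    fix z assume *: "\<forall>x\<in>D. z \<in> ball x (r x) \<longrightarrow> \<bar>u z\<bar> \<le> C x"
    show "z \<in> \<Omega>' \<longrightarrow> \<bar>u z\<bar> \<le> (\<Sum>x\<in>D. \<bar>C x\<bar>)"
    proof
      assume "z \<in> \<Omega>'"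
      then have "z \<in> (\<Union>x\<in>D. ball x (r x))" using D(3) closure_subset by blast
      then obtain x where x: "x \<in> D" "\<bar>u z\<bar> \<le> C x" using * by blast
      have "\<bar>C x\<bar> \<le> (\<Sum>x\<in>D. \<bar>C x\<bar>)" using D(2) x(1) by (intro member_le_sum) auto
      with x(2) show "\<bar>u z\<bar> \<le> (\<Sum>x\<in>D. \<bar>C x\<bar>)" by linarith
    qed
  qed
  show "\<exists>C. AE x in lebesgue_on \<Omega>'. \<bar>u x\<bar> \<le> C"
  proof (rule exI, rule AE_restrict_space_iff[THEN iffD2])
    show "\<Omega>' \<inter> space lebesgue \<in> sets lebesgue" using \<Omega>'(1) by simp
    show "AE z in lebesgue. z \<in> \<Omega>' \<longrightarrow> \<bar>u z\<bar> \<le> (\<Sum>x\<in>D. \<bar>C x\<bar>)" by (rule AE_completion[OF ae])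
  qed
qed

text \<open>With H = A (|grad u| / l), almost every x is a Lebesgue point of u, of the components of
  the gradient and of H. Near such an x the averages of H over balls of radius 2 \<delta> \<sigma>
  about points within \<sigma> of x are bounded independently of \<delta>, and
  \<open>osc_ball\<close> then bounds the oscillation by C \<delta> \<sigma> with one C for all
  \<delta>.\<close>

lemma weakly_monotone_differentiable_ball:
  fixes u :: "'a::euclidean_space \<Rightarrow> real"
  assumes n: "DIM('a) \<ge> 2" and A: "young_function A" and wm: "weakly_monotone \<Omega> u"
    and u: "u \<in> orlicz_sobolev_loc A \<Omega>"
    and t: "t1 > 0" "cone_integral (DIM('a) - 1) (young_conj A) t1 < \<infinity>"
    and r: "r > 0" and B: "compactly_contained (ball x0 (2 * r)) \<Omega>"
  shows "AE x in lborel. x \<in> ball x0 r \<longrightarrow> ess_lower u x = u x \<and> ess_lower u differentiable (at x)"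
proof -
  let ?n = "DIM('a)"
  define \<omega> where "\<omega> = unit_ball_vol (real ?n)"
  have \<omega>: "\<omega> > 0" unfolding \<omega>_def by simp
  have r2: "2 * r > 0" using r by simp
  obtain g l where g: "weak_gradient (ball x0 (2 * r)) u g" and l: "l > 0"
    and I: "(\<integral>\<^sup>+z\<in>ball x0 (2 * r). A (norm (g z) / l) \<partial>lebesgue) \<le> 1"
    by (rule orlicz_sobolev_locD[OF u r2 B])
  define A' where "A' s = A (max (s / l) 0)" for s
  have [measurable]: "(\<lambda>s. A (max s 0)) \<in> borel_measurable borel" by (rule young_extension_measurable[OF A])
  have A'm[measurable]: "A' \<in> borel_measurable borel"
    unfolding A'_def by (rule measurable_compose[of "\<lambda>s. s / l" borel borel "\<lambda>s. A (max s 0)"]) measurable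
  have A'n: "A' (norm y) = A (norm y / l)" for y :: 'a using l by (simp add: A'_def max_absorb1)
  have \<Psi>m: "(\<lambda>k. young_conj A (l * k)) \<in> borel_measurable borel" by measurable
  have young: "ennreal (s * k) \<le> A' s + young_conj A (l * k)" if "s \<ge> 0" "k > 0" for s k
    using young_inequality[of "s / l" "l * k" A] that l by (simp add: A'_def max_absorb1)
  define \<kappa> where "\<kappa> = enn2real (cone_integral (?n - 1) (young_conj A) t1)"
  have \<kappa>: "cone_integral (?n - 1) (\<lambda>k. young_conj A (l * k)) (t1 / l) = ennreal \<kappa>" "\<kappa> \<ge> 0"
    unfolding \<kappa>_def cone_integral_scale using t l by auto
  define \<tau> where "\<tau> = t1 / l"
  have \<tau>: "\<tau> > 0" unfolding \<tau>_def using t l by simp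
  define K where "K = cball x0 r"
  have K: "compact K" "K \<subseteq> ball x0 (2 * r)" unfolding K_def using r by auto
  have Kb[measurable]: "K \<in> sets borel" unfolding K_def by simp
  obtain U G where U: "integrable lborel U" and G: "integrable lborel G"
    and ae: "AE x in lborel. x \<in> K \<longrightarrow> U x = u x \<and> G x = g x"
    and grad: "\<And>y e b. e > 0 \<Longrightarrow> cball y e \<subseteq> K \<Longrightarrow> b \<in> Basis \<Longrightarrow>
       partial_deriv b (conv (moll e) U) y = conv (moll e) (\<lambda>z. G z \<bullet> b) y"
  proof (rule weak_gradient_borel[OF g K])
    fix U :: "'a \<Rightarrow> real" and G :: "'a \<Rightarrow> 'a"
    assume 1: "integrable lborel U" and 2: "integrable lborel G"
      and 3: "AE x in lborel. x \<in> K \<longrightarrow> U x = u x \<and> G x = g x"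
      and "\<And>x. x \<notin> K \<Longrightarrow> U x = 0 \<and> G x = 0"
      and 4: "\<And>y e b. e > 0 \<Longrightarrow> cball y e \<subseteq> K \<Longrightarrow> b \<in> Basis \<Longrightarrow>
         partial_deriv b (conv (moll e) U) y = conv (moll e) (\<lambda>z. G z \<bullet> b) y"
    show thesis by (rule that[OF 1 2 3 4])
  qed
  have [measurable]: "U \<in> borel_measurable borel" "G \<in> borel_measurable borel" using U G by auto
  define H0 where "H0 z = A' (norm (G z)) * indicator K z" for z
  have [measurable]: "H0 \<in> borel_measurable borel" unfolding H0_def by measurable
  have H0I: "(\<integral>\<^sup>+z. H0 z \<partial>lborel) \<le> 1"
  proof -
    have "(\<integral>\<^sup>+z. H0 z \<partial>lborel) \<le> (\<integral>\<^sup>+z\<in>ball x0 (2 * r). A (norm (g z) / l) \<partial>lborel)"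
    proof (rule nn_integral_mono_AE, use ae in eventually_elim)
      fix x assume "x \<in> K \<longrightarrow> U x = u x \<and> G x = g x"
      then show "H0 x \<le> A (norm (g x) / l) * indicator (ball x0 (2 * r)) x"
        using K(2) by (cases "x \<in> K") (auto simp: H0_def A'n)
    qed
    also have "\<dots> \<le> 1" using I by (simp add: nn_integral_completion)
    finally show ?thesis .
  qed
  \<comment> \<open>Lebesgue points are defined for real functions. The density is integrable, hence
    finite almost everywhere, so nothing is lost.\<close>
  define H where "H z = enn2real (H0 z)" for z
  have [measurable]: "H \<in> borel_measurable borel" unfolding H_def by measurable
  have "AE z in lborel. H0 z \<noteq> \<infinity>"
    by (rule nn_integral_PInf_AE) (use H0I in \<open>auto simp: top_unique\<close>)
  then have HH0: "AE z in lborel. ennreal (H z) = H0 z"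
    by eventually_elim (simp add: H_def less_top)
  have Hint: "integrable lborel H"
  proof (rule integrableI_bounded)
    have "(\<integral>\<^sup>+z. ennreal (norm (H z)) \<partial>lborel) = (\<integral>\<^sup>+z. H0 z \<partial>lborel)"
      by (rule nn_integral_cong_AE, use HH0 in eventually_elim) (simp add: H_def)
    also have "\<dots> < \<infinity>" using H0I by (rule le_less_trans) simp
    finally show "(\<integral>\<^sup>+z. ennreal (norm (H z)) \<partial>lborel) < \<infinity>" .
  qed simp
  have Hg: "AE z in lborel. z \<in> K \<longrightarrow> A' (norm (g z)) = ennreal (H z)"
    using HH0 ae by eventually_elim (auto simp: H0_def)
  have aeG: "AE x in lborel. \<forall>b\<in>Basis. lebesgue_point (\<lambda>z. G z \<bullet> b) x"
    by (intro AE_finite_allI AE_lebesgue_point integrable_inner_left G) simp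
  from AE_lebesgue_point[OF U] aeG AE_lebesgue_point[OF Hint] ae show ?thesis
  proof eventually_elim
    fix x assume lpU: "lebesgue_point U x" and lpG: "\<forall>b\<in>Basis. lebesgue_point (\<lambda>z. G z \<bullet> b) x"
      and lpH: "lebesgue_point H x" and Uu: "x \<in> K \<longrightarrow> U x = u x \<and> G x = g x"
    show "x \<in> ball x0 r \<longrightarrow> ess_lower u x = u x \<and> ess_lower u differentiable (at x)"
    proof
      assume x: "x \<in> ball x0 r"
      obtain s0 where s0: "s0 > 0" "cball x s0 \<subseteq> ball x0 r" using open_ball x by (rule open_cballE)
      have s0K: "cball x s0 \<subseteq> K" using s0(2) by (auto simp: K_def)
      \<comment> \<open>One unit pays for the deviation of H from H x, the other makes the bound
        strict.\<close>
      define \<alpha> where "\<alpha> = H x + 2"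
      have \<alpha>: "\<alpha> > 0" "H x \<ge> 0" unfolding \<alpha>_def H_def by (auto simp: add_nonneg_pos)
      define C where "C = osc_const ?n * (\<alpha> + \<kappa>) / \<tau>"
      have C: "C \<ge> 0" unfolding C_def using osc_const_pos[of ?n] \<alpha> \<kappa>(2) \<tau> by simp
      have osc: "\<exists>d>0. \<forall>\<sigma> y. 0 < \<sigma> \<and> \<sigma> < d \<and> dist y x \<le> \<sigma> \<longrightarrow>
         (\<exists>m M. M - m \<le> C * \<delta> * \<sigma> \<and> m \<le> ess_lower u y \<and> ess_lower u y \<le> M \<and>
            (AE z in lborel. z \<in> ball y (\<delta> * \<sigma>) \<longrightarrow> m \<le> U z \<and> U z \<le> M))"
        if \<delta>: "0 < \<delta>" "\<delta> \<le> 1 / 2" for \<delta>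
      proof -
        \<comment> \<open>With this tolerance the integral of |H - H x| over the ball of radius 2
          \<sigma> about x is at most the volume of the ball of radius 2 \<delta> \<sigma> about
          y.\<close>
        have "\<omega> * \<delta> ^ ?n > 0" using \<omega> \<delta> by simp
        then obtain d3 where d3: "d3 > 0" "\<And>r. 0 < r \<Longrightarrow> r < d3 \<Longrightarrow>
          (\<integral>\<^sup>+y\<in>ball x r. ennreal \<bar>H y - H x\<bar> \<partial>lborel) \<le> ennreal (\<omega> * \<delta> ^ ?n * r ^ ?n)"
          using lpH unfolding lebesgue_point_def by auto
        define d where "d = min (d3 / 2) (s0 / 2)"
        have d: "d > 0" unfolding d_def using d3 s0 by simp
        have "\<exists>m M. M - m \<le> C * \<delta> * \<sigma> \<and> m \<le> ess_lower u y \<and> ess_lower u y \<le> M \<and>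
            (AE z in lborel. z \<in> ball y (\<delta> * \<sigma>) \<longrightarrow> m \<le> U z \<and> U z \<le> M)"
          if \<sigma>: "0 < \<sigma>" "\<sigma> < d" and y: "dist y x \<le> \<sigma>" for \<sigma> y
        proof -
          define \<rho> where "\<rho> = \<delta> * \<sigma>"
          have \<rho>: "\<rho> > 0" "2 * \<rho> \<le> \<sigma>" unfolding \<rho>_def using \<delta> \<sigma> by (auto simp: mult_le_cancel_right2)
          have sub: "ball y (2 * \<rho>) \<subseteq> ball x (2 * \<sigma>)"
          proof
            fix z assume "z \<in> ball y (2 * \<rho>)"
            then have "dist x z < 2 * \<sigma>" using y \<rho> dist_triangle[of x z y] by (simp add: dist_commute)
            then show "z \<in> ball x (2 * \<sigma>)" by simp
          qed
          have subK: "ball x (2 * \<sigma>) \<subseteq> cball x s0" using \<sigma> by (auto simp: d_def)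
          have subB: "ball y (2 * \<rho>) \<subseteq> ball x0 (2 * r)" using sub subK s0K K(2) by blast
          have cc: "compactly_contained (ball y (2 * \<rho>)) \<Omega>"
          proof -
            have "closure (ball y (2 * \<rho>)) \<subseteq> closure (ball x0 (2 * r))" using subB by (rule closure_mono)
            then show ?thesis using B by (auto simp: compactly_contained_def)
          qed
          define V where "V = \<omega> * (2 * \<rho>) ^ ?n"
          have V: "V > 0" unfolding V_def using \<omega> \<rho> by simp
          have [measurable]: "ball y (2 * \<rho>) \<in> sets borel" "ball x (2 * \<sigma>) \<in> sets borel" by auto
          have "(\<integral>\<^sup>+z\<in>ball y (2 * \<rho>). A' (norm (g z)) \<partial>lebesgue) = (\<integral>\<^sup>+z\<in>ball y (2 * \<rho>). ennreal (H z) \<partial>lborel)"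
            by (rule set_nn_integral_lebesgue, use Hg in eventually_elim) (use sub subK s0K in blast)
          also have "\<dots> \<le> (\<integral>\<^sup>+z. ennreal \<bar>H z - H x\<bar> * indicator (ball x (2 * \<sigma>)) z + ennreal (H x) * indicator (ball y (2 * \<rho>)) z \<partial>lborel)"
          proof (rule nn_integral_mono)
            fix z
            have "ennreal (H z) \<le> ennreal (\<bar>H z - H x\<bar> + H x)" by (intro ennreal_leI) simp
            also have "\<dots> = ennreal \<bar>H z - H x\<bar> + ennreal (H x)" using \<alpha> by (simp add: ennreal_plus)
            finally show "ennreal (H z) * indicator (ball y (2 * \<rho>)) z
              \<le> ennreal \<bar>H z - H x\<bar> * indicator (ball x (2 * \<sigma>)) z + ennreal (H x) * indicator (ball y (2 * \<rho>)) z"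
              using sub by (cases "z \<in> ball y (2 * \<rho>)") auto
          qed
          also have "\<dots> = (\<integral>\<^sup>+z\<in>ball x (2 * \<sigma>). ennreal \<bar>H z - H x\<bar> \<partial>lborel) + ennreal (H x) * emeasure lborel (ball y (2 * \<rho>))"
            by (simp add: nn_integral_add nn_integral_cmult_indicator)
          also have "\<dots> \<le> ennreal (\<omega> * \<delta> ^ ?n * (2 * \<sigma>) ^ ?n) + ennreal (H x) * ennreal V"
            using \<sigma> \<rho> by (intro add_mono d3 mult_left_mono) (auto simp: d_def emeasure_ball V_def \<omega>_def)
          also have "\<omega> * \<delta> ^ ?n * (2 * \<sigma>) ^ ?n = V" unfolding V_def \<rho>_def by (simp add: power_mult_distrib)
          also have "ennreal V + ennreal (H x) * ennreal V = ennreal ((H x + 1) * V)"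
            using \<alpha> V by (simp add: ennreal_mult[symmetric] ennreal_plus[symmetric] algebra_simps del: ennreal_plus)
          also have "\<dots> < ennreal (\<alpha> * V)"
            using \<alpha> V by (intro ennreal_lessI) (auto simp: \<alpha>_def)
          finally have lt: "(\<integral>\<^sup>+z\<in>ball y (2 * \<rho>). A' (norm (g z)) \<partial>lebesgue) < ennreal (\<alpha> * (unit_ball_vol ?n * (2 * \<rho>) ^ ?n))"
            unfolding V_def \<omega>_def .
          obtain m M where mM: "M - m \<le> osc_const ?n * \<rho> * (\<alpha> + \<kappa>) / \<tau>"
            "AE z in lborel. z \<in> ball y \<rho> \<longrightarrow> m \<le> u z \<and> u z \<le> M"
            using osc_ball[OF n wm \<rho>(1) cc weak_gradient_subset[OF g subB] A'm \<Psi>m young \<tau> \<kappa>[folded \<tau>_def] lt] by blast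
          have "osc_const ?n * \<rho> * (\<alpha> + \<kappa>) / \<tau> = C * \<delta> * \<sigma>" unfolding C_def \<rho>_def by (simp add: mult_ac)
          moreover note ess_lower_bounds[OF \<rho>(1) mM(2)]
          moreover have "AE z in lborel. z \<in> ball y (\<delta> * \<sigma>) \<longrightarrow> m \<le> U z \<and> U z \<le> M"
            using mM(2) ae
          proof eventually_elim
            fix z assume z: "z \<in> ball y \<rho> \<longrightarrow> m \<le> u z \<and> u z \<le> M" "z \<in> K \<longrightarrow> U z = u z \<and> G z = g z"
            have "ball y \<rho> \<subseteq> ball y (2 * \<rho>)" using \<rho> by (intro subset_ball) simp
            then have "ball y \<rho> \<subseteq> K" using sub subK s0K by blast
            then show "z \<in> ball y (\<delta> * \<sigma>) \<longrightarrow> m \<le> U z \<and> U z \<le> M" using z by (auto simp: \<rho>_def)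
          qed
          ultimately show ?thesis using mM(1) by (intro exI[of _ m] exI[of _ M]) auto
        qed
        with d show ?thesis by blast
      qed
      note good = differentiable_at_good_point[OF U G grad s0(1) s0K lpU _ C osc]
      have "ess_lower u x = U x" by (rule good(1)) (use lpG in auto)
      moreover have "(ess_lower u has_derivative (\<lambda>h. h \<bullet> G x)) (at x)" by (rule good(2)) (use lpG in auto)
      moreover have "x \<in> K" using x by (simp add: K_def)
      ultimately show "ess_lower u x = u x \<and> ess_lower u differentiable (at x)"
        using Uu by (auto intro: differentiableI)
    qed
  qed
qed

lemma cone_integral_finite:
  assumes A: "young_function A" and n: "n = 2 \<or> n \<ge> 3 \<and> young_growth n A"
  obtains t where "t > 0" "cone_integral (n - 1) (young_conj A) t < \<infinity>"
proof (cases "n = 2")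
  case True
  obtain y b where y: "y > 0" "b > 0" "ennreal b \<le> A y" by (rule young_function_pos[OF A])
  have "cone_integral (n - 1) (young_conj A) (b / y) \<le> ennreal b"
    using young_conj_le[OF A y] True by (simp add: cone_integral_1)
  then have "cone_integral (n - 1) (young_conj A) (b / y) < \<infinity>" by (rule le_less_trans) simp
  with y show ?thesis by (intro that[of "b / y"]) auto
next
  case False
  then show ?thesis using n growth_cone_integral_finite[OF A] by (intro that[of 1]) auto
qed

theorem theorem3p1:
  assumes dim: "CARD('n::finite) \<ge> 2"
  shows "\<exists>c::real. 0 < c \<and>
    (\<forall>(\<Omega> :: (real ^ 'n) set) (A :: real \<Rightarrow> ennreal) (u :: real ^ 'n \<Rightarrow> real).
       open \<Omega> \<and> young_function A \<and>
       (CARD('n) = 2 \<or> CARD('n) \<ge> 3 \<and> young_growth CARD('n) A) \<and>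
       u \<in> orlicz_sobolev_loc A \<Omega> \<and> weakly_monotone \<Omega> u \<longrightarrow>
         u \<in> Linf_loc \<Omega> \<and>
         (\<forall>x r g. 0 < r \<and> compactly_contained (ball x (2 * r)) \<Omega> \<and>
            weak_gradient (ball x (2 * r)) u g \<longrightarrow>
            essosc (ball x r) u \<le>
              enn2ereal (ennreal (c * r) *
                right_inverse (young_reduced CARD('n) A)
                  ((\<integral>\<^sup>+ z\<in>ball x (2 * r). A (norm (g z)) \<partial>lebesgue) /
                    emeasure lebesgue (ball x (2 * r))))) \<and>
         (\<exists>v. (AE x in lebesgue_on \<Omega>. v x = u x) \<and>
              (AE x in lebesgue_on \<Omega>. v differentiable (at x))))"
\<comment> \<open>The factor 2 is that of \<open>right_inverse_bound\<close>; the rest is the ball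
  constant, which depends on n alone.\<close>
proof (rule exI[of _ "2 * osc_const CARD('n)"], intro conjI allI impI)
  show "0 < 2 * osc_const CARD('n)" using osc_const_pos by simp
  fix \<Omega> :: "(real ^ 'n) set" and A :: "real \<Rightarrow> ennreal" and u :: "real ^ 'n \<Rightarrow> real"
  assume "open \<Omega> \<and> young_function A \<and> (CARD('n) = 2 \<or> CARD('n) \<ge> 3 \<and> young_growth CARD('n) A) \<and>
       u \<in> orlicz_sobolev_loc A \<Omega> \<and> weakly_monotone \<Omega> u"
  then have \<Omega>: "open \<Omega>" and A: "young_function A"
    and growth: "CARD('n) = 2 \<or> CARD('n) \<ge> 3 \<and> young_growth CARD('n) A"
    and u: "u \<in> orlicz_sobolev_loc A \<Omega>" and wm: "weakly_monotone \<Omega> u" by auto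
  have D: "DIM(real ^ 'n) = CARD('n)" by simp
  have n: "DIM(real ^ 'n) \<ge> 2" using dim by simp
  obtain t where t: "t > 0" "cone_integral (DIM(real ^ 'n) - 1) (young_conj A) t < \<infinity>"
    using cone_integral_finite[OF A growth] unfolding D by blast
  show "u \<in> Linf_loc \<Omega>" by (rule weakly_monotone_Linf_loc[OF n A wm \<Omega> u t])
  show "essosc (ball x r) u \<le> enn2ereal (ennreal (2 * osc_const CARD('n) * r) *
      right_inverse (young_reduced CARD('n) A)
        ((\<integral>\<^sup>+ z\<in>ball x (2 * r). A (norm (g z)) \<partial>lebesgue) / emeasure lebesgue (ball x (2 * r))))"
    if "0 < r \<and> compactly_contained (ball x (2 * r)) \<Omega> \<and> weak_gradient (ball x (2 * r)) u g" for x r g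
    using oscillation_estimate[OF n A wm, of r x g] that unfolding D by blast
  \<comment> \<open>The representative is defined at each point from u near that point, with no
    choice of a ball, so the local statements glue along a countable cover.\<close>
  have "AE x in lborel. x \<in> \<Omega> \<longrightarrow> ess_lower u x = u x \<and> ess_lower u differentiable (at x)"
  proof (rule AE_cover_open)
    fix y assume "y \<in> \<Omega>"
    with \<Omega> obtain e where e: "e > 0" "cball y e \<subseteq> \<Omega>" by (rule open_cballE)
    then have "compactly_contained (ball y (2 * (e / 2))) \<Omega>" by (simp add: compactly_contained_ball)
    from weakly_monotone_differentiable_ball[OF n A wm u t _ this] e(1)
    show "\<exists>r>0. AE x in lborel. x \<in> ball y r \<longrightarrow> ess_lower u x = u x \<and> ess_lower u differentiable (at x)"
      by (intro exI[of _ "e / 2"]) auto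
  qed
  then have "AE x in lebesgue. x \<in> \<Omega> \<longrightarrow> ess_lower u x = u x \<and> ess_lower u differentiable (at x)"
    by (rule AE_completion)
  then have "AE x in lebesgue_on \<Omega>. ess_lower u x = u x \<and> ess_lower u differentiable (at x)"
    using \<Omega> by (intro AE_restrict_space_iff[THEN iffD2]) auto
  then show "\<exists>v. (AE x in lebesgue_on \<Omega>. v x = u x) \<and> (AE x in lebesgue_on \<Omega>. v differentiable (at x))"
    by (intro exI[of _ "ess_lower u"]) auto
qed

end
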